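(* Let $rs^{-1}=q^2$ and let $\sigma$ be the Hopf $2$-cocycle on $U_q(\mathfrak g)$ given by the bilinear form $\sigma:U_q(\mathfrak g)\times U_q(\mathfrak g)\to\mathbb K$ determined by $$\sigma(K_{\mu_1}K'_{\mu_2},K_{\nu_1}K'_{\nu_2})=r^{\frac{\langle\nu,\mu\rangle}{2}}s^{-\frac{\langle\mu,\nu\rangle}{2}},\qquad \mu=\mu_1+\mu_2,\ \nu=\nu_1+\nu_2,\quad \mu_1,\mu_2,\nu_1,\nu_2\in Q,$$ and $\sigma(x,y)=0$ whenever $x$ or $y$ is of the form $F\,K_{\lambda}K'_{\rho}\,E$ with $F$ a monomial in the $F_i$, $E$ a monomial in the $E_i$, and $F$ and $E$ not both equal to $1$. Then, as $\mathbb K$-Hopf algebras, $$U_{r,s}(\mathfrak g)\simeq U_q^{\sigma}(\mathfrak g),$$ where $U_q^\sigma(\mathfrak g)$ is the new Hopf algebra arising from the deformation of $U_q(\mathfrak g)$ by the Hopf $2$-cocycle $\sigma$.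
   Context: Setting. $\mathfrak g$ is a finite-dimensional simple Lie algebra with Cartan matrix $(a_{ij})_{i,j\in I}$, $I=\{1,\dots,n\}$; $d_i$ are relatively prime positive integers with $d_ia_{ij}=d_ja_{ji}$; $\alpha_i$ are the simple roots, $Q=\bigoplus_i\mathbb Z\alpha_i$, and $\Lambda$ is the weight lattice. $\mathbb K\supseteq\mathbb Q(r,s)$ is a field ($r,s$ indeterminates over $\mathbb Q$) containing $(rs^{-1})^{1/m}$, where $m$ is the smallest positive integer with $m\Lambda\subseteq Q$; $rs^{-1}$ is not a root of unity. Square roots $r^{1/2},s^{1/2}\in\mathbb K$ are fixed and $q=r^{1/2}s^{-1/2}$. $r_i=r^{d_i}$, $s_i=s^{d_i}$, $q_i=q^{d_i}$. The Euler form is the bilinear form on $Q$ with $\langle\alpha_i,\alpha_j\rangle=\langle i,j\rangle=d_ia_{ij}$ if $i<j$, $d_i$ if $i=j$, $0$ if $i>j$. Put $(k)_v=\frac{v^k-1}{v-1}$, $(k)_v!=(1)_v\cdots(k)_v$, $(0)_v!=1$, $\binom{k}{l}_v=\frac{(k)_v!}{(l)_v!(k-l)_v!}$. $U_{r,s}(\mathfrak g)$ is the unital associative $\mathbb K$-algebra generated by $e_i,f_i,\omega_i^{\pm1},\omega_i'^{\pm1}$ ($i\in I$) with relations: $\omega_i^{\pm1}\omega_i^{\mp1}=\omega_i'^{\pm1}\omega_i'^{\mp1}=1$; all $\omega_i,\omega_j'$ commute with each other; $\omega_ie_j=r^{\langle j,i\rangle}s^{-\langle i,j\rangle}e_j\omega_i$,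 $\omega_i'e_j=r^{-\langle i,j\rangle}s^{\langle j,i\rangle}e_j\omega_i'$, $\omega_if_j=r^{-\langle j,i\rangle}s^{\langle i,j\rangle}f_j\omega_i$, $\omega_i'f_j=r^{\langle i,j\rangle}s^{-\langle j,i\rangle}f_j\omega_i'$; $e_if_j-f_je_i=\delta_{i,j}\frac{\omega_i-\omega_i'}{r_i-s_i}$; and for $i\ne j$, with $c_{ij}^{(k)}=(r_is_i^{-1})^{k(k-1)/2}r^{k\langle j,i\rangle}s^{-k\langle i,j\rangle}$, $\sum_{k=0}^{1-a_{ij}}(-1)^k\binom{1-a_{ij}}{k}_{r_is_i^{-1}}c_{ij}^{(k)}e_i^{1-a_{ij}-k}e_je_i^k=0$, $\ \sum_{k=0}^{1-a_{ij}}(-1)^k\binom{1-a_{ij}}{k}_{r_is_i^{-1}}c_{ij}^{(k)}f_i^kf_jf_i^{1-a_{ij}-k}=0$. It is a Hopf algebra with $\omega_i,\omega_i'$ group-like, $\Delta(e_i)=e_i\otimes1+\omega_i\otimes e_i$, $\Delta(f_i)=1\otimes f_i+f_i\otimes\omega_i'$, $\varepsilon(e_i)=\varepsilon(f_i)=0$, $S(e_i)=-\omega_i^{-1}e_i$, $S(f_i)=-f_i\omega_i'^{-1}$. $U_q=U_q(\mathfrak g):=U_{q,q^{-1}}(\mathfrak g)$ is the Hopf algebra over $\mathbb K$ obtained from the same presentation with $r,s$ replaced by $q,q^{-1}$; its generators are written $E_i,F_i,K_i^{\pm1},K_i'^{\pm1}$ (in place of $e_i,f_i,\omega_i^{\pm1},\omega_i'^{\pm1}$).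 Thus $K_iE_jK_i^{-1}=q_i^{a_{ij}}E_j$, $K_i'E_jK_i'^{-1}=q_i^{-a_{ij}}E_j$, $K_iF_jK_i^{-1}=q_i^{-a_{ij}}F_j$, $K_i'F_jK_i'^{-1}=q_i^{a_{ij}}F_j$, $[E_i,F_j]=\delta_{ij}\frac{K_i-K_i'}{q_i-q_i^{-1}}$, with the usual quantum Serre relations. For $\mu=\sum\mu_i\alpha_i\in Q$: $K_\mu=\prod K_i^{\mu_i}$, $K'_\mu=\prod K_i'^{\mu_i}$. A Hopf $2$-cocycle on a Hopf algebra $H$ over a field $k$ is a convolution-invertible bilinear form $\sigma:H\times H\to k$ with $\sum\sigma(a_1,b_1)\sigma(a_2b_2,c)=\sum\sigma(b_1,c_1)\sigma(a,b_2c_2)$ and $\sigma(a,1)=\varepsilon(a)=\sigma(1,a)$. The deformed Hopf algebra $H^\sigma$ is the coalgebra $H$ with the same unit, multiplication $m^\sigma(a\otimes b)=\sum\sigma(a_1,b_1)a_2b_2\sigma^{-1}(a_3,b_3)$ and antipode $S^\sigma(a)=\sum\sigma^{-1}(a_1,S(a_2))S(a_3)\sigma(S(a_4),a_5)$.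
   Formalization: The antipode of the deformed algebra is taken as σ(a1,S(a2))S(a3)σ^{-1}(S(a4),a5); the printed formula has σ and σ^{-1} interchanged and gives q_i S(E_i) where the antipode axiom forces q_i^{-1} S(E_i). *)

theory Defs
  imports
    "HOL-Library.Poly_Mapping"
    "HOL-Algebra.Algebraic_Closure_Type"
begin

section \<open>Simple Lie algebras and their Cartan matrices\<close>

locale lie_algebra = vector_space scale
  for scale :: "complex \<Rightarrow> 'g::ab_group_add \<Rightarrow> 'g" +
  fixes bracket :: "'g \<Rightarrow> 'g \<Rightarrow> 'g"
  assumes bracket_add_left: "bracket (x + y) z = bracket x z + bracket y z"
    and bracket_add_right: "bracket x (y + z) = bracket x y + bracket x z"
    and bracket_scale_left: "bracket (scale c x) y = scale c (bracket x y)"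
    and bracket_scale_right: "bracket x (scale c y) = scale c (bracket x y)"
    and bracket_self: "bracket x x = 0"
    and jacobi: "bracket x (bracket y z) + bracket y (bracket z x) + bracket z (bracket x y) = 0"
begin

definition lie_ideal :: "'g set \<Rightarrow> bool" where
  "lie_ideal J \<longleftrightarrow> subspace J \<and> (\<forall>x. \<forall>y\<in>J. bracket x y \<in> J)"

definition lie_subalgebra :: "'g set \<Rightarrow> bool" where
  "lie_subalgebra H \<longleftrightarrow> subspace H \<and> (\<forall>x\<in>H. \<forall>y\<in>H. bracket x y \<in> H)"

primrec lower_central :: "'g set \<Rightarrow> nat \<Rightarrow> 'g set" where
  "lower_central H 0 = H"
| "lower_central H (Suc n) = span {bracket x y | x y. x \<in> H \<and> y \<in> lower_central H n}"

definition cartan_subalgebra :: "'g set \<Rightarrow> bool" where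
  "cartan_subalgebra H \<longleftrightarrow> lie_subalgebra H
     \<and> (\<exists>n. lower_central H n = {0})
     \<and> (\<forall>x. (\<forall>y\<in>H. bracket x y \<in> H) \<longrightarrow> x \<in> H)"

text \<open>Weights are functions on the whole algebra of which only the restriction to \<open>H\<close> matters;
  a function with a nonzero root space is automatically linear on \<open>H\<close>.\<close>

definition root_space :: "'g set \<Rightarrow> ('g \<Rightarrow> complex) \<Rightarrow> 'g set" where
  "root_space H \<beta> = {x. \<forall>h\<in>H. bracket h x = scale (\<beta> h) x}"

definition is_root :: "'g set \<Rightarrow> ('g \<Rightarrow> complex) \<Rightarrow> bool" where
  "is_root H \<beta> \<longleftrightarrow> (\<exists>h\<in>H. \<beta> h \<noteq> 0) \<and> root_space H \<beta> \<noteq> {0}"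

definition simple_roots :: "'g set \<Rightarrow> ('i::finite \<Rightarrow> 'g \<Rightarrow> complex) \<Rightarrow> bool" where
  "simple_roots H \<alpha> \<longleftrightarrow>
     (\<forall>i. is_root H (\<alpha> i))
     \<and> (\<forall>c. (\<forall>h\<in>H. (\<Sum>i\<in>UNIV. c i * \<alpha> i h) = 0) \<longrightarrow> (\<forall>i. c i = 0))
     \<and> (\<forall>\<beta>. is_root H \<beta> \<longrightarrow> (\<exists>c :: 'i \<Rightarrow> nat.
           (\<forall>h\<in>H. \<beta> h = (\<Sum>i\<in>UNIV. of_nat (c i) * \<alpha> i h))
         \<or> (\<forall>h\<in>H. \<beta> h = - (\<Sum>i\<in>UNIV. of_nat (c i) * \<alpha> i h))))"

definition coroot :: "'g set \<Rightarrow> ('g \<Rightarrow> complex) \<Rightarrow> 'g \<Rightarrow> bool" where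
  "coroot H \<beta> t \<longleftrightarrow> t \<in> H \<and> \<beta> t = 2
     \<and> (\<exists>x\<in>root_space H \<beta>. \<exists>y\<in>root_space H (\<lambda>h. - \<beta> h). bracket x y = t)"

definition is_cartan_matrix :: "('i::finite \<Rightarrow> 'i \<Rightarrow> int) \<Rightarrow> bool" where
  "is_cartan_matrix A \<longleftrightarrow> (\<exists>H \<alpha> \<alpha>v. cartan_subalgebra H \<and> simple_roots H \<alpha>
     \<and> (\<forall>i. coroot H (\<alpha> i) (\<alpha>v i))
     \<and> (\<forall>i j. \<alpha> j (\<alpha>v i) = of_int (A i j)))"

end

locale simple_lie_algebra = lie_algebra +
  assumes finite_dim: "\<exists>B. finite B \<and> span B = UNIV"
    and nonabelian: "\<exists>x y. bracket x y \<noteq> 0"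
    and ideals_trivial: "lie_ideal J \<Longrightarrow> J = {0} \<or> J = UNIV"

text \<open>The weight lattice consists of the \<open>\<Sum>\<^sub>j x\<^sub>j \<alpha>\<^sub>j\<close> with rational \<open>x\<^sub>j\<close> pairing integrally with
  all simple coroots, the root lattice of those with integral \<open>x\<^sub>j\<close>.\<close>

definition weight_lattice :: "('i::finite \<Rightarrow> 'i \<Rightarrow> int) \<Rightarrow> ('i \<Rightarrow> rat) set" where
  "weight_lattice A = {x. \<forall>i. (\<Sum>j\<in>UNIV. of_int (A i j) * x j) \<in> \<int>}"

definition root_lattice :: "('i \<Rightarrow> rat) set" where
  "root_lattice = {x. \<forall>j. x j \<in> \<int>}"

definition weight_exponent :: "('i::finite \<Rightarrow> 'i \<Rightarrow> int) \<Rightarrow> nat" where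
  "weight_exponent A =
     (LEAST m. 0 < m \<and> (\<forall>x\<in>weight_lattice A. (\<lambda>j. of_nat m * x j) \<in> root_lattice))"

definition euler :: "('i::linorder \<Rightarrow> 'i \<Rightarrow> int) \<Rightarrow> ('i \<Rightarrow> nat) \<Rightarrow> 'i \<Rightarrow> 'i \<Rightarrow> int" where
  "euler A d i j = (if i < j then int (d i) * A i j else if i = j then int (d i) else 0)"

definition euler_form ::
    "('i::{finite,linorder} \<Rightarrow> 'i \<Rightarrow> int) \<Rightarrow> ('i \<Rightarrow> nat) \<Rightarrow> ('i \<Rightarrow> int) \<Rightarrow> ('i \<Rightarrow> int) \<Rightarrow> int" where
  "euler_form A d \<mu> \<nu> = (\<Sum>i\<in>UNIV. \<Sum>j\<in>UNIV. \<mu> i * \<nu> j * euler A d i j)"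

definition indeterminates_over_rat :: "'k::field_char_0 \<Rightarrow> 'k \<Rightarrow> bool" where
  "indeterminates_over_rat r s \<longleftrightarrow>
     (\<forall>P :: rat poly poly. P \<noteq> 0 \<longrightarrow> poly (map_poly (\<lambda>p. poly (map_poly of_rat p) r) P) s \<noteq> 0)"


section \<open>Tensor products of vector spaces and algebras\<close>

abbreviation K_ring :: "'k::field ring" where
  "K_ring \<equiv> ring_of_type_algebra"

definition K_alg :: "('k::field, 'k) module" where
  "K_alg = \<lparr>carrier = UNIV, monoid.mult = (*), one = 1, ring.zero = 0, add = (+), module.smult = (*)\<rparr>"

definition linear_maps ::
    "('k, 'a, 'm) module_scheme \<Rightarrow> ('k, 'b, 'n) module_scheme \<Rightarrow> ('a \<Rightarrow> 'b) set" where
  "linear_maps V W = {f \<in> carrier V \<rightarrow> carrier W.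
     (\<forall>x\<in>carrier V. \<forall>y\<in>carrier V. f (x \<oplus>\<^bsub>V\<^esub> y) = f x \<oplus>\<^bsub>W\<^esub> f y)
     \<and> (\<forall>c. \<forall>x\<in>carrier V. f (c \<odot>\<^bsub>V\<^esub> x) = c \<odot>\<^bsub>W\<^esub> f x)}"

definition alg_hom ::
    "('k, 'a, 'm) module_scheme \<Rightarrow> ('k, 'b, 'n) module_scheme \<Rightarrow> ('a \<Rightarrow> 'b) set" where
  "alg_hom V W = ring_hom V W \<inter> linear_maps V W"

definition pm_scale :: "'k::field \<Rightarrow> ('c \<Rightarrow>\<^sub>0 'k) \<Rightarrow> ('c \<Rightarrow>\<^sub>0 'k)" where
  "pm_scale c t = Poly_Mapping.map ((*) c) t"

text \<open>\<open>V \<otimes> W\<close> is the free vector space on \<open>V \<times> W\<close> modulo the span of the bilinearity relators.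
  An element of \<open>V \<otimes> W\<close> is thus a coset of formal linear combinations of pairs.\<close>

definition tens_rel ::
    "('k::field, 'a, 'm) module_scheme \<Rightarrow> ('k, 'b, 'n) module_scheme \<Rightarrow> ('a \<times> 'b \<Rightarrow>\<^sub>0 'k) set" where
  "tens_rel V W = Modules.module.span pm_scale
     ({Poly_Mapping.single (x \<oplus>\<^bsub>V\<^esub> x', y) 1 - Poly_Mapping.single (x, y) 1
          - Poly_Mapping.single (x', y) 1
         | x x' y. x \<in> carrier V \<and> x' \<in> carrier V \<and> y \<in> carrier W}
      \<union> {Poly_Mapping.single (x, y \<oplus>\<^bsub>W\<^esub> y') 1 - Poly_Mapping.single (x, y) 1
          - Poly_Mapping.single (x, y') 1
         | x y y'. x \<in> carrier V \<and> y \<in> carrier W \<and> y' \<in> carrier W}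
      \<union> {Poly_Mapping.single (c \<odot>\<^bsub>V\<^esub> x, y) 1 - Poly_Mapping.single (x, y) c
         | c x y. x \<in> carrier V \<and> y \<in> carrier W}
      \<union> {Poly_Mapping.single (x, c \<odot>\<^bsub>W\<^esub> y) 1 - Poly_Mapping.single (x, y) c
         | c x y. x \<in> carrier V \<and> y \<in> carrier W})"

definition tens_class ::
    "('k::field, 'a, 'm) module_scheme \<Rightarrow> ('k, 'b, 'n) module_scheme
      \<Rightarrow> ('a \<times> 'b \<Rightarrow>\<^sub>0 'k) \<Rightarrow> ('a \<times> 'b \<Rightarrow>\<^sub>0 'k) set" where
  "tens_class V W t = (+) t ` tens_rel V W"

definition pure ::
    "('k::field, 'a, 'm) module_scheme \<Rightarrow> ('k, 'b, 'n) module_scheme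
      \<Rightarrow> 'a \<Rightarrow> 'b \<Rightarrow> ('a \<times> 'b \<Rightarrow>\<^sub>0 'k) set" where
  "pure V W x y = tens_class V W (Poly_Mapping.single (x, y) 1)"

definition rep :: "'c set \<Rightarrow> 'c" where
  "rep S = (SOME t. t \<in> S)"

definition tensor ::
    "('k::field, 'a, 'm) module_scheme \<Rightarrow> ('k, 'b, 'n) module_scheme
      \<Rightarrow> ('k, ('a \<times> 'b \<Rightarrow>\<^sub>0 'k) set) module" where
  "tensor V W = \<lparr>
     carrier = tens_class V W ` {t. Poly_Mapping.keys t \<subseteq> carrier V \<times> carrier W},
     monoid.mult = (\<lambda>S T. tens_class V W
       (\<Sum>(a, b)\<in>Poly_Mapping.keys (rep S). \<Sum>(a', b')\<in>Poly_Mapping.keys (rep T).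
          Poly_Mapping.single (a \<otimes>\<^bsub>V\<^esub> a', b \<otimes>\<^bsub>W\<^esub> b')
            (Poly_Mapping.lookup (rep S) (a, b) * Poly_Mapping.lookup (rep T) (a', b')))),
     one = pure V W \<one>\<^bsub>V\<^esub> \<one>\<^bsub>W\<^esub>,
     ring.zero = tens_class V W 0,
     add = (\<lambda>S T. tens_class V W (rep S + rep T)),
     module.smult = (\<lambda>c S. tens_class V W (pm_scale c (rep S)))\<rparr>"

text \<open>The value at a tensor of the linear map into \<open>Z\<close> induced by a bilinear map \<open>g\<close>.\<close>

definition tens_lift ::
    "('k::field, 'c, 'm) module_scheme \<Rightarrow> ('a \<Rightarrow> 'b \<Rightarrow> 'c) \<Rightarrow> ('a \<times> 'b \<Rightarrow>\<^sub>0 'k) set \<Rightarrow> 'c" where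
  "tens_lift Z g S =
     finsum Z (\<lambda>(a, b). Poly_Mapping.lookup (rep S) (a, b) \<odot>\<^bsub>Z\<^esub> g a b)
       (Poly_Mapping.keys (rep S))"


section \<open>Hopf algebras, 2-cocycles and deformations\<close>

record (overloaded) ('k::zero, 'a) hopf = "('k, 'a) module" +
  comult :: "'a \<Rightarrow> ('a \<times> 'a \<Rightarrow>\<^sub>0 'k) set"
  counit :: "'a \<Rightarrow> 'k"
  antipode :: "'a \<Rightarrow> 'a"

text \<open>\<open>sweedler H Z g a\<close> is the sum of \<open>g a\<^sub>1 a\<^sub>2\<close> in Sweedler notation, with values in \<open>Z\<close>.
  By nesting, \<open>a\<^sub>1\<close>, \<open>a\<^sub>2\<close>, \<open>a\<^sub>3\<close> are obtained by splitting the second leg again.\<close>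

definition sweedler ::
    "('k::field, 'a, 'm) hopf_scheme \<Rightarrow> ('k, 'c, 'n) module_scheme \<Rightarrow> ('a \<Rightarrow> 'a \<Rightarrow> 'c) \<Rightarrow> 'a \<Rightarrow> 'c" where
  "sweedler H Z g a = tens_lift Z g (comult H a)"

locale hopf_algebra =
  fixes H :: "('k::field, 'a) hopf" (structure)
  assumes is_ring: "ring H"
    and is_module: "Module.module K_ring H"
    and smult_mult_left:
      "x \<in> carrier H \<Longrightarrow> y \<in> carrier H \<Longrightarrow> (c \<odot> x) \<otimes> y = c \<odot> (x \<otimes> y)"
    and smult_mult_right:
      "x \<in> carrier H \<Longrightarrow> y \<in> carrier H \<Longrightarrow> x \<otimes> (c \<odot> y) = c \<odot> (x \<otimes> y)"
    and comult_hom: "comult H \<in> alg_hom H (tensor H H)"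
    and counit_hom: "counit H \<in> alg_hom H K_alg"
    and coassoc: "x \<in> carrier H \<Longrightarrow>
      sweedler H (tensor H (tensor H H)) (\<lambda>a b. pure H (tensor H H) a (comult H b)) x =
      sweedler H (tensor H (tensor H H))
        (\<lambda>a b. sweedler H (tensor H (tensor H H))
           (\<lambda>a' a''. pure H (tensor H H) a' (pure H H a'' b)) a) x"
    and counit_left: "x \<in> carrier H \<Longrightarrow> sweedler H H (\<lambda>a b. counit H a \<odot> b) x = x"
    and counit_right: "x \<in> carrier H \<Longrightarrow> sweedler H H (\<lambda>a b. counit H b \<odot> a) x = x"
    and antipode_linear: "antipode H \<in> linear_maps H H"
    and antipode_left:
      "x \<in> carrier H \<Longrightarrow> sweedler H H (\<lambda>a b. antipode H a \<otimes> b) x = counit H x \<odot> \<one>"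
    and antipode_right:
      "x \<in> carrier H \<Longrightarrow> sweedler H H (\<lambda>a b. a \<otimes> antipode H b) x = counit H x \<odot> \<one>"

definition hopf_iso :: "('k::field, 'a) hopf \<Rightarrow> ('k, 'b) hopf \<Rightarrow> ('a \<Rightarrow> 'b) set" where
  "hopf_iso H H' = {\<phi> \<in> alg_hom H H'. bij_betw \<phi> (carrier H) (carrier H')
     \<and> (\<forall>x\<in>carrier H.
          comult H' (\<phi> x) = sweedler H (tensor H' H') (\<lambda>a b. pure H' H' (\<phi> a) (\<phi> b)) x
        \<and> counit H' (\<phi> x) = counit H x
        \<and> antipode H' (\<phi> x) = \<phi> (antipode H x))}"

definition isomorphic_hopf_algebras :: "('k::field, 'a) hopf \<Rightarrow> ('k, 'b) hopf \<Rightarrow> bool" where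
  "isomorphic_hopf_algebras H H' \<longleftrightarrow> hopf_algebra H \<and> hopf_algebra H' \<and> hopf_iso H H' \<noteq> {}"

text \<open>Bilinear forms are taken to be extensional, so that they are determined by their values on
  the carrier.\<close>

definition bilinear_forms :: "('k::field, 'a, 'm) module_scheme \<Rightarrow> ('a \<times> 'a \<Rightarrow> 'k) set" where
  "bilinear_forms H = {\<sigma> \<in> extensional (carrier H \<times> carrier H).
     \<forall>x\<in>carrier H. (\<lambda>y. \<sigma> (x, y)) \<in> linear_maps H K_alg \<and> (\<lambda>y. \<sigma> (y, x)) \<in> linear_maps H K_alg}"

definition convolution ::
    "('k::field, 'a) hopf \<Rightarrow> ('a \<times> 'a \<Rightarrow> 'k) \<Rightarrow> ('a \<times> 'a \<Rightarrow> 'k) \<Rightarrow> 'a \<times> 'a \<Rightarrow> 'k" where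
  "convolution H \<sigma> \<tau> = restrict
     (\<lambda>(a, b). sweedler H K_alg (\<lambda>a1 a2. sweedler H K_alg (\<lambda>b1 b2. \<sigma> (a1, b1) * \<tau> (a2, b2)) b) a)
     (carrier H \<times> carrier H)"

definition conv_unit :: "('k::field, 'a) hopf \<Rightarrow> 'a \<times> 'a \<Rightarrow> 'k" where
  "conv_unit H = restrict (\<lambda>(a, b). counit H a * counit H b) (carrier H \<times> carrier H)"

definition is_conv_inverse ::
    "('k::field, 'a) hopf \<Rightarrow> ('a \<times> 'a \<Rightarrow> 'k) \<Rightarrow> ('a \<times> 'a \<Rightarrow> 'k) \<Rightarrow> bool" where
  "is_conv_inverse H \<sigma> \<tau> \<longleftrightarrow> \<tau> \<in> bilinear_forms H
     \<and> convolution H \<sigma> \<tau> = conv_unit H \<and> convolution H \<tau> \<sigma> = conv_unit H"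

definition conv_inverse :: "('k::field, 'a) hopf \<Rightarrow> ('a \<times> 'a \<Rightarrow> 'k) \<Rightarrow> 'a \<times> 'a \<Rightarrow> 'k" where
  "conv_inverse H \<sigma> = (THE \<tau>. is_conv_inverse H \<sigma> \<tau>)"

definition hopf_2_cocycle :: "('k::field, 'a) hopf \<Rightarrow> ('a \<times> 'a \<Rightarrow> 'k) \<Rightarrow> bool" where
  "hopf_2_cocycle H \<sigma> \<longleftrightarrow> \<sigma> \<in> bilinear_forms H \<and> (\<exists>\<tau>. is_conv_inverse H \<sigma> \<tau>)
     \<and> (\<forall>a\<in>carrier H. \<forall>b\<in>carrier H. \<forall>c\<in>carrier H.
          sweedler H K_alg (\<lambda>a1 a2. sweedler H K_alg (\<lambda>b1 b2.
            \<sigma> (a1, b1) * \<sigma> (a2 \<otimes>\<^bsub>H\<^esub> b2, c)) b) a =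
          sweedler H K_alg (\<lambda>b1 b2. sweedler H K_alg (\<lambda>c1 c2.
            \<sigma> (b1, c1) * \<sigma> (a, b2 \<otimes>\<^bsub>H\<^esub> c2)) c) b)
     \<and> (\<forall>a\<in>carrier H. \<sigma> (a, \<one>\<^bsub>H\<^esub>) = counit H a \<and> \<sigma> (\<one>\<^bsub>H\<^esub>, a) = counit H a)"

text \<open>With this multiplication the antipode carries \<open>\<sigma>\<close> on the left and its inverse on the right.
  Exchanging the two does not give an antipode: for a skew-primitive element
  \<open>\<Delta>(x) = x \<otimes> 1 + g \<otimes> x\<close> such that \<open>\<sigma>\<close> and its inverse vanish on all pairs involving
  \<open>x\<close> or \<open>g\<^sup>-\<^sup>1 x\<close>, and \<open>\<sigma>\<close> is multiplicative on the powers of \<open>g\<close>, the axiom forces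
  \<open>S\<^sup>\<sigma>(x) = - \<sigma>(g\<^sup>-\<^sup>1, g) g\<^sup>-\<^sup>1 x\<close>.\<close>

definition deform :: "('k::field, 'a) hopf \<Rightarrow> ('a \<times> 'a \<Rightarrow> 'k) \<Rightarrow> ('k, 'a) hopf" where
  "deform H \<sigma> = H\<lparr>
     monoid.mult := (\<lambda>a b.
       sweedler H H (\<lambda>a1 a'. sweedler H H (\<lambda>a2 a3.
       sweedler H H (\<lambda>b1 b'. sweedler H H (\<lambda>b2 b3.
         (\<sigma> (a1, b1) * conv_inverse H \<sigma> (a3, b3)) \<odot>\<^bsub>H\<^esub> (a2 \<otimes>\<^bsub>H\<^esub> b2)) b') b) a') a),
     antipode := (\<lambda>a.
       sweedler H H (\<lambda>a1 a'. sweedler H H (\<lambda>a2 a''. sweedler H H (\<lambda>a3 a'''. sweedler H H (\<lambda>a4 a5.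
         (\<sigma> (a1, antipode H a2) * conv_inverse H \<sigma> (antipode H a4, a5)) \<odot>\<^bsub>H\<^esub> antipode H a3)
         a''') a'') a') a)\<rparr>"


section \<open>Free algebras\<close>

text \<open>The free associative algebra is the monoid algebra of the free monoid; the monoid operation
  has to be written additively for the ring structure on \<^type>\<open>poly_mapping\<close>.\<close>

datatype 'a word = Word (letters: "'a list")

instantiation word :: (type) monoid_add
begin

definition zero_word :: "'a word" where "zero_word = Word []"

definition plus_word :: "'a word \<Rightarrow> 'a word \<Rightarrow> 'a word" where
  "plus_word u v = Word (letters u @ letters v)"

instance by standard (simp_all add: zero_word_def plus_word_def)

end

definition gvar :: "'a \<Rightarrow> 'a word \<Rightarrow>\<^sub>0 'k::field" where
  "gvar x = Poly_Mapping.single (Word [x]) 1"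

definition sc :: "'k::field \<Rightarrow> 'a word \<Rightarrow>\<^sub>0 'k" where
  "sc c = Poly_Mapping.single 0 c"

definition free_eval ::
    "('k::field, 'b, 'm) module_scheme \<Rightarrow> ('a \<Rightarrow> 'b) \<Rightarrow> ('a word \<Rightarrow>\<^sub>0 'k) \<Rightarrow> 'b" where
  "free_eval B g p = finsum B
     (\<lambda>w. Poly_Mapping.lookup p w \<odot>\<^bsub>B\<^esub> foldr (\<lambda>x y. g x \<otimes>\<^bsub>B\<^esub> y) (letters w) \<one>\<^bsub>B\<^esub>)
     (Poly_Mapping.keys p)"

definition opposite :: "('k, 'b, 'm) module_scheme \<Rightarrow> ('k, 'b, 'm) module_scheme" where
  "opposite B = B\<lparr>monoid.mult := (\<lambda>x y. y \<otimes>\<^bsub>B\<^esub> x)\<rparr>"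


section \<open>Two-parameter quantum groups\<close>

text \<open>\<open>Gw\<close> and \<open>Gw'\<close> are the group-like generators \<open>\<omega>\<close> and \<open>\<omega>'\<close>.\<close>

datatype 'i generator = Ge 'i | Gf 'i | Gw 'i | Gw_inv 'i | Gw' 'i | Gw'_inv 'i

type_synonym ('i, 'k) free_alg = "'i generator word \<Rightarrow>\<^sub>0 'k"

definition qint :: "'k::field \<Rightarrow> nat \<Rightarrow> 'k" where
  "qint v k = (v ^ k - 1) / (v - 1)"

definition qfact :: "'k::field \<Rightarrow> nat \<Rightarrow> 'k" where
  "qfact v k = (\<Prod>l = 1..k. qint v l)"

definition qbinom :: "'k::field \<Rightarrow> nat \<Rightarrow> nat \<Rightarrow> 'k" where
  "qbinom v k l = qfact v k / (qfact v l * qfact v (k - l))"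

definition serre_coeff ::
    "('i::linorder \<Rightarrow> 'i \<Rightarrow> int) \<Rightarrow> ('i \<Rightarrow> nat) \<Rightarrow> 'k::field \<Rightarrow> 'k \<Rightarrow> 'i \<Rightarrow> 'i \<Rightarrow> nat \<Rightarrow> 'k" where
  "serre_coeff A d r s i j k =
     (- 1) ^ k * qbinom (r ^ d i / s ^ d i) (nat (1 - A i j)) k
     * ((r ^ d i / s ^ d i) ^ (k * (k - 1) div 2)
        * r powi (int k * euler A d j i) * s powi (- (int k * euler A d i j)))"

definition relators ::
    "('i::linorder \<Rightarrow> 'i \<Rightarrow> int) \<Rightarrow> ('i \<Rightarrow> nat) \<Rightarrow> 'k::field \<Rightarrow> 'k \<Rightarrow> ('i, 'k) free_alg set" where
  "relators A d r s =
     (\<Union>i. {gvar (Gw i) * gvar (Gw_inv i) - 1, gvar (Gw_inv i) * gvar (Gw i) - 1,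
           gvar (Gw' i) * gvar (Gw'_inv i) - 1, gvar (Gw'_inv i) * gvar (Gw' i) - 1})
   \<union> (\<Union>i j. {gvar (Gw i) * gvar (Gw j) - gvar (Gw j) * gvar (Gw i),
             gvar (Gw i) * gvar (Gw' j) - gvar (Gw' j) * gvar (Gw i),
             gvar (Gw' i) * gvar (Gw' j) - gvar (Gw' j) * gvar (Gw' i)})
   \<union> (\<Union>i j.
        {gvar (Gw i) * gvar (Ge j)
           - sc (r powi euler A d j i * s powi (- euler A d i j)) * gvar (Ge j) * gvar (Gw i),
         gvar (Gw' i) * gvar (Ge j)
           - sc (r powi (- euler A d i j) * s powi euler A d j i) * gvar (Ge j) * gvar (Gw' i),
         gvar (Gw i) * gvar (Gf j)
           - sc (r powi (- euler A d j i) * s powi euler A d i j) * gvar (Gf j) * gvar (Gw i),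
         gvar (Gw' i) * gvar (Gf j)
           - sc (r powi euler A d i j * s powi (- euler A d j i)) * gvar (Gf j) * gvar (Gw' i)})
   \<union> (\<Union>i j.
        {gvar (Ge i) * gvar (Gf j) - gvar (Gf j) * gvar (Ge i)
           - (if i = j then sc (1 / (r ^ d i - s ^ d i)) * (gvar (Gw i) - gvar (Gw' i)) else 0)})
   \<union> {(\<Sum>k = 0..nat (1 - A i j). sc (serre_coeff A d r s i j k)
          * gvar (Ge i) ^ (nat (1 - A i j) - k) * gvar (Ge j) * gvar (Ge i) ^ k) | i j. i \<noteq> j}
   \<union> {(\<Sum>k = 0..nat (1 - A i j). sc (serre_coeff A d r s i j k)
          * gvar (Gf i) ^ k * gvar (Gf j) * gvar (Gf i) ^ (nat (1 - A i j) - k)) | i j. i \<noteq> j}"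

definition U_ideal ::
    "('i::linorder \<Rightarrow> 'i \<Rightarrow> int) \<Rightarrow> ('i \<Rightarrow> nat) \<Rightarrow> 'k::field \<Rightarrow> 'k \<Rightarrow> ('i, 'k) free_alg set" where
  "U_ideal A d r s = Idl\<^bsub>ring_of_type_algebra\<^esub> (relators A d r s)"

definition U_class ::
    "('i::linorder \<Rightarrow> 'i \<Rightarrow> int) \<Rightarrow> ('i \<Rightarrow> nat) \<Rightarrow> 'k::field \<Rightarrow> 'k
      \<Rightarrow> ('i, 'k) free_alg \<Rightarrow> ('i, 'k) free_alg set" where
  "U_class A d r s p = U_ideal A d r s +>\<^bsub>ring_of_type_algebra\<^esub> p"

definition U_alg ::
    "('i::linorder \<Rightarrow> 'i \<Rightarrow> int) \<Rightarrow> ('i \<Rightarrow> nat) \<Rightarrow> 'k::field \<Rightarrow> 'k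
      \<Rightarrow> ('k, ('i, 'k) free_alg set) module" where
  "U_alg A d r s = (let Q = ring_of_type_algebra Quot U_ideal A d r s in
     \<lparr>carrier = carrier Q, monoid.mult = monoid.mult Q, one = one Q,
      ring.zero = ring.zero Q, add = add Q,
      module.smult = (\<lambda>c S. U_class A d r s (sc c) \<otimes>\<^bsub>Q\<^esub> S)\<rparr>)"

primrec comult_gen ::
    "('i::linorder \<Rightarrow> 'i \<Rightarrow> int) \<Rightarrow> ('i \<Rightarrow> nat) \<Rightarrow> 'k::field \<Rightarrow> 'k \<Rightarrow> 'i generator
      \<Rightarrow> (('i, 'k) free_alg set \<times> ('i, 'k) free_alg set \<Rightarrow>\<^sub>0 'k) set" where
  "comult_gen A d r s (Ge i) = (let T = tensor (U_alg A d r s) (U_alg A d r s);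
       p = (\<lambda>x y. pure (U_alg A d r s) (U_alg A d r s) (U_class A d r s x) (U_class A d r s y))
     in p (gvar (Ge i)) 1 \<oplus>\<^bsub>T\<^esub> p (gvar (Gw i)) (gvar (Ge i)))"
| "comult_gen A d r s (Gf i) = (let T = tensor (U_alg A d r s) (U_alg A d r s);
       p = (\<lambda>x y. pure (U_alg A d r s) (U_alg A d r s) (U_class A d r s x) (U_class A d r s y))
     in p 1 (gvar (Gf i)) \<oplus>\<^bsub>T\<^esub> p (gvar (Gf i)) (gvar (Gw' i)))"
| "comult_gen A d r s (Gw i) = pure (U_alg A d r s) (U_alg A d r s)
     (U_class A d r s (gvar (Gw i))) (U_class A d r s (gvar (Gw i)))"
| "comult_gen A d r s (Gw_inv i) = pure (U_alg A d r s) (U_alg A d r s)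
     (U_class A d r s (gvar (Gw_inv i))) (U_class A d r s (gvar (Gw_inv i)))"
| "comult_gen A d r s (Gw' i) = pure (U_alg A d r s) (U_alg A d r s)
     (U_class A d r s (gvar (Gw' i))) (U_class A d r s (gvar (Gw' i)))"
| "comult_gen A d r s (Gw'_inv i) = pure (U_alg A d r s) (U_alg A d r s)
     (U_class A d r s (gvar (Gw'_inv i))) (U_class A d r s (gvar (Gw'_inv i)))"

primrec counit_gen :: "'i generator \<Rightarrow> 'k::field" where
  "counit_gen (Ge i) = 0"
| "counit_gen (Gf i) = 0"
| "counit_gen (Gw i) = 1"
| "counit_gen (Gw_inv i) = 1"
| "counit_gen (Gw' i) = 1"
| "counit_gen (Gw'_inv i) = 1"

primrec antipode_gen :: "'i generator \<Rightarrow> ('i, 'k::field) free_alg" where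
  "antipode_gen (Ge i) = - (gvar (Gw_inv i) * gvar (Ge i))"
| "antipode_gen (Gf i) = - (gvar (Gf i) * gvar (Gw'_inv i))"
| "antipode_gen (Gw i) = gvar (Gw_inv i)"
| "antipode_gen (Gw_inv i) = gvar (Gw i)"
| "antipode_gen (Gw' i) = gvar (Gw'_inv i)"
| "antipode_gen (Gw'_inv i) = gvar (Gw' i)"

text \<open>The structure maps are the (anti)homomorphisms prescribed on generators, evaluated at a
  representative in the free algebra.\<close>

definition quantum_group ::
    "('i::linorder \<Rightarrow> 'i \<Rightarrow> int) \<Rightarrow> ('i \<Rightarrow> nat) \<Rightarrow> 'k::field \<Rightarrow> 'k
      \<Rightarrow> ('k, ('i, 'k) free_alg set) hopf" where
  "quantum_group A d r s = module.extend (U_alg A d r s) (hopf.fields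
     (\<lambda>S. free_eval (tensor (U_alg A d r s) (U_alg A d r s)) (comult_gen A d r s) (rep S))
     (\<lambda>S. free_eval K_alg counit_gen (rep S))
     (\<lambda>S. free_eval (opposite (U_alg A d r s)) (\<lambda>g. U_class A d r s (antipode_gen g)) (rep S)))"


section \<open>The twisting form\<close>

text \<open>Representatives of \<open>K\<^sub>\<mu>\<close> and \<open>K'\<^sub>\<mu>\<close>; the order of the factors is immaterial in the quotient.\<close>

definition K_mon :: "('i::{finite,linorder} \<Rightarrow> int) \<Rightarrow> ('i, 'k::field) free_alg" where
  "K_mon \<mu> = prod_list (map (\<lambda>i. if 0 \<le> \<mu> i then gvar (Gw i) ^ nat (\<mu> i)
      else gvar (Gw_inv i) ^ nat (- \<mu> i)) (sorted_list_of_set UNIV))"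

definition K'_mon :: "('i::{finite,linorder} \<Rightarrow> int) \<Rightarrow> ('i, 'k::field) free_alg" where
  "K'_mon \<mu> = prod_list (map (\<lambda>i. if 0 \<le> \<mu> i then gvar (Gw' i) ^ nat (\<mu> i)
      else gvar (Gw'_inv i) ^ nat (- \<mu> i)) (sorted_list_of_set UNIV))"

definition E_mon :: "'i list \<Rightarrow> ('i, 'k::field) free_alg" where
  "E_mon es = prod_list (map (\<lambda>i. gvar (Ge i)) es)"

definition F_mon :: "'i list \<Rightarrow> ('i, 'k::field) free_alg" where
  "F_mon fs = prod_list (map (\<lambda>i. gvar (Gf i)) fs)"

text \<open>\<open>rh\<close> and \<open>sh\<close> are the chosen square roots of \<open>r\<close> and \<open>s\<close>, and \<open>\<sigma>\<close> is a form on
  \<open>U\<^sub>q\<close> with \<open>q = rh / sh\<close>.\<close>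

definition twisting_form ::
    "('i::{finite,linorder} \<Rightarrow> 'i \<Rightarrow> int) \<Rightarrow> ('i \<Rightarrow> nat) \<Rightarrow> 'k::field \<Rightarrow> 'k
      \<Rightarrow> (('i, 'k) free_alg set \<times> ('i, 'k) free_alg set \<Rightarrow> 'k) \<Rightarrow> bool" where
  "twisting_form A d rh sh \<sigma> \<longleftrightarrow> (let q = rh / sh; Uq = quantum_group A d q (inverse q);
       cl = U_class A d q (inverse q)
     in \<sigma> \<in> bilinear_forms Uq
      \<and> (\<forall>\<mu>1 \<mu>2 \<nu>1 \<nu>2. let \<mu> = (\<lambda>i. \<mu>1 i + \<mu>2 i); \<nu> = (\<lambda>i. \<nu>1 i + \<nu>2 i) in
           \<sigma> (cl (K_mon \<mu>1 * K'_mon \<mu>2), cl (K_mon \<nu>1 * K'_mon \<nu>2))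
             = rh powi euler_form A d \<nu> \<mu> * sh powi (- euler_form A d \<mu> \<nu>))
      \<and> (\<forall>fs es lam rho. \<not> (fs = [] \<and> es = []) \<longrightarrow>
           (\<forall>y\<in>carrier Uq.
              \<sigma> (cl (F_mon fs * K_mon lam * K'_mon rho * E_mon es), y) = 0
            \<and> \<sigma> (y, cl (F_mon fs * K_mon lam * K'_mon rho * E_mon es)) = 0)))"

end

theory Submission
  imports Defs
begin

text \<open>
  Let \<open>Q\<close> be the root lattice. The quantum group is graded by \<open>Q \<times> Q\<close>, with \<open>e\<^sub>i\<close> in degree
  \<open>(\<alpha>\<^sub>i, 0)\<close>, \<open>f\<^sub>i\<close> in degree \<open>(0, \<alpha>\<^sub>i)\<close> and both \<open>\<omega>\<^sub>i\<close> and \<open>\<omega>'\<^sub>i\<close> in degree \<open>(\<alpha>\<^sub>i, \<alpha>\<^sub>i)\<close>, and the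
  coproduct maps the component of degree \<open>(\<lambda>, \<rho>)\<close> into the sum over \<open>\<nu>\<close> of the components
  \<open>(\<lambda>, \<nu>) \<otimes> (\<nu>, \<rho>)\<close> (\<open>balanced_comult\<close>). The grading comes from the Hopf algebra map \<open>proj\<close> onto the
  group algebra of \<open>Q\<close> that kills all \<open>e\<^sub>i\<close>, \<open>f\<^sub>i\<close> and sends \<open>\<omega>\<^sub>i\<close>, \<open>\<omega>'\<^sub>i\<close> to \<open>\<alpha>\<^sub>i\<close>. The form of the
  theorem is the pullback along \<open>proj\<close> of the bicharacter
  \<open>\<chi>(\<mu>, \<nu>) = r\<^bsup>\<langle>\<nu>,\<mu>\<rangle>/2\<^esup> s\<^bsup>-\<langle>\<mu>,\<nu>\<rangle>/2\<^esup>\<close> of \<open>Q\<close>. It is the only form with the prescribed values because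
  the ordered monomials \<open>F K\<^sub>\<lambda> K'\<^sub>\<rho> E\<close> span the algebra (\<open>form_of_characterization\<close>), and it is a
  2-cocycle because a bicharacter is one, with convolution inverse the pullback of \<open>\<chi>\<^sup>-\<^sup>1\<close>
  (\<open>cocycle_form_of\<close>, \<open>conv_inverse_form_of\<close>).

  By the shape of the coproduct, the deformed product of elements of degrees \<open>(\<lambda>, \<rho>)\<close> and
  \<open>(\<lambda>', \<rho>')\<close> is the old product times the scalar \<open>\<chi>(\<lambda>, \<lambda>') / \<chi>(\<rho>, \<rho>')\<close> (\<open>D_mult_word\<close>). So
  deforming multiplies the scalar \<open>\<beta>\<^sub>i\<^sub>j\<close> in \<open>\<omega>\<^sub>i e\<^sub>j = \<beta>\<^sub>i\<^sub>j e\<^sub>j \<omega>\<^sub>i\<close> by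
  \<open>\<chi>(\<alpha>\<^sub>i, \<alpha>\<^sub>j) / \<chi>(\<alpha>\<^sub>j, \<alpha>\<^sub>i)\<close>. The defining relations involve \<open>r\<close> and \<open>s\<close> only through the
  \<open>\<beta>\<^sub>i\<^sub>j\<close>, the quotients \<open>r\<^sub>i / s\<^sub>i\<close> and the differences \<open>r\<^sub>i - s\<^sub>i\<close>. For the bicharacter above, the
  \<open>\<beta>\<^sub>i\<^sub>j\<close> of \<open>U\<^sub>q\<close> are deformed into those of \<open>U\<^sub>r\<^sub>,\<^sub>s\<close>, the quotients agree, and the
  differences are adjusted by rescaling the \<open>f\<^sub>i\<close>. This gives a homomorphism from \<open>U\<^sub>r\<^sub>,\<^sub>s\<close> to the
  deformation (\<open>qrep_rescaled_gen\<close>) which maps every word in the generators to a nonzero multiple of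
  the same word. The inverse bicharacter gives a homomorphism with the inverse multiples in the
  other direction, hence the homomorphism is bijective (\<open>twist_isomorphic\<close>).

  The Serre relations enter through the q-binomial theorem: the Serre element of \<open>x\<close> and \<open>y\<close> is
  obtained by applying to \<open>y\<close> the product of the commuting operators \<open>L - v\<^sup>k b R\<close> for \<open>k < n\<close>, where
  \<open>L\<close> and \<open>R\<close> are left and right multiplication by \<open>x\<close> (\<open>qad_free_alg\<close>). In this form it is a short
  induction that coproduct, antipode and deformation respect them (\<open>qad_sum\<close>,
  \<open>qad_opposite_twist\<close>, \<open>qad_D_e\<close>, \<open>qad_D_f\<close>). The structure maps of the quantum group and of its deformation
  are then multiplicative or antimultiplicative, so that the Hopf algebra axioms and the
  compatibility of the isomorphism need to be checked on generators only
  (\<open>hopf_from_skew_primitives\<close>).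
\<close>

section \<open>Vector spaces and algebras with explicit carriers\<close>

text \<open>The scalars form a whole type, so the module laws take a simpler form than for a general ring
  of scalars with a carrier.\<close>

locale kspace =
  fixes V :: "('k::field, 'a, 'm) module_scheme" (structure)
  assumes is_mod: "Module.module K_ring V"
begin

sublocale abelian_group V
  using is_mod by (simp add: Module.module_def)

lemma smult_closed [simp, intro]: "x \<in> carrier V \<Longrightarrow> c \<odot> x \<in> carrier V"
  using module.smult_closed[OF is_mod, of c x] by (simp add: ring_of_type_algebra_def)

lemma smult_add_left: "x \<in> carrier V \<Longrightarrow> (a + b) \<odot> x = a \<odot> x \<oplus> b \<odot> x"
  using module.smult_l_distr[OF is_mod, of a b x] by (simp add: ring_of_type_algebra_def)

lemma smult_add_right: "x \<in> carrier V \<Longrightarrow> y \<in> carrier V \<Longrightarrow> c \<odot> (x \<oplus> y) = c \<odot> x \<oplus> c \<odot> y"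
  using module.smult_r_distr[OF is_mod, of c x y] by (simp add: ring_of_type_algebra_def)

lemma smult_smult [simp]: "x \<in> carrier V \<Longrightarrow> a \<odot> (b \<odot> x) = (a * b) \<odot> x"
  using module.smult_assoc1[OF is_mod, of a b x] by (simp add: ring_of_type_algebra_def)

lemma smult_one [simp]: "x \<in> carrier V \<Longrightarrow> 1 \<odot> x = x"
  using module.smult_one[OF is_mod, of x] by (simp add: ring_of_type_algebra_def)

lemma smult_zero_left [simp]: "x \<in> carrier V \<Longrightarrow> 0 \<odot> x = \<zero>"
  using smult_add_left[of x 0 0] by (metis add.l_cancel_one' add_0 smult_closed)

lemma smult_zero_right [simp]: "c \<odot> \<zero> = \<zero>"
  using smult_add_right[of \<zero> \<zero> c] by (metis add.l_cancel_one' l_zero smult_closed zero_closed)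

lemma smult_minus_one: "x \<in> carrier V \<Longrightarrow> (- 1) \<odot> x = \<ominus> x"
  using smult_add_left[of x "- 1" 1]
  by (metis add.inv_equality smult_closed smult_one smult_zero_left add.left_inverse)

lemma a_minus_smult: "x \<in> carrier V \<Longrightarrow> y \<in> carrier V \<Longrightarrow> x \<ominus> y = x \<oplus> (- 1) \<odot> y"
  by (simp add: a_minus_def smult_minus_one)

lemma finsum_mono_neutral:
  assumes "finite B" "A \<subseteq> B" "\<And>x. x \<in> B - A \<Longrightarrow> f x = \<zero>" "f \<in> A \<rightarrow> carrier V"
  shows "finsum V f B = finsum V f A"
  using assms by (intro add.finprod_mono_neutral_cong_right) auto

end

lemma kspaceI:
  fixes V :: "('k::field, 'a, 'm) module_scheme" (structure)
  assumes "abelian_group V"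
    and "\<And>c x. x \<in> carrier V \<Longrightarrow> c \<odot> x \<in> carrier V"
    and "\<And>a b x. x \<in> carrier V \<Longrightarrow> (a + b) \<odot> x = a \<odot> x \<oplus> b \<odot> x"
    and "\<And>c x y. x \<in> carrier V \<Longrightarrow> y \<in> carrier V \<Longrightarrow> c \<odot> (x \<oplus> y) = c \<odot> x \<oplus> c \<odot> y"
    and "\<And>a b x. x \<in> carrier V \<Longrightarrow> (a * b) \<odot> x = a \<odot> (b \<odot> x)"
    and "\<And>x. x \<in> carrier V \<Longrightarrow> 1 \<odot> x = x"
  shows "kspace V"
proof (rule kspace.intro)
  have "cring (K_ring :: 'k ring)" by (rule cring_from_type_algebra)
  then show "Module.module K_ring V"
    using assms by (intro moduleI) (auto simp: ring_of_type_algebra_def)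
qed

locale kalg = kspace V + ring V
  for V :: "('k::field, 'a, 'm) module_scheme" (structure) +
  assumes smult_mult_left [simp]:
      "x \<in> carrier V \<Longrightarrow> y \<in> carrier V \<Longrightarrow> (c \<odot> x) \<otimes> y = c \<odot> (x \<otimes> y)"
    and smult_mult_right [simp]:
      "x \<in> carrier V \<Longrightarrow> y \<in> carrier V \<Longrightarrow> x \<otimes> (c \<odot> y) = c \<odot> (x \<otimes> y)"

lemma linear_mapsI:
  assumes "\<And>x. x \<in> carrier V \<Longrightarrow> f x \<in> carrier W"
    and "\<And>x y. x \<in> carrier V \<Longrightarrow> y \<in> carrier V \<Longrightarrow> f (x \<oplus>\<^bsub>V\<^esub> y) = f x \<oplus>\<^bsub>W\<^esub> f y"
    and "\<And>c x. x \<in> carrier V \<Longrightarrow> f (c \<odot>\<^bsub>V\<^esub> x) = c \<odot>\<^bsub>W\<^esub> f x"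
  shows "f \<in> linear_maps V W"
  using assms by (auto simp: linear_maps_def)

lemma linear_maps_closed: "f \<in> linear_maps V W \<Longrightarrow> x \<in> carrier V \<Longrightarrow> f x \<in> carrier W"
  by (auto simp: linear_maps_def)

lemma linear_maps_add:
  "f \<in> linear_maps V W \<Longrightarrow> x \<in> carrier V \<Longrightarrow> y \<in> carrier V \<Longrightarrow> f (x \<oplus>\<^bsub>V\<^esub> y) = f x \<oplus>\<^bsub>W\<^esub> f y"
  by (auto simp: linear_maps_def)

lemma linear_maps_smult:
  "f \<in> linear_maps V W \<Longrightarrow> x \<in> carrier V \<Longrightarrow> f (c \<odot>\<^bsub>V\<^esub> x) = c \<odot>\<^bsub>W\<^esub> f x"
  by (auto simp: linear_maps_def)

lemma linear_maps_comp:
  "f \<in> linear_maps U V \<Longrightarrow> g \<in> linear_maps V W \<Longrightarrow> (\<lambda>x. g (f x)) \<in> linear_maps U W"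
  by (auto simp: linear_maps_def Pi_iff)

lemma linear_maps_zero:
  assumes "kspace V" "kspace W" "f \<in> linear_maps V W"
  shows "f \<zero>\<^bsub>V\<^esub> = \<zero>\<^bsub>W\<^esub>"
proof -
  interpret V: kspace V by fact
  interpret W: kspace W by fact
  have "f (0 \<odot>\<^bsub>V\<^esub> \<zero>\<^bsub>V\<^esub>) = 0 \<odot>\<^bsub>W\<^esub> f \<zero>\<^bsub>V\<^esub>"
    using assms(3) by (intro linear_maps_smult) auto
  then show ?thesis
    using linear_maps_closed[OF assms(3)] by simp
qed

lemma linear_maps_finsum:
  assumes "kspace V" "kspace W" "f \<in> linear_maps V W" "g \<in> A \<rightarrow> carrier V"
  shows "f (finsum V g A) = finsum W (\<lambda>x. f (g x)) A"
proof -
  interpret V: kspace V by fact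
  interpret W: kspace W by fact
  show ?thesis
    using assms(4)
  proof (induction A rule: infinite_finite_induct)
    case (insert x A)
    have "f (finsum V g A) = finsum W (\<lambda>x. f (g x)) A"
      using insert by auto
    moreover have "g x \<in> carrier V" "g \<in> A \<rightarrow> carrier V" using insert.prems by auto
    moreover have "(\<lambda>x. f (g x)) \<in> A \<rightarrow> carrier W" "f (g x) \<in> carrier W"
      using insert.prems linear_maps_closed[OF assms(3)] by auto
    ultimately show ?case using insert.hyps
      by (simp add: V.finsum_insert W.finsum_insert linear_maps_add[OF assms(3)] V.finsum_closed)
  qed (use linear_maps_zero[OF assms(1-3)] in auto)
qed

lemma linear_maps_id: "(\<lambda>x. x) \<in> linear_maps V V"
  by (auto simp: linear_maps_def)

lemma linear_maps_smult_left:
  assumes "kspace W" "f \<in> linear_maps V W"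
  shows "(\<lambda>x. c \<odot>\<^bsub>W\<^esub> f x) \<in> linear_maps V W"
proof -
  interpret W: kspace W by fact
  show ?thesis using assms(2)
    by (auto simp: linear_maps_def W.smult_add_right mult.commute Pi_iff)
qed

lemma alg_hom_linear: "f \<in> alg_hom V W \<Longrightarrow> f \<in> linear_maps V W"
  by (simp add: alg_hom_def)

lemma alg_hom_mult: "f \<in> alg_hom V W \<Longrightarrow> x \<in> carrier V \<Longrightarrow> y \<in> carrier V
    \<Longrightarrow> f (x \<otimes>\<^bsub>V\<^esub> y) = f x \<otimes>\<^bsub>W\<^esub> f y"
  by (simp add: alg_hom_def ring_hom_def)

lemma alg_hom_one: "f \<in> alg_hom V W \<Longrightarrow> f \<one>\<^bsub>V\<^esub> = \<one>\<^bsub>W\<^esub>"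
  by (simp add: alg_hom_def ring_hom_def)

lemma alg_homI:
  assumes "f \<in> linear_maps V W"
    and "\<And>x y. x \<in> carrier V \<Longrightarrow> y \<in> carrier V \<Longrightarrow> f (x \<otimes>\<^bsub>V\<^esub> y) = f x \<otimes>\<^bsub>W\<^esub> f y"
    and "f \<one>\<^bsub>V\<^esub> = \<one>\<^bsub>W\<^esub>"
  shows "f \<in> alg_hom V W"
  using assms by (auto simp: alg_hom_def linear_maps_def ring_hom_def)

section \<open>Linear extension from formal combinations\<close>

text \<open>The linear extension of \<open>g\<close> to formal combinations. Tensors, elements of free algebras and of
  group algebras are all formal combinations, and the maps out of them are obtained this way.\<close>

definition lin :: "('k::field, 'b, 'm) module_scheme \<Rightarrow> ('c \<Rightarrow> 'b) \<Rightarrow> ('c \<Rightarrow>\<^sub>0 'k) \<Rightarrow> 'b" where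
  "lin Z g t = finsum Z (\<lambda>k. Poly_Mapping.lookup t k \<odot>\<^bsub>Z\<^esub> g k) (Poly_Mapping.keys t)"

lemma lookup_pm_scale [simp]:
  "Poly_Mapping.lookup (pm_scale c t) k = c * Poly_Mapping.lookup t k"
  unfolding pm_scale_def by transfer (simp add: when_def)

lemma keys_pm_scale: "Poly_Mapping.keys (pm_scale c t) \<subseteq> Poly_Mapping.keys t"
  by (auto simp: in_keys_iff)

lemma pm_scale_single [simp]: "pm_scale c (Poly_Mapping.single k a) = Poly_Mapping.single k (c * a)"
  by (rule poly_mapping_eqI) (simp add: lookup_single when_def)

lemma pm_scale_zero [simp]: "pm_scale c 0 = 0"
  by (rule poly_mapping_eqI) simp

lemma module_pm_scale: "Modules.module pm_scale"
  by unfold_locales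
    (auto intro!: poly_mapping_eqI simp: lookup_add algebra_simps)

lemma pm_induct [consumes 1, case_names zero add]:
  fixes t :: "'c \<Rightarrow>\<^sub>0 'k::comm_monoid_add"
  assumes "Poly_Mapping.keys t \<subseteq> D" and "P 0"
    and "\<And>s k c. Poly_Mapping.keys s \<subseteq> D \<Longrightarrow> k \<in> D \<Longrightarrow> P s \<Longrightarrow> P (s + Poly_Mapping.single k c)"
  shows "P t"
proof -
  have *: "t = (\<Sum>k\<in>Poly_Mapping.keys t. Poly_Mapping.single k (Poly_Mapping.lookup t k))"
    by (rule poly_mapping_eqI)
       (auto simp: lookup_sum lookup_single when_def sum.delta in_keys_iff)
  have "P (\<Sum>k\<in>A. Poly_Mapping.single k (Poly_Mapping.lookup t k))
        \<and> Poly_Mapping.keys (\<Sum>k\<in>A. Poly_Mapping.single k (Poly_Mapping.lookup t k)) \<subseteq> D"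
    if "finite A" "A \<subseteq> D" for A
    using that
  proof (induction A rule: finite_induct)
    case (insert x A)
    then show ?case
      using assms(3)[of "\<Sum>k\<in>A. Poly_Mapping.single k (Poly_Mapping.lookup t k)" x "Poly_Mapping.lookup t x"]
        keys_add[of "\<Sum>k\<in>A. Poly_Mapping.single k (Poly_Mapping.lookup t k)" "Poly_Mapping.single x (Poly_Mapping.lookup t x)"]
      by (fastforce simp: add.commute split: if_splits)
  qed (use assms(2) in auto)
  then show ?thesis using * assms(1) by (metis finite_keys)
qed

context kspace
begin

lemma lin_superset:
  assumes "finite A" "Poly_Mapping.keys t \<subseteq> A" "\<And>k. k \<in> A \<Longrightarrow> g k \<in> carrier V"
  shows "lin V g t = finsum V (\<lambda>k. Poly_Mapping.lookup t k \<odot> g k) A"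
  unfolding lin_def
  by (rule finsum_mono_neutral[symmetric]) (use assms in \<open>auto simp: in_keys_iff\<close>)

lemma lin_closed: "(\<And>k. k \<in> Poly_Mapping.keys t \<Longrightarrow> g k \<in> carrier V) \<Longrightarrow> lin V g t \<in> carrier V"
  unfolding lin_def by (auto intro!: finsum_closed)

lemma lin_add:
  assumes "Poly_Mapping.keys s \<subseteq> D" "Poly_Mapping.keys t \<subseteq> D" "\<And>k. k \<in> D \<Longrightarrow> g k \<in> carrier V"
  shows "lin V g (s + t) = lin V g s \<oplus> lin V g t"
proof -
  let ?A = "Poly_Mapping.keys s \<union> Poly_Mapping.keys t"
  have g: "\<And>k. k \<in> ?A \<Longrightarrow> g k \<in> carrier V" using assms by auto
  have "lin V g (s + t) = finsum V (\<lambda>k. Poly_Mapping.lookup (s + t) k \<odot> g k) ?A"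
    by (rule lin_superset) (use g keys_add[of s t] in auto)
  also have "\<dots> = finsum V (\<lambda>k. Poly_Mapping.lookup s k \<odot> g k \<oplus> Poly_Mapping.lookup t k \<odot> g k) ?A"
    by (rule finsum_cong') (use g in \<open>auto simp: lookup_add smult_add_left\<close>)
  also have "\<dots> = finsum V (\<lambda>k. Poly_Mapping.lookup s k \<odot> g k) ?A
      \<oplus> finsum V (\<lambda>k. Poly_Mapping.lookup t k \<odot> g k) ?A"
    by (rule finsum_addf) (use g in auto)
  also have "\<dots> = lin V g s \<oplus> lin V g t"
    using g by (subst (1 2) lin_superset[of ?A]) auto
  finally show ?thesis .
qed

lemma lin_single: "g k \<in> carrier V \<Longrightarrow> lin V g (Poly_Mapping.single k c) = c \<odot> g k"
  by (subst lin_superset[of "{k}"]) (auto simp: finsum_insert)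

lemma lin_zero [simp]: "lin V g 0 = \<zero>"
  by (simp add: lin_def)

lemma lin_scale:
  assumes "\<And>k. k \<in> Poly_Mapping.keys t \<Longrightarrow> g k \<in> carrier V"
  shows "lin V g (pm_scale c t) = c \<odot> lin V g t"
  using subset_refl[of "Poly_Mapping.keys t"] 
proof (induction rule: pm_induct)
  case zero
  show ?case by simp
next
  case (add s k a)
  have [simp]: "pm_scale c (s + Poly_Mapping.single k a) = pm_scale c s + Poly_Mapping.single k (c * a)"
    by (rule poly_mapping_eqI) (simp add: lookup_add lookup_single when_def algebra_simps)
  have g: "\<And>k. k \<in> Poly_Mapping.keys t \<Longrightarrow> g k \<in> carrier V" by fact
  then have gs: "lin V g s \<in> carrier V" using add by (intro lin_closed) auto
  have "lin V g (pm_scale c (s + Poly_Mapping.single k a)) = c \<odot> lin V g s \<oplus> (c * a) \<odot> g k"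
    using add keys_pm_scale[of c s] g
    by (simp, subst lin_add[of _ "Poly_Mapping.keys t"]) (auto simp: lin_single)
  moreover have "lin V g (s + Poly_Mapping.single k a) = lin V g s \<oplus> a \<odot> g k"
    using add g by (subst lin_add[of _ "Poly_Mapping.keys t"]) (auto simp: lin_single)
  ultimately show ?case using add g gs by (simp add: smult_add_right)
qed

lemma lin_diff:
  assumes "Poly_Mapping.keys s \<subseteq> D" "Poly_Mapping.keys t \<subseteq> D" "\<And>k. k \<in> D \<Longrightarrow> g k \<in> carrier V"
  shows "lin V g (s - t) = lin V g s \<ominus> lin V g t"
proof -
  have [simp]: "s - t = s + pm_scale (- 1) t"
    by (rule poly_mapping_eqI) (simp add: lookup_add lookup_minus)
  show ?thesis
    using assms keys_pm_scale[of "- 1" t] lin_closed[of s g] lin_closed[of t g]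
    by (simp, subst lin_add[of _ D]) (auto simp: lin_scale subset_iff a_minus_smult)
qed

lemma lin_cong:
  assumes "\<And>k. k \<in> Poly_Mapping.keys t \<Longrightarrow> g k = h k" "\<And>k. k \<in> Poly_Mapping.keys t \<Longrightarrow> h k \<in> carrier V"
  shows "lin V g t = lin V h t"
  unfolding lin_def by (rule finsum_cong') (use assms in auto)

end

section \<open>Tensor products\<close>

definition bilin :: "('k::field, 'a, 'm) module_scheme \<Rightarrow> ('k, 'b, 'n) module_scheme
    \<Rightarrow> ('k, 'c, 'l) module_scheme \<Rightarrow> ('a \<Rightarrow> 'b \<Rightarrow> 'c) \<Rightarrow> bool" where
  "bilin V W Z g \<longleftrightarrow> (\<forall>x\<in>carrier V. g x \<in> linear_maps W Z)
     \<and> (\<forall>y\<in>carrier W. (\<lambda>x. g x y) \<in> linear_maps V Z)"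

lemma bilinI:
  assumes "\<And>x. x \<in> carrier V \<Longrightarrow> g x \<in> linear_maps W Z"
    and "\<And>y. y \<in> carrier W \<Longrightarrow> (\<lambda>x. g x y) \<in> linear_maps V Z"
  shows "bilin V W Z g"
  using assms by (auto simp: bilin_def)

lemma bilin_right: "bilin V W Z g \<Longrightarrow> x \<in> carrier V \<Longrightarrow> g x \<in> linear_maps W Z"
  by (simp add: bilin_def)

lemma bilin_left: "bilin V W Z g \<Longrightarrow> y \<in> carrier W \<Longrightarrow> (\<lambda>x. g x y) \<in> linear_maps V Z"
  by (simp add: bilin_def)

lemma bilin_closed: "bilin V W Z g \<Longrightarrow> x \<in> carrier V \<Longrightarrow> y \<in> carrier W \<Longrightarrow> g x y \<in> carrier Z"
  by (auto simp: bilin_def dest: linear_maps_closed)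

lemma tens_lift_lin: "tens_lift Z g S = lin Z (\<lambda>(a, b). g a b) (rep S)"
proof -
  have "(\<lambda>(a, b). Poly_Mapping.lookup (rep S) (a, b) \<odot>\<^bsub>Z\<^esub> g a b)
      = (\<lambda>k. Poly_Mapping.lookup (rep S) k \<odot>\<^bsub>Z\<^esub> (case k of (a, b) \<Rightarrow> g a b))"
    by auto
  then show ?thesis by (simp add: tens_lift_def lin_def)
qed

locale kspace2 = V: kspace V + W: kspace W
  for V :: "('k::field, 'a, 'm) module_scheme" and W :: "('k, 'b, 'n) module_scheme"
begin

abbreviation "CVW \<equiv> carrier V \<times> carrier W"

interpretation pm: Modules.module "pm_scale :: 'k \<Rightarrow> ('a \<times> 'b \<Rightarrow>\<^sub>0 'k) \<Rightarrow> _"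
  by (rule module_pm_scale)

lemma tens_rel_zero: "0 \<in> tens_rel V W"
  unfolding tens_rel_def by (rule pm.span_zero)
lemma tens_rel_add: "s \<in> tens_rel V W \<Longrightarrow> t \<in> tens_rel V W \<Longrightarrow> s + t \<in> tens_rel V W"
  unfolding tens_rel_def by (rule pm.span_add)
lemma tens_rel_diff: "s \<in> tens_rel V W \<Longrightarrow> t \<in> tens_rel V W \<Longrightarrow> s - t \<in> tens_rel V W"
  unfolding tens_rel_def by (rule pm.span_diff)
lemma tens_rel_scale: "t \<in> tens_rel V W \<Longrightarrow> pm_scale c t \<in> tens_rel V W"
  unfolding tens_rel_def by (rule pm.span_scale)

lemma tens_rel_induct [consumes 1, case_names zero left right smult_left smult_right]:
  assumes "t \<in> tens_rel V W" and "P 0"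
    and left: "\<And>x x' y c t. x \<in> carrier V \<Longrightarrow> x' \<in> carrier V \<Longrightarrow> y \<in> carrier W \<Longrightarrow> P t \<Longrightarrow>
      P (pm_scale c (Poly_Mapping.single (x \<oplus>\<^bsub>V\<^esub> x', y) 1 - Poly_Mapping.single (x, y) 1
          - Poly_Mapping.single (x', y) 1) + t)"
    and right: "\<And>x y y' c t. x \<in> carrier V \<Longrightarrow> y \<in> carrier W \<Longrightarrow> y' \<in> carrier W \<Longrightarrow> P t \<Longrightarrow>
      P (pm_scale c (Poly_Mapping.single (x, y \<oplus>\<^bsub>W\<^esub> y') 1 - Poly_Mapping.single (x, y) 1
          - Poly_Mapping.single (x, y') 1) + t)"
    and sl: "\<And>x y c' c t. x \<in> carrier V \<Longrightarrow> y \<in> carrier W \<Longrightarrow> P t \<Longrightarrow>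
      P (pm_scale c (Poly_Mapping.single (c' \<odot>\<^bsub>V\<^esub> x, y) 1 - Poly_Mapping.single (x, y) c') + t)"
    and sr: "\<And>x y c' c t. x \<in> carrier V \<Longrightarrow> y \<in> carrier W \<Longrightarrow> P t \<Longrightarrow>
      P (pm_scale c (Poly_Mapping.single (x, c' \<odot>\<^bsub>W\<^esub> y) 1 - Poly_Mapping.single (x, y) c') + t)"
  shows "P t"
  using assms(1) unfolding tens_rel_def
proof (induction rule: pm.span_induct_alt)
  case base
  then show ?case by fact
next
  case (step c x y)
  from step(1) show ?case
    by (elim UnE CollectE exE conjE) (simp_all only: left right sl sr step(2))
qed

lemma keys_diff_subset: "Poly_Mapping.keys s \<subseteq> D \<Longrightarrow> Poly_Mapping.keys t \<subseteq> D \<Longrightarrow> Poly_Mapping.keys (s - t) \<subseteq> D"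
  by (rule order.trans[OF keys_diff]) blast

lemma keys_add_subset: "Poly_Mapping.keys s \<subseteq> D \<Longrightarrow> Poly_Mapping.keys t \<subseteq> D \<Longrightarrow> Poly_Mapping.keys (s + t) \<subseteq> D"
  by (rule order.trans[OF keys_add]) blast

lemma keys_scale_subset: "Poly_Mapping.keys t \<subseteq> CVW \<Longrightarrow> Poly_Mapping.keys (pm_scale c t) \<subseteq> CVW"
  using keys_pm_scale[of c t] by blast

lemma keys_single_subset: "k \<in> CVW \<Longrightarrow> Poly_Mapping.keys (Poly_Mapping.single k (c :: 'k)) \<subseteq> CVW"
  by simp

lemma tens_rel_keys: "t \<in> tens_rel V W \<Longrightarrow> Poly_Mapping.keys t \<subseteq> CVW"
  by (induction rule: tens_rel_induct)
     (simp, (intro keys_add_subset keys_scale_subset keys_diff_subset keys_single_subset SigmaI; simp)+)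

text \<open>Bilinearity kills each relator, which is what makes the linear extension descend to the tensor
  product.\<close>

lemma lin_tens_rel:
  assumes "kspace Z" "bilin V W Z g" "t \<in> tens_rel V W"
  shows "lin Z (\<lambda>(a, b). g a b) t = \<zero>\<^bsub>Z\<^esub>"
proof -
  interpret Z: kspace Z by fact
  let ?g = "\<lambda>(a, b). g a b"
  note gc = bilin_closed[OF assms(2)]
  have g: "\<And>k. k \<in> CVW \<Longrightarrow> ?g k \<in> carrier Z" using gc by auto
  have main: "lin Z ?g (pm_scale c s + t) = \<zero>\<^bsub>Z\<^esub>"
    if "Poly_Mapping.keys s \<subseteq> CVW" "lin Z ?g s = \<zero>\<^bsub>Z\<^esub>" "Poly_Mapping.keys t \<subseteq> CVW" "lin Z ?g t = \<zero>\<^bsub>Z\<^esub>" for s t c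
  proof -
    have k: "Poly_Mapping.keys (pm_scale c s) \<subseteq> CVW" using that(1) keys_pm_scale[of c s] by blast
    have "lin Z ?g (pm_scale c s) = \<zero>\<^bsub>Z\<^esub>"
      using Z.lin_scale[of s ?g c] g subsetD[OF that(1)] that(2) by (metis Z.smult_zero_right)
    then show ?thesis using that Z.lin_add[OF k that(3) g] by simp
  qed
  note s1 = keys_single_subset
  have "Poly_Mapping.keys t \<subseteq> CVW \<and> lin Z ?g t = \<zero>\<^bsub>Z\<^esub>"
    using assms(3)
  proof (induction rule: tens_rel_induct)
    case zero show ?case by simp
  next
    case (left x x' y c t)
    have "lin Z ?g (Poly_Mapping.single (x \<oplus>\<^bsub>V\<^esub> x', y) 1 - Poly_Mapping.single (x, y) 1
          - Poly_Mapping.single (x', y) 1) = \<zero>\<^bsub>Z\<^esub>"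
      using left g linear_maps_add[OF bilin_left[OF assms(2) left(3)] left(1,2)] gc[OF left(1,3)] gc[OF left(2,3)]
      by (simp add: Z.lin_diff[of _ CVW] s1 keys_diff_subset Z.lin_single split_beta)
         (simp add: Z.minus_eq Z.minus_add Z.a_ac Z.r_neg)
    then show ?case using left s1
      by (intro conjI main keys_add_subset keys_scale_subset keys_diff_subset keys_single_subset SigmaI) auto
  next
    case (right x y y' c t)
    have "lin Z ?g (Poly_Mapping.single (x, y \<oplus>\<^bsub>W\<^esub> y') 1 - Poly_Mapping.single (x, y) 1
          - Poly_Mapping.single (x, y') 1) = \<zero>\<^bsub>Z\<^esub>"
      using right g linear_maps_add[OF bilin_right[OF assms(2) right(1)] right(2,3)] gc[OF right(1,2)] gc[OF right(1,3)]
      by (simp add: Z.lin_diff[of _ CVW] s1 keys_diff_subset Z.lin_single split_beta)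
         (simp add: Z.minus_eq Z.minus_add Z.a_ac Z.r_neg)
    then show ?case using right s1
      by (intro conjI main keys_add_subset keys_scale_subset keys_diff_subset keys_single_subset SigmaI) auto
  next
    case (smult_left x y c' c t)
    have "lin Z ?g (Poly_Mapping.single (c' \<odot>\<^bsub>V\<^esub> x, y) 1 - Poly_Mapping.single (x, y) c') = \<zero>\<^bsub>Z\<^esub>"
      using smult_left g linear_maps_smult[OF bilin_left[OF assms(2) smult_left(2)] smult_left(1)] gc[OF smult_left(1,2)]
      by (simp add: Z.lin_diff[of _ CVW] s1 Z.lin_single split_beta Z.r_neg Z.minus_eq)
    then show ?case using smult_left s1
      by (intro conjI main keys_add_subset keys_scale_subset keys_diff_subset keys_single_subset SigmaI) auto
  next
    case (smult_right x y c' c t)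
    have "lin Z ?g (Poly_Mapping.single (x, c' \<odot>\<^bsub>W\<^esub> y) 1 - Poly_Mapping.single (x, y) c') = \<zero>\<^bsub>Z\<^esub>"
      using smult_right g linear_maps_smult[OF bilin_right[OF assms(2) smult_right(1)] smult_right(2)] gc[OF smult_right(1,2)]
      by (simp add: Z.lin_diff[of _ CVW] s1 Z.lin_single split_beta Z.r_neg Z.minus_eq)
    then show ?case using smult_right s1
      by (intro conjI main keys_add_subset keys_scale_subset keys_diff_subset keys_single_subset SigmaI) auto
  qed
  then show ?thesis by simp
qed

lemma tens_class_eq_iff: "tens_class V W s = tens_class V W t \<longleftrightarrow> s - t \<in> tens_rel V W"
proof
  assume "tens_class V W s = tens_class V W t"
  moreover have "s \<in> tens_class V W s" unfolding tens_class_def using tens_rel_zero by (force simp: image_iff)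
  ultimately show "s - t \<in> tens_rel V W" by (auto simp: tens_class_def)
next
  assume st: "s - t \<in> tens_rel V W"
  show "tens_class V W s = tens_class V W t"
  proof (intro subset_antisym subsetI)
    fix u assume "u \<in> tens_class V W s"
    then obtain n where "n \<in> tens_rel V W" "u = s + n" by (auto simp: tens_class_def)
    then have "u = t + (s - t + n)" "s - t + n \<in> tens_rel V W" using st by (auto intro: tens_rel_add)
    then show "u \<in> tens_class V W t" unfolding tens_class_def by blast
  next
    fix u assume "u \<in> tens_class V W t"
    then obtain n where "n \<in> tens_rel V W" "u = t + n" by (auto simp: tens_class_def)
    then have "u = s + (n - (s - t))" "n - (s - t) \<in> tens_rel V W" using st by (auto intro: tens_rel_diff)
    then show "u \<in> tens_class V W s" unfolding tens_class_def by blast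
  qed
qed

lemma rep_tens_class: "rep (tens_class V W t) - t \<in> tens_rel V W"
proof -
  have "t + 0 \<in> tens_class V W t" unfolding tens_class_def using tens_rel_zero by blast
  then have "rep (tens_class V W t) \<in> tens_class V W t" unfolding rep_def by (rule someI)
  then show ?thesis by (auto simp: tens_class_def)
qed

lemma keys_rep_tens_class:
  assumes "Poly_Mapping.keys t \<subseteq> CVW" shows "Poly_Mapping.keys (rep (tens_class V W t)) \<subseteq> CVW"
  using keys_add_subset[OF tens_rel_keys[OF rep_tens_class[of t]] assms] by simp

lemma carrier_tensor: "carrier (tensor V W) = tens_class V W ` {t. Poly_Mapping.keys t \<subseteq> CVW}"
  by (simp add: tensor_def)

lemma tensor_add: "tens_class V W s \<oplus>\<^bsub>tensor V W\<^esub> tens_class V W t = tens_class V W (s + t)"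
proof -
  have "(rep (tens_class V W s) - s) + (rep (tens_class V W t) - t) \<in> tens_rel V W"
    by (intro tens_rel_add rep_tens_class)
  then show ?thesis by (simp add: tensor_def tens_class_eq_iff algebra_simps)
qed

lemma tensor_smult: "c \<odot>\<^bsub>tensor V W\<^esub> tens_class V W t = tens_class V W (pm_scale c t)"
proof -
  have "pm_scale c (rep (tens_class V W t) - t) \<in> tens_rel V W"
    by (intro tens_rel_scale rep_tens_class)
  moreover have "pm_scale c (rep (tens_class V W t) - t) = pm_scale c (rep (tens_class V W t)) - pm_scale c t"
    by (rule pm.scale_right_diff_distrib)
  ultimately show ?thesis by (simp add: tensor_def tens_class_eq_iff)
qed

lemma tensor_zero: "\<zero>\<^bsub>tensor V W\<^esub> = tens_class V W 0"
  by (simp add: tensor_def)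

lemma tens_class_closed: "Poly_Mapping.keys t \<subseteq> CVW \<Longrightarrow> tens_class V W t \<in> carrier (tensor V W)"
  by (auto simp: carrier_tensor)

lemma tensor_cases:
  assumes "S \<in> carrier (tensor V W)"
  obtains t where "S = tens_class V W t" "Poly_Mapping.keys t \<subseteq> CVW"
  using assms unfolding carrier_tensor by blast

lemma kspace_tensor: "kspace (tensor V W)"
proof (rule kspaceI)
  show "abelian_group (tensor V W)"
  proof (rule abelian_groupI)
    show "\<zero>\<^bsub>tensor V W\<^esub> \<in> carrier (tensor V W)"
      unfolding tensor_zero by (rule tens_class_closed) simp
  next
    fix x assume x: "x \<in> carrier (tensor V W)"
    obtain t where t: "x = tens_class V W t" "Poly_Mapping.keys t \<subseteq> CVW" by (rule tensor_cases[OF x])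
    have "tens_class V W (- t) \<oplus>\<^bsub>tensor V W\<^esub> x = \<zero>\<^bsub>tensor V W\<^esub>"
      by (simp add: t(1) tensor_add tensor_zero)
    moreover have "tens_class V W (- t) \<in> carrier (tensor V W)"
      using t(2) by (intro tens_class_closed) simp
    ultimately show "\<exists>y\<in>carrier (tensor V W). y \<oplus>\<^bsub>tensor V W\<^esub> x = \<zero>\<^bsub>tensor V W\<^esub>" by blast
    show "\<zero>\<^bsub>tensor V W\<^esub> \<oplus>\<^bsub>tensor V W\<^esub> x = x"
      by (simp add: t(1) tensor_add tensor_zero)
    fix y assume y: "y \<in> carrier (tensor V W)"
    obtain u where u: "y = tens_class V W u" "Poly_Mapping.keys u \<subseteq> CVW" by (rule tensor_cases[OF y])
    show "x \<oplus>\<^bsub>tensor V W\<^esub> y \<in> carrier (tensor V W)"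
      unfolding t(1) u(1) tensor_add using t(2) u(2) by (intro tens_class_closed keys_add_subset)
    show "x \<oplus>\<^bsub>tensor V W\<^esub> y = y \<oplus>\<^bsub>tensor V W\<^esub> x"
      unfolding t(1) u(1) tensor_add by (simp add: add.commute)
    fix z assume z: "z \<in> carrier (tensor V W)"
    obtain v where v: "z = tens_class V W v" "Poly_Mapping.keys v \<subseteq> CVW" by (rule tensor_cases[OF z])
    show "x \<oplus>\<^bsub>tensor V W\<^esub> y \<oplus>\<^bsub>tensor V W\<^esub> z = x \<oplus>\<^bsub>tensor V W\<^esub> (y \<oplus>\<^bsub>tensor V W\<^esub> z)"
      unfolding t(1) u(1) v(1) tensor_add by (simp add: add.assoc)
  qed
next
  fix a b :: 'k and x assume x: "x \<in> carrier (tensor V W)"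
  obtain t where t: "x = tens_class V W t" "Poly_Mapping.keys t \<subseteq> CVW" by (rule tensor_cases[OF x])
  show "a \<odot>\<^bsub>tensor V W\<^esub> x \<in> carrier (tensor V W)"
    unfolding t(1) tensor_smult by (rule tens_class_closed[OF keys_scale_subset[OF t(2)]])
  show "(a + b) \<odot>\<^bsub>tensor V W\<^esub> x = a \<odot>\<^bsub>tensor V W\<^esub> x \<oplus>\<^bsub>tensor V W\<^esub> b \<odot>\<^bsub>tensor V W\<^esub> x"
    unfolding t(1) tensor_smult tensor_add by (simp add: pm.scale_left_distrib)
  show "(a * b) \<odot>\<^bsub>tensor V W\<^esub> x = a \<odot>\<^bsub>tensor V W\<^esub> (b \<odot>\<^bsub>tensor V W\<^esub> x)"
    unfolding t(1) tensor_smult by simp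
  show "1 \<odot>\<^bsub>tensor V W\<^esub> x = x"
    unfolding t(1) tensor_smult by simp
  fix y assume y: "y \<in> carrier (tensor V W)"
  obtain u where u: "y = tens_class V W u" "Poly_Mapping.keys u \<subseteq> CVW" by (rule tensor_cases[OF y])
  show "a \<odot>\<^bsub>tensor V W\<^esub> (x \<oplus>\<^bsub>tensor V W\<^esub> y) = a \<odot>\<^bsub>tensor V W\<^esub> x \<oplus>\<^bsub>tensor V W\<^esub> a \<odot>\<^bsub>tensor V W\<^esub> y"
    unfolding t(1) u(1) tensor_smult tensor_add by (simp add: pm.scale_right_distrib)
qed

sublocale T: kspace "tensor V W" by (rule kspace_tensor)

text \<open>A lift is computed on a chosen representative, but any representative gives the same value, as
  two of them differ by relators.\<close>

lemma tens_lift_class: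
  assumes "kspace Z" "bilin V W Z g" "Poly_Mapping.keys t \<subseteq> CVW"
  shows "tens_lift Z g (tens_class V W t) = lin Z (\<lambda>(a, b). g a b) t"
proof -
  interpret Z: kspace Z by fact
  have g: "\<And>k. k \<in> CVW \<Longrightarrow> (\<lambda>(a, b). g a b) k \<in> carrier Z" using bilin_closed[OF assms(2)] by auto
  have "lin Z (\<lambda>(a, b). g a b) ((rep (tens_class V W t) - t) + t)
      = lin Z (\<lambda>(a, b). g a b) (rep (tens_class V W t) - t) \<oplus>\<^bsub>Z\<^esub> lin Z (\<lambda>(a, b). g a b) t"
    using g by (intro Z.lin_add[of _ CVW] tens_rel_keys rep_tens_class assms(3))
  moreover have "lin Z (\<lambda>(a, b). g a b) t \<in> carrier Z"
    using assms(3) g by (intro Z.lin_closed) blast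
  ultimately show ?thesis
    by (simp add: tens_lift_lin lin_tens_rel[OF assms(1,2) rep_tens_class])
qed

lemma pure_closed [simp, intro]: "x \<in> carrier V \<Longrightarrow> y \<in> carrier W \<Longrightarrow> pure V W x y \<in> carrier (tensor V W)"
  by (auto simp: pure_def carrier_tensor)

lemma tens_lift_pure:
  assumes "kspace Z" "bilin V W Z g" "x \<in> carrier V" "y \<in> carrier W"
  shows "tens_lift Z g (pure V W x y) = g x y"
proof -
  interpret Z: kspace Z by fact
  show ?thesis using assms bilin_closed[OF assms(2-4)]
    by (simp add: pure_def tens_lift_class Z.lin_single)
qed

lemma tens_lift_linear:
  assumes "kspace Z" "bilin V W Z g"
  shows "tens_lift Z g \<in> linear_maps (tensor V W) Z"
proof -
  interpret Z: kspace Z by fact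
  have g: "\<And>k. k \<in> CVW \<Longrightarrow> (\<lambda>(a, b). g a b) k \<in> carrier Z" using bilin_closed[OF assms(2)] by auto
  show ?thesis
  proof (rule linear_mapsI)
    fix S assume "S \<in> carrier (tensor V W)"
    then obtain t where t: "S = tens_class V W t" "Poly_Mapping.keys t \<subseteq> CVW" by (rule tensor_cases)
    then show "tens_lift Z g S \<in> carrier Z" using g by (auto simp: tens_lift_class[OF assms] intro!: Z.lin_closed)
    show "tens_lift Z g (c \<odot>\<^bsub>tensor V W\<^esub> S) = c \<odot>\<^bsub>Z\<^esub> tens_lift Z g S" for c
      using t g by (simp add: tensor_smult tens_lift_class[OF assms] keys_scale_subset) (subst Z.lin_scale, auto)
    fix S' assume "S' \<in> carrier (tensor V W)"
    then obtain t' where t': "S' = tens_class V W t'" "Poly_Mapping.keys t' \<subseteq> CVW" by (rule tensor_cases)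
    show "tens_lift Z g (S \<oplus>\<^bsub>tensor V W\<^esub> S') = tens_lift Z g S \<oplus>\<^bsub>Z\<^esub> tens_lift Z g S'"
      using t t' g by (simp add: tensor_add tens_lift_class[OF assms] keys_add_subset) (subst Z.lin_add[of _ CVW], auto)
  qed
qed

lemma bilin_pure: "bilin V W (tensor V W) (pure V W)"
proof (rule bilinI; rule linear_mapsI)
  interpret pm: Modules.module "pm_scale :: 'k \<Rightarrow> ('a \<times> 'b \<Rightarrow>\<^sub>0 'k) \<Rightarrow> _" by (rule module_pm_scale)
  fix x y y' c assume *: "x \<in> carrier V" "y \<in> carrier W" "y' \<in> carrier W"
  show "pure V W x (y \<oplus>\<^bsub>W\<^esub> y') = pure V W x y \<oplus>\<^bsub>tensor V W\<^esub> pure V W x y'"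
    unfolding pure_def tensor_add tens_class_eq_iff diff_diff_eq[symmetric] unfolding tens_rel_def
    by (rule pm.span_base, rule UnI1, rule UnI1, rule UnI2, rule CollectI, intro exI conjI, rule refl) (use * in auto)
  show "pure V W x (c \<odot>\<^bsub>W\<^esub> y) = c \<odot>\<^bsub>tensor V W\<^esub> pure V W x y"
    unfolding pure_def tensor_smult tens_class_eq_iff pm_scale_single mult_1_right unfolding tens_rel_def
    by (rule pm.span_base, rule UnI2, rule CollectI, intro exI conjI, rule refl) (use * in auto)
next
  fix y x x' c assume *: "y \<in> carrier W" "x \<in> carrier V" "x' \<in> carrier V"
  show "pure V W (x \<oplus>\<^bsub>V\<^esub> x') y = pure V W x y \<oplus>\<^bsub>tensor V W\<^esub> pure V W x' y"
    unfolding pure_def tensor_add tens_class_eq_iff diff_diff_eq[symmetric] unfolding tens_rel_def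
    by (rule pm.span_base, rule UnI1, rule UnI1, rule UnI1, rule CollectI, intro exI conjI, rule refl) (use * in auto)
  show "pure V W (c \<odot>\<^bsub>V\<^esub> x) y = c \<odot>\<^bsub>tensor V W\<^esub> pure V W x y"
    unfolding pure_def tensor_smult tens_class_eq_iff pm_scale_single mult_1_right unfolding tens_rel_def
    by (rule pm.span_base, rule UnI1, rule UnI2, rule CollectI, intro exI conjI, rule refl) (use * in auto)
qed auto

lemma pure_smult_left: "x \<in> carrier V \<Longrightarrow> y \<in> carrier W \<Longrightarrow> pure V W (c \<odot>\<^bsub>V\<^esub> x) y = c \<odot>\<^bsub>tensor V W\<^esub> pure V W x y"
  using linear_maps_smult[OF bilin_left[OF bilin_pure]] by auto
lemma pure_smult_right: "x \<in> carrier V \<Longrightarrow> y \<in> carrier W \<Longrightarrow> pure V W x (c \<odot>\<^bsub>W\<^esub> y) = c \<odot>\<^bsub>tensor V W\<^esub> pure V W x y"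
  using linear_maps_smult[OF bilin_right[OF bilin_pure]] by auto
lemma pure_add_left: "x \<in> carrier V \<Longrightarrow> x' \<in> carrier V \<Longrightarrow> y \<in> carrier W \<Longrightarrow>
    pure V W (x \<oplus>\<^bsub>V\<^esub> x') y = pure V W x y \<oplus>\<^bsub>tensor V W\<^esub> pure V W x' y"
  using linear_maps_add[OF bilin_left[OF bilin_pure]] by auto
lemma pure_add_right: "x \<in> carrier V \<Longrightarrow> y \<in> carrier W \<Longrightarrow> y' \<in> carrier W \<Longrightarrow>
    pure V W x (y \<oplus>\<^bsub>W\<^esub> y') = pure V W x y \<oplus>\<^bsub>tensor V W\<^esub> pure V W x y'"
  using linear_maps_add[OF bilin_right[OF bilin_pure]] by auto

lemma tensor_induct [consumes 1, case_names zero add]: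
  assumes "S \<in> carrier (tensor V W)" and "P \<zero>\<^bsub>tensor V W\<^esub>"
    and "\<And>S x y. S \<in> carrier (tensor V W) \<Longrightarrow> x \<in> carrier V \<Longrightarrow> y \<in> carrier W \<Longrightarrow> P S
       \<Longrightarrow> P (S \<oplus>\<^bsub>tensor V W\<^esub> pure V W x y)"
  shows "P S"
proof -
  obtain t where t: "S = tens_class V W t" "Poly_Mapping.keys t \<subseteq> CVW"
    using assms(1) by (rule tensor_cases)
  have "P (tens_class V W t)" using t(2)
  proof (induction rule: pm_induct)
    case zero then show ?case using assms(2) by (simp add: tensor_zero)
  next
    case (add s k c)
    obtain x y where k: "k = (x, y)" "x \<in> carrier V" "y \<in> carrier W" using add by auto
    have "tens_class V W (Poly_Mapping.single k c) = pure V W (c \<odot>\<^bsub>V\<^esub> x) y"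
      using k by (simp add: pure_smult_left) (simp add: pure_def tensor_smult)
    then show ?case using assms(3)[of "tens_class V W s" "c \<odot>\<^bsub>V\<^esub> x" y] k add
      by (auto simp: tensor_add[symmetric] carrier_tensor)
  qed
  then show ?thesis using t by simp
qed

lemma tensor_linear_eq:
  assumes "kspace Z" "f \<in> linear_maps (tensor V W) Z" "g \<in> linear_maps (tensor V W) Z"
    and "\<And>x y. x \<in> carrier V \<Longrightarrow> y \<in> carrier W \<Longrightarrow> f (pure V W x y) = g (pure V W x y)"
    and "S \<in> carrier (tensor V W)"
  shows "f S = g S"
  using assms(5)
proof (induction rule: tensor_induct)
  case zero
  then show ?case using linear_maps_zero[OF kspace_tensor assms(1)] assms(2,3) by metis
next
  case (add S x y)
  then show ?case using assms(4) by (simp add: linear_maps_add[OF assms(2)] linear_maps_add[OF assms(3)])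
qed

lemma linear_maps_tens_lift:
  assumes "kspace Y" "kspace Z" "bilin V W Y g" "f \<in> linear_maps Y Z" "S \<in> carrier (tensor V W)"
  shows "f (tens_lift Y g S) = tens_lift Z (\<lambda>a b. f (g a b)) S"
proof -
  have b: "bilin V W Z (\<lambda>a b. f (g a b))"
    using assms(3,4) by (auto intro!: bilinI linear_maps_comp[OF _ assms(4)] dest: bilin_left bilin_right)
  show ?thesis
    by (rule tensor_linear_eq[OF assms(2) _ _ _ assms(5), of "\<lambda>S. f (tens_lift Y g S)"])
       (use assms b in \<open>auto intro!: linear_maps_comp[OF _ assms(4)] tens_lift_linear simp: tens_lift_pure\<close>)
qed

lemma tens_lift_cong:
  assumes "kspace Z" "bilin V W Z g" "\<And>x y. x \<in> carrier V \<Longrightarrow> y \<in> carrier W \<Longrightarrow> f x y = g x y"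
    and "S \<in> carrier (tensor V W)"
  shows "tens_lift Z f S = tens_lift Z g S"
proof -
  interpret Z: kspace Z by fact
  obtain t where t: "S = tens_class V W t" "Poly_Mapping.keys t \<subseteq> CVW"
    using assms(4) by (rule tensor_cases)
  have "Poly_Mapping.keys (rep S) \<subseteq> CVW" using t keys_rep_tens_class by simp
  then show ?thesis unfolding tens_lift_lin
    by (intro Z.lin_cong) (use assms(3) bilin_closed[OF assms(2)] in auto)
qed

end

lemma kalgI:
  fixes V :: "('k::field, 'a, 'm) module_scheme" (structure)
  assumes "kspace V" "bilin V V V (\<otimes>)" "\<one> \<in> carrier V"
    and "\<And>x y z. x \<in> carrier V \<Longrightarrow> y \<in> carrier V \<Longrightarrow> z \<in> carrier V \<Longrightarrow> x \<otimes> y \<otimes> z = x \<otimes> (y \<otimes> z)"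
    and "\<And>x. x \<in> carrier V \<Longrightarrow> \<one> \<otimes> x = x" "\<And>x. x \<in> carrier V \<Longrightarrow> x \<otimes> \<one> = x"
  shows "kalg V"
proof -
  interpret kspace V by fact
  note b = linear_maps_add[OF bilin_left[OF assms(2)]] linear_maps_add[OF bilin_right[OF assms(2)]]
    linear_maps_smult[OF bilin_left[OF assms(2)]] linear_maps_smult[OF bilin_right[OF assms(2)]]
    bilin_closed[OF assms(2)]
  have "ring V"
    by (rule ringI) (use assms b in \<open>auto intro!: monoidI abelian_group_axioms\<close>)
  then show ?thesis
    using assms(1) b by (intro kalg.intro) (auto simp: kalg_axioms_def)
qed

context kalg
begin

lemma bilin_mult: "bilin V V V (\<otimes>)"
  by (rule bilinI; rule linear_mapsI) (auto simp: l_distr r_distr)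

lemma linear_mult_left: "x \<in> carrier V \<Longrightarrow> f \<in> linear_maps W V \<Longrightarrow> (\<lambda>y. x \<otimes> f y) \<in> linear_maps W V"
  using linear_maps_comp bilin_right[OF bilin_mult] by blast

lemma linear_mult_right: "x \<in> carrier V \<Longrightarrow> f \<in> linear_maps W V \<Longrightarrow> (\<lambda>y. f y \<otimes> x) \<in> linear_maps W V"
  using linear_maps_comp[OF _ bilin_left[OF bilin_mult]] by blast

end

section \<open>Tensor products of algebras\<close>

context kspace2
begin

lemma tens_class_sum:
  assumes "\<And>i. i \<in> I \<Longrightarrow> Poly_Mapping.keys (f i) \<subseteq> CVW"
  shows "tens_class V W (\<Sum>i\<in>I. f i) = finsum (tensor V W) (\<lambda>i. tens_class V W (f i)) I
    \<and> Poly_Mapping.keys (\<Sum>i\<in>I. f i) \<subseteq> CVW"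
  using assms
proof (induction I rule: infinite_finite_induct)
  case (insert x I)
  have "(\<lambda>i. tens_class V W (f i)) \<in> I \<rightarrow> carrier (tensor V W)" "tens_class V W (f x) \<in> carrier (tensor V W)"
    using insert.prems by (auto intro!: tens_class_closed simp del: mem_Sigma_iff)
  moreover have "Poly_Mapping.keys (f x + (\<Sum>i\<in>I. f i)) \<subseteq> CVW"
    using insert by (intro keys_add_subset) auto
  ultimately show ?case using insert tensor_add[of "f x" "sum f I"] by (simp add: T.finsum_insert)
qed (auto simp: tensor_zero)

end

locale kalg2 = V: kalg V + W: kalg W
  for V :: "('k::field, 'a, 'm) module_scheme" and W :: "('k, 'b, 'n) module_scheme"
begin

sublocale kspace2 ..

lemma bilin_pure_mult:
  assumes "a \<in> carrier V" "b \<in> carrier W"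
  shows "bilin V W (tensor V W) (\<lambda>a' b'. pure V W (a \<otimes>\<^bsub>V\<^esub> a') (b \<otimes>\<^bsub>W\<^esub> b'))"
  by (rule bilinI; rule linear_mapsI)
     (use assms in \<open>auto simp: V.r_distr W.r_distr pure_add_left pure_add_right pure_smult_left pure_smult_right\<close>)

lemma bilin_tensor_mult_aux:
  assumes "T \<in> carrier (tensor V W)"
  shows "bilin V W (tensor V W)
    (\<lambda>a b. tens_lift (tensor V W) (\<lambda>a' b'. pure V W (a \<otimes>\<^bsub>V\<^esub> a') (b \<otimes>\<^bsub>W\<^esub> b')) T)"
proof -
  let ?T = "tensor V W"
  let ?g = "\<lambda>a b a' b'. pure V W (a \<otimes>\<^bsub>V\<^esub> a') (b \<otimes>\<^bsub>W\<^esub> b')"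
  have closed: "tens_lift ?T (?g a b) T \<in> carrier ?T" if "a \<in> carrier V" "b \<in> carrier W" for a b
    using linear_maps_closed[OF tens_lift_linear[OF kspace_tensor bilin_pure_mult[OF that]] assms] .
  have "tens_lift ?T (?g (a1 \<oplus>\<^bsub>V\<^esub> a2) b) T = tens_lift ?T (?g a1 b) T \<oplus>\<^bsub>?T\<^esub> tens_lift ?T (?g a2 b) T"
    if *: "a1 \<in> carrier V" "a2 \<in> carrier V" "b \<in> carrier W" for a1 a2 b
    using assms
  proof (induction rule: tensor_induct)
    case zero
    then show ?case using * linear_maps_zero[OF kspace_tensor kspace_tensor tens_lift_linear[OF kspace_tensor bilin_pure_mult]] by simp
  next
    case (add S x y)
    have "tens_lift ?T (?g a b) S \<in> carrier ?T" if "a \<in> carrier V" "b \<in> carrier W" for a b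
      using linear_maps_closed[OF tens_lift_linear[OF kspace_tensor bilin_pure_mult[OF that]] add(1)] .
    with add * show ?case
      by (simp add: linear_maps_add[OF tens_lift_linear[OF kspace_tensor bilin_pure_mult]]
          tens_lift_pure[OF kspace_tensor bilin_pure_mult] V.l_distr pure_add_left T.a_ac)
  qed
  moreover have "tens_lift ?T (?g a (b1 \<oplus>\<^bsub>W\<^esub> b2)) T = tens_lift ?T (?g a b1) T \<oplus>\<^bsub>?T\<^esub> tens_lift ?T (?g a b2) T"
    if *: "a \<in> carrier V" "b1 \<in> carrier W" "b2 \<in> carrier W" for a b1 b2
    using assms
  proof (induction rule: tensor_induct)
    case zero
    then show ?case using * linear_maps_zero[OF kspace_tensor kspace_tensor tens_lift_linear[OF kspace_tensor bilin_pure_mult]] by simp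
  next
    case (add S x y)
    have "tens_lift ?T (?g a b) S \<in> carrier ?T" if "a \<in> carrier V" "b \<in> carrier W" for a b
      using linear_maps_closed[OF tens_lift_linear[OF kspace_tensor bilin_pure_mult[OF that]] add(1)] .
    with add * show ?case
      by (simp add: linear_maps_add[OF tens_lift_linear[OF kspace_tensor bilin_pure_mult]]
          tens_lift_pure[OF kspace_tensor bilin_pure_mult] W.l_distr pure_add_right T.a_ac)
  qed
  moreover have "tens_lift ?T (?g (c \<odot>\<^bsub>V\<^esub> a) b) T = c \<odot>\<^bsub>?T\<^esub> tens_lift ?T (?g a b) T"
    "tens_lift ?T (?g a (c \<odot>\<^bsub>W\<^esub> b)) T = c \<odot>\<^bsub>?T\<^esub> tens_lift ?T (?g a b) T"
    if *: "a \<in> carrier V" "b \<in> carrier W" for a b c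
  proof -
    have l: "(\<lambda>S. c \<odot>\<^bsub>?T\<^esub> tens_lift ?T (?g a b) S) \<in> linear_maps ?T ?T"
      by (intro linear_maps_smult_left tens_lift_linear kspace_tensor bilin_pure_mult *)
    show "tens_lift ?T (?g (c \<odot>\<^bsub>V\<^esub> a) b) T = c \<odot>\<^bsub>?T\<^esub> tens_lift ?T (?g a b) T"
      by (rule tensor_linear_eq[OF kspace_tensor tens_lift_linear[OF kspace_tensor bilin_pure_mult] l _ assms])
         (use * in \<open>auto simp: tens_lift_pure[OF kspace_tensor bilin_pure_mult] pure_smult_left\<close>)
    show "tens_lift ?T (?g a (c \<odot>\<^bsub>W\<^esub> b)) T = c \<odot>\<^bsub>?T\<^esub> tens_lift ?T (?g a b) T"
      by (rule tensor_linear_eq[OF kspace_tensor tens_lift_linear[OF kspace_tensor bilin_pure_mult] l _ assms])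
         (use * in \<open>auto simp: tens_lift_pure[OF kspace_tensor bilin_pure_mult] pure_smult_right\<close>)
  qed
  ultimately show ?thesis using closed by (intro bilinI linear_mapsI) auto
qed

text \<open>The product is defined by a double sum over representatives. Written as an iterated lift it is
  visibly independent of them, and all further properties follow from those of lifts.\<close>

lemma tensor_mult:
  assumes "S \<in> carrier (tensor V W)" "T \<in> carrier (tensor V W)"
  shows "S \<otimes>\<^bsub>tensor V W\<^esub> T = tens_lift (tensor V W)
    (\<lambda>a b. tens_lift (tensor V W) (\<lambda>a' b'. pure V W (a \<otimes>\<^bsub>V\<^esub> a') (b \<otimes>\<^bsub>W\<^esub> b')) T) S"
proof -
  let ?T = "tensor V W"
  let ?l = "\<lambda>S k. Poly_Mapping.lookup (rep S) k"
  have kS: "Poly_Mapping.keys (rep S) \<subseteq> CVW" and kT: "Poly_Mapping.keys (rep T) \<subseteq> CVW"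
    using assms keys_rep_tens_class by (metis tensor_cases)+
  define h where "h k k' = (fst k \<otimes>\<^bsub>V\<^esub> fst k', snd k \<otimes>\<^bsub>W\<^esub> snd k')" for k k'
  have h: "h k k' \<in> CVW" if "k \<in> CVW" "k' \<in> CVW" for k k'
    using that by (auto simp: h_def)
  define g where "g k k' = tens_class V W (Poly_Mapping.single (h k k') (1::'k))" for k k'
  have g: "g k k' \<in> carrier ?T" if "k \<in> CVW" "k' \<in> CVW" for k k'
    unfolding g_def using h[OF that] by (intro tens_class_closed keys_single_subset)
  have g': "tens_class V W (Poly_Mapping.single (h k k') (c * c')) = c \<odot>\<^bsub>?T\<^esub> (c' \<odot>\<^bsub>?T\<^esub> g k k')" for k k' c c'
    by (simp add: g_def tensor_smult)
  have "S \<otimes>\<^bsub>?T\<^esub> T = tens_class V W (\<Sum>k\<in>Poly_Mapping.keys (rep S). \<Sum>k'\<in>Poly_Mapping.keys (rep T).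
      Poly_Mapping.single (h k k') (?l S k * ?l T k'))"
    by (simp add: tensor_def split_beta h_def)
  also have "\<dots> = finsum ?T (\<lambda>k. finsum ?T (\<lambda>k'. ?l S k \<odot>\<^bsub>?T\<^esub> (?l T k' \<odot>\<^bsub>?T\<^esub> g k k'))
      (Poly_Mapping.keys (rep T))) (Poly_Mapping.keys (rep S))"
    using kS kT
    apply (subst tens_class_sum[THEN conjunct1])
     apply (rule tens_class_sum[THEN conjunct2])
     apply (rule keys_single_subset, rule h; blast)
    apply (rule T.finsum_cong')
      apply simp
     apply (auto intro!: T.finsum_closed T.smult_closed g)[1]
    apply (subst tens_class_sum[THEN conjunct1])
     apply (rule keys_single_subset, rule h; blast)
    apply (simp add: g')
    done
  also have "\<dots> = finsum ?T (\<lambda>k. ?l S k \<odot>\<^bsub>?T\<^esub> lin ?T (g k) (rep T)) (Poly_Mapping.keys (rep S))"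
  proof (rule T.finsum_cong')
    show "(\<lambda>k. ?l S k \<odot>\<^bsub>?T\<^esub> lin ?T (g k) (rep T)) \<in> Poly_Mapping.keys (rep S) \<rightarrow> carrier ?T"
      by (intro Pi_I T.smult_closed T.lin_closed g subsetD[OF kS] subsetD[OF kT])
    fix k assume k: "k \<in> Poly_Mapping.keys (rep S)"
    show "finsum ?T (\<lambda>k'. ?l S k \<odot>\<^bsub>?T\<^esub> (?l T k' \<odot>\<^bsub>?T\<^esub> g k k')) (Poly_Mapping.keys (rep T))
      = ?l S k \<odot>\<^bsub>?T\<^esub> lin ?T (g k) (rep T)"
      unfolding lin_def
      by (rule linear_maps_finsum[symmetric, OF kspace_tensor kspace_tensor
            linear_maps_smult_left[OF kspace_tensor linear_maps_id]])
         (intro Pi_I T.smult_closed g[OF subsetD[OF kS k] subsetD[OF kT]])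
  qed simp
  also have "\<dots> = lin ?T (\<lambda>k. lin ?T (g k) (rep T)) (rep S)"
    by (simp add: lin_def)
  also have "\<dots> = tens_lift ?T (\<lambda>a b. tens_lift ?T (\<lambda>a' b'. pure V W (a \<otimes>\<^bsub>V\<^esub> a') (b \<otimes>\<^bsub>W\<^esub> b')) T) S"
    unfolding tens_lift_lin
    by (simp add: g_def[abs_def] h_def pure_def case_prod_beta')
  finally show ?thesis .
qed

lemma pure_mult:
  assumes "a \<in> carrier V" "b \<in> carrier W" "a' \<in> carrier V" "b' \<in> carrier W"
  shows "pure V W a b \<otimes>\<^bsub>tensor V W\<^esub> pure V W a' b' = pure V W (a \<otimes>\<^bsub>V\<^esub> a') (b \<otimes>\<^bsub>W\<^esub> b')"
  using assms by (simp add: tensor_mult tens_lift_pure kspace_tensor bilin_pure_mult bilin_tensor_mult_aux)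

lemma bilin_tensor_mult: "bilin (tensor V W) (tensor V W) (tensor V W) (\<otimes>\<^bsub>tensor V W\<^esub>)"
proof -
  let ?T = "tensor V W"
  let ?g = "\<lambda>a b a' b'. pure V W (a \<otimes>\<^bsub>V\<^esub> a') (b \<otimes>\<^bsub>W\<^esub> b')"
  have 1: "(\<lambda>S. S \<otimes>\<^bsub>?T\<^esub> T) \<in> linear_maps ?T ?T" if "T \<in> carrier ?T" for T
  proof -
    have "tens_lift ?T (\<lambda>a b. tens_lift ?T (?g a b) T) \<in> linear_maps ?T ?T"
      by (intro tens_lift_linear kspace_tensor bilin_tensor_mult_aux that)
    then show ?thesis using that by (auto simp: linear_maps_def tensor_mult Pi_iff)
  qed
  moreover have "(\<lambda>T. S \<otimes>\<^bsub>?T\<^esub> T) \<in> linear_maps ?T ?T" if "S \<in> carrier ?T" for S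
  proof (rule linear_mapsI)
    note cl = linear_maps_closed[OF 1] and ad = linear_maps_add[OF 1] and z = linear_maps_zero[OF kspace_tensor kspace_tensor 1]
    have p: "pure V W a b \<otimes>\<^bsub>?T\<^esub> T = tens_lift ?T (?g a b) T" if "a \<in> carrier V" "b \<in> carrier W" "T \<in> carrier ?T" for a b T
      using that by (simp add: tensor_mult tens_lift_pure kspace_tensor bilin_tensor_mult_aux)
    show "S \<otimes>\<^bsub>?T\<^esub> T \<in> carrier ?T" if "T \<in> carrier ?T" for T using cl that \<open>S \<in> _\<close> by auto
    fix T assume T: "T \<in> carrier ?T"
    show "S \<otimes>\<^bsub>?T\<^esub> (c \<odot>\<^bsub>?T\<^esub> T) = c \<odot>\<^bsub>?T\<^esub> (S \<otimes>\<^bsub>?T\<^esub> T)" for c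
      using that
    proof (induction rule: tensor_induct)
      case (add S a b)
      then show ?case using T by (simp add: ad cl T.smult_add_right p
            linear_maps_smult[OF tens_lift_linear[OF kspace_tensor bilin_pure_mult]]
            linear_maps_closed[OF tens_lift_linear[OF kspace_tensor bilin_pure_mult]])
    qed (use T in \<open>simp add: z\<close>)
    fix T' assume T': "T' \<in> carrier ?T"
    show "S \<otimes>\<^bsub>?T\<^esub> (T \<oplus>\<^bsub>?T\<^esub> T') = (S \<otimes>\<^bsub>?T\<^esub> T) \<oplus>\<^bsub>?T\<^esub> (S \<otimes>\<^bsub>?T\<^esub> T')"
      using that
    proof (induction rule: tensor_induct)
      case (add S a b)
      then show ?case using T T' by (simp add: ad cl T.a_ac p
            linear_maps_add[OF tens_lift_linear[OF kspace_tensor bilin_pure_mult]]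
            linear_maps_closed[OF tens_lift_linear[OF kspace_tensor bilin_pure_mult]])
    qed (use T T' in \<open>simp add: z\<close>)
  qed
  ultimately show ?thesis by (auto intro: bilinI)
qed

lemma tensor_one: "\<one>\<^bsub>tensor V W\<^esub> = pure V W \<one>\<^bsub>V\<^esub> \<one>\<^bsub>W\<^esub>"
  by (simp add: tensor_def)

lemma kalg_tensor: "kalg (tensor V W)"
proof (rule kalgI[OF kspace_tensor bilin_tensor_mult])
  let ?T = "tensor V W"
  note m = bilin_left[OF bilin_tensor_mult] bilin_right[OF bilin_tensor_mult]
  note add = linear_maps_add[OF m(1)] linear_maps_add[OF m(2)]
  note z = linear_maps_zero[OF kspace_tensor kspace_tensor m(1)] linear_maps_zero[OF kspace_tensor kspace_tensor m(2)]
  note cl = bilin_closed[OF bilin_tensor_mult]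
  show "\<one>\<^bsub>?T\<^esub> \<in> carrier ?T" by (simp add: tensor_one)
  fix x assume x: "x \<in> carrier ?T"
  show "\<one>\<^bsub>?T\<^esub> \<otimes>\<^bsub>?T\<^esub> x = x"
    using x by (induction rule: tensor_induct) (simp_all add: tensor_one add z pure_mult)
  show "x \<otimes>\<^bsub>?T\<^esub> \<one>\<^bsub>?T\<^esub> = x"
    using x by (induction rule: tensor_induct) (simp_all add: tensor_one add z pure_mult)
  fix y z' assume y: "y \<in> carrier ?T" and z': "z' \<in> carrier ?T"
  show "x \<otimes>\<^bsub>?T\<^esub> y \<otimes>\<^bsub>?T\<^esub> z' = x \<otimes>\<^bsub>?T\<^esub> (y \<otimes>\<^bsub>?T\<^esub> z')"
    using x
  proof (induction rule: tensor_induct)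
    case zero then show ?case using y z' by (simp add: z cl)
  next
    case (add S a b)
    have "pure V W a b \<otimes>\<^bsub>?T\<^esub> y \<otimes>\<^bsub>?T\<^esub> z' = pure V W a b \<otimes>\<^bsub>?T\<^esub> (y \<otimes>\<^bsub>?T\<^esub> z')"
      using y
    proof (induction rule: tensor_induct)
      case zero then show ?case using add z' by (simp add: z cl)
    next
      case (add S' a' b')
      note ab = \<open>a \<in> carrier V\<close> \<open>b \<in> carrier W\<close> 
      have "pure V W a b \<otimes>\<^bsub>?T\<^esub> pure V W a' b' \<otimes>\<^bsub>?T\<^esub> z' = pure V W a b \<otimes>\<^bsub>?T\<^esub> (pure V W a' b' \<otimes>\<^bsub>?T\<^esub> z')"
        using z'
      proof (induction rule: tensor_induct)
        case zero then show ?case using add ab by (simp add: z cl)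
      next
        case (add S'' a'' b'')
        then show ?case using ab \<open>a' \<in> _\<close> \<open>b' \<in> _\<close> by (simp add: linear_maps_add[OF m(2)] cl pure_mult V.m_assoc W.m_assoc)
      qed
      then show ?case using add ab z' by (simp add: linear_maps_add[OF m(1)] linear_maps_add[OF m(2)] cl)
    qed
    then show ?case using add y z' by (simp add: linear_maps_add[OF m(1)] cl)
  qed
qed

sublocale T: kalg "tensor V W"
  by (rule kalg_tensor)

text \<open>A bilinear map that is multiplicative in the pair of its arguments induces an algebra
  homomorphism. Three different bilinear maps are allowed because in an iterated coproduct they
  depend on further elements, which are multiplied too.\<close>

lemma tens_lift_mult:
  assumes "kalg Z" "bilin V W Z g1" "bilin V W Z g2" "bilin V W Z g3"
    and "\<And>a b a' b'. a \<in> carrier V \<Longrightarrow> b \<in> carrier W \<Longrightarrow> a' \<in> carrier V \<Longrightarrow> b' \<in> carrier W \<Longrightarrow>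
      g3 (a \<otimes>\<^bsub>V\<^esub> a') (b \<otimes>\<^bsub>W\<^esub> b') = g1 a b \<otimes>\<^bsub>Z\<^esub> g2 a' b'"
    and S: "S \<in> carrier (tensor V W)" and T: "T \<in> carrier (tensor V W)"
  shows "tens_lift Z g3 (S \<otimes>\<^bsub>tensor V W\<^esub> T) = tens_lift Z g1 S \<otimes>\<^bsub>Z\<^esub> tens_lift Z g2 T"
proof -
  interpret Z: kalg Z by fact
  have Z: "kspace Z" ..
  note L = tens_lift_linear[OF Z assms(2)] tens_lift_linear[OF Z assms(3)] tens_lift_linear[OF Z assms(4)]
  note cl = linear_maps_closed[OF L(1)] linear_maps_closed[OF L(2)] linear_maps_closed[OF L(3)]
  note ad = linear_maps_add[OF L(1)] linear_maps_add[OF L(2)] linear_maps_add[OF L(3)]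
  note z = linear_maps_zero[OF kspace_tensor Z L(1)] linear_maps_zero[OF kspace_tensor Z L(2)] linear_maps_zero[OF kspace_tensor Z L(3)]
  note p = tens_lift_pure[OF Z assms(2)] tens_lift_pure[OF Z assms(3)] tens_lift_pure[OF Z assms(4)]
  note gc = bilin_closed[OF assms(2)] bilin_closed[OF assms(3)]
  show ?thesis using S
  proof (induction rule: tensor_induct)
    case zero then show ?case using T by (simp add: z cl)
  next
    case (add S a b)
    have "tens_lift Z g3 (pure V W a b \<otimes>\<^bsub>tensor V W\<^esub> T) = tens_lift Z g1 (pure V W a b) \<otimes>\<^bsub>Z\<^esub> tens_lift Z g2 T"
      using T
    proof (induction rule: tensor_induct)
      case zero then show ?case using add by (simp add: z cl)
    next
      case (add T' a' b')
      then show ?case using \<open>a \<in> _\<close> \<open>b \<in> _\<close>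
        by (simp add: T.r_distr Z.r_distr ad cl pure_mult p assms(5) gc)
    qed
    then show ?case using add T by (simp add: T.l_distr Z.l_distr ad cl)
  qed
qed

lemma tens_lift_alg_hom:
  assumes "kalg Z" "bilin V W Z g"
    and "\<And>a b a' b'. a \<in> carrier V \<Longrightarrow> b \<in> carrier W \<Longrightarrow> a' \<in> carrier V \<Longrightarrow> b' \<in> carrier W \<Longrightarrow>
      g (a \<otimes>\<^bsub>V\<^esub> a') (b \<otimes>\<^bsub>W\<^esub> b') = g a b \<otimes>\<^bsub>Z\<^esub> g a' b'"
    and "g \<one>\<^bsub>V\<^esub> \<one>\<^bsub>W\<^esub> = \<one>\<^bsub>Z\<^esub>"
  shows "tens_lift Z g \<in> alg_hom (tensor V W) Z"
proof (rule alg_homI)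
  have Z: "kspace Z" using assms(1) by (simp add: kalg_def)
  show "tens_lift Z g \<in> linear_maps (tensor V W) Z"
    by (rule tens_lift_linear[OF Z assms(2)])
  show "tens_lift Z g \<one>\<^bsub>tensor V W\<^esub> = \<one>\<^bsub>Z\<^esub>"
    using assms(4) by (simp add: tensor_one tens_lift_pure[OF Z assms(2)])
qed (rule tens_lift_mult[OF assms(1,2,2,2,3)])

end

section \<open>Opposite algebras, the ground field and monoid algebras\<close>

lemma opposite_simps [simp]:
  "carrier (opposite B) = carrier B" "\<one>\<^bsub>opposite B\<^esub> = \<one>\<^bsub>B\<^esub>" "\<zero>\<^bsub>opposite B\<^esub> = \<zero>\<^bsub>B\<^esub>"
  "x \<oplus>\<^bsub>opposite B\<^esub> y = x \<oplus>\<^bsub>B\<^esub> y" "c \<odot>\<^bsub>opposite B\<^esub> x = c \<odot>\<^bsub>B\<^esub> x"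
  "x \<otimes>\<^bsub>opposite B\<^esub> y = y \<otimes>\<^bsub>B\<^esub> x"
  by (simp_all add: opposite_def)

lemma linear_maps_opposite [simp]:
  "linear_maps (opposite B) Z = linear_maps B Z" "linear_maps Z (opposite B) = linear_maps Z B"
  by (simp_all add: linear_maps_def)

lemma kspace_opposite: "kspace B \<Longrightarrow> kspace (opposite B)"
proof -
  assume "kspace B"
  then interpret kspace B .
  show ?thesis
    by (rule kspaceI; (rule abelian_groupI)?)
       (use add.l_inv_ex in \<open>auto simp: smult_add_left smult_add_right a_ac\<close>)
qed

lemma kalg_opposite: "kalg B \<Longrightarrow> kalg (opposite B)"
proof -
  assume B: "kalg B"
  then interpret kalg B .
  have "kspace B" ..
  then show ?thesis
    by (intro kalgI kspace_opposite) (auto simp: m_assoc l_distr r_distr intro!: bilinI linear_mapsI)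
qed

lemma K_alg_simps [simp]:
  "carrier K_alg = UNIV" "\<one>\<^bsub>K_alg\<^esub> = 1" "\<zero>\<^bsub>K_alg\<^esub> = 0"
  "x \<oplus>\<^bsub>K_alg\<^esub> y = x + y" "c \<odot>\<^bsub>K_alg\<^esub> x = c * x" "x \<otimes>\<^bsub>K_alg\<^esub> y = x * y"
  by (simp_all add: K_alg_def)

lemma kalg_K_alg: "kalg K_alg"
proof -
  have "kspace K_alg"
    by (rule kspaceI; (rule abelian_groupI)?)
       (auto simp: algebra_simps intro: exI[of _ "- x" for x])
  then show ?thesis
    by (intro kalgI) (auto simp: algebra_simps intro!: bilinI linear_mapsI)
qed

text \<open>Both the free algebra, for the monoid of words, and the group algebra of the root lattice are
  instances.\<close>

definition mon_alg :: "('k::field, 'w::monoid_add \<Rightarrow>\<^sub>0 'k) module" where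
  "mon_alg = \<lparr>carrier = UNIV, monoid.mult = (*), one = 1, ring.zero = 0, add = (+), module.smult = pm_scale\<rparr>"

lemma mon_alg_simps [simp]:
  "carrier mon_alg = UNIV" "\<one>\<^bsub>mon_alg\<^esub> = 1" "\<zero>\<^bsub>mon_alg\<^esub> = 0"
  "x \<oplus>\<^bsub>mon_alg\<^esub> y = x + y" "c \<odot>\<^bsub>mon_alg\<^esub> x = pm_scale c x" "x \<otimes>\<^bsub>mon_alg\<^esub> y = x * y"
  by (simp_all add: mon_alg_def)

lemma pm_scale_conv_mult: "pm_scale c p = Poly_Mapping.single 0 c * p"
  unfolding pm_scale_def by (rule mult_map_scale_conv_mult)

lemma single_central: "p * Poly_Mapping.single 0 c = pm_scale c (p :: 'w::monoid_add \<Rightarrow>\<^sub>0 'k::field)"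
  using subset_refl[of "Poly_Mapping.keys p"]
  by (induction rule: pm_induct)
     (simp_all add: distrib_right distrib_left mult_single pm_scale_conv_mult mult.commute)

interpretation pm: Modules.module "pm_scale :: 'k::field \<Rightarrow> ('w \<Rightarrow>\<^sub>0 'k) \<Rightarrow> _"
  by (rule module_pm_scale)

lemma kalg_mon_alg: "kalg (mon_alg :: ('k::field, 'w::monoid_add \<Rightarrow>\<^sub>0 'k) module)"
proof -
  have "kspace (mon_alg :: ('k::field, 'w::monoid_add \<Rightarrow>\<^sub>0 'k) module)"
    by (rule kspaceI; (rule abelian_groupI)?)
       (auto simp: algebra_simps pm.scale_left_distrib pm.scale_right_distrib intro: exI[of _ "- x" for x])
  then show ?thesis
  proof (rule kalgI)
    have "x * pm_scale c y = pm_scale c (x * y)" for c and x y :: "'w::monoid_add \<Rightarrow>\<^sub>0 'k"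
      by (simp add: single_central[symmetric] mult.assoc)
    then show "bilin (mon_alg :: ('k::field, 'w::monoid_add \<Rightarrow>\<^sub>0 'k) module) mon_alg mon_alg (\<otimes>\<^bsub>mon_alg\<^esub>)"
      by (intro bilinI linear_mapsI) (auto simp: algebra_simps pm_scale_conv_mult)
  qed (auto simp: mult.assoc)
qed

section \<open>Evaluation on the free algebra\<close>

definition word_val :: "('k::field, 'b, 'm) module_scheme \<Rightarrow> ('a \<Rightarrow> 'b) \<Rightarrow> 'a list \<Rightarrow> 'b" where
  "word_val B g ws = foldr (\<lambda>x y. g x \<otimes>\<^bsub>B\<^esub> y) ws \<one>\<^bsub>B\<^esub>"

lemma word_val_simps [simp]:
  "word_val B g [] = \<one>\<^bsub>B\<^esub>" "word_val B g (x # ws) = g x \<otimes>\<^bsub>B\<^esub> word_val B g ws"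
  by (simp_all add: word_val_def)

lemma free_eval_lin: "free_eval B g p = lin B (\<lambda>w. word_val B g (letters w)) p"
  by (simp add: free_eval_def lin_def word_val_def)

abbreviation word_monom :: "'a list \<Rightarrow> 'a word \<Rightarrow>\<^sub>0 'k::field" where
  "word_monom ws \<equiv> Poly_Mapping.single (Word ws) 1"

lemma word_monom_append: "word_monom (us @ vs) = word_monom us * word_monom vs"
  by (simp add: mult_single plus_word_def)

lemma word_monom_Nil: "word_monom [] = 1"
  by (simp add: zero_word_def[symmetric])

lemma word_monom_Cons: "word_monom (g # vs) = gvar g * word_monom vs"
  by (simp add: gvar_def mult_single plus_word_def)

lemma sc_conv_scale: "sc c = pm_scale c 1"
  by (simp add: sc_def single_one[symmetric] del: single_one)

lemma sc_mult: "sc c * p = pm_scale c p"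
  by (simp add: sc_def pm_scale_conv_mult)

locale free_hom = kalg B for B :: "('k::field, 'b, 'm) module_scheme" (structure) +
  fixes g :: "'a \<Rightarrow> 'b"
  assumes gen_closed [simp, intro]: "g x \<in> carrier B"
begin

lemma word_val_closed [simp, intro]: "word_val B g ws \<in> carrier B"
  by (induction ws) auto

lemma word_val_append: "word_val B g (us @ vs) = word_val B g us \<otimes> word_val B g vs"
  by (induction us) (auto simp: m_assoc)

lemma free_eval_closed [simp, intro]: "free_eval B g p \<in> carrier B"
  by (auto simp: free_eval_lin intro!: lin_closed)

lemma free_eval_add: "free_eval B g (p + q) = free_eval B g p \<oplus> free_eval B g q"
  unfolding free_eval_lin by (rule lin_add[of _ UNIV]) auto

lemma free_eval_diff: "free_eval B g (p - q) = free_eval B g p \<ominus> free_eval B g q"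
  unfolding free_eval_lin by (rule lin_diff[of _ UNIV]) auto

lemma free_eval_zero: "free_eval B g 0 = \<zero>"
  by (simp add: free_eval_lin)

lemma free_eval_scale: "free_eval B g (pm_scale c p) = c \<odot> free_eval B g p"
  unfolding free_eval_lin by (rule lin_scale) auto

lemma free_eval_single: "free_eval B g (Poly_Mapping.single (Word ws) c) = c \<odot> word_val B g ws"
  unfolding free_eval_lin by (subst lin_single) auto

lemma free_eval_one: "free_eval B g 1 = \<one>"
  using free_eval_single[of "[]" 1] by (simp add: word_monom_Nil)

lemma free_eval_gvar: "free_eval B g (gvar x) = g x"
  by (simp add: gvar_def free_eval_single)

lemma free_eval_mult: "free_eval B g (p * q) = free_eval B g p \<otimes> free_eval B g q"
  using subset_UNIV[of "Poly_Mapping.keys p"]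
proof (induction rule: pm_induct)
  case zero show ?case by (simp add: free_eval_zero)
next
  case (add s k c)
  have "free_eval B g (Poly_Mapping.single k c * q) = free_eval B g (Poly_Mapping.single k c) \<otimes> free_eval B g q"
    using subset_UNIV[of "Poly_Mapping.keys q"]
  proof (induction rule: pm_induct)
    case zero show ?case by (simp add: free_eval_zero)
  next
    case (add s' k' c')
    then show ?case
      by (cases k; cases k')
         (simp add: distrib_left free_eval_add r_distr mult_single plus_word_def free_eval_single word_val_append mult.commute)
  qed
  with add show ?case by (simp add: distrib_right free_eval_add l_distr)
qed

lemma free_eval_sc: "free_eval B g (sc c) = c \<odot> \<one>"
  by (simp add: sc_conv_scale free_eval_scale free_eval_one)

lemmas free_eval_simps = free_eval_add free_eval_diff free_eval_zero free_eval_one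
  free_eval_gvar free_eval_mult free_eval_sc free_eval_scale

lemma free_eval_alg_hom: "free_eval B g \<in> alg_hom mon_alg B"
  by (intro alg_homI linear_mapsI) (auto simp: free_eval_simps)

end

lemma ring_free_alg: "ring (ring_of_type_algebra :: ('a word \<Rightarrow>\<^sub>0 'k::field) ring)"
proof -
  have "ring (mon_alg :: ('k, 'a word \<Rightarrow>\<^sub>0 'k) module)"
    by (rule kalg.axioms(2)[OF kalg_mon_alg])
  then interpret ring "mon_alg :: ('k, 'a word \<Rightarrow>\<^sub>0 'k) module" .
  show ?thesis
    by (rule ringI; (rule abelian_groupI monoidI)?)
       (auto simp: ring_of_type_algebra_def algebra_simps intro: exI[of _ "- x" for x])
qed

section \<open>Quantum Serre elements as iterated q-commutators\<close>

text \<open>With \<open>L\<close> and \<open>R\<close> the left and right multiplication by \<open>x\<close>, this is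
  \<open>(L - v\<^bsup>n-1\<^esup> b R) \<cdots> (L - v b R) (L - b R) y\<close>.\<close>

primrec qad :: "('k::field, 'b, 'm) module_scheme \<Rightarrow> 'k \<Rightarrow> 'k \<Rightarrow> nat \<Rightarrow> 'b \<Rightarrow> 'b \<Rightarrow> 'b" where
  "qad B v b 0 x y = y"
| "qad B v b (Suc n) x y = x \<otimes>\<^bsub>B\<^esub> qad B v b n x y \<oplus>\<^bsub>B\<^esub> (- (v ^ n * b)) \<odot>\<^bsub>B\<^esub> (qad B v b n x y \<otimes>\<^bsub>B\<^esub> x)"

context kalg
begin

lemma qad_closed [simp, intro]: "x \<in> carrier V \<Longrightarrow> y \<in> carrier V \<Longrightarrow> qad V v b n x y \<in> carrier V"
  by (induction n) auto

lemma qad_add: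
  assumes "x \<in> carrier V" "y \<in> carrier V" "y' \<in> carrier V"
  shows "qad V v b n x (y \<oplus> y') = qad V v b n x y \<oplus> qad V v b n x y'"
  by (induction n) (use assms in \<open>auto simp: l_distr r_distr smult_add_right a_ac\<close>)

lemma qad_scale:
  assumes "x \<in> carrier V" "y \<in> carrier V"
  shows "qad V v b n (c \<odot> x) (c' \<odot> y) = (c ^ n * c') \<odot> qad V v b n x y"
  by (induction n) (use assms in \<open>auto simp: smult_add_right mult_ac\<close>)

lemma qad_zero: "x \<in> carrier V \<Longrightarrow> qad V v b n x \<zero> = \<zero>"
  by (induction n) auto

lemma qad_shift:
  assumes "x \<in> carrier V" "y \<in> carrier V"
  shows "qad V v b (Suc n) x y = qad V v (v * b) n x (qad V v b 1 x y)"
  by (induction n) (use assms in \<open>simp_all add: mult_ac\<close>)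

lemma qad_commute:
  assumes "x \<in> carrier V" "y \<in> carrier V"
  shows "qad V v b n x (x \<otimes> y \<oplus> c \<odot> (y \<otimes> x)) = x \<otimes> qad V v b n x y \<oplus> c \<odot> (qad V v b n x y \<otimes> x)"
proof (induction n)
  case (Suc n)
  let ?z = "qad V v b n x y"
  have z: "?z \<in> carrier V" using assms by simp
  show ?case unfolding qad.simps Suc using assms z
    by (simp add: l_distr r_distr smult_add_right m_assoc a_ac mult_ac)
qed simp

text \<open>The factors \<open>L - v\<^sup>k b R\<close> commute, so they can be applied in the opposite order; their scalars
  then form a geometric progression with ratio \<open>1 / v\<close> that starts at \<open>v\<^sup>n b\<close>.\<close>

lemma qad_reverse:
  assumes "x \<in> carrier V" "y \<in> carrier V" "v \<noteq> 0"
  shows "qad V v b (Suc n) x y = qad V (1 / v) (v ^ n * b) (Suc n) x y"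
  using assms(1,2)
proof (induction n arbitrary: b y)
  case (Suc n)
  have "qad V v b (Suc (Suc n)) x y = qad V v (v * b) (Suc n) x (qad V v b 1 x y)"
    using Suc.prems by (rule qad_shift)
  also have "\<dots> = qad V (1 / v) (v ^ Suc n * b) (Suc n) x (qad V v b 1 x y)"
    using Suc by (subst Suc.IH) (auto simp: mult_ac)
  also have "\<dots> = qad V (1 / v) (v ^ Suc n * b) (Suc n) x (x \<otimes> y \<oplus> (- b) \<odot> (y \<otimes> x))"
    by simp
  also have "\<dots> = x \<otimes> qad V (1 / v) (v ^ Suc n * b) (Suc n) x y
      \<oplus> (- b) \<odot> (qad V (1 / v) (v ^ Suc n * b) (Suc n) x y \<otimes> x)"
    by (rule qad_commute[OF Suc.prems])
  also have "\<dots> = qad V (1 / v) (v ^ Suc n * b) (Suc (Suc n)) x y"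
    using assms(3) by (subst (3) qad.simps) (simp add: power_divide)
  finally show ?case .
qed simp

text \<open>The element \<open>x2\<close> q-commutes with every iterated commutator of \<open>x1\<close> and \<open>y\<close>, and the scalar is
  exactly the one with which the next commutator is formed, so its contribution cancels.\<close>

lemma qad_absorb:
  assumes "x1 \<in> carrier V" "x2 \<in> carrier V" "y \<in> carrier V"
    and "x2 \<otimes> x1 = v \<odot> (x1 \<otimes> x2)" "x2 \<otimes> y = b \<odot> (y \<otimes> x2)"
  shows "qad V v b n (x1 \<oplus> x2) y = qad V v b n x1 y
    \<and> x2 \<otimes> qad V v b n x1 y = (v ^ n * b) \<odot> (qad V v b n x1 y \<otimes> x2)"
proof (induction n)
  case (Suc n)
  define z c where "z = qad V v b n x1 y" and "c = v ^ n * b"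
  have z: "z \<in> carrier V" using assms by (simp add: z_def)
  have x2z: "x2 \<otimes> z = c \<odot> (z \<otimes> x2)" using Suc by (simp add: z_def c_def)
  have "qad V v b (Suc n) (x1 \<oplus> x2) y = (x1 \<otimes> z \<oplus> (- c) \<odot> (z \<otimes> x1)) \<oplus> (c \<odot> (z \<otimes> x2) \<oplus> (- c) \<odot> (z \<otimes> x2))"
    using Suc assms z x2z by (simp add: z_def[symmetric] c_def[symmetric] l_distr r_distr smult_add_right a_ac)
  also have "c \<odot> (z \<otimes> x2) \<oplus> (- c) \<odot> (z \<otimes> x2) = \<zero>"
    using z assms by (simp add: smult_add_left[symmetric])
  finally have 1: "qad V v b (Suc n) (x1 \<oplus> x2) y = qad V v b (Suc n) x1 y"
    using assms z by (simp add: z_def[symmetric] c_def[symmetric])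
  have "x2 \<otimes> (x1 \<otimes> z) = (v * c) \<odot> ((x1 \<otimes> z) \<otimes> x2)"
    using assms z x2z by (simp add: m_assoc[symmetric]) (simp add: m_assoc x2z)
  moreover have "x2 \<otimes> (z \<otimes> x1) = (v * c) \<odot> ((z \<otimes> x1) \<otimes> x2)"
    using assms z x2z by (simp add: m_assoc[symmetric]) (simp add: m_assoc assms(4) mult_ac)
  ultimately have "x2 \<otimes> (x1 \<otimes> z \<oplus> (- c) \<odot> (z \<otimes> x1)) = (v * c) \<odot> ((x1 \<otimes> z \<oplus> (- c) \<odot> (z \<otimes> x1)) \<otimes> x2)"
    using assms z by (simp add: l_distr r_distr smult_add_right mult_ac)
  with 1 show ?case by (simp add: z_def c_def mult_ac)
qed (use assms in simp)

text \<open>This computes the coproduct of a Serre element, where the summands are those of the coproducts of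
  two generators. By \<open>qad_absorb\<close>, \<open>x2\<close> does not contribute to the part with \<open>y1\<close>. After the order of
  the factors is reversed, the roles of \<open>x1\<close> and \<open>x2\<close> are exchanged, and \<open>x1\<close> does not contribute to
  the part with \<open>y2\<close>. The assumption on \<open>b * c * v ^ m\<close> is the one that ties the number of factors to
  the commutation scalars; it holds for the length of the Serre relation.\<close>

lemma qad_sum:
  assumes "x1 \<in> carrier V" "x2 \<in> carrier V" "y1 \<in> carrier V" "y2 \<in> carrier V"
    and "x2 \<otimes> x1 = v \<odot> (x1 \<otimes> x2)" "x2 \<otimes> y1 = b \<odot> (y1 \<otimes> x2)" "y2 \<otimes> x1 = c \<odot> (x1 \<otimes> y2)"
    and "n = Suc m" "b * c * v ^ m = 1"
  shows "qad V v b n (x1 \<oplus> x2) (y1 \<oplus> y2) = qad V v b n x1 y1 \<oplus> qad V v b n x2 y2"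
proof -
  have c: "c \<noteq> 0" using assms(9) by auto
  have v: "v \<noteq> 0" if "m \<noteq> 0" using assms(9) that by (cases "v = 0") (auto simp: zero_power)
  have 1: "qad V v b n (x1 \<oplus> x2) y1 = qad V v b n x1 y1"
    using qad_absorb[OF assms(1-3,5,6)] by simp
  have "qad V v b n (x1 \<oplus> x2) y2 = qad V v b n x2 y2"
  proof (cases "m = 0")
    case True
    have "y2 \<otimes> x1 = c \<odot> (x1 \<otimes> y2)" by fact
    then have "x1 \<otimes> y2 \<oplus> (- b) \<odot> (y2 \<otimes> x1) = \<zero>"
      using assms True by (simp add: smult_minus_one r_neg)
    then have z: "x1 \<otimes> y2 \<oplus> (- b) \<odot> (y2 \<otimes> x1) = \<zero>" .
    have "qad V v b 1 (x1 \<oplus> x2) y2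
      = (x1 \<otimes> y2 \<oplus> (- b) \<odot> (y2 \<otimes> x1)) \<oplus> (x2 \<otimes> y2 \<oplus> (- b) \<odot> (y2 \<otimes> x2))"
      using assms(1-4) by (simp add: l_distr r_distr smult_add_right a_ac)
    then show ?thesis unfolding z using assms(1-4,8) True by simp
  next
    case False
    note v = v[OF False]
    have xy1: "x1 \<otimes> x2 = (1 / v) \<odot> (x2 \<otimes> x1)" using assms v by simp
    have xy2: "x1 \<otimes> y2 = (v ^ m * b) \<odot> (y2 \<otimes> x1)" using assms by (simp add: mult_ac)
    have "qad V v b n (x2 \<oplus> x1) y2 = qad V (1 / v) (v ^ m * b) n (x2 \<oplus> x1) y2"
      using assms v unfolding assms(8) by (intro qad_reverse) auto
    also have "\<dots> = qad V (1 / v) (v ^ m * b) n x2 y2"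
      using qad_absorb[OF assms(2,1,4) xy1 xy2] by simp
    also have "\<dots> = qad V v b n x2 y2"
      using assms v unfolding assms(8) by (intro qad_reverse[symmetric]) auto
    finally show ?thesis using assms by (simp add: a_comm)
  qed
  with 1 show ?thesis using qad_add[OF a_closed[OF assms(1,2)] assms(3,4)] by (simp only:)
qed

text \<open>This computes the image of a Serre element under the antipode, which sends \<open>x\<close> to a
  multiple of \<open>a \<otimes> x\<close> in the opposite algebra. The torus elements \<open>a\<close> and \<open>a'\<close> can be collected on
  the left; reversing the multiplication inverts the scalars.\<close>

lemma qad_opposite_twist:
  assumes "a \<in> carrier V" "a' \<in> carrier V" "x \<in> carrier V" "y \<in> carrier V"
    and "a \<otimes> a' = a' \<otimes> a"
    and "x \<otimes> a = p \<odot> (a \<otimes> x)" "y \<otimes> a = p' \<odot> (a \<otimes> y)" "x \<otimes> a' = p'' \<odot> (a' \<otimes> x)"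
    and "v \<noteq> 0" "c \<noteq> 0" "c * p' = b * p''"
  shows "\<exists>K. qad (opposite V) v b n (a \<otimes> x) (a' \<otimes> y)
    = K \<odot> (((\<otimes>) a ^^ n) a' \<otimes> qad V (1 / v) (1 / c) n x y)"
proof -
  let ?W = "\<lambda>n. ((\<otimes>) a ^^ n) a'"
  let ?z = "\<lambda>n. qad V (1 / v) (1 / c) n x y"
  have W: "?W n \<in> carrier V" for n by (induction n) (use assms in auto)
  have aW: "?W n \<otimes> a = a \<otimes> ?W n" for n
    by (induction n) (use assms W in \<open>auto simp: m_assoc\<close>)
  have xW: "x \<otimes> ?W n = (p ^ n * p'') \<odot> (?W n \<otimes> x)" for n
  proof (induction n)
    case (Suc n)
    have "x \<otimes> ?W (Suc n) = (x \<otimes> a) \<otimes> ?W n" using assms(1,3) W by (simp add: m_assoc)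
    also have "\<dots> = (p \<odot> (a \<otimes> x)) \<otimes> ?W n" by (simp only: assms(6))
    also have "\<dots> = p \<odot> (a \<otimes> (x \<otimes> ?W n))" using assms(1,3) W by (simp add: m_assoc)
    also have "\<dots> = (p ^ Suc n * p'') \<odot> (?W (Suc n) \<otimes> x)"
      using assms W[of n] by (simp add: Suc m_assoc mult_ac)
    finally show ?case .
  qed (use assms in simp)
  have z: "?z n \<in> carrier V" for n using assms by simp
  have za: "?z n \<otimes> a = (p ^ n * p') \<odot> (a \<otimes> ?z n)" for n
  proof (induction n)
    case (Suc n)
    have 1: "(x \<otimes> ?z n) \<otimes> a = (p ^ Suc n * p') \<odot> (a \<otimes> (x \<otimes> ?z n))"
      using assms z[of n] by (simp add: m_assoc Suc) (simp add: m_assoc[symmetric] assms(6) mult_ac)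
    have 2: "(?z n \<otimes> x) \<otimes> a = (p ^ Suc n * p') \<odot> (a \<otimes> (?z n \<otimes> x))"
      using assms z[of n] by (simp add: m_assoc assms(6)) (simp add: m_assoc[symmetric] Suc mult_ac)
    show ?case using assms z[of n] by (simp add: l_distr r_distr smult_add_right 1[simplified] 2[simplified] mult_ac)
  qed (use assms in simp)
  show ?thesis
  proof (induction n)
    case 0
    have "a' \<otimes> y = 1 \<odot> (a' \<otimes> y)" using assms by simp
    then show ?case by (metis funpow_0 qad.simps(1))
  next
    case (Suc n)
    then obtain K where K: "qad (opposite V) v b n (a \<otimes> x) (a' \<otimes> y) = K \<odot> (?W n \<otimes> ?z n)" by blast
    have 1: "?W n \<otimes> ?z n \<otimes> (a \<otimes> x) = (p ^ n * p') \<odot> (?W (Suc n) \<otimes> (?z n \<otimes> x))"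
    proof -
      have "?W n \<otimes> ?z n \<otimes> (a \<otimes> x) = ?W n \<otimes> (?z n \<otimes> a) \<otimes> x"
        using assms W[of n] z[of n] by (simp add: m_assoc)
      also have "\<dots> = (p ^ n * p') \<odot> ((?W n \<otimes> a) \<otimes> ?z n \<otimes> x)"
        unfolding za using assms W[of n] z[of n] by (simp add: m_assoc)
      finally show ?thesis unfolding aW using assms W[of n] z[of n] by (simp add: m_assoc)
    qed
    have 2: "(a \<otimes> x) \<otimes> (?W n \<otimes> ?z n) = (p ^ n * p'') \<odot> (?W (Suc n) \<otimes> (x \<otimes> ?z n))"
    proof -
      have "(a \<otimes> x) \<otimes> (?W n \<otimes> ?z n) = a \<otimes> (x \<otimes> ?W n) \<otimes> ?z n"
        using assms W[of n] z[of n] by (simp add: m_assoc)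
      then show ?thesis unfolding xW using assms W[of n] z[of n] by (simp add: m_assoc)
    qed
    have e: "v ^ n * b * p'' * ((1 / v) ^ n * (1 / c)) = p'"
      using assms(9,10,11) by (simp add: field_simps power_divide)
    let ?K = "- (K * (v ^ n * b) * (p ^ n * p''))"
    have Wc: "?W (Suc n) \<in> carrier V" by (rule W)
    have "qad (opposite V) v b (Suc n) (a \<otimes> x) (a' \<otimes> y)
      = (K * (p ^ n * p')) \<odot> (?W (Suc n) \<otimes> (?z n \<otimes> x)) \<oplus> ?K \<odot> (?W (Suc n) \<otimes> (x \<otimes> ?z n))"
      using assms W[of n] z[of n] by (simp add: K 1[simplified] 2[simplified] mult_ac)
    also have "\<dots> = ?K \<odot> (?W (Suc n) \<otimes> (x \<otimes> ?z n) \<oplus> (- ((1 / v) ^ n * (1 / c))) \<odot> (?W (Suc n) \<otimes> (?z n \<otimes> x)))"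
    proof -
      have "?K * (- ((1 / v) ^ n * (1 / c))) = K * p ^ n * (v ^ n * b * p'' * ((1 / v) ^ n * (1 / c)))"
        by (simp add: mult_ac)
      then have "?K * (- ((1 / v) ^ n * (1 / c))) = K * (p ^ n * p')"
        unfolding e by (simp add: mult_ac)
      moreover have "?W (Suc n) \<otimes> (x \<otimes> ?z n) \<in> carrier V" "?W (Suc n) \<otimes> (?z n \<otimes> x) \<in> carrier V"
        using assms Wc z[of n] by auto
      ultimately show ?thesis by (simp add: smult_add_right a_comm del: funpow.simps)
    qed
    also have "\<dots> = ?K \<odot> (?W (Suc n) \<otimes> ?z (Suc n))"
      using assms Wc z[of n] by (simp add: r_distr del: funpow.simps)
    finally show ?case by blast
  qed
qed

end

lemma alg_hom_qad:
  assumes "kalg V" "kalg W" "f \<in> alg_hom V W" "x \<in> carrier V" "y \<in> carrier V"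
  shows "f (qad V v b n x y) = qad W v b n (f x) (f y)"
proof -
  interpret V: kalg V by fact
  interpret W: kalg W by fact
  show ?thesis
    by (induction n)
       (use assms(4,5) in \<open>auto simp: linear_maps_add[OF alg_hom_linear[OF assms(3)]]
          linear_maps_smult[OF alg_hom_linear[OF assms(3)]] alg_hom_mult[OF assms(3)]\<close>)
qed

lemma alg_hom_opposite: "f \<in> alg_hom V W \<Longrightarrow> f \<in> alg_hom (opposite V) (opposite W)"
  by (intro alg_homI) (auto simp: alg_hom_linear alg_hom_mult alg_hom_one)

context kalg2
begin

text \<open>In a tensor product the commuting first legs only accumulate a power and do not affect the
  commutators formed in the second leg.\<close>

lemma qad_pure_right:
  assumes "a \<in> carrier V" "a' \<in> carrier V" "x \<in> carrier W" "y \<in> carrier W" "a \<otimes>\<^bsub>V\<^esub> a' = a' \<otimes>\<^bsub>V\<^esub> a"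
  shows "qad (tensor V W) v b n (pure V W a x) (pure V W a' y) = pure V W (((\<otimes>\<^bsub>V\<^esub>) a ^^ n) a') (qad W v b n x y)"
proof -
  have W: "((\<otimes>\<^bsub>V\<^esub>) a ^^ n) a' \<in> carrier V" for n by (induction n) (use assms in auto)
  have "((\<otimes>\<^bsub>V\<^esub>) a ^^ n) a' \<otimes>\<^bsub>V\<^esub> a = a \<otimes>\<^bsub>V\<^esub> ((\<otimes>\<^bsub>V\<^esub>) a ^^ n) a'" for n
    by (induction n) (use assms W in \<open>auto simp: V.m_assoc\<close>)
  then show ?thesis using assms W
    by (induction n) (auto simp: pure_mult pure_add_right pure_smult_right)
qed

lemma qad_pure_left:
  assumes "a \<in> carrier W" "a' \<in> carrier W" "x \<in> carrier V" "y \<in> carrier V" "a \<otimes>\<^bsub>W\<^esub> a' = a' \<otimes>\<^bsub>W\<^esub> a"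
  shows "qad (tensor V W) v b n (pure V W x a) (pure V W y a') = pure V W (qad V v b n x y) (((\<otimes>\<^bsub>W\<^esub>) a ^^ n) a')"
proof -
  have W: "((\<otimes>\<^bsub>W\<^esub>) a ^^ n) a' \<in> carrier W" for n by (induction n) (use assms in auto)
  have "((\<otimes>\<^bsub>W\<^esub>) a ^^ n) a' \<otimes>\<^bsub>W\<^esub> a = a \<otimes>\<^bsub>W\<^esub> ((\<otimes>\<^bsub>W\<^esub>) a ^^ n) a'" for n
    by (induction n) (use assms W in \<open>auto simp: W.m_assoc\<close>)
  then show ?thesis using assms W
    by (induction n) (auto simp: pure_mult pure_add_left pure_smult_left)
qed

lemma pure_zero_left: "y \<in> carrier W \<Longrightarrow> pure V W \<zero>\<^bsub>V\<^esub> y = \<zero>\<^bsub>tensor V W\<^esub>"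
  using linear_maps_zero[OF _ kspace_tensor bilin_left[OF bilin_pure]] V.kspace_axioms by blast
lemma pure_zero_right: "x \<in> carrier V \<Longrightarrow> pure V W x \<zero>\<^bsub>W\<^esub> = \<zero>\<^bsub>tensor V W\<^esub>"
  using linear_maps_zero[OF _ kspace_tensor bilin_right[OF bilin_pure]] W.kspace_axioms by blast

end

lemma tensor_opposite: "tensor (opposite V) (opposite W) = opposite (tensor V W)"
proof -
  have r: "tens_rel (opposite V) (opposite W) = tens_rel V W"
    by (simp add: tens_rel_def)
  have c: "tens_class (opposite V) (opposite W) = tens_class V W"
    by (simp add: tens_class_def r fun_eq_iff)
  show ?thesis
  proof (rule module.equality)
    show "monoid.mult (tensor (opposite V) (opposite W)) = monoid.mult (opposite (tensor V W))"
      by (intro ext, simp add: tensor_def c split_beta mult.commute)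
         (intro arg_cong[of _ _ "tens_class V W"] sum.swap)
  qed (simp_all only: opposite_simps, simp_all add: tensor_def c pure_def fun_eq_iff)
qed

lemma (in kalg) funpow_mult_closed [simp]:
  "a \<in> carrier V \<Longrightarrow> b \<in> carrier V \<Longrightarrow> (((\<otimes>) a) ^^ n) b \<in> carrier V"
  by (induction n) auto

lemma pure_opposite: "pure (opposite V) (opposite W) = pure V W"
  by (simp add: pure_def tens_class_def tens_rel_def fun_eq_iff)

section \<open>The q-binomial expansion of the Serre elements\<close>

text \<open>The coefficients of the product of the \<open>X - v\<^sup>k b Y\<close> for \<open>k < n\<close> in commuting variables.\<close>

definition gauss_coeff :: "'k::field \<Rightarrow> 'k \<Rightarrow> nat \<Rightarrow> nat \<Rightarrow> 'k" where
  "gauss_coeff v b n k = (if k \<le> n then (- 1) ^ k * qbinom v n k * (v ^ (k * (k - 1) div 2) * b ^ k) else 0)"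

lemma qint_nonzero: "(\<And>l. 0 < l \<Longrightarrow> v ^ l \<noteq> 1) \<Longrightarrow> 0 < k \<Longrightarrow> qint v k \<noteq> (0 :: 'k::field)"
  using power_one_right[of v] by (auto simp: qint_def) (metis power_one_right zero_less_one)

lemma qfact_nonzero: "(\<And>l. 0 < l \<Longrightarrow> v ^ l \<noteq> 1) \<Longrightarrow> qfact v k \<noteq> (0 :: 'k::field)"
  unfolding qfact_def using qint_nonzero[of v] by (subst prod_zero_iff) auto

lemma qfact_Suc: "qfact v (Suc k) = qfact v k * qint v (Suc k)"
  by (simp add: qfact_def)

lemma qint_add: "(v :: 'k::field) \<noteq> 1 \<Longrightarrow> qint v (a + b) = qint v a + v ^ a * qint v b"
  unfolding qint_def times_divide_eq_right add_divide_distrib[symmetric]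
  by (simp add: power_add algebra_simps)

lemma qbinom_pascal:
  fixes v :: "'k::field"
  assumes v: "\<And>l. 0 < l \<Longrightarrow> v ^ l \<noteq> 1" and "k < n"
  shows "qbinom v (Suc n) (Suc k) = qbinom v n (Suc k) + v ^ (n - k) * qbinom v n k"
proof -
  obtain m where n: "n = Suc (k + m)" using assms(2) less_imp_Suc_add by blast
  have nz: "qfact v l \<noteq> 0" "qint v (Suc l) \<noteq> 0" for l using qfact_nonzero[of v] qint_nonzero[of v] v by auto
  have v1: "v \<noteq> 1" using v[of 1] by auto
  have "qint v (Suc n) = qint v (Suc m) + v ^ Suc m * qint v (Suc k)"
    using qint_add[OF v1, of "Suc m" "Suc k"] by (simp add: n add_ac)
  then have "qbinom v (Suc n) (Suc k) * (qfact v (Suc k) * qfact v (Suc m))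
     = qfact v n * (qint v (Suc m) + v ^ Suc m * qint v (Suc k))"
    using nz by (simp add: qbinom_def n qfact_Suc[of v "Suc (k + m)"])
  moreover have "qbinom v n (Suc k) * (qfact v (Suc k) * qfact v (Suc m)) = qfact v n * qint v (Suc m)"
    using nz by (simp add: qbinom_def n qfact_Suc[of v m])
  moreover have "qbinom v n k * (qfact v (Suc k) * qfact v (Suc m)) = qfact v n * qint v (Suc k)"
    using nz by (simp add: qbinom_def n qfact_Suc[of v k])
  ultimately have "qbinom v (Suc n) (Suc k) * (qfact v (Suc k) * qfact v (Suc m))
      = (qbinom v n (Suc k) + v ^ (n - k) * qbinom v n k) * (qfact v (Suc k) * qfact v (Suc m))"
    by (simp add: algebra_simps n)
  then show ?thesis using nz by (metis mult_cancel_right mult_eq_0_iff)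
qed

lemma qbinom_n_n: "(\<And>l. 0 < l \<Longrightarrow> v ^ l \<noteq> 1) \<Longrightarrow> qbinom v n n = (1 :: 'k::field)"
  and qbinom_0: "(\<And>l. 0 < l \<Longrightarrow> v ^ l \<noteq> 1) \<Longrightarrow> qbinom v n 0 = (1 :: 'k::field)"
  using qfact_nonzero[of v n] by (auto simp: qbinom_def) (auto simp: qfact_def)

lemma gauss_coeff_Suc:
  fixes v :: "'k::field"
  assumes v: "\<And>l. 0 < l \<Longrightarrow> v ^ l \<noteq> 1"
  shows "gauss_coeff v b (Suc n) (Suc k) = gauss_coeff v b n (Suc k) - v ^ n * b * gauss_coeff v b n k"
    and "gauss_coeff v b (Suc n) 0 = gauss_coeff v b n 0"
proof -
  have t: "Suc k * (Suc k - 1) div 2 = k * (k - 1) div 2 + k" for k :: nat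
    by (induction k) (auto simp: algebra_simps)
  consider "k < n" | "k = n" | "k > n" by linarith
  then show "gauss_coeff v b (Suc n) (Suc k) = gauss_coeff v b n (Suc k) - v ^ n * b * gauss_coeff v b n k"
  proof cases
    case 1
    then obtain m where n: "n = k + m" using less_imp_add_positive by blast
    show ?thesis using 1 unfolding gauss_coeff_def t
      by (simp add: qbinom_pascal[OF v 1] algebra_simps power_add) (simp add: n algebra_simps power_add)
  next
    case 2
    then show ?thesis unfolding gauss_coeff_def t
      by (simp add: qbinom_n_n[OF v] algebra_simps power_add)
  qed (simp add: gauss_coeff_def)
  show "gauss_coeff v b (Suc n) 0 = gauss_coeff v b n 0"
    by (simp add: gauss_coeff_def qbinom_0[OF v])
qed

text \<open>The q-binomial theorem for two commuting operators; left and right multiplication by the same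
  element are such operators even if the algebra is not commutative.\<close>

lemma gauss_product:
  fixes v :: "'k::field" and L R :: "('w \<Rightarrow>\<^sub>0 'k) \<Rightarrow> ('w \<Rightarrow>\<^sub>0 'k)"
  assumes v: "\<And>l. 0 < l \<Longrightarrow> v ^ l \<noteq> 1"
    and L: "\<And>x y. L (x + y) = L x + L y" "\<And>c x. L (pm_scale c x) = pm_scale c (L x)"
    and R: "\<And>x y. R (x + y) = R x + R y" "\<And>c x. R (pm_scale c x) = pm_scale c (R x)"
    and LR: "\<And>x. L (R x) = R (L x)"
    and z: "z 0 = y" "\<And>n. z (Suc n) = L (z n) + pm_scale (- (v ^ n * b)) (R (z n))"
  shows "z n = (\<Sum>k = 0..n. pm_scale (gauss_coeff v b n k) ((L ^^ (n - k)) ((R ^^ k) y)))"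
proof (induction n)
  case 0
  show ?case by (simp add: z gauss_coeff_def qbinom_0[OF v] pm_scale_conv_mult)
next
  case (Suc n)
  interpret pm: Modules.module "pm_scale :: 'k \<Rightarrow> ('w \<Rightarrow>\<^sub>0 'k) \<Rightarrow> _" by (rule module_pm_scale)
  have R0: "R 0 = 0" and L0: "L 0 = 0" using R(1)[of 0 0] L(1)[of 0 0] by auto
  have Ls: "L (\<Sum>k\<in>I. f k) = (\<Sum>k\<in>I. L (f k))" for f and I :: "nat set"
    by (induction I rule: infinite_finite_induct) (auto simp: L L0)
  have Rs: "R (\<Sum>k\<in>I. f k) = (\<Sum>k\<in>I. R (f k))" for f and I :: "nat set"
    by (induction I rule: infinite_finite_induct) (auto simp: R R0)
  have RL: "R ((L ^^ m) x) = (L ^^ m) (R x)" for m x by (induction m) (simp_all add: LR[symmetric])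
  let ?t = "\<lambda>n k. (L ^^ (n - k)) ((R ^^ k) y)"
  let ?g = "gauss_coeff v b"
  have "L (z n) = (\<Sum>k = 0..n. pm_scale (?g n k) (?t (Suc n) k))"
    unfolding Suc Ls by (rule sum.cong) (auto simp: L Suc_diff_le)
  also have "\<dots> = (\<Sum>k = 0..Suc n. pm_scale (?g n k) (?t (Suc n) k))"
    by (simp add: gauss_coeff_def)
  also have "\<dots> = pm_scale (?g n 0) (?t (Suc n) 0) + (\<Sum>k = 0..n. pm_scale (?g n (Suc k)) (?t (Suc n) (Suc k)))"
    by (simp only: sum.atLeast0_atMost_Suc_shift comp_def)
  finally have 1: "L (z n) = pm_scale (?g n 0) (?t (Suc n) 0) + (\<Sum>k = 0..n. pm_scale (?g n (Suc k)) (?t (Suc n) (Suc k)))" .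
  have 2: "R (z n) = (\<Sum>k = 0..n. pm_scale (?g n k) (?t (Suc n) (Suc k)))"
    unfolding Suc Rs by (rule sum.cong) (auto simp: R RL)
  have "z (Suc n) = pm_scale (?g n 0) (?t (Suc n) 0)
      + (\<Sum>k = 0..n. pm_scale (?g n (Suc k) - v ^ n * b * ?g n k) (?t (Suc n) (Suc k)))"
    unfolding z 1 2 pm.scale_sum_right
    by (simp add: pm.scale_left_diff_distrib sum_subtractf sum_negf)
  also have "\<dots> = pm_scale (?g (Suc n) 0) (?t (Suc n) 0)
      + (\<Sum>k = 0..n. pm_scale (?g (Suc n) (Suc k)) (?t (Suc n) (Suc k)))"
    by (simp only: gauss_coeff_Suc[OF v])
  also have "\<dots> = (\<Sum>k = 0..Suc n. pm_scale (?g (Suc n) k) (?t (Suc n) k))"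
    by (simp only: sum.atLeast0_atMost_Suc_shift comp_def)
  finally show ?case .
qed

lemma funpow_mult_left: "(((*) x) ^^ n) y = x ^ n * (y :: 'r::ring_1)"
  by (induction n) (simp_all add: mult.assoc)

lemma funpow_mult_right: "((\<lambda>z. z * x) ^^ n) y = (y :: 'r::ring_1) * x ^ n"
  by (induction n) (simp_all add: mult.assoc power_commutes)

lemma qad_free_alg:
  fixes v :: "'k::field" and x y :: "'w::monoid_add \<Rightarrow>\<^sub>0 'k"
  assumes v: "\<And>l. 0 < l \<Longrightarrow> v ^ l \<noteq> 1"
  shows "(\<Sum>k = 0..n. pm_scale (gauss_coeff v b n k) (x ^ (n - k) * y * x ^ k)) = qad mon_alg v b n x y"
    and "(\<Sum>k = 0..n. pm_scale (gauss_coeff v b n k) (x ^ k * y * x ^ (n - k))) = qad (opposite mon_alg) v b n x y"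
proof -
  have sr: "u * pm_scale c w = pm_scale c (u * w)" for c and u w :: "'w \<Rightarrow>\<^sub>0 'k"
    by (simp add: single_central[symmetric] mult.assoc)
  have sl: "pm_scale c u * w = pm_scale c (u * w)" for c and u w :: "'w \<Rightarrow>\<^sub>0 'k"
    by (simp add: pm_scale_conv_mult mult.assoc)
  show "(\<Sum>k = 0..n. pm_scale (gauss_coeff v b n k) (x ^ (n - k) * y * x ^ k)) = qad mon_alg v b n x y"
    by (subst gauss_product[OF v, of "(*) x" "\<lambda>z. z * x" "\<lambda>n. qad mon_alg v b n x y" y b])
       (auto simp: algebra_simps sr sl funpow_mult_left funpow_mult_right)
  show "(\<Sum>k = 0..n. pm_scale (gauss_coeff v b n k) (x ^ k * y * x ^ (n - k))) = qad (opposite mon_alg) v b n x y"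
    by (subst gauss_product[OF v, of "\<lambda>z. z * x" "(*) x" "\<lambda>n. qad (opposite mon_alg) v b n x y" y b])
       (auto simp: algebra_simps sr sl funpow_mult_left funpow_mult_right)
qed

section \<open>Representations of the defining relations\<close>

text \<open>The scalar \<open>\<beta>\<^sub>i\<^sub>j\<close> with \<open>\<omega>\<^sub>i e\<^sub>j = \<beta>\<^sub>i\<^sub>j e\<^sub>j \<omega>\<^sub>i\<close>. The coefficients of the Serre relations and the
  commutation with \<open>\<omega>'\<^sub>i\<close> are expressed through these scalars as well, since
  the coefficient \<open>c\<^sub>i\<^sub>j\<close> of the \<open>k\<close>-th term is \<open>(r\<^sub>i / s\<^sub>i)\<^bsup>k(k-1)/2\<^esup> \<beta>\<^sub>i\<^sub>j\<^sup>k\<close>.\<close>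

definition bt :: "('i::linorder \<Rightarrow> 'i \<Rightarrow> int) \<Rightarrow> ('i \<Rightarrow> nat) \<Rightarrow> 'k::field \<Rightarrow> 'k \<Rightarrow> 'i \<Rightarrow> 'i \<Rightarrow> 'k" where
  "bt A d r s i j = r powi euler A d j i * s powi (- euler A d i j)"

primrec torus :: "'i generator \<Rightarrow> bool" where
  "torus (Ge i) = False" | "torus (Gf i) = False" | "torus (Gw i) = True" | "torus (Gw_inv i) = True"
| "torus (Gw' i) = True" | "torus (Gw'_inv i) = True"

text \<open>On \<open>e\<^sub>i\<close> and \<open>f\<^sub>i\<close> this is the identity, so that it is an involution without exception.\<close>

primrec tinv :: "'i generator \<Rightarrow> 'i generator" where
  "tinv (Ge i) = Ge i" | "tinv (Gf i) = Gf i" | "tinv (Gw i) = Gw_inv i" | "tinv (Gw_inv i) = Gw i"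
| "tinv (Gw' i) = Gw'_inv i" | "tinv (Gw'_inv i) = Gw' i"

lemma torus_tinv [simp]: "torus (tinv t) = torus t" and tinv_tinv [simp]: "tinv (tinv t) = t"
  by (cases t; simp)+

text \<open>The scalar with which a torus generator \<open>t\<close> is moved past \<open>e\<^sub>j\<close>; the values for \<open>e\<^sub>i\<close> and \<open>f\<^sub>i\<close>
  are dummies.\<close>

primrec wt :: "('i::linorder \<Rightarrow> 'i \<Rightarrow> int) \<Rightarrow> ('i \<Rightarrow> nat) \<Rightarrow> 'k::field \<Rightarrow> 'k \<Rightarrow> 'i generator \<Rightarrow> 'i \<Rightarrow> 'k" where
  "wt A d r s (Ge i) = (\<lambda>j. 1)"
| "wt A d r s (Gf i) = (\<lambda>j. 1)"
| "wt A d r s (Gw i) = (\<lambda>j. bt A d r s i j)"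
| "wt A d r s (Gw_inv i) = (\<lambda>j. inverse (bt A d r s i j))"
| "wt A d r s (Gw' i) = (\<lambda>j. inverse (bt A d r s j i))"
| "wt A d r s (Gw'_inv i) = (\<lambda>j. bt A d r s j i)"

lemma wt_tinv: "wt A d r s (tinv t) j = inverse (wt A d r s t j)"
  by (cases t) auto

text \<open>A symmetrizable matrix and parameters for which no q-integer in a power of \<open>r / s\<close> vanishes.\<close>

locale qdata =
  fixes A :: "'i::linorder \<Rightarrow> 'i \<Rightarrow> int" and d :: "'i \<Rightarrow> nat" and r s :: "'k::field"
  assumes r_nz: "r \<noteq> 0" and s_nz: "s \<noteq> 0" and d_pos: "0 < d i"
    and d_sym: "int (d i) * A i j = int (d j) * A j i"
    and non_root: "0 < n \<Longrightarrow> (r / s) ^ n \<noteq> 1"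
begin

declare r_nz [simp] s_nz [simp]

abbreviation "bet \<equiv> bt A d r s"
abbreviation "vi i \<equiv> r ^ d i / s ^ d i"
abbreviation "serre_len i j \<equiv> nat (1 - A i j)"
abbreviation "ef_coeff i \<equiv> 1 / (r ^ d i - s ^ d i)"

lemma bt_nz [simp]: "bet i j \<noteq> 0"
  using r_nz s_nz by (simp add: bt_def power_int_not_zero)

lemma wt_nz [simp]: "wt A d r s t j \<noteq> 0"
  by (cases t) simp_all

lemma bt_self: "bet i i = vi i"
  using s_nz by (simp add: bt_def euler_def power_int_minus field_simps)

lemma vi_nz [simp]: "vi i \<noteq> 0"
  using r_nz s_nz by simp

lemma vi_non_root: "0 < n \<Longrightarrow> vi i ^ n \<noteq> 1"
proof -
  assume "0 < n"
  then have "(r / s) ^ (d i * n) \<noteq> 1" using d_pos[of i] by (intro non_root) simp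
  then show ?thesis by (simp add: power_mult power_divide)
qed

lemma rs_diff_nz: "r ^ d i - s ^ d i \<noteq> 0"
  using vi_non_root[of 1 i] s_nz by auto

lemma bt_sym:
  assumes "i \<noteq> j" shows "bet i j * bet j i = vi i powi A i j"
proof -
  have e: "euler A d i j + euler A d j i = int (d i) * A i j"
    using assms d_sym[of i j] by (auto simp: euler_def)
  have "bet i j * bet j i = (r powi euler A d j i * r powi euler A d i j) * (s powi (- euler A d i j) * s powi (- euler A d j i))"
    by (simp add: bt_def)
  also have "\<dots> = r powi (int (d i) * A i j) * s powi (- (int (d i) * A i j))"
    using r_nz s_nz by (simp add: power_int_add[symmetric] e[symmetric] add.commute)
  also have "\<dots> = vi i powi A i j"
    by (simp only: power_int_mult power_int_of_nat power_int_minus power_int_mult_distrib power_int_inverse divide_inverse)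
  finally show ?thesis .
qed

text \<open>The exponent is that of the last factor of the Serre element, which gives the assumption of
  \<open>qad_sum\<close>.\<close>

lemma bt_serre: "i \<noteq> j \<Longrightarrow> serre_len i j = Suc m \<Longrightarrow> bet i j * bet j i * vi i ^ m = 1"
proof -
  assume *: "i \<noteq> j" "serre_len i j = Suc m"
  then have "A i j = - int m" by linarith
  then show ?thesis using bt_sym[OF *(1)] vi_nz[of i] by (simp only: power_int_minus power_int_of_nat) simp
qed

lemma bt_swap: "r powi (- euler A d i j) * s powi euler A d j i = inverse (bet j i)"
  "r powi (- euler A d j i) * s powi euler A d i j = inverse (bet i j)"
  "r powi euler A d i j * s powi (- euler A d j i) = bet j i"
  by (simp_all add: bt_def power_int_minus)

lemma serre_coeff_gauss: "serre_coeff A d r s i j k = gauss_coeff (vi i) (bet i j) (serre_len i j) k" if "k \<le> serre_len i j"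
proof -
  have "x powi (int k * m) = (x powi m) ^ k" for x :: 'k and m
    by (metis mult.commute power_int_mult power_int_of_nat)
  moreover have "- (int k * m) = int k * - m" for m by simp
  ultimately show ?thesis using that
    by (simp only: serre_coeff_def gauss_coeff_def bt_def power_mult_distrib mult.assoc if_True)
qed

end

text \<open>Elements of an algebra that satisfy the defining relations. The four kinds of torus generators
  are treated alike, and the Serre relations are stated through iterated q-commutators, for the
  \<open>f\<^sub>i\<close> in the opposite algebra, because in this form they can be verified for the coproduct, the
  antipode and the deformation.\<close>

locale qrep = qdata A d r s + kalg B
  for A :: "'i::linorder \<Rightarrow> 'i \<Rightarrow> int" and d and r s :: "'k::field"
    and B :: "('k, 'b, 'm) module_scheme" (structure) +
  fixes g :: "'i generator \<Rightarrow> 'b"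
  assumes gen_closed' [simp, intro]: "g x \<in> carrier B"
    and rel_inv: "torus t \<Longrightarrow> g t \<otimes> g (tinv t) = \<one>"
    and rel_torus: "torus t \<Longrightarrow> torus t' \<Longrightarrow> g t \<otimes> g t' = g t' \<otimes> g t"
    and rel_te: "torus t \<Longrightarrow> g t \<otimes> g (Ge j) = wt A d r s t j \<odot> (g (Ge j) \<otimes> g t)"
    and rel_tf: "torus t \<Longrightarrow> g t \<otimes> g (Gf j) = inverse (wt A d r s t j) \<odot> (g (Gf j) \<otimes> g t)"
    and rel_ef: "g (Ge i) \<otimes> g (Gf j) = g (Gf j) \<otimes> g (Ge i)
        \<oplus> (if i = j then ef_coeff i \<odot> (g (Gw i) \<oplus> (- 1) \<odot> g (Gw' i)) else \<zero>)"
    and serre_e: "i \<noteq> j \<Longrightarrow> qad B (vi i) (bet i j) (serre_len i j) (g (Ge i)) (g (Ge j)) = \<zero>"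
    and serre_f: "i \<noteq> j \<Longrightarrow> qad (opposite B) (vi i) (bet i j) (serre_len i j) (g (Gf i)) (g (Gf j)) = \<zero>"
begin

sublocale free_hom B g by unfold_locales simp

lemma rel_et: "torus t \<Longrightarrow> g (Ge j) \<otimes> g t = inverse (wt A d r s t j) \<odot> (g t \<otimes> g (Ge j))"
  by (simp add: rel_te)

lemma rel_inv': "torus t \<Longrightarrow> g (tinv t) \<otimes> g t = \<one>"
  using rel_inv[of "tinv t"] by simp

lemma reorder:
  assumes "z \<in> carrier B"
  shows "torus t \<Longrightarrow> g t \<otimes> (g (Gf j) \<otimes> z) = inverse (wt A d r s t j) \<odot> (g (Gf j) \<otimes> (g t \<otimes> z))"
    and "torus t \<Longrightarrow> g (Ge j) \<otimes> (g t \<otimes> z) = inverse (wt A d r s t j) \<odot> (g t \<otimes> (g (Ge j) \<otimes> z))"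
    and "torus t \<Longrightarrow> torus t' \<Longrightarrow> g t \<otimes> (g t' \<otimes> z) = g t' \<otimes> (g t \<otimes> z)"
    and "torus t \<Longrightarrow> g t \<otimes> (g (tinv t) \<otimes> z) = z"
    and "torus t \<Longrightarrow> g (tinv t) \<otimes> (g t \<otimes> z) = z"
  using assms by (simp_all add: m_assoc[symmetric] rel_tf rel_et rel_inv rel_inv')
     (simp_all add: m_assoc rel_torus)

end

lemma (in kalg) inv_commute:
  assumes "u \<in> carrier V" "u' \<in> carrier V" "y \<in> carrier V" "u \<otimes> u' = \<one>" "u' \<otimes> u = \<one>"
    and "u \<otimes> y = c \<odot> (y \<otimes> u)"
  shows "y \<otimes> u' = c \<odot> (u' \<otimes> y)"
proof -
  have "y \<otimes> u' = u' \<otimes> (u \<otimes> y) \<otimes> u'" using assms(1-5) by (simp add: m_assoc[symmetric])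
  also have "\<dots> = c \<odot> (u' \<otimes> y \<otimes> (u \<otimes> u'))" unfolding assms(6) using assms(1-3) by (simp add: m_assoc)
  finally show ?thesis using assms(1-4) by simp
qed

lemma (in free_hom) free_eval_qad:
  "free_eval B g (qad mon_alg v b n p q) = qad B v b n (free_eval B g p) (free_eval B g q)"
  "free_eval B g (qad (opposite mon_alg) v b n p q) = qad (opposite B) v b n (free_eval B g p) (free_eval B g q)"
proof -
  have B: "kalg B" ..
  show "free_eval B g (qad mon_alg v b n p q) = qad B v b n (free_eval B g p) (free_eval B g q)"
    by (rule alg_hom_qad[OF kalg_mon_alg B free_eval_alg_hom]) auto
  show "free_eval B g (qad (opposite mon_alg) v b n p q) = qad (opposite B) v b n (free_eval B g p) (free_eval B g q)"
    by (rule alg_hom_qad[OF kalg_opposite[OF kalg_mon_alg] kalg_opposite[OF B] alg_hom_opposite[OF free_eval_alg_hom]]) auto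
qed

lemma (in qdata) serre_element_qad:
  "(\<Sum>k = 0..serre_len i j. sc (serre_coeff A d r s i j k) * x ^ (serre_len i j - k) * y * x ^ k)
     = qad mon_alg (vi i) (bet i j) (serre_len i j) x (y :: 'a word \<Rightarrow>\<^sub>0 'k)"
  "(\<Sum>k = 0..serre_len i j. sc (serre_coeff A d r s i j k) * x ^ k * y * x ^ (serre_len i j - k))
     = qad (opposite mon_alg) (vi i) (bet i j) (serre_len i j) x y"
  by (subst qad_free_alg[OF vi_non_root, symmetric], assumption,
      rule sum.cong[OF refl], simp add: serre_coeff_gauss sc_mult pm_scale_conv_mult mult.assoc)+

locale qfree = qdata A d r s + free_hom B g
  for A :: "'i::linorder \<Rightarrow> 'i \<Rightarrow> int" and d and r s :: "'k::field"
    and B :: "('k, 'b, 'm) module_scheme" (structure) and g :: "'i generator \<Rightarrow> 'b"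
begin

lemma commutator_zero_iff: "free_eval B g (gvar a * gvar b - gvar a' * gvar b') = \<zero> \<longleftrightarrow> g a \<otimes> g b = g a' \<otimes> g b'"
  by (simp add: free_eval_simps r_right_minus_eq)

lemma inverse_zero_iff: "free_eval B g (gvar a * gvar b - 1) = \<zero> \<longleftrightarrow> g a \<otimes> g b = \<one>"
  by (simp add: free_eval_simps r_right_minus_eq)

lemma weight_zero_iff: "free_eval B g (gvar a * gvar b - sc c * gvar b' * gvar a') = \<zero> \<longleftrightarrow> g a \<otimes> g b = c \<odot> (g b' \<otimes> g a')"
  by (simp add: free_eval_simps r_right_minus_eq)

lemma ef_zero_iff: "free_eval B g (gvar (Ge i) * gvar (Gf j) - gvar (Gf j) * gvar (Ge i)
           - (if i = j then sc (1 / (r ^ d i - s ^ d i)) * (gvar (Gw i) - gvar (Gw' i)) else 0)) = \<zero>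
    \<longleftrightarrow> g (Ge i) \<otimes> g (Gf j) = g (Gf j) \<otimes> g (Ge i)
        \<oplus> (if i = j then ef_coeff i \<odot> (g (Gw i) \<oplus> (- 1) \<odot> g (Gw' i)) else \<zero>)"
proof -
  have *: "x \<ominus> y \<ominus> z = \<zero> \<longleftrightarrow> x = y \<oplus> z" if "x \<in> carrier B" "y \<in> carrier B" "z \<in> carrier B" for x y z
  proof -
    have "x \<ominus> y \<ominus> z = x \<ominus> (y \<oplus> z)" using that by (simp add: minus_eq minus_add a_assoc)
    then show ?thesis using that by (simp add: r_right_minus_eq)
  qed
  have m: "g x \<ominus> g y = g x \<oplus> (- 1) \<odot> g y" for x y
    by (simp add: a_minus_smult)
  have "free_eval B g (gvar (Ge i) * gvar (Gf j) - gvar (Gf j) * gvar (Ge i)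
           - (if i = j then sc (1 / (r ^ d i - s ^ d i)) * (gvar (Gw i) - gvar (Gw' i)) else 0))
    = g (Ge i) \<otimes> g (Gf j) \<ominus> g (Gf j) \<otimes> g (Ge i)
        \<ominus> (if i = j then ef_coeff i \<odot> (g (Gw i) \<oplus> (- 1) \<odot> g (Gw' i)) else \<zero>)"
    by (simp add: free_eval_simps m)
  then show ?thesis
    by (simp only:) (rule *, auto)
qed

lemma relators_vanish_iff:
  "(\<forall>p\<in>relators A d r s. free_eval B g p = \<zero>) \<longleftrightarrow>
     (\<forall>i. g (Gw i) \<otimes> g (Gw_inv i) = \<one> \<and> g (Gw_inv i) \<otimes> g (Gw i) = \<one>
        \<and> g (Gw' i) \<otimes> g (Gw'_inv i) = \<one> \<and> g (Gw'_inv i) \<otimes> g (Gw' i) = \<one>)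
   \<and> (\<forall>i j. g (Gw i) \<otimes> g (Gw j) = g (Gw j) \<otimes> g (Gw i) \<and> g (Gw i) \<otimes> g (Gw' j) = g (Gw' j) \<otimes> g (Gw i)
        \<and> g (Gw' i) \<otimes> g (Gw' j) = g (Gw' j) \<otimes> g (Gw' i))
   \<and> (\<forall>i j. g (Gw i) \<otimes> g (Ge j) = bet i j \<odot> (g (Ge j) \<otimes> g (Gw i))
        \<and> g (Gw' i) \<otimes> g (Ge j) = inverse (bet j i) \<odot> (g (Ge j) \<otimes> g (Gw' i))
        \<and> g (Gw i) \<otimes> g (Gf j) = inverse (bet i j) \<odot> (g (Gf j) \<otimes> g (Gw i))
        \<and> g (Gw' i) \<otimes> g (Gf j) = bet j i \<odot> (g (Gf j) \<otimes> g (Gw' i)))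
   \<and> (\<forall>i j. g (Ge i) \<otimes> g (Gf j) = g (Gf j) \<otimes> g (Ge i)
        \<oplus> (if i = j then ef_coeff i \<odot> (g (Gw i) \<oplus> (- 1) \<odot> g (Gw' i)) else \<zero>))
   \<and> (\<forall>i j. i \<noteq> j \<longrightarrow> qad B (vi i) (bet i j) (serre_len i j) (g (Ge i)) (g (Ge j)) = \<zero>)
   \<and> (\<forall>i j. i \<noteq> j \<longrightarrow> qad (opposite B) (vi i) (bet i j) (serre_len i j) (g (Gf i)) (g (Gf j)) = \<zero>)"
proof -
  have s1: "(\<forall>p\<in>{F i j | i j. i \<noteq> j}. P p) \<longleftrightarrow> (\<forall>i j. i \<noteq> j \<longrightarrow> P (F i j))" for F :: "'i \<Rightarrow> 'i \<Rightarrow> 'x" and P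
    by blast
  have s2: "(\<forall>p\<in>insert a S. P p) \<longleftrightarrow> P a \<and> (\<forall>p\<in>S. P p)" for a :: 'x and S P
    by simp
  show ?thesis
    unfolding relators_def ball_Un ball_UN s1 s2 commutator_zero_iff inverse_zero_iff weight_zero_iff
      ef_zero_iff serre_element_qad free_eval_qad free_eval_gvar bt_swap bt_def[symmetric] conj_assoc
    by simp
qed

text \<open>The relators contain the commutation rules for \<open>\<omega>\<^sub>i\<close> and \<open>\<omega>'\<^sub>i\<close>; those for the inverses follow by
  multiplying with the inverses on both sides.\<close>

lemma qrep_iff: "(\<forall>p\<in>relators A d r s. free_eval B g p = \<zero>) \<longleftrightarrow> qrep A d r s B g"
proof
  assume *: "\<forall>p\<in>relators A d r s. free_eval B g p = \<zero>"
  note rel = *[unfolded relators_vanish_iff]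
  have inv: "g t \<otimes> g (tinv t) = \<one>" if "torus t" for t using rel that by (cases t) auto
  have inv': "g (tinv t) \<otimes> g t = \<one>" if "torus t" for t using inv[of "tinv t"] that by simp
  have flip: "g y \<otimes> g (tinv t) = c \<odot> (g (tinv t) \<otimes> g y)" if "torus t" "g t \<otimes> g y = c \<odot> (g y \<otimes> g t)" for t y c
    by (rule inv_commute[OF _ _ _ inv inv']) (use that in auto)
  have flip1: "g y \<otimes> g (tinv t) = g (tinv t) \<otimes> g y" if "torus t" "g t \<otimes> g y = g y \<otimes> g t" for t y
    using flip[of t y 1] that by simp
  have flip': "g (tinv t) \<otimes> g y = inverse c \<odot> (g y \<otimes> g (tinv t))"
    if "torus t" "g t \<otimes> g y = c \<odot> (g y \<otimes> g t)" "c \<noteq> 0" for t y c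
    using flip[OF that(1,2)] that(3) by simp
  have c0: "g (Gw i) \<otimes> g (Gw j) = g (Gw j) \<otimes> g (Gw i)" "g (Gw i) \<otimes> g (Gw' j) = g (Gw' j) \<otimes> g (Gw i)"
    "g (Gw' i) \<otimes> g (Gw j) = g (Gw j) \<otimes> g (Gw' i)" "g (Gw' i) \<otimes> g (Gw' j) = g (Gw' j) \<otimes> g (Gw' i)" for i j
    using rel by auto
  have f1: "g y \<otimes> g (Gw_inv i) = g (Gw_inv i) \<otimes> g y" if "g (Gw i) \<otimes> g y = g y \<otimes> g (Gw i)" for y i
    by (rule flip1[of "Gw i" y, unfolded tinv.simps]) (simp, rule that)
  have f2: "g y \<otimes> g (Gw'_inv i) = g (Gw'_inv i) \<otimes> g y" if "g (Gw' i) \<otimes> g y = g y \<otimes> g (Gw' i)" for y i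
    by (rule flip1[of "Gw' i" y, unfolded tinv.simps]) (simp, rule that)
  have c1: "g t \<otimes> g (Gw i) = g (Gw i) \<otimes> g t" "g t \<otimes> g (Gw' i) = g (Gw' i) \<otimes> g t" if "torus t" for t i
    using that c0 f1[OF c0(1)] f2[OF c0(3)] f1[OF c0(2)] f2[OF c0(4)]
    by (cases t; metis torus.simps)+
  have c2: "g t \<otimes> g t' = g t' \<otimes> g t" if "torus t" "torus t'" for t t'
    using that c1[OF that(1)] f1[OF c1(1)[OF that(1), symmetric]] f2[OF c1(2)[OF that(1), symmetric]]
    by (cases t'; metis torus.simps)
  have te: "g t \<otimes> g (Ge j) = wt A d r s t j \<odot> (g (Ge j) \<otimes> g t)" if "torus t" for t j
    using that rel flip'[of "Gw _" "Ge j"] flip'[of "Gw' _" "Ge j"] by (cases t) auto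
  have tf: "g t \<otimes> g (Gf j) = inverse (wt A d r s t j) \<odot> (g (Gf j) \<otimes> g t)" if "torus t" for t j
    using that rel flip'[of "Gw _" "Gf j"] flip'[of "Gw' _" "Gf j"] by (cases t) auto
  show "qrep A d r s B g"
  proof unfold_locales
    fix i j :: 'i
    show "g (Ge i) \<otimes> g (Gf j) = g (Gf j) \<otimes> g (Ge i)
        \<oplus> (if i = j then ef_coeff i \<odot> (g (Gw i) \<oplus> (- 1) \<odot> g (Gw' i)) else \<zero>)"
      by (rule rel[THEN conjunct2, THEN conjunct2, THEN conjunct2, THEN conjunct1, rule_format])
    assume "i \<noteq> j"
    then show "qad B (vi i) (bet i j) (serre_len i j) (g (Ge i)) (g (Ge j)) = \<zero>"
      "qad (opposite B) (vi i) (bet i j) (serre_len i j) (g (Gf i)) (g (Gf j)) = \<zero>"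
      using rel[THEN conjunct2, THEN conjunct2, THEN conjunct2, THEN conjunct2] by blast+
  qed (simp_all only: inv c2 te tf gen_closed)
next
  assume "qrep A d r s B g"
  then interpret q: qrep A d r s B g .
  show "\<forall>p\<in>relators A d r s. free_eval B g p = \<zero>"
    unfolding relators_vanish_iff
    using q.rel_inv[of "Gw _"] q.rel_inv[of "Gw' _"] q.rel_inv[of "Gw_inv _"] q.rel_inv[of "Gw'_inv _"]
      q.rel_te[of "Gw _"] q.rel_te[of "Gw' _"] q.rel_tf[of "Gw _"] q.rel_tf[of "Gw' _"]
    by (auto simp: q.rel_ef q.serre_e q.serre_f intro!: q.rel_torus)
qed

end

section \<open>Coproduct, antipode and counit on generators\<close>

text \<open>Coproduct and antipode of the generators, realised in an arbitrary algebra in place of the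
  quotient.\<close>

primrec dgen :: "('k::field, 'b, 'm) module_scheme \<Rightarrow> ('i generator \<Rightarrow> 'b) \<Rightarrow> 'i generator \<Rightarrow> ('b \<times> 'b \<Rightarrow>\<^sub>0 'k) set" where
  "dgen B g (Ge i) = pure B B (g (Ge i)) \<one>\<^bsub>B\<^esub> \<oplus>\<^bsub>tensor B B\<^esub> pure B B (g (Gw i)) (g (Ge i))"
| "dgen B g (Gf i) = pure B B \<one>\<^bsub>B\<^esub> (g (Gf i)) \<oplus>\<^bsub>tensor B B\<^esub> pure B B (g (Gf i)) (g (Gw' i))"
| "dgen B g (Gw i) = pure B B (g (Gw i)) (g (Gw i))"
| "dgen B g (Gw_inv i) = pure B B (g (Gw_inv i)) (g (Gw_inv i))"
| "dgen B g (Gw' i) = pure B B (g (Gw' i)) (g (Gw' i))"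
| "dgen B g (Gw'_inv i) = pure B B (g (Gw'_inv i)) (g (Gw'_inv i))"

primrec sgen :: "('k::field, 'b, 'm) module_scheme \<Rightarrow> ('i generator \<Rightarrow> 'b) \<Rightarrow> 'i generator \<Rightarrow> 'b" where
  "sgen B g (Ge i) = (- 1) \<odot>\<^bsub>B\<^esub> (g (Gw_inv i) \<otimes>\<^bsub>B\<^esub> g (Ge i))"
| "sgen B g (Gf i) = (- 1) \<odot>\<^bsub>B\<^esub> (g (Gf i) \<otimes>\<^bsub>B\<^esub> g (Gw'_inv i))"
| "sgen B g (Gw i) = g (Gw_inv i)"
| "sgen B g (Gw_inv i) = g (Gw i)"
| "sgen B g (Gw' i) = g (Gw'_inv i)"
| "sgen B g (Gw'_inv i) = g (Gw' i)"

lemma dgen_torus: "torus t \<Longrightarrow> dgen B g t = pure B B (g t) (g t)"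
  by (cases t) auto

lemma sgen_torus: "torus t \<Longrightarrow> sgen B g t = g (tinv t)"
  by (cases t) auto

context qrep
begin

text \<open>The two mixed terms of \<open>\<Delta>(e\<^sub>i) \<Delta>(f\<^sub>j)\<close> and \<open>\<Delta>(f\<^sub>j) \<Delta>(e\<^sub>i)\<close> coincide, and for \<open>i = j\<close> the
  remaining ones give a multiple of
  \<open>(\<omega>\<^sub>i - \<omega>'\<^sub>i) \<otimes> \<omega>'\<^sub>i + \<omega>\<^sub>i \<otimes> (\<omega>\<^sub>i - \<omega>'\<^sub>i)\<close>, which telescopes. By \<open>qad_sum\<close>, the Serre
  element of the coproducts is the sum of two Serre elements supported in one leg.\<close>

lemma qrep_tensor: "qrep A d r s (tensor B B) (dgen B g)"
proof -
  interpret BB: kalg2 B B by unfold_locales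
  let ?T = "tensor B B"
  have cl [simp]: "dgen B g x \<in> carrier ?T" for x by (cases x) auto
  show ?thesis
  proof
    show "dgen B g x \<in> carrier ?T" for x by simp
  next
    fix t :: "'i generator" assume t: "torus t"
    show "dgen B g t \<otimes>\<^bsub>?T\<^esub> dgen B g (tinv t) = \<one>\<^bsub>?T\<^esub>"
      using t by (simp add: dgen_torus BB.pure_mult rel_inv BB.tensor_one)
    show "dgen B g t \<otimes>\<^bsub>?T\<^esub> dgen B g t' = dgen B g t' \<otimes>\<^bsub>?T\<^esub> dgen B g t" if "torus t'" for t'
      using t that by (simp add: dgen_torus BB.pure_mult rel_torus[of t t'])
    show "dgen B g t \<otimes>\<^bsub>?T\<^esub> dgen B g (Ge j) = wt A d r s t j \<odot>\<^bsub>?T\<^esub> (dgen B g (Ge j) \<otimes>\<^bsub>?T\<^esub> dgen B g t)" for j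
      using t by (simp add: dgen_torus BB.pure_mult rel_te rel_torus[of "Gw j" t] BB.T.l_distr BB.T.r_distr
          BB.pure_smult_left BB.pure_smult_right BB.T.smult_add_right)
    show "dgen B g t \<otimes>\<^bsub>?T\<^esub> dgen B g (Gf j) = inverse (wt A d r s t j) \<odot>\<^bsub>?T\<^esub> (dgen B g (Gf j) \<otimes>\<^bsub>?T\<^esub> dgen B g t)" for j
      using t by (simp add: dgen_torus BB.pure_mult rel_tf rel_torus[of "Gw' j" t] BB.T.l_distr BB.T.r_distr
          BB.pure_smult_left BB.pure_smult_right BB.T.smult_add_right)
  next
    fix i j :: 'i
    have 1: "dgen B g (Ge i) \<otimes>\<^bsub>?T\<^esub> dgen B g (Gf j) =
       pure B B (g (Ge i)) (g (Gf j)) \<oplus>\<^bsub>?T\<^esub> pure B B (g (Ge i) \<otimes> g (Gf j)) (g (Gw' j))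
        \<oplus>\<^bsub>?T\<^esub> (pure B B (g (Gw i)) (g (Ge i) \<otimes> g (Gf j)) \<oplus>\<^bsub>?T\<^esub> pure B B (g (Gf j) \<otimes> g (Gw i)) (g (Gw' j) \<otimes> g (Ge i)))"
      by (simp add: BB.T.l_distr BB.T.r_distr BB.pure_mult rel_tf rel_et BB.pure_smult_left BB.pure_smult_right BB.T.a_ac)
    have 2: "dgen B g (Gf j) \<otimes>\<^bsub>?T\<^esub> dgen B g (Ge i) =
       pure B B (g (Ge i)) (g (Gf j)) \<oplus>\<^bsub>?T\<^esub> pure B B (g (Gf j) \<otimes> g (Ge i)) (g (Gw' j))
        \<oplus>\<^bsub>?T\<^esub> (pure B B (g (Gw i)) (g (Gf j) \<otimes> g (Ge i)) \<oplus>\<^bsub>?T\<^esub> pure B B (g (Gf j) \<otimes> g (Gw i)) (g (Gw' j) \<otimes> g (Ge i)))"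
      by (simp add: BB.T.l_distr BB.T.r_distr BB.pure_mult BB.T.a_ac)
    show "dgen B g (Ge i) \<otimes>\<^bsub>?T\<^esub> dgen B g (Gf j) = dgen B g (Gf j) \<otimes>\<^bsub>?T\<^esub> dgen B g (Ge i)
       \<oplus>\<^bsub>?T\<^esub> (if i = j then ef_coeff i \<odot>\<^bsub>?T\<^esub> (dgen B g (Gw i) \<oplus>\<^bsub>?T\<^esub> (- 1) \<odot>\<^bsub>?T\<^esub> dgen B g (Gw' i)) else \<zero>\<^bsub>?T\<^esub>)"
    proof (cases "i = j")
      case True
      let ?p = "pure B B (g (Gw i)) (g (Gw' i))"
      have "?p \<oplus>\<^bsub>?T\<^esub> (- 1) \<odot>\<^bsub>?T\<^esub> ?p = \<zero>\<^bsub>?T\<^esub>"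
        by (simp add: BB.T.smult_minus_one BB.T.r_neg)
      then have "ef_coeff i \<odot>\<^bsub>?T\<^esub> ?p \<oplus>\<^bsub>?T\<^esub> (- ef_coeff i) \<odot>\<^bsub>?T\<^esub> ?p = \<zero>\<^bsub>?T\<^esub>"
        by (simp add: BB.T.smult_add_left[symmetric])
      then have c: "ef_coeff i \<odot>\<^bsub>?T\<^esub> ?p \<oplus>\<^bsub>?T\<^esub> ((- ef_coeff i) \<odot>\<^bsub>?T\<^esub> ?p \<oplus>\<^bsub>?T\<^esub> w) = w" if "w \<in> carrier ?T" for w
        using that by (simp add: BB.T.a_assoc[symmetric])
      have j: "j = i" using True by simp
      show ?thesis unfolding 1 2 unfolding j
        by (simp add: rel_ef BB.pure_add_left BB.pure_add_right BB.pure_smult_left BB.pure_smult_right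
            BB.T.smult_add_right smult_add_right BB.T.a_ac c[simplified])
    next
      case False
      then show ?thesis unfolding 1 2 by (simp add: rel_ef)
    qed
    assume ij: "i \<noteq> j"
    show "qad ?T (vi i) (bet i j) (serre_len i j) (dgen B g (Ge i)) (dgen B g (Ge j)) = \<zero>\<^bsub>?T\<^esub>"
    proof (cases "serre_len i j")
      case 0
      then have "g (Ge j) = \<zero>" using serre_e[OF ij] by simp
      then show ?thesis using 0 by (simp add: BB.pure_zero_left BB.pure_zero_right)
    next
      case (Suc m)
      have "qad ?T (vi i) (bet i j) (serre_len i j) (dgen B g (Ge i)) (dgen B g (Ge j))
        = qad ?T (vi i) (bet i j) (serre_len i j) (pure B B (g (Ge i)) \<one>) (pure B B (g (Ge j)) \<one>)
         \<oplus>\<^bsub>?T\<^esub> qad ?T (vi i) (bet i j) (serre_len i j) (pure B B (g (Gw i)) (g (Ge i))) (pure B B (g (Gw j)) (g (Ge j)))"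
        unfolding dgen.simps
        by (rule BB.T.qad_sum[OF _ _ _ _ _ _ _ Suc bt_serre[OF ij Suc]])
           (simp_all add: BB.pure_mult rel_te BB.pure_smult_left bt_self)
      also have "\<dots> = \<zero>\<^bsub>?T\<^esub>"
        by (simp add: BB.qad_pure_left BB.qad_pure_right rel_torus serre_e[OF ij] BB.pure_zero_left BB.pure_zero_right funpow_mult_closed)
      finally show ?thesis .
    qed
    show "qad (opposite ?T) (vi i) (bet i j) (serre_len i j) (dgen B g (Gf i)) (dgen B g (Gf j)) = \<zero>\<^bsub>?T\<^esub>"
    proof (cases "serre_len i j")
      case 0
      then have "g (Gf j) = \<zero>" using serre_f[OF ij] by simp
      then show ?thesis using 0 by (simp add: BB.pure_zero_left BB.pure_zero_right)
    next
      case (Suc m)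
      interpret O: kalg2 "opposite B" "opposite B"
        by (intro kalg2.intro kalg_opposite) unfold_locales
      note O = O.qad_pure_left O.qad_pure_right O.T.qad_sum
      note O' = O[unfolded tensor_opposite pure_opposite]
      have "qad (opposite ?T) (vi i) (bet i j) (serre_len i j) (dgen B g (Gf i)) (dgen B g (Gf j))
        = qad (opposite ?T) (vi i) (bet i j) (serre_len i j) (pure B B (g (Gf i)) (g (Gw' i))) (pure B B (g (Gf j)) (g (Gw' j)))
         \<oplus>\<^bsub>?T\<^esub> qad (opposite ?T) (vi i) (bet i j) (serre_len i j) (pure B B \<one> (g (Gf i))) (pure B B \<one> (g (Gf j)))"
        unfolding dgen.simps BB.T.a_comm[OF BB.pure_closed[OF one_closed gen_closed'] BB.pure_closed[OF gen_closed' gen_closed']]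
        by (rule O'(3)[OF _ _ _ _ _ _ _ Suc bt_serre[OF ij Suc], simplified])
           (simp_all add: BB.pure_mult rel_tf BB.pure_smult_right bt_self)
      also have "\<dots> = \<zero>\<^bsub>?T\<^esub>"
        by (simp add: O'(1,2)[simplified] rel_torus serre_f[OF ij] BB.pure_zero_left BB.pure_zero_right O.V.funpow_mult_closed[simplified])
      finally show ?thesis .
    qed
  qed
qed

text \<open>The antipode sends \<open>e\<^sub>i\<close> to a multiple of \<open>\<omega>\<^sub>i\<^sup>-\<^sup>1 e\<^sub>i\<close>. By \<open>qad_opposite_twist\<close> the Serre element of
  these products in the opposite algebra is a multiple of a torus element times the Serre element
  with inverse scalars, which is the original one by \<open>qad_reverse\<close>.\<close>

lemma qrep_opposite: "qrep A d r s (opposite B) (sgen B g)"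
proof -
  have B: "kalg B" ..
  interpret O: kalg "opposite B" by (rule kalg_opposite[OF B])
  have cl [simp]: "sgen B g x \<in> carrier B" for x by (cases x) auto
  show ?thesis
  proof
    show "sgen B g x \<in> carrier (opposite B)" for x by simp
  next
    fix t :: "'i generator" assume t: "torus t"
    show "sgen B g t \<otimes>\<^bsub>opposite B\<^esub> sgen B g (tinv t) = \<one>\<^bsub>opposite B\<^esub>"
      using t by (simp add: sgen_torus rel_inv)
    show "sgen B g t \<otimes>\<^bsub>opposite B\<^esub> sgen B g t' = sgen B g t' \<otimes>\<^bsub>opposite B\<^esub> sgen B g t" if "torus t'" for t'
      using t that by (simp add: sgen_torus rel_torus[of "tinv t" "tinv t'"])
    show "sgen B g t \<otimes>\<^bsub>opposite B\<^esub> sgen B g (Ge j) = wt A d r s t j \<odot>\<^bsub>opposite B\<^esub> (sgen B g (Ge j) \<otimes>\<^bsub>opposite B\<^esub> sgen B g t)" for j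
    proof -
      have "g (Gw_inv j) \<otimes> g (Ge j) \<otimes> g (tinv t) = g (Gw_inv j) \<otimes> (g (Ge j) \<otimes> g (tinv t))"
        by (simp add: m_assoc)
      also have "\<dots> = wt A d r s t j \<odot> (g (Gw_inv j) \<otimes> g (tinv t) \<otimes> g (Ge j))"
        using t by (simp add: rel_et wt_tinv m_assoc)
      finally show ?thesis using t
        by (simp add: sgen_torus rel_torus[of "Gw_inv j"] m_assoc mult.commute)
    qed
    show "sgen B g t \<otimes>\<^bsub>opposite B\<^esub> sgen B g (Gf j) = inverse (wt A d r s t j) \<odot>\<^bsub>opposite B\<^esub> (sgen B g (Gf j) \<otimes>\<^bsub>opposite B\<^esub> sgen B g t)" for j
    proof -
      have "g (tinv t) \<otimes> (g (Gf j) \<otimes> g (Gw'_inv j)) = wt A d r s t j \<odot> (g (Gf j) \<otimes> g (Gw'_inv j) \<otimes> g (tinv t))"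
        using t by (simp add: rel_tf wt_tinv m_assoc[symmetric]) (simp add: m_assoc rel_torus[of "tinv t"])
      then show ?thesis using t
        by (simp add: sgen_torus mult.commute)
    qed
  next
    fix i j :: 'i
    let ?K = "g (Gw'_inv j) \<otimes> g (Gw_inv i)"
    have 1: "sgen B g (Ge i) \<otimes> sgen B g (Gf j) = g (Gw_inv i) \<otimes> (g (Ge i) \<otimes> g (Gf j)) \<otimes> g (Gw'_inv j)"
      by (simp add: m_assoc)
    have 2: "g (Gw_inv i) \<otimes> (g (Gf j) \<otimes> g (Ge i)) \<otimes> g (Gw'_inv j) = g (Gf j) \<otimes> g (Gw'_inv j) \<otimes> (g (Gw_inv i) \<otimes> g (Ge i))"
    proof -
      have "g (Gw_inv i) \<otimes> (g (Gf j) \<otimes> g (Ge i)) \<otimes> g (Gw'_inv j) = (g (Gw_inv i) \<otimes> g (Gf j)) \<otimes> (g (Ge i) \<otimes> g (Gw'_inv j))"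
        by (simp add: m_assoc)
      also have "\<dots> = g (Gf j) \<otimes> (g (Gw_inv i) \<otimes> g (Gw'_inv j)) \<otimes> g (Ge i)"
        by (simp add: rel_tf rel_et) (simp add: m_assoc)
      finally show ?thesis by (simp add: m_assoc rel_torus[of "Gw_inv i" "Gw'_inv j"])
    qed
    show "sgen B g (Ge i) \<otimes>\<^bsub>opposite B\<^esub> sgen B g (Gf j) = sgen B g (Gf j) \<otimes>\<^bsub>opposite B\<^esub> sgen B g (Ge i)
       \<oplus>\<^bsub>opposite B\<^esub> (if i = j then ef_coeff i \<odot>\<^bsub>opposite B\<^esub> (sgen B g (Gw i) \<oplus>\<^bsub>opposite B\<^esub> (- 1) \<odot>\<^bsub>opposite B\<^esub> sgen B g (Gw' i)) else \<zero>\<^bsub>opposite B\<^esub>)"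
    proof (cases "i = j")
      case True
      then have j: "j = i" by simp
      have a: "g (Gw_inv i) \<otimes> g (Gw i) \<otimes> g (Gw'_inv i) = g (Gw'_inv i)" "g (Gw_inv i) \<otimes> g (Gw' i) \<otimes> g (Gw'_inv i) = g (Gw_inv i)"
        using rel_inv[of "Gw_inv i"] rel_inv[of "Gw' i"] by (simp_all add: m_assoc[of "g (Gw_inv i)" "g (Gw' i)"])
      have "sgen B g (Ge i) \<otimes> sgen B g (Gf j) = g (Gf j) \<otimes> g (Gw'_inv j) \<otimes> (g (Gw_inv i) \<otimes> g (Ge i))
         \<oplus> ef_coeff i \<odot> (g (Gw'_inv i) \<oplus> (- 1) \<odot> g (Gw_inv i))"
        unfolding 1 rel_ef unfolding j by (simp add: r_distr l_distr 2[unfolded j] a)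
      moreover have "(p \<oplus> c \<odot> (u \<oplus> (- 1) \<odot> w)) \<oplus> c \<odot> (w \<oplus> (- 1) \<odot> u) = p"
        if "p \<in> carrier B" "u \<in> carrier B" "w \<in> carrier B" for p u w c
      proof -
        have "c \<odot> (w \<oplus> (- 1) \<odot> u) = (- 1) \<odot> (c \<odot> (u \<oplus> (- 1) \<odot> w))"
          using that by (simp add: smult_add_right a_comm)
        then show ?thesis using that by (simp add: smult_minus_one a_assoc r_neg del: smult_smult)
      qed
      ultimately show ?thesis using True by simp
    next
      case False
      then show ?thesis using 1[unfolded rel_ef] 2 by simp
    qed
    assume ij: "i \<noteq> j"
    show "qad (opposite B) (vi i) (bet i j) (serre_len i j) (sgen B g (Ge i)) (sgen B g (Ge j)) = \<zero>\<^bsub>opposite B\<^esub>"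
    proof (cases "serre_len i j")
      case 0
      then have "g (Ge j) = \<zero>" using serre_e[OF ij] by simp
      then show ?thesis using 0 by simp
    next
      case (Suc m)
      have "bet i j * bet j i * vi i ^ m = 1" by (rule bt_serre[OF ij Suc])
      then have c: "1 / bet j i = vi i ^ m * bet i j" by (simp add: field_simps)
      have "qad B (1 / vi i) (1 / bet j i) (serre_len i j) (g (Ge i)) (g (Ge j)) = \<zero>"
        using serre_e[OF ij] unfolding c Suc by (subst qad_reverse[symmetric]) (auto simp: r_nz s_nz simp del: qad.simps)
      moreover obtain K where "qad (opposite B) (vi i) (bet i j) (serre_len i j) (g (Gw_inv i) \<otimes> g (Ge i)) (g (Gw_inv j) \<otimes> g (Ge j))
        = K \<odot> (((\<otimes>) (g (Gw_inv i)) ^^ serre_len i j) (g (Gw_inv j)) \<otimes> qad B (1 / vi i) (1 / bet j i) (serre_len i j) (g (Ge i)) (g (Ge j)))"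
        using qad_opposite_twist[of "g (Gw_inv i)" "g (Gw_inv j)" "g (Ge i)" "g (Ge j)" "bet i i" "bet i j" "bet j i" "vi i" "bet j i" "bet i j" "serre_len i j"]
        by (auto simp: rel_et rel_torus)
      ultimately show ?thesis using O.qad_scale by simp
    qed
    show "qad (opposite (opposite B)) (vi i) (bet i j) (serre_len i j) (sgen B g (Gf i)) (sgen B g (Gf j)) = \<zero>\<^bsub>opposite B\<^esub>"
    proof (cases "serre_len i j")
      case 0
      then have "g (Gf j) = \<zero>" using serre_f[OF ij] by simp
      then show ?thesis using 0 by simp
    next
      case (Suc m)
      have OO: "opposite (opposite B) = B" by (simp add: opposite_def)
      have "bet i j * bet j i * vi i ^ m = 1" by (rule bt_serre[OF ij Suc])
      then have c: "1 / bet j i = vi i ^ m * bet i j" by (simp add: field_simps)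
      have "qad (opposite B) (1 / vi i) (1 / bet j i) (serre_len i j) (g (Gf i)) (g (Gf j)) = \<zero>"
        using serre_f[OF ij] unfolding c Suc by (subst O.qad_reverse[symmetric]) (auto simp: r_nz s_nz simp del: qad.simps)
      moreover obtain K where "qad (opposite (opposite B)) (vi i) (bet i j) (serre_len i j) (g (Gf i) \<otimes> g (Gw'_inv i)) (g (Gf j) \<otimes> g (Gw'_inv j))
        = K \<odot> (qad (opposite B) (1 / vi i) (1 / bet j i) (serre_len i j) (g (Gf i)) (g (Gf j)) \<otimes> ((\<otimes>\<^bsub>opposite B\<^esub>) (g (Gw'_inv i)) ^^ serre_len i j) (g (Gw'_inv j)))"
        using O.qad_opposite_twist[of "g (Gw'_inv i)" "g (Gw'_inv j)" "g (Gf i)" "g (Gf j)" "inverse (bet i i)" "inverse (bet j i)" "inverse (bet i j)" "vi i" "bet j i" "bet i j" "serre_len i j"]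
        by (auto simp: rel_tf rel_torus)
      ultimately show ?thesis using O.funpow_mult_closed[of "g (Gw'_inv i)" "g (Gw'_inv j)" "serre_len i j"] 
        by (simp add: OO qad_scale)
    qed
  qed
qed

end

text \<open>If the \<open>e\<^sub>i\<close> and \<open>f\<^sub>i\<close> act by zero, only commutative torus relations are left. This covers the
  counit and the projection to the group algebra of the root lattice.\<close>

lemma qrep_torus_only:
  assumes "qdata A d r s" "kalg B" "\<And>x. g x \<in> carrier B"
    and "\<And>i. g (Ge i) = \<zero>\<^bsub>B\<^esub>" "\<And>i. g (Gf i) = \<zero>\<^bsub>B\<^esub>" "\<And>i. g (Gw i) = g (Gw' i)"
    and "\<And>t. torus t \<Longrightarrow> g t \<otimes>\<^bsub>B\<^esub> g (tinv t) = \<one>\<^bsub>B\<^esub>"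
    and "\<And>t t'. torus t \<Longrightarrow> torus t' \<Longrightarrow> g t \<otimes>\<^bsub>B\<^esub> g t' = g t' \<otimes>\<^bsub>B\<^esub> g t"
  shows "qrep A d r s B g"
proof -
  interpret qdata A d r s by fact
  interpret B: kalg B by fact
  interpret O: kalg "opposite B" by (rule kalg_opposite[OF assms(2)])
  show ?thesis
  proof
    fix i j :: 'a
    have "g (Gw' i) \<oplus>\<^bsub>B\<^esub> (- 1) \<odot>\<^bsub>B\<^esub> g (Gw' i) = \<zero>\<^bsub>B\<^esub>" for i
      using assms(3) by (simp add: B.smult_minus_one B.r_neg)
    then show "g (Ge i) \<otimes>\<^bsub>B\<^esub> g (Gf j) = g (Gf j) \<otimes>\<^bsub>B\<^esub> g (Ge i)
        \<oplus>\<^bsub>B\<^esub> (if i = j then ef_coeff i \<odot>\<^bsub>B\<^esub> (g (Gw i) \<oplus>\<^bsub>B\<^esub> (- 1) \<odot>\<^bsub>B\<^esub> g (Gw' i)) else \<zero>\<^bsub>B\<^esub>)"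
      by (simp add: assms(4-6))
    show "qad B (vi i) (bet i j) (serre_len i j) (g (Ge i)) (g (Ge j)) = \<zero>\<^bsub>B\<^esub>"
      "qad (opposite B) (vi i) (bet i j) (serre_len i j) (g (Gf i)) (g (Gf j)) = \<zero>\<^bsub>B\<^esub>"
      using B.qad_zero[of "\<zero>\<^bsub>B\<^esub>"] O.qad_zero[of "\<zero>\<^bsub>B\<^esub>"] by (simp_all add: assms(4,5))
  qed (use assms(3-8) in simp_all)
qed

section \<open>The quotient algebra\<close>

lemma free_alg_hom_eq:
  assumes "kalg B" "f \<in> alg_hom mon_alg B" "f' \<in> alg_hom mon_alg B"
    and "\<And>x. f (gvar x) = f' (gvar (x :: 'a))"
  shows "f p = f' (p :: 'a word \<Rightarrow>\<^sub>0 'k::field)"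
proof -
  interpret B: kalg B by fact
  have B: "kspace B" ..
  have M: "kspace (mon_alg :: ('k, 'a word \<Rightarrow>\<^sub>0 'k) module)"
    using kalg_mon_alg by (rule kalg.axioms(1))
  have w: "f (word_monom ws) = f' (word_monom ws)" for ws
  proof (induction ws)
    case Nil
    then show ?case using alg_hom_one[OF assms(2)] alg_hom_one[OF assms(3)] by (simp add: word_monom_Nil)
  next
    case (Cons x ws)
    then show ?case using alg_hom_mult[OF assms(2), of "gvar x" "word_monom ws"] alg_hom_mult[OF assms(3), of "gvar x" "word_monom ws"]
      by (simp add: word_monom_Cons assms(4))
  qed
  show ?thesis using subset_UNIV[of "Poly_Mapping.keys p"]
  proof (induction rule: pm_induct)
    case zero
    then show ?case using linear_maps_zero[OF M B alg_hom_linear[OF assms(2)]] linear_maps_zero[OF M B alg_hom_linear[OF assms(3)]] by simp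
  next
    case (add s k c)
    have k: "Poly_Mapping.single k c = pm_scale c (word_monom (letters k))" by simp
    show ?case
      using add linear_maps_add[OF alg_hom_linear[OF assms(2)], of s "pm_scale c (word_monom (letters k))"]
        linear_maps_add[OF alg_hom_linear[OF assms(3)], of s "pm_scale c (word_monom (letters k))"]
        linear_maps_smult[OF alg_hom_linear[OF assms(2)], of "word_monom (letters k)" c]
        linear_maps_smult[OF alg_hom_linear[OF assms(3)], of "word_monom (letters k)" c] w[of "letters k"]
      unfolding k by (simp del: pm_scale_single)
  qed
qed

lemma free_alg_ring_simps:
  "carrier ring_of_type_algebra = UNIV" "x \<otimes>\<^bsub>ring_of_type_algebra\<^esub> y = x * y" "\<one>\<^bsub>ring_of_type_algebra\<^esub> = 1"
  "x \<oplus>\<^bsub>ring_of_type_algebra\<^esub> y = x + y" "\<zero>\<^bsub>ring_of_type_algebra\<^esub> = 0"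
  by (simp_all add: ring_of_type_algebra_def)

context qdata
begin

abbreviation "U \<equiv> U_alg A d r s"
abbreviation "cl \<equiv> U_class A d r s"

lemma U_ideal_ideal: "ideal (U_ideal A d r s) ring_of_type_algebra"
proof -
  interpret R: ring "ring_of_type_algebra :: ('i, 'k) free_alg ring" by (rule ring_free_alg)
  show ?thesis unfolding U_ideal_def by (rule R.genideal_ideal) (simp add: free_alg_ring_simps)
qed

lemma cl_ops:
  "carrier U = range cl" "cl p \<otimes>\<^bsub>U\<^esub> cl q = cl (p * q)" "\<one>\<^bsub>U\<^esub> = cl 1" "cl p \<oplus>\<^bsub>U\<^esub> cl q = cl (p + q)"
  "\<zero>\<^bsub>U\<^esub> = cl 0" "c \<odot>\<^bsub>U\<^esub> cl p = cl (pm_scale c p)"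
proof -
  interpret I: ideal "U_ideal A d r s" ring_of_type_algebra by (rule U_ideal_ideal)
  note m = I.rcoset_mult_add[unfolded free_alg_ring_simps, OF UNIV_I UNIV_I, folded U_class_def]
  show "carrier U = range cl"
    by (auto simp: U_alg_def Let_def FactRing_def A_RCOSETS_def' free_alg_ring_simps U_class_def)
  show "cl p \<otimes>\<^bsub>U\<^esub> cl q = cl (p * q)"
    by (simp add: U_alg_def Let_def FactRing_def m)
  show "\<one>\<^bsub>U\<^esub> = cl 1"
    by (simp add: U_alg_def Let_def FactRing_def U_class_def free_alg_ring_simps)
  show "cl p \<oplus>\<^bsub>U\<^esub> cl q = cl (p + q)"
    using I.a_rcos_sum[of p q, unfolded free_alg_ring_simps, OF UNIV_I UNIV_I, folded U_class_def]
    by (simp add: U_alg_def Let_def FactRing_def)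
  show "\<zero>\<^bsub>U\<^esub> = cl 0"
    using I.a_rcos_zero[OF U_ideal_ideal additive_subgroup.zero_closed[OF ideal.axioms(1)[OF U_ideal_ideal]], unfolded free_alg_ring_simps, folded U_class_def]
    by (simp add: U_alg_def Let_def FactRing_def)
  show "c \<odot>\<^bsub>U\<^esub> cl p = cl (pm_scale c p)"
    by (simp add: U_alg_def Let_def FactRing_def m sc_mult)
qed

lemma cl_eq_iff: "cl p = cl q \<longleftrightarrow> p - q \<in> U_ideal A d r s"
proof -
  interpret I: ideal "U_ideal A d r s" ring_of_type_algebra by (rule U_ideal_ideal)
  have "p \<ominus>\<^bsub>ring_of_type_algebra\<^esub> q = p - q"
  proof -
    have "- q = \<ominus>\<^bsub>ring_of_type_algebra\<^esub> q"
      by (rule I.minus_equality[symmetric]) (simp_all add: free_alg_ring_simps)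
    then show ?thesis by (metis I.minus_eq free_alg_ring_simps(4) diff_conv_add_uminus)
  qed
  then show ?thesis
    using I.quotient_eq_iff_same_a_r_cos[OF U_ideal_ideal, of p q] by (simp add: free_alg_ring_simps U_class_def)
qed

lemma rep_cl: "rep (cl p) - p \<in> U_ideal A d r s"
proof -
  interpret I: ideal "U_ideal A d r s" ring_of_type_algebra by (rule U_ideal_ideal)
  have "p \<in> cl p" unfolding U_class_def
    by (rule I.a_rcos_self) (simp add: free_alg_ring_simps)
  then have "rep (cl p) \<in> cl p" unfolding rep_def by (rule someI)
  then obtain h where "h \<in> U_ideal A d r s" "rep (cl p) = h + p"
    by (auto simp: U_class_def a_r_coset_def' free_alg_ring_simps)
  then show ?thesis by simp
qed

lemma kalg_U: "kalg U"
proof (rule kalgI)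
  interpret M: kalg "mon_alg :: ('k, ('i, 'k) free_alg) module" by (rule kalg_mon_alg)
  note sc = M.smult_add_left[simplified] M.smult_add_right[simplified] M.smult_mult_right[simplified] M.smult_mult_left[simplified]
  show "kspace U"
  proof (rule kspaceI; (rule abelian_groupI)?)
    fix x assume "x \<in> carrier U"
    then obtain p where p: "x = cl p" by (auto simp: cl_ops)
    show "\<exists>y\<in>carrier U. y \<oplus>\<^bsub>U\<^esub> x = \<zero>\<^bsub>U\<^esub>"
      by (rule bexI[of _ "cl (- p)"]) (simp_all add: p cl_ops)
  qed (auto simp: cl_ops sc add_ac)
  show "bilin U U U (\<otimes>\<^bsub>U\<^esub>)"
    by (rule bilinI; rule linear_mapsI) (auto simp: cl_ops sc distrib_left distrib_right)
qed (auto simp: cl_ops mult.assoc)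

lemma cl_alg_hom: "cl \<in> alg_hom mon_alg U"
  by (intro alg_homI linear_mapsI) (auto simp: cl_ops)

lemma cl_closed [simp, intro]: "cl p \<in> carrier U"
  by (simp add: cl_ops)

sublocale U: kalg U by (rule kalg_U)

lemma free_hom_U: "free_hom U (\<lambda>x. cl (gvar x))"
  by unfold_locales simp

lemma free_eval_U: "free_eval U (\<lambda>x. cl (gvar x)) p = cl p"
proof -
  interpret free_hom U "\<lambda>x. cl (gvar x)" by (rule free_hom_U)
  show ?thesis
    by (rule free_alg_hom_eq[OF kalg_U free_eval_alg_hom cl_alg_hom]) (simp add: free_eval_gvar)
qed

lemma qrep_U: "qrep A d r s U (\<lambda>x. cl (gvar x))"
proof -
  interpret qfree A d r s U "\<lambda>x. cl (gvar x)"
    by (intro qfree.intro free_hom_U qdata_axioms)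
  interpret R: ring "ring_of_type_algebra :: ('i, 'k) free_alg ring" by (rule ring_free_alg)
  have "cl p = cl 0" if "p \<in> relators A d r s" for p
    using R.genideal_self[of "relators A d r s"] that
    by (auto simp: cl_eq_iff U_ideal_def free_alg_ring_simps)
  then show ?thesis unfolding qrep_iff[symmetric] by (simp add: free_eval_U cl_ops)
qed

end

context qrep
begin

lemma kills_ideal: "p \<in> U_ideal A d r s \<Longrightarrow> free_eval B g p = \<zero>"
proof -
  let ?R = "ring_of_type_algebra :: ('i, 'k) free_alg ring"
  interpret R: ring ?R by (rule ring_free_alg)
  interpret qfree A d r s B g by unfold_locales
  have qrep: "qrep A d r s B g" by unfold_locales
  have "free_eval B g \<in> ring_hom ?R B"
    by (auto simp: ring_hom_def free_alg_ring_simps free_eval_simps)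
  then interpret h: ring_hom_ring ?R B "free_eval B g"
    by (intro ring_hom_ringI2 R.ring_axioms ring_axioms)
  have "relators A d r s \<subseteq> a_kernel ?R B (free_eval B g)"
    using qrep_iff[THEN iffD2, OF qrep] unfolding a_kernel_def' free_alg_ring_simps by blast
  then have "U_ideal A d r s \<subseteq> a_kernel ?R B (free_eval B g)"
    unfolding U_ideal_def by (rule R.genideal_minimal[OF h.kernel_is_ideal])
  then show "p \<in> U_ideal A d r s \<Longrightarrow> free_eval B g p = \<zero>"
    unfolding a_kernel_def' by blast
qed

lemma free_eval_rep: "free_eval B g (rep (cl p)) = free_eval B g p"
  using kills_ideal[OF rep_cl[of p]] by (simp add: free_eval_diff r_right_minus_eq)

text \<open>The universal property of the quotient, evaluated on a chosen representative.\<close>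

lemma induced_alg_hom: "(\<lambda>S. free_eval B g (rep S)) \<in> alg_hom U B"
  by (intro alg_homI linear_mapsI) (auto simp: cl_ops free_eval_rep free_eval_simps)

end

section \<open>Hopf algebras checked on generators\<close>

text \<open>Formulated through closed sets, so that the induction principle is immediate. A closed set may
  contain elements outside of the carrier, therefore the closure conditions only concern those inside.\<close>

definition generates :: "('k, 'a, 'm) module_scheme \<Rightarrow> 'a set \<Rightarrow> bool" where
  "generates H G \<longleftrightarrow> (\<forall>S. G \<subseteq> S \<longrightarrow> \<one>\<^bsub>H\<^esub> \<in> S \<longrightarrow> (\<forall>x\<in>S \<inter> carrier H. \<forall>y\<in>S \<inter> carrier H. x \<oplus>\<^bsub>H\<^esub> y \<in> S \<and> x \<otimes>\<^bsub>H\<^esub> y \<in> S)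
     \<longrightarrow> (\<forall>c. \<forall>x\<in>S \<inter> carrier H. c \<odot>\<^bsub>H\<^esub> x \<in> S) \<longrightarrow> carrier H \<subseteq> S)"

lemma generates_induct [consumes 2, case_names gen one add mult smult]:
  assumes "generates H G" "x \<in> carrier H"
    and "\<And>x. x \<in> G \<Longrightarrow> P x" "P \<one>\<^bsub>H\<^esub>"
    and "\<And>x y. x \<in> carrier H \<Longrightarrow> y \<in> carrier H \<Longrightarrow> P x \<Longrightarrow> P y \<Longrightarrow> P (x \<oplus>\<^bsub>H\<^esub> y)"
    and "\<And>x y. x \<in> carrier H \<Longrightarrow> y \<in> carrier H \<Longrightarrow> P x \<Longrightarrow> P y \<Longrightarrow> P (x \<otimes>\<^bsub>H\<^esub> y)"
    and "\<And>c x. x \<in> carrier H \<Longrightarrow> P x \<Longrightarrow> P (c \<odot>\<^bsub>H\<^esub> x)"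
  shows "P x"
proof -
  have "carrier H \<subseteq> Collect P"
    using assms(1)[unfolded generates_def, THEN spec, of "Collect P"] assms(3-) by (simp add: subset_iff)
  then show ?thesis using assms(2) by auto
qed

lemma alg_hom_eq_on_generators:
  assumes "generates H G" "f \<in> alg_hom H B" "f' \<in> alg_hom H B" "\<And>x. x \<in> G \<Longrightarrow> f x = f' x" "x \<in> carrier H"
  shows "f x = f' x"
  using assms(1,5)
  by (induction rule: generates_induct)
     (simp_all add: assms(4) alg_hom_one[OF assms(2)] alg_hom_one[OF assms(3)] alg_hom_mult[OF assms(2)] alg_hom_mult[OF assms(3)]
       linear_maps_add[OF alg_hom_linear[OF assms(2)]] linear_maps_add[OF alg_hom_linear[OF assms(3)]]
       linear_maps_smult[OF alg_hom_linear[OF assms(2)]] linear_maps_smult[OF alg_hom_linear[OF assms(3)]])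

lemma alg_hom_comp:
  assumes "f \<in> alg_hom U V" "g \<in> alg_hom V W" shows "(\<lambda>x. g (f x)) \<in> alg_hom U W"
proof (rule alg_homI)
  show "(\<lambda>x. g (f x)) \<in> linear_maps U W"
    by (rule linear_maps_comp[OF alg_hom_linear[OF assms(1)] alg_hom_linear[OF assms(2)]])
  fix x y assume "x \<in> carrier U" "y \<in> carrier U"
  then show "g (f (x \<otimes>\<^bsub>U\<^esub> y)) = g (f x) \<otimes>\<^bsub>W\<^esub> g (f y)"
    by (simp add: alg_hom_mult[OF assms(1)] alg_hom_mult[OF assms(2)] linear_maps_closed[OF alg_hom_linear[OF assms(1)]])
qed (simp add: alg_hom_one[OF assms(1)] alg_hom_one[OF assms(2)])

lemma alg_hom_id: "(\<lambda>x. x) \<in> alg_hom V V"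
  by (intro alg_homI linear_maps_id) auto

text \<open>The structure maps are known to be multiplicative or antimultiplicative, which reduces the
  remaining Hopf algebra axioms to the generators.\<close>

locale prehopf = kalg H for H :: "('k::field, 'a) hopf" (structure) +
  fixes G :: "'a set"
  assumes G_closed: "G \<subseteq> carrier H"
    and G_generates: "generates H G"
    and comult_alg_hom: "comult H \<in> alg_hom H (tensor H H)"
    and counit_alg_hom: "counit H \<in> alg_hom H K_alg"
    and antipode_alg_hom: "antipode H \<in> alg_hom H (opposite H)"
begin

sublocale HH: kalg2 H H by unfold_locales

sublocale H3: kalg2 H "tensor H H" by (intro kalg2.intro kalg_axioms HH.kalg_tensor)

lemma kalg_H: "kalg H" ..

lemma kspace_H: "kspace H" ..

lemma counit_linear: "counit H \<in> linear_maps H K_alg"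
  by (rule alg_hom_linear[OF counit_alg_hom])

lemma comult_linear: "comult H \<in> linear_maps H (tensor H H)"
  by (rule alg_hom_linear[OF comult_alg_hom])

lemma comult_closed [simp, intro]: "x \<in> carrier H \<Longrightarrow> comult H x \<in> carrier (tensor H H)"
  by (rule linear_maps_closed[OF comult_linear])

lemma antipode_lin: "antipode H \<in> linear_maps H H"
  using alg_hom_linear[OF antipode_alg_hom] by simp

lemma antipode_closed [simp, intro]: "x \<in> carrier H \<Longrightarrow> antipode H x \<in> carrier H"
  by (rule linear_maps_closed[OF antipode_lin])

lemma antipode_mult: "x \<in> carrier H \<Longrightarrow> y \<in> carrier H \<Longrightarrow> antipode H (x \<otimes> y) = antipode H y \<otimes> antipode H x"
  using alg_hom_mult[OF antipode_alg_hom, of x y] by simp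

lemma antipode_one: "antipode H \<one> = \<one>"
  using alg_hom_one[OF antipode_alg_hom] by simp

lemma counit_add: "x \<in> carrier H \<Longrightarrow> y \<in> carrier H \<Longrightarrow> counit H (x \<oplus> y) = counit H x + counit H y"
  and counit_smult: "x \<in> carrier H \<Longrightarrow> counit H (c \<odot> x) = c * counit H x"
  and counit_mult: "x \<in> carrier H \<Longrightarrow> y \<in> carrier H \<Longrightarrow> counit H (x \<otimes> y) = counit H x * counit H y"
  and counit_one: "counit H \<one> = 1"
  using linear_maps_add[OF counit_linear] linear_maps_smult[OF counit_linear] alg_hom_mult[OF counit_alg_hom]
    alg_hom_one[OF counit_alg_hom] by simp_all

lemma comult_one: "comult H \<one> = pure H H \<one> \<one>"
  using alg_hom_one[OF comult_alg_hom] by (simp add: HH.tensor_one)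

lemmas comult_add = linear_maps_add[OF comult_linear]
lemmas comult_smult = linear_maps_smult[OF comult_linear]
lemmas comult_mult = alg_hom_mult[OF comult_alg_hom]

lemma sweedler_linear: "kspace Z \<Longrightarrow> bilin H H Z f \<Longrightarrow> sweedler H Z f \<in> linear_maps H Z"
  unfolding sweedler_def by (rule linear_maps_comp[OF comult_linear]) (rule HH.tens_lift_linear)

lemma bilin_counit_left: "bilin H H H (\<lambda>a b. counit H a \<odot> b)"
  by (rule bilinI; rule linear_mapsI) (auto simp: counit_add counit_smult smult_add_left smult_add_right mult_ac)

lemma bilin_counit_right: "bilin H H H (\<lambda>a b. counit H b \<odot> a)"
  by (rule bilinI; rule linear_mapsI) (auto simp: counit_add counit_smult smult_add_left smult_add_right mult_ac)

lemma bilin_antipode_left: "bilin H H H (\<lambda>a b. antipode H a \<otimes> b)"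
  by (rule bilinI; rule linear_mapsI)
     (auto simp: linear_maps_add[OF antipode_lin] linear_maps_smult[OF antipode_lin] l_distr r_distr)

lemma bilin_antipode_right: "bilin H H H (\<lambda>a b. a \<otimes> antipode H b)"
  by (rule bilinI; rule linear_mapsI)
     (auto simp: linear_maps_add[OF antipode_lin] linear_maps_smult[OF antipode_lin] l_distr r_distr)

text \<open>The two sides of coassociativity. Triple tensors are bracketed to the right, therefore
  \<open>delta_left\<close> has to rebracket the coproduct of its left factor.\<close>

abbreviation "delta_right \<equiv> \<lambda>a b. pure H (tensor H H) a (comult H b)"

abbreviation "delta_left \<equiv> \<lambda>a b. sweedler H (tensor H (tensor H H))
   (\<lambda>a' a''. pure H (tensor H H) a' (pure H H a'' b)) a"

lemma bilin_delta_right: "bilin H H (tensor H (tensor H H)) delta_right"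
  by (rule bilinI; rule linear_mapsI)
     (auto simp: comult_add comult_smult H3.pure_add_left H3.pure_add_right H3.pure_smult_left H3.pure_smult_right)

lemma bilin_delta_left_aux: "b \<in> carrier H \<Longrightarrow> bilin H H (tensor H (tensor H H)) (\<lambda>a' a''. pure H (tensor H H) a' (pure H H a'' b))"
  by (rule bilinI; rule linear_mapsI)
     (auto simp: H3.pure_add_left H3.pure_add_right H3.pure_smult_left H3.pure_smult_right HH.pure_add_left HH.pure_smult_left)

lemma bilin_delta_left: "bilin H H (tensor H (tensor H H)) delta_left"
proof (rule bilinI)
  fix b assume b: "b \<in> carrier H"
  show "(\<lambda>a. delta_left a b) \<in> linear_maps H (tensor H (tensor H H))"
    by (rule sweedler_linear[OF H3.kspace_tensor bilin_delta_left_aux[OF b]])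
next
  fix a assume a: "a \<in> carrier H"
  let ?f = "\<lambda>S b. tens_lift (tensor H (tensor H H)) (\<lambda>a' a''. pure H (tensor H H) a' (pure H H a'' b)) S"
  note L = HH.tens_lift_linear[OF H3.kspace_tensor bilin_delta_left_aux]
  have "?f S \<in> linear_maps H (tensor H (tensor H H))" if "S \<in> carrier (tensor H H)" for S
    using that
  proof (induction rule: HH.tensor_induct)
    case zero
    have "?f \<zero>\<^bsub>tensor H H\<^esub> b = \<zero>\<^bsub>tensor H (tensor H H)\<^esub>" if "b \<in> carrier H" for b
      using linear_maps_zero[OF HH.kspace_tensor H3.kspace_tensor L[OF that]] .
    then show ?case by (intro linear_mapsI) auto
  next
    case (add S x y)
    note l = linear_maps_closed[OF add(4)] linear_maps_add[OF add(4)] linear_maps_smult[OF add(4)]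
    show ?case
      by (rule linear_mapsI)
         (use add in \<open>simp_all add: linear_maps_add[OF L] l HH.tens_lift_pure[OF H3.kspace_tensor bilin_delta_left_aux]
           HH.pure_add_right HH.pure_smult_right H3.pure_add_right H3.pure_smult_right H3.T.a_ac H3.T.smult_add_right\<close>)
  qed
  then show "delta_left a \<in> linear_maps H (tensor H (tensor H H))"
    unfolding sweedler_def using a by simp
qed

lemma delta_left_mult:
  assumes "a \<in> carrier H" "b \<in> carrier H" "a' \<in> carrier H" "b' \<in> carrier H"
  shows "delta_left (a \<otimes> a') (b \<otimes> b') = delta_left a b \<otimes>\<^bsub>tensor H (tensor H H)\<^esub> delta_left a' b'"
  unfolding sweedler_def using assms
  by (simp add: comult_mult)
     (rule HH.tens_lift_mult[OF H3.kalg_tensor], auto intro!: bilin_delta_left_aux simp: H3.pure_mult HH.pure_mult)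

lemma delta_left_pure:
  assumes "a \<in> carrier H" "b \<in> carrier H" "comult H a = pure H H x y" "x \<in> carrier H" "y \<in> carrier H"
  shows "delta_left a b = pure H (tensor H H) x (pure H H y b)"
  unfolding sweedler_def using assms by (simp add: HH.tens_lift_pure[OF H3.kspace_tensor bilin_delta_left_aux])

text \<open>Both sides are algebra homomorphisms.\<close>

lemma coassoc_from_generators:
  assumes "\<And>x. x \<in> G \<Longrightarrow> sweedler H (tensor H (tensor H H)) delta_right x = sweedler H (tensor H (tensor H H)) delta_left x"
    and "x \<in> carrier H"
  shows "sweedler H (tensor H (tensor H H)) delta_right x = sweedler H (tensor H (tensor H H)) delta_left x"
proof -
  let ?Z = "tensor H (tensor H H)"
  have "tens_lift ?Z delta_right \<in> alg_hom (tensor H H) ?Z"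
    by (rule HH.tens_lift_alg_hom[OF H3.kalg_tensor bilin_delta_right])
       (auto simp: comult_mult H3.pure_mult HH.tensor_one H3.tensor_one comult_one)
  then have "sweedler H ?Z delta_right \<in> alg_hom H ?Z"
    unfolding sweedler_def by (rule alg_hom_comp[OF comult_alg_hom])
  moreover have "tens_lift ?Z delta_left \<in> alg_hom (tensor H H) ?Z"
    by (rule HH.tens_lift_alg_hom[OF H3.kalg_tensor bilin_delta_left])
       (auto simp: delta_left_mult delta_left_pure comult_one HH.tensor_one H3.tensor_one)
  then have "sweedler H ?Z delta_left \<in> alg_hom H ?Z"
    unfolding sweedler_def by (rule alg_hom_comp[OF comult_alg_hom])
  ultimately show ?thesis
    by (rule alg_hom_eq_on_generators[OF G_generates _ _ _ assms(2)]) (rule assms(1))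
qed

lemma counit_left_from_generators:
  assumes "\<And>x. x \<in> G \<Longrightarrow> sweedler H H (\<lambda>a b. counit H a \<odot> b) x = x" and "x \<in> carrier H"
  shows "sweedler H H (\<lambda>a b. counit H a \<odot> b) x = x"
proof -
  have "tens_lift H (\<lambda>a b. counit H a \<odot> b) \<in> alg_hom (tensor H H) H"
    by (rule HH.tens_lift_alg_hom[OF kalg_H bilin_counit_left])
       (auto simp: counit_mult counit_one mult_ac)
  then have "sweedler H H (\<lambda>a b. counit H a \<odot> b) \<in> alg_hom H H"
    unfolding sweedler_def by (rule alg_hom_comp[OF comult_alg_hom])
  then show ?thesis
    by (rule alg_hom_eq_on_generators[OF G_generates _ alg_hom_id _ assms(2)]) (rule assms(1))
qed

lemma counit_right_from_generators:
  assumes "\<And>x. x \<in> G \<Longrightarrow> sweedler H H (\<lambda>a b. counit H b \<odot> a) x = x" and "x \<in> carrier H"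
  shows "sweedler H H (\<lambda>a b. counit H b \<odot> a) x = x"
proof -
  have "tens_lift H (\<lambda>a b. counit H b \<odot> a) \<in> alg_hom (tensor H H) H"
    by (rule HH.tens_lift_alg_hom[OF kalg_H bilin_counit_right])
       (auto simp: counit_mult counit_one mult_ac)
  then have "sweedler H H (\<lambda>a b. counit H b \<odot> a) \<in> alg_hom H H"
    unfolding sweedler_def by (rule alg_hom_comp[OF comult_alg_hom])
  then show ?thesis
    by (rule alg_hom_eq_on_generators[OF G_generates _ alg_hom_id _ assms(2)]) (rule assms(1))
qed

text \<open>The convolution of the antipode with the identity is not multiplicative, but by
  \<open>S((a b)\<^sub>1) (a b)\<^sub>2 = S(b\<^sub>1) (S(a\<^sub>1) a\<^sub>2) b\<^sub>2\<close> the elements that satisfy the axiom are closed under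
  products.\<close>

lemma antipode_left_from_generators:
  assumes "\<And>x. x \<in> G \<Longrightarrow> sweedler H H (\<lambda>a b. antipode H a \<otimes> b) x = counit H x \<odot> \<one>" and "x \<in> carrier H"
  shows "sweedler H H (\<lambda>a b. antipode H a \<otimes> b) x = counit H x \<odot> \<one>"
proof -
  let ?m = "tens_lift H (\<lambda>a b. antipode H a \<otimes> b)"
  note L = HH.tens_lift_linear[OF kspace_H bilin_antipode_left]
  note p = HH.tens_lift_pure[OF kspace_H bilin_antipode_left]
  have 1: "?m (S \<otimes>\<^bsub>tensor H H\<^esub> pure H H x y) = antipode H x \<otimes> ?m S \<otimes> y"
    if "S \<in> carrier (tensor H H)" "x \<in> carrier H" "y \<in> carrier H" for S x y
  proof (rule HH.tensor_linear_eq[OF kspace_H, of "\<lambda>S. ?m (S \<otimes>\<^bsub>tensor H H\<^esub> pure H H x y)" "\<lambda>S. antipode H x \<otimes> ?m S \<otimes> y"])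
    show "(\<lambda>S. ?m (S \<otimes>\<^bsub>tensor H H\<^esub> pure H H x y)) \<in> linear_maps (tensor H H) H"
      using that by (intro linear_maps_comp[OF _ L] HH.T.linear_mult_right linear_maps_id) auto
    show "(\<lambda>S. antipode H x \<otimes> ?m S \<otimes> y) \<in> linear_maps (tensor H H) H"
      using that by (intro linear_mult_right linear_mult_left L) auto
  qed (use that in \<open>auto simp: HH.pure_mult p antipode_mult m_assoc\<close>)
  have 2: "?m (comult H a \<otimes>\<^bsub>tensor H H\<^esub> S) = counit H a \<odot> ?m S"
    if a: "a \<in> carrier H" "?m (comult H a) = counit H a \<odot> \<one>" and S: "S \<in> carrier (tensor H H)" for a S
    by (rule HH.tensor_linear_eq[OF kspace_H, of "\<lambda>S. ?m (comult H a \<otimes>\<^bsub>tensor H H\<^esub> S)" "\<lambda>S. counit H a \<odot> ?m S"])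
       (use a S in \<open>auto intro!: linear_maps_comp[OF _ L] HH.T.linear_mult_left linear_maps_id linear_maps_smult_left kspace_H L simp: 1 p\<close>)
  show ?thesis using G_generates assms(2)
  proof (induction rule: generates_induct)
    case one
    then show ?case by (simp add: sweedler_def comult_one p antipode_one counit_one)
  next
    case (mult x y)
    then show ?case by (simp add: sweedler_def comult_mult 2 counit_mult)
  qed (simp_all add: assms(1), simp_all add: sweedler_def comult_add comult_smult linear_maps_add[OF L] linear_maps_smult[OF L]
      counit_add counit_smult smult_add_left)
qed

lemma antipode_right_from_generators:
  assumes "\<And>x. x \<in> G \<Longrightarrow> sweedler H H (\<lambda>a b. a \<otimes> antipode H b) x = counit H x \<odot> \<one>" and "x \<in> carrier H"
  shows "sweedler H H (\<lambda>a b. a \<otimes> antipode H b) x = counit H x \<odot> \<one>"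
proof -
  let ?m = "tens_lift H (\<lambda>a b. a \<otimes> antipode H b)"
  note L = HH.tens_lift_linear[OF kspace_H bilin_antipode_right]
  note p = HH.tens_lift_pure[OF kspace_H bilin_antipode_right]
  have 1: "?m (pure H H x y \<otimes>\<^bsub>tensor H H\<^esub> S) = x \<otimes> ?m S \<otimes> antipode H y"
    if "S \<in> carrier (tensor H H)" "x \<in> carrier H" "y \<in> carrier H" for S x y
  proof (rule HH.tensor_linear_eq[OF kspace_H, of "\<lambda>S. ?m (pure H H x y \<otimes>\<^bsub>tensor H H\<^esub> S)" "\<lambda>S. x \<otimes> ?m S \<otimes> antipode H y"])
    show "(\<lambda>S. ?m (pure H H x y \<otimes>\<^bsub>tensor H H\<^esub> S)) \<in> linear_maps (tensor H H) H"
      using that by (intro linear_maps_comp[OF _ L] HH.T.linear_mult_left linear_maps_id) auto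
    show "(\<lambda>S. x \<otimes> ?m S \<otimes> antipode H y) \<in> linear_maps (tensor H H) H"
      using that by (intro linear_mult_right linear_mult_left L) auto
  qed (use that in \<open>auto simp: HH.pure_mult p antipode_mult m_assoc\<close>)
  have 2: "?m (S \<otimes>\<^bsub>tensor H H\<^esub> comult H b) = counit H b \<odot> ?m S"
    if b: "b \<in> carrier H" "?m (comult H b) = counit H b \<odot> \<one>" and S: "S \<in> carrier (tensor H H)" for b S
    by (rule HH.tensor_linear_eq[OF kspace_H, of "\<lambda>S. ?m (S \<otimes>\<^bsub>tensor H H\<^esub> comult H b)" "\<lambda>S. counit H b \<odot> ?m S"])
       (use b S in \<open>auto intro!: linear_maps_comp[OF _ L] HH.T.linear_mult_right linear_maps_id linear_maps_smult_left kspace_H L simp: 1 p\<close>)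
  show ?thesis using G_generates assms(2)
  proof (induction rule: generates_induct)
    case one
    then show ?case by (simp add: sweedler_def comult_one p antipode_one counit_one)
  next
    case (mult x y)
    then show ?case by (simp add: sweedler_def comult_mult 2 counit_mult mult.commute)
  qed (simp_all add: assms(1), simp_all add: sweedler_def comult_add comult_smult linear_maps_add[OF L] linear_maps_smult[OF L]
      counit_add counit_smult smult_add_left)
qed

text \<open>The generators of quantum groups are group-like or skew-primitive. The antipode is included in
  these notions, since it is prescribed and not determined in what follows.\<close>

definition group_like where "group_like w w' \<longleftrightarrow> w \<in> carrier H \<and> w' \<in> carrier H
   \<and> comult H w = pure H H w w \<and> counit H w = 1 \<and> antipode H w = w' \<and> w \<otimes> w' = \<one> \<and> w' \<otimes> w = \<one>"

definition skew_left where "skew_left x w \<longleftrightarrow> x \<in> carrier H \<and> (\<exists>w'. group_like w w' \<and>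
   comult H x = pure H H x \<one> \<oplus>\<^bsub>tensor H H\<^esub> pure H H w x \<and> counit H x = 0 \<and> antipode H x = (- 1) \<odot> (w' \<otimes> x))"

definition skew_right where "skew_right x w \<longleftrightarrow> x \<in> carrier H \<and> (\<exists>w'. group_like w w' \<and>
   comult H x = pure H H \<one> x \<oplus>\<^bsub>tensor H H\<^esub> pure H H x w \<and> counit H x = 0 \<and> antipode H x = (- 1) \<odot> (x \<otimes> w'))"

lemma hopf_from_skew_primitives:
  assumes "\<And>x. x \<in> G \<Longrightarrow> (\<exists>w'. group_like x w') \<or> (\<exists>w. skew_left x w) \<or> (\<exists>w. skew_right x w)"
  shows "hopf_algebra H"
proof -
  let ?Z = "tensor H (tensor H H)"
  note bl = bilin_counit_left bilin_counit_right bilin_antipode_left bilin_antipode_right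
  note p = bl[THEN HH.tens_lift_pure[OF kspace_H]] HH.tens_lift_pure[OF H3.kspace_tensor bilin_delta_right]
    HH.tens_lift_pure[OF H3.kspace_tensor bilin_delta_left] HH.tens_lift_pure[OF H3.kspace_tensor bilin_delta_left_aux]
  note a = bl[THEN linear_maps_add[OF HH.tens_lift_linear[OF kspace_H]]]
    linear_maps_add[OF HH.tens_lift_linear[OF H3.kspace_tensor bilin_delta_right]]
    linear_maps_add[OF HH.tens_lift_linear[OF H3.kspace_tensor bilin_delta_left]]
    linear_maps_add[OF HH.tens_lift_linear[OF H3.kspace_tensor bilin_delta_left_aux]]
  have neg: "y \<oplus> (- 1) \<odot> y = \<zero>" "(- 1) \<odot> y \<oplus> y = \<zero>" if "y \<in> carrier H" for y
    using that by (simp_all add: smult_minus_one r_neg l_neg)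
  have gens: "sweedler H ?Z delta_right x = sweedler H ?Z delta_left x \<and>
     sweedler H H (\<lambda>a b. counit H a \<odot> b) x = x \<and> sweedler H H (\<lambda>a b. counit H b \<odot> a) x = x \<and>
     sweedler H H (\<lambda>a b. antipode H a \<otimes> b) x = counit H x \<odot> \<one> \<and>
     sweedler H H (\<lambda>a b. a \<otimes> antipode H b) x = counit H x \<odot> \<one>" if x: "x \<in> G" for x
  proof -
    consider w' where "group_like x w'" | w where "skew_left x w" | w where "skew_right x w"
      using assms[OF x] by blast
    then show ?thesis
    proof cases
      case 1
      then show ?thesis by (simp add: group_like_def sweedler_def p[unfolded sweedler_def])
    next
      case 2
      then obtain w' where c: "x \<in> carrier H" "w \<in> carrier H" "w' \<in> carrier H" "comult H w = pure H H w w" "counit H w = 1"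
         "antipode H w = w'" "w \<otimes> w' = \<one>" "w' \<otimes> w = \<one>"
        and d: "comult H x = pure H H x \<one> \<oplus>\<^bsub>tensor H H\<^esub> pure H H w x" "counit H x = 0" "antipode H x = (- 1) \<odot> (w' \<otimes> x)"
        by (auto simp: skew_left_def group_like_def)
      have "w \<otimes> (w' \<otimes> x) = x" using c by (simp add: m_assoc[symmetric])
      then show ?thesis using c d
        by (simp add: sweedler_def p[unfolded sweedler_def] a[unfolded sweedler_def] comult_one counit_one antipode_one neg H3.pure_add_right H3.T.a_ac)
    next
      case 3
      then obtain w' where c: "x \<in> carrier H" "w \<in> carrier H" "w' \<in> carrier H" "comult H w = pure H H w w" "counit H w = 1"
         "antipode H w = w'" "w \<otimes> w' = \<one>" "w' \<otimes> w = \<one>"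
        and d: "comult H x = pure H H \<one> x \<oplus>\<^bsub>tensor H H\<^esub> pure H H x w" "counit H x = 0" "antipode H x = (- 1) \<odot> (x \<otimes> w')"
        by (auto simp: skew_right_def group_like_def)
      have "x \<otimes> w' \<otimes> w = x" using c by (simp add: m_assoc)
      then show ?thesis using c d
        by (simp add: sweedler_def p[unfolded sweedler_def] a[unfolded sweedler_def] comult_one counit_one antipode_one neg H3.pure_add_right H3.T.a_ac)
    qed
  qed
  show ?thesis
  proof (rule hopf_algebra.intro)
    show "ring H" by (rule ring_axioms)
    show "Module.module K_ring H" by (rule is_mod)
    show "comult H \<in> alg_hom H (tensor H H)" "counit H \<in> alg_hom H K_alg" "antipode H \<in> linear_maps H H"
      by (rule comult_alg_hom counit_alg_hom antipode_lin)+
    fix x assume x: "x \<in> carrier H"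
    show "sweedler H ?Z delta_right x = sweedler H ?Z delta_left x"
      by (rule coassoc_from_generators[OF _ x]) (use gens in blast)
    show "sweedler H H (\<lambda>a b. counit H a \<odot> b) x = x"
      by (rule counit_left_from_generators[OF _ x]) (use gens in blast)
    show "sweedler H H (\<lambda>a b. counit H b \<odot> a) x = x"
      by (rule counit_right_from_generators[OF _ x]) (use gens in blast)
    show "sweedler H H (\<lambda>a b. antipode H a \<otimes> b) x = counit H x \<odot> \<one>"
      by (rule antipode_left_from_generators[OF _ x]) (use gens in blast)
    show "sweedler H H (\<lambda>a b. a \<otimes> antipode H b) x = counit H x \<odot> \<one>"
      by (rule antipode_right_from_generators[OF _ x]) (use gens in blast)
  qed simp_all
qed

end

section \<open>The quantum group is a Hopf algebra\<close>

context qdata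
begin

abbreviation "H \<equiv> quantum_group A d r s"
abbreviation "gg \<equiv> \<lambda>x. cl (gvar x)"
abbreviation "clw ws \<equiv> cl (word_monom ws)"

lemma H_fields [simp]:
  "carrier H = carrier U" "monoid.mult H = monoid.mult U" "one H = one U" "ring.zero H = ring.zero U"
  "add H = add U" "module.smult H = module.smult U"
  by (simp_all add: quantum_group_def module.extend_def hopf.fields_def)

lemma H_structure:
  "comult H S = free_eval (tensor U U) (comult_gen A d r s) (rep S)"
  "counit H S = free_eval K_alg counit_gen (rep S)"
  "antipode H S = free_eval (opposite U) (\<lambda>g. cl (antipode_gen g)) (rep S)"
  by (simp_all add: quantum_group_def module.extend_def hopf.fields_def)

lemma tensor_H: "tensor H H = tensor U U"
  by (simp add: tensor_def pure_def tens_class_def tens_rel_def fun_eq_iff)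

lemma pure_H: "pure H H = pure U U"
  by (simp add: pure_def tens_class_def tens_rel_def fun_eq_iff)

lemma alg_hom_H [simp]: "alg_hom H B = alg_hom U B" "alg_hom B H = alg_hom B U"
  by (auto simp: alg_hom_def linear_maps_def ring_hom_def)

lemma alg_hom_opposite_H: "alg_hom B (opposite H) = alg_hom B (opposite U)"
  by (auto simp: alg_hom_def linear_maps_def ring_hom_def)

lemma kalg_H: "kalg H"
  by (rule kalgI; (rule kspaceI)?; (rule abelian_groupI)?)
     (auto simp: U.smult_add_left U.smult_add_right U.l_distr U.r_distr U.a_ac U.m_assoc
       intro!: bilinI linear_mapsI intro: bexI[of _ "\<ominus>\<^bsub>U\<^esub> x" for x] U.l_neg)

lemma comult_gen_dgen: "comult_gen A d r s = dgen U gg"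
proof
  fix x show "comult_gen A d r s x = dgen U gg x"
    by (cases x) (simp_all add: cl_ops Let_def)
qed

lemma antipode_gen_sgen: "(\<lambda>g. cl (antipode_gen g)) = sgen U gg"
proof
  interpret pm: Modules.module "pm_scale :: 'k \<Rightarrow> ('i, 'k) free_alg \<Rightarrow> _" by (rule module_pm_scale)
  fix x show "cl (antipode_gen x) = sgen U gg x"
    by (cases x) (simp_all add: cl_ops)
qed

lemma qrep_comult: "qrep A d r s (tensor U U) (comult_gen A d r s)"
  unfolding comult_gen_dgen by (rule qrep.qrep_tensor[OF qrep_U])

lemma qrep_antipode: "qrep A d r s (opposite U) (\<lambda>g. cl (antipode_gen g))"
  unfolding antipode_gen_sgen by (rule qrep.qrep_opposite[OF qrep_U])

lemma qrep_counit: "qrep A d r s K_alg counit_gen"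
proof (rule qrep_torus_only[OF qdata_axioms kalg_K_alg])
  fix t t' :: "'i generator" assume "torus t"
  then show "counit_gen t \<otimes>\<^bsub>K_alg\<^esub> counit_gen (tinv t) = \<one>\<^bsub>K_alg\<^esub>" by (cases t) auto
qed auto

lemma comult_cl: "comult H (cl p) = free_eval (tensor U U) (comult_gen A d r s) p"
  by (simp add: H_structure qrep.free_eval_rep[OF qrep_comult])

lemma counit_cl: "counit H (cl p) = free_eval K_alg counit_gen p"
  by (simp add: H_structure qrep.free_eval_rep[OF qrep_counit])

lemma antipode_cl: "antipode H (cl p) = free_eval (opposite U) (\<lambda>g. cl (antipode_gen g)) p"
  by (simp add: H_structure qrep.free_eval_rep[OF qrep_antipode])

lemma structure_gen:
  "comult H (gg x) = dgen U gg x" "counit H (gg x) = counit_gen x" "antipode H (gg x) = sgen U gg x"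
proof -
  interpret c: qrep A d r s "tensor U U" "comult_gen A d r s" by (rule qrep_comult)
  interpret e: qrep A d r s K_alg counit_gen by (rule qrep_counit)
  interpret a: qrep A d r s "opposite U" "\<lambda>g. cl (antipode_gen g)" by (rule qrep_antipode)
  show "comult H (gg x) = dgen U gg x" by (simp only: comult_cl c.free_eval_gvar) (simp add: comult_gen_dgen)
  show "counit H (gg x) = counit_gen x" by (simp add: counit_cl e.free_eval_gvar)
  show "antipode H (gg x) = sgen U gg x"
    using fun_cong[OF antipode_gen_sgen, of x] by (simp add: antipode_cl a.free_eval_gvar)
qed

lemma clw_simps: "clw [] = \<one>\<^bsub>U\<^esub>" "clw (x # ws) = gg x \<otimes>\<^bsub>U\<^esub> clw ws" "clw (us @ vs) = clw us \<otimes>\<^bsub>U\<^esub> clw vs"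
  by (simp_all add: word_monom_Nil word_monom_Cons word_monom_append cl_ops)

lemma clw_singleton: "clw [x] = gg x"
  by (simp add: gvar_def)

lemma U_induct [consumes 1, case_names zero word add smult]:
  assumes "x \<in> carrier U" "P \<zero>\<^bsub>U\<^esub>" "\<And>ws. P (clw ws)"
    and "\<And>x y. x \<in> carrier U \<Longrightarrow> y \<in> carrier U \<Longrightarrow> P x \<Longrightarrow> P y \<Longrightarrow> P (x \<oplus>\<^bsub>U\<^esub> y)"
    and "\<And>c x. x \<in> carrier U \<Longrightarrow> P x \<Longrightarrow> P (c \<odot>\<^bsub>U\<^esub> x)"
  shows "P x"
proof -
  obtain p where x: "x = cl p" using assms(1) by (auto simp: cl_ops)
  have "P (cl p)" using subset_UNIV[of "Poly_Mapping.keys p"]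
  proof (induction rule: pm_induct)
    case zero then show ?case using assms(2) by (simp add: cl_ops)
  next
    case (add q k c)
    have "cl (q + Poly_Mapping.single k c) = cl q \<oplus>\<^bsub>U\<^esub> (c \<odot>\<^bsub>U\<^esub> clw (letters k))"
      by (simp add: cl_ops)
    then show ?case using add assms(3)[of "letters k"] assms(4,5) by auto
  qed
  then show ?thesis by (simp add: x)
qed

lemma U_linear_eq:
  assumes "kspace Z" "f \<in> linear_maps U Z" "f' \<in> linear_maps U Z" "\<And>ws. f (clw ws) = f' (clw ws)" "x \<in> carrier U"
  shows "f x = f' x"
proof -
  have U: "kspace U" ..
  show ?thesis using assms(5)
    by (induction rule: U_induct)
       (simp_all add: assms(4) linear_maps_zero[OF U assms(1)] assms(2,3) linear_maps_add[OF assms(2)] linear_maps_add[OF assms(3)]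
         linear_maps_smult[OF assms(2)] linear_maps_smult[OF assms(3)])
qed

lemma generates_U: "generates H (range gg)"
  unfolding generates_def
proof (intro allI impI subsetI)
  fix S x assume S: "range gg \<subseteq> S" "\<one>\<^bsub>H\<^esub> \<in> S" "\<forall>x\<in>S \<inter> carrier H. \<forall>y\<in>S \<inter> carrier H. x \<oplus>\<^bsub>H\<^esub> y \<in> S \<and> x \<otimes>\<^bsub>H\<^esub> y \<in> S"
    "\<forall>c. \<forall>x\<in>S \<inter> carrier H. c \<odot>\<^bsub>H\<^esub> x \<in> S"
  assume "x \<in> carrier H"
  then have "x \<in> carrier U" by simp
  then show "x \<in> S"
  proof (induction rule: U_induct)
    case zero
    have "0 \<odot>\<^bsub>H\<^esub> \<one>\<^bsub>H\<^esub> \<in> S" by (rule S(4)[rule_format]) (use S(2) in simp)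
    then show ?case by simp
  next
    case (word ws)
    then show ?case
    proof (induction ws)
      case (Cons x ws)
      then show ?case using S(1,3) by (auto simp: clw_simps(2))
    qed (use S(2) in \<open>simp add: clw_simps\<close>)
  qed (use S(3,4) in simp_all)
qed

lemma prehopf_H: "prehopf H (range gg)"
proof (intro prehopf.intro kalg_H prehopf_axioms.intro generates_U)
  have "comult H \<in> alg_hom U (tensor U U)"
    using qrep.induced_alg_hom[OF qrep_comult] by (simp add: alg_hom_def linear_maps_def ring_hom_def Pi_iff H_structure)
  then show "comult H \<in> alg_hom H (tensor H H)" by (simp add: tensor_H)
  show "counit H \<in> alg_hom H K_alg"
    using qrep.induced_alg_hom[OF qrep_counit] by (simp add: alg_hom_def linear_maps_def ring_hom_def Pi_iff H_structure)
  show "antipode H \<in> alg_hom H (opposite H)"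
    unfolding alg_hom_opposite_H
    using qrep.induced_alg_hom[OF qrep_antipode] by (simp add: alg_hom_def linear_maps_def ring_hom_def Pi_iff H_structure)
qed auto

sublocale H: prehopf H "range gg" by (rule prehopf_H)

lemma antipode_closed_U [simp, intro]: "x \<in> carrier U \<Longrightarrow> antipode H x \<in> carrier U"
  using H.antipode_closed by simp

interpretation q: qrep A d r s U gg by (rule qrep_U)

lemma hopf_algebra_H: "hopf_algebra H"
proof (rule H.hopf_from_skew_primitives)
  have gl: "H.group_like (gg t) (gg (tinv t))" if "torus t" for t
    using that q.rel_inv[of t] q.rel_inv'[of t]
    by (cases t) (auto simp: H.group_like_def structure_gen pure_H)
  fix x assume "x \<in> range gg"
  then obtain y where x: "x = gg y" by auto
  have t: "\<exists>w'. H.group_like x w'" if "torus y" using gl[OF that] x by blast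
  show "(\<exists>w'. H.group_like x w') \<or> (\<exists>w. H.skew_left x w) \<or> (\<exists>w. H.skew_right x w)"
  proof (cases y)
    case (Ge i)
    have "H.skew_left x (gg (Gw i))" unfolding H.skew_left_def x Ge
      using gl[of "Gw i"] by (auto simp: structure_gen pure_H tensor_H)
    then show ?thesis by blast
  next
    case (Gf i)
    have "H.skew_right x (gg (Gw' i))" unfolding H.skew_right_def x Gf
      using gl[of "Gw' i"] by (auto simp: structure_gen pure_H tensor_H)
    then show ?thesis by blast
  qed (use t in simp_all)
qed

end

section \<open>The bigrading\<close>

abbreviation sroot :: "'i \<Rightarrow> 'i \<Rightarrow>\<^sub>0 int" where "sroot i \<equiv> Poly_Mapping.single i 1"

text \<open>The left and right degree of the generators in the grading by two copies of the root lattice.\<close>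

primrec lgen :: "'i generator \<Rightarrow> 'i \<Rightarrow>\<^sub>0 int" where
  "lgen (Ge i) = sroot i" | "lgen (Gf i) = 0" | "lgen (Gw i) = sroot i" | "lgen (Gw_inv i) = - sroot i"
| "lgen (Gw' i) = sroot i" | "lgen (Gw'_inv i) = - sroot i"

primrec rgen :: "'i generator \<Rightarrow> 'i \<Rightarrow>\<^sub>0 int" where
  "rgen (Ge i) = 0" | "rgen (Gf i) = sroot i" | "rgen (Gw i) = sroot i" | "rgen (Gw_inv i) = - sroot i"
| "rgen (Gw' i) = sroot i" | "rgen (Gw'_inv i) = - sroot i"

primrec ldeg :: "'i generator list \<Rightarrow> 'i \<Rightarrow>\<^sub>0 int" where
  "ldeg [] = 0" | "ldeg (x # ws) = lgen x + ldeg ws"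

primrec rdeg :: "'i generator list \<Rightarrow> 'i \<Rightarrow>\<^sub>0 int" where
  "rdeg [] = 0" | "rdeg (x # ws) = rgen x + rdeg ws"

lemma ldeg_append [simp]: "ldeg (us @ vs) = ldeg us + ldeg vs" and rdeg_append [simp]: "rdeg (us @ vs) = rdeg us + rdeg vs"
  by (induction us) (simp_all add: add.assoc)

lemma rgen_eq_lgen: "counit_gen x \<noteq> (0 :: 'k::field) \<Longrightarrow> rgen x = lgen x"
  by (cases x) auto

context qdata
begin

inductive homog :: "('i \<Rightarrow>\<^sub>0 int) \<Rightarrow> ('i \<Rightarrow>\<^sub>0 int) \<Rightarrow> ('i, 'k) free_alg set \<Rightarrow> bool" for l r' where
  zero: "homog l r' \<zero>\<^bsub>U\<^esub>"
| word: "ldeg ws = l \<Longrightarrow> rdeg ws = r' \<Longrightarrow> homog l r' (clw ws)"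
| add: "homog l r' x \<Longrightarrow> homog l r' y \<Longrightarrow> homog l r' (x \<oplus>\<^bsub>U\<^esub> y)"
| smult: "homog l r' x \<Longrightarrow> homog l r' (c \<odot>\<^bsub>U\<^esub> x)"

lemma homog_closed: "homog l r' x \<Longrightarrow> x \<in> carrier U"
  by (induction rule: homog.induct) auto

lemma homog_gen: "homog (lgen x) (rgen x) (gg x)"
  using homog.word[of "[x]"] by (simp add: clw_singleton)

lemma homog_one: "homog 0 0 \<one>\<^bsub>U\<^esub>"
  using homog.word[of "[]"] by (simp add: clw_simps)

lemma homog_mult:
  assumes "homog l r' x" "homog l2 r2 y" shows "homog (l + l2) (r' + r2) (x \<otimes>\<^bsub>U\<^esub> y)"
  using assms(1)
proof (induction rule: homog.induct)
  case (word ws)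
  show ?case using assms(2)
  proof (induction rule: homog.induct)
    case (word vs)
    then show ?case using homog.word[of "ws @ vs"] \<open>ldeg ws = l\<close> \<open>rdeg ws = r'\<close> by (simp add: clw_simps)
  qed (auto simp: U.r_distr homog_closed intro: homog.intros)
qed (use homog_closed[OF assms(2)] in \<open>auto simp: U.l_distr homog_closed intro: homog.intros\<close>)

text \<open>The tensors of left degree \<open>l\<close> and right degree \<open>r'\<close> for which the two inner degrees agree.\<close>

inductive balanced :: "('i \<Rightarrow>\<^sub>0 int) \<Rightarrow> ('i \<Rightarrow>\<^sub>0 int) \<Rightarrow> (('i, 'k) free_alg set \<times> ('i, 'k) free_alg set \<Rightarrow>\<^sub>0 'k) set \<Rightarrow> bool" for l r' where
  zero: "balanced l r' \<zero>\<^bsub>tensor H H\<^esub>"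
| word: "ldeg us = l \<Longrightarrow> rdeg us = ldeg vs \<Longrightarrow> rdeg vs = r' \<Longrightarrow> balanced l r' (pure H H (clw us) (clw vs))"
| add: "balanced l r' S \<Longrightarrow> balanced l r' T \<Longrightarrow> balanced l r' (S \<oplus>\<^bsub>tensor H H\<^esub> T)"
| smult: "balanced l r' S \<Longrightarrow> balanced l r' (c \<odot>\<^bsub>tensor H H\<^esub> S)"

lemma balanced_closed: "balanced l r' S \<Longrightarrow> S \<in> carrier (tensor H H)"
  by (induction rule: balanced.induct) auto

lemma balanced_mult:
  assumes "balanced l r' S" "balanced l2 r2 T" shows "balanced (l + l2) (r' + r2) (S \<otimes>\<^bsub>tensor H H\<^esub> T)"
  using assms(1)
proof (induction rule: balanced.induct)
  case (word us vs)
  show ?case using assms(2)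
  proof (induction rule: balanced.induct)
    case (word us' vs')
    then show ?case using balanced.word[of "us @ us'" "l + l2" "vs @ vs'" "r' + r2"] \<open>ldeg us = l\<close> \<open>rdeg us = ldeg vs\<close> \<open>rdeg vs = r'\<close>
      by (simp add: clw_simps H.HH.pure_mult)
  qed (auto simp: H.HH.T.r_distr balanced_closed intro: balanced.intros)
qed (use balanced_closed[OF assms(2)] in \<open>auto simp: H.HH.T.l_distr balanced_closed intro: balanced.intros\<close>)

text \<open>This is what the degrees of the generators were chosen for: the coproduct of each generator is
  balanced, and balanced tensors multiply.\<close>

lemma balanced_comult: "balanced (ldeg ws) (rdeg ws) (comult H (clw ws))"
proof (induction ws)
  case Nil
  show ?case using balanced.word[of "[]" 0 "[]" 0] by (simp add: clw_simps H.comult_one[simplified])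
next
  case (Cons x ws)
  have c: "[y] = [] @ [y]" for y :: "'i generator" by simp
  have "balanced (lgen x) (rgen x) (comult H (gg x))"
  proof (cases x)
    case (Ge i)
    show ?thesis unfolding structure_gen Ge
      using balanced.add[OF balanced.word[of "[Ge i]" "sroot i" "[]" 0] balanced.word[of "[Gw i]" "sroot i" "[Ge i]" 0]]
      by (simp add: clw_singleton clw_simps(1) pure_H tensor_H)
  next
    case (Gf i)
    show ?thesis unfolding structure_gen Gf
      using balanced.add[OF balanced.word[of "[]" 0 "[Gf i]" "sroot i"] balanced.word[of "[Gf i]" 0 "[Gw' i]" "sroot i"]]
      by (simp add: clw_singleton clw_simps(1) pure_H tensor_H)
  qed (use balanced.word[of "[x]" "lgen x" "[x]" "rgen x"] in \<open>simp_all add: structure_gen clw_singleton pure_H\<close>)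
  then show ?case
    using balanced_mult[OF _ Cons] H.comult_mult[of "gg x" "clw ws"] by (simp add: clw_simps(2))
qed

text \<open>The generators of the Hopf algebra map onto the group algebra of the root lattice: the counit is
  zero on \<open>e\<^sub>i\<close> and \<open>f\<^sub>i\<close> and one on the torus, where \<open>\<omega>\<^sub>i\<close> and \<open>\<omega>'\<^sub>i\<close> become equal.\<close>

definition pgen :: "'i generator \<Rightarrow> (('i \<Rightarrow>\<^sub>0 int) \<Rightarrow>\<^sub>0 'k)" where
  "pgen x = Poly_Mapping.single (lgen x) (counit_gen x)"

definition proj :: "('i, 'k) free_alg set \<Rightarrow> (('i \<Rightarrow>\<^sub>0 int) \<Rightarrow>\<^sub>0 'k)" where
  "proj S = free_eval mon_alg pgen (rep S)"

lemma qrep_proj: "qrep A d r s mon_alg pgen"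
proof (rule qrep_torus_only[OF qdata_axioms kalg_mon_alg])
  fix t t' :: "'i generator" assume "torus t"
  then show "pgen t \<otimes>\<^bsub>mon_alg\<^esub> pgen (tinv t) = \<one>\<^bsub>mon_alg\<^esub>" by (cases t) (auto simp: pgen_def mult_single)
qed (auto simp: pgen_def mult.commute)

lemma proj_alg_hom: "proj \<in> alg_hom U mon_alg"
  using qrep.induced_alg_hom[OF qrep_proj] by (simp add: proj_def[abs_def])

lemma proj_linear: "proj \<in> linear_maps U mon_alg"
  by (rule alg_hom_linear[OF proj_alg_hom])

lemma proj_gen: "proj (gg x) = pgen x"
proof -
  interpret p: qrep A d r s mon_alg pgen by (rule qrep_proj)
  show ?thesis by (simp add: proj_def p.free_eval_rep p.free_eval_gvar)
qed

lemma counit_clw_Cons: "counit H (clw (x # ws)) = counit_gen x * counit H (clw ws)"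
  using H.counit_mult[of "gg x" "clw ws"] by (simp add: clw_simps(2) structure_gen)

lemma proj_clw: "proj (clw ws) = Poly_Mapping.single (ldeg ws) (counit H (clw ws))"
proof (induction ws)
  case Nil
  show ?case using alg_hom_one[OF proj_alg_hom] H.counit_one by (simp add: clw_simps(1))
next
  case (Cons x ws)
  then show ?case using alg_hom_mult[OF proj_alg_hom, of "gg x" "clw ws"] counit_clw_Cons[of x ws]
    by (simp add: clw_simps(2) proj_gen pgen_def mult_single)
qed

lemma rdeg_eq_ldeg: "counit H (clw ws) \<noteq> 0 \<Longrightarrow> rdeg ws = ldeg ws"
proof (induction ws)
  case (Cons x ws)
  then show ?case using counit_clw_Cons[of x ws] rgen_eq_lgen[of x, where 'k = 'k] by auto
qed simp

text \<open>The counit is nonzero only on words of torus generators, and for those the two degrees agree.\<close>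

lemma proj_homog:
  assumes "homog l r' x"
  shows "proj x = Poly_Mapping.single l (counit H x)" "proj x = Poly_Mapping.single r' (counit H x)"
proof -
  have *: "Poly_Mapping.single l a + Poly_Mapping.single l b = Poly_Mapping.single l (a + b)" for a b :: 'k and l :: "'i \<Rightarrow>\<^sub>0 int"
    by (simp add: single_add)
  have U: "kspace U" ..
  note z = linear_maps_zero[OF U kalg.axioms(1)[OF kalg_mon_alg] proj_linear] linear_maps_zero[OF H.kspace_H kalg.axioms(1)[OF kalg_K_alg] H.counit_linear]
  note l = linear_maps_add[OF proj_linear] linear_maps_smult[OF proj_linear] H.counit_add[simplified] H.counit_smult[simplified]
  show "proj x = Poly_Mapping.single l (counit H x)" using assms
    by (induction rule: homog.induct) (use z in \<open>auto simp: l homog_closed proj_clw *\<close>)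
  show "proj x = Poly_Mapping.single r' (counit H x)" using assms
  proof (induction rule: homog.induct)
    case (word ws)
    then show ?case using rdeg_eq_ldeg[of ws] by (cases "counit H (clw ws) = 0") (auto simp: proj_clw)
  qed (use z in \<open>auto simp: l homog_closed *\<close>)
qed

lemma homog_antipode: "homog (- rdeg ws) (- ldeg ws) (antipode H (clw ws))"
proof (induction ws)
  case Nil
  show ?case using homog_one H.antipode_one by (simp add: clw_simps(1))
next
  case (Cons x ws)
  have "homog (- rgen x) (- lgen x) (antipode H (gg x))"
  proof (cases x)
    case (Ge i)
    then show ?thesis using homog.smult[OF homog_mult[OF homog_gen[of "Gw_inv i"] homog_gen[of "Ge i"]], of "-1"] by (simp add: structure_gen)
  next
    case (Gf i)
    then show ?thesis using homog.smult[OF homog_mult[OF homog_gen[of "Gf i"] homog_gen[of "Gw'_inv i"]], of "-1"] by (simp add: structure_gen)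
  qed (use homog_gen[of "tinv x"] in \<open>simp_all add: structure_gen\<close>)
  from homog_mult[OF Cons this] show ?case
    using H.antipode_mult[of "gg x" "clw ws"] by (simp add: clw_simps(2) add.commute)
qed

lemma counit_antipode: "x \<in> carrier U \<Longrightarrow> counit H (antipode H x) = counit H x"
proof -
  assume x: "x \<in> carrier U"
  have h: "(\<lambda>x. counit H (antipode H x)) \<in> alg_hom H K_alg"
    by (intro alg_homI linear_maps_comp[OF H.antipode_lin H.counit_linear])
       (use H.antipode_mult H.counit_mult H.antipode_one H.counit_one in \<open>auto simp: mult.commute\<close>)
  show ?thesis
  proof (rule alg_hom_eq_on_generators[OF H.G_generates h H.counit_alg_hom])
    fix y assume "y \<in> range gg"
    then obtain z where y: "y = gg z" by auto
    show "counit H (antipode H y) = counit H y"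
      using H.counit_mult[simplified] H.counit_smult[simplified]
      by (cases z) (simp_all add: y structure_gen)
  qed (use x in simp)
qed

end

section \<open>Contracting one leg of the coproduct\<close>

context kspace2
begin

lemma tens_lift_param_linear:
  assumes "kspace Y0" "kspace Z" "\<And>x. x \<in> carrier Y0 \<Longrightarrow> bilin V W Z (F x)"
    and "\<And>a b. a \<in> carrier V \<Longrightarrow> b \<in> carrier W \<Longrightarrow> (\<lambda>x. F x a b) \<in> linear_maps Y0 Z"
    and "S \<in> carrier (tensor V W)"
  shows "(\<lambda>x. tens_lift Z (F x) S) \<in> linear_maps Y0 Z"
  using assms(5)
proof (induction rule: tensor_induct)
  case zero
  interpret Y0: kspace Y0 by fact
  interpret Z: kspace Z by fact
  have "tens_lift Z (F x) \<zero>\<^bsub>tensor V W\<^esub> = \<zero>\<^bsub>Z\<^esub>" if "x \<in> carrier Y0" for x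
    using linear_maps_zero[OF kspace_tensor assms(2) tens_lift_linear[OF assms(2,3)]] that by simp
  then show ?case by (intro linear_mapsI) auto
next
  case (add S a b)
  interpret Y0: kspace Y0 by fact
  interpret Z: kspace Z by fact
  note F = assms(4)[OF add(2,3)]
  have 1: "tens_lift Z (F x) (S \<oplus>\<^bsub>tensor V W\<^esub> pure V W a b) = tens_lift Z (F x) S \<oplus>\<^bsub>Z\<^esub> F x a b" if "x \<in> carrier Y0" for x
    using add that by (simp add: linear_maps_add[OF tens_lift_linear[OF assms(2,3)]] tens_lift_pure[OF assms(2,3)])
  show ?case
    by (rule linear_mapsI)
       (simp_all add: 1 linear_maps_closed[OF add(4)] linear_maps_add[OF add(4)] linear_maps_smult[OF add(4)]
         linear_maps_closed[OF F] linear_maps_add[OF F] linear_maps_smult[OF F] Z.a_ac Z.smult_add_right)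
qed

end

lemma kspace_K_alg: "kspace K_alg"
  by (rule kalg.axioms(1)[OF kalg_K_alg])

lemma linear_maps_scalar:
  assumes "kspace Z" "\<phi> \<in> linear_maps Y0 K_alg" "z \<in> carrier Z"
  shows "(\<lambda>x. \<phi> x \<odot>\<^bsub>Z\<^esub> z) \<in> linear_maps Y0 Z"
proof -
  interpret Z: kspace Z by fact
  show ?thesis using linear_maps_add[OF assms(2)] linear_maps_smult[OF assms(2)] assms(3)
    by (intro linear_mapsI) (simp_all add: Z.smult_add_left)
qed

context prehopf
begin

text \<open>The two actions of the linear functionals on a Hopf algebra.\<close>

definition contractL :: "('a \<Rightarrow> 'k) \<Rightarrow> 'a \<Rightarrow> 'a" where
  "contractL \<phi> = sweedler H H (\<lambda>a b. \<phi> a \<odot> b)"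

definition contractR :: "('a \<Rightarrow> 'k) \<Rightarrow> 'a \<Rightarrow> 'a" where
  "contractR \<phi> = sweedler H H (\<lambda>a b. \<phi> b \<odot> a)"

lemma bilin_contractL: "kspace Z \<Longrightarrow> \<phi> \<in> linear_maps H K_alg \<Longrightarrow> f \<in> linear_maps H Z \<Longrightarrow> bilin H H Z (\<lambda>a b. \<phi> a \<odot>\<^bsub>Z\<^esub> f b)"
  by (intro bilinI linear_maps_smult_left linear_maps_scalar) (auto dest: linear_maps_closed)

lemma bilin_contractR: "kspace Z \<Longrightarrow> \<phi> \<in> linear_maps H K_alg \<Longrightarrow> f \<in> linear_maps H Z \<Longrightarrow> bilin H H Z (\<lambda>a b. \<phi> b \<odot>\<^bsub>Z\<^esub> f a)"
  by (intro bilinI linear_maps_smult_left linear_maps_scalar) (auto dest: linear_maps_closed)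

lemma contractL_linear: "\<phi> \<in> linear_maps H K_alg \<Longrightarrow> contractL \<phi> \<in> linear_maps H H"
  unfolding contractL_def by (intro sweedler_linear kspace_H bilin_contractL linear_maps_id)

lemma contractR_linear: "\<phi> \<in> linear_maps H K_alg \<Longrightarrow> contractR \<phi> \<in> linear_maps H H"
  unfolding contractR_def by (intro sweedler_linear kspace_H bilin_contractR linear_maps_id)

lemma contractL_closed [simp]: "\<phi> \<in> linear_maps H K_alg \<Longrightarrow> x \<in> carrier H \<Longrightarrow> contractL \<phi> x \<in> carrier H"
  by (rule linear_maps_closed[OF contractL_linear])

lemma contractR_closed [simp]: "\<phi> \<in> linear_maps H K_alg \<Longrightarrow> x \<in> carrier H \<Longrightarrow> contractR \<phi> x \<in> carrier H"
  by (rule linear_maps_closed[OF contractR_linear])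

lemma sweedler_param_linear:
  assumes "kspace Y0" "kspace Z" "\<And>x. x \<in> carrier Y0 \<Longrightarrow> bilin H H Z (F x)"
    and "\<And>a b. a \<in> carrier H \<Longrightarrow> b \<in> carrier H \<Longrightarrow> (\<lambda>x. F x a b) \<in> linear_maps Y0 Z"
    and "y \<in> carrier H"
  shows "(\<lambda>x. sweedler H Z (F x) y) \<in> linear_maps Y0 Z"
  unfolding sweedler_def by (rule HH.tens_lift_param_linear) (use assms in auto)

lemma contractL_param:
  assumes "kspace Y0" "\<And>z. z \<in> carrier Y0 \<Longrightarrow> \<phi> z \<in> linear_maps H K_alg"
    and "\<And>a. a \<in> carrier H \<Longrightarrow> (\<lambda>z. \<phi> z a) \<in> linear_maps Y0 K_alg" and "x \<in> carrier H"
  shows "(\<lambda>z. contractL (\<phi> z) x) \<in> linear_maps Y0 H"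
  unfolding contractL_def
  by (rule sweedler_param_linear[OF assms(1) kspace_H _ _ assms(4)])
     (auto intro!: bilin_contractL kspace_H linear_maps_id linear_maps_scalar assms)

lemma contractR_param:
  assumes "kspace Y0" "\<And>z. z \<in> carrier Y0 \<Longrightarrow> \<phi> z \<in> linear_maps H K_alg"
    and "\<And>a. a \<in> carrier H \<Longrightarrow> (\<lambda>z. \<phi> z a) \<in> linear_maps Y0 K_alg" and "x \<in> carrier H"
  shows "(\<lambda>z. contractR (\<phi> z) x) \<in> linear_maps Y0 H"
  unfolding contractR_def
  by (rule sweedler_param_linear[OF assms(1) kspace_H _ _ assms(4)])
     (auto intro!: bilin_contractR kspace_H linear_maps_id linear_maps_scalar assms)

lemma sweedler_cong:
  assumes "kspace Z" "bilin H H Z g" "\<And>x y. x \<in> carrier H \<Longrightarrow> y \<in> carrier H \<Longrightarrow> f x y = g x y" "x \<in> carrier H"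
  shows "sweedler H Z f x = sweedler H Z g x"
  unfolding sweedler_def using assms by (intro HH.tens_lift_cong) auto

lemma linear_maps_sweedler:
  assumes "kspace Y" "kspace Z" "bilin H H Y g" "f \<in> linear_maps Y Z" "x \<in> carrier H"
  shows "f (sweedler H Y g x) = sweedler H Z (\<lambda>a b. f (g a b)) x"
  unfolding sweedler_def using assms by (intro HH.linear_maps_tens_lift) auto

lemma sweedler_left:
  assumes "kspace Z" "\<phi> \<in> linear_maps H K_alg" "f \<in> linear_maps H Z" "x \<in> carrier H"
  shows "sweedler H Z (\<lambda>a b. \<phi> a \<odot>\<^bsub>Z\<^esub> f b) x = f (contractL \<phi> x)"
  unfolding contractL_def linear_maps_sweedler[OF kspace_H assms(1) bilin_contractL[OF kspace_H assms(2) linear_maps_id] assms(3,4)]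
  by (rule sweedler_cong[symmetric, OF assms(1) bilin_contractL[OF assms(1-3)] _ assms(4)]) (simp add: linear_maps_smult[OF assms(3)])

lemma sweedler_right:
  assumes "kspace Z" "\<phi> \<in> linear_maps H K_alg" "f \<in> linear_maps H Z" "x \<in> carrier H"
  shows "sweedler H Z (\<lambda>a b. \<phi> b \<odot>\<^bsub>Z\<^esub> f a) x = f (contractR \<phi> x)"
  unfolding contractR_def linear_maps_sweedler[OF kspace_H assms(1) bilin_contractR[OF kspace_H assms(2) linear_maps_id] assms(3,4)]
  by (rule sweedler_cong[symmetric, OF assms(1) bilin_contractR[OF assms(1-3)] _ assms(4)]) (simp add: linear_maps_smult[OF assms(3)])

subsection \<open>The deformed product, antipode and convolution\<close>

text \<open>The deformed product, convolution and antipode for arbitrary forms \<open>\<alpha>\<close> and \<open>\<beta>\<close> instead of a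
  cocycle and its inverse. Inner sums are written as contractions, so that each step
  depends linearly on a single element, and nested sums can be evaluated one after the other.\<close>

definition twisted_mult :: "('a \<Rightarrow> 'a \<Rightarrow> 'k) \<Rightarrow> ('a \<Rightarrow> 'a \<Rightarrow> 'k) \<Rightarrow> 'a \<Rightarrow> 'a \<Rightarrow> 'a" where
  "twisted_mult \<alpha> \<beta> a b = sweedler H H (\<lambda>a1 a'. sweedler H H (\<lambda>a2 a3. a2 \<otimes> contractR (\<beta> a3) (contractL (\<alpha> a1) b)) a') a"

definition twisted_antipode :: "('a \<Rightarrow> 'a \<Rightarrow> 'k) \<Rightarrow> ('a \<Rightarrow> 'a \<Rightarrow> 'k) \<Rightarrow> 'a \<Rightarrow> 'a" where
  "twisted_antipode \<alpha> \<beta> = sweedler H H (\<lambda>a1 a'. antipode H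
     (contractR (sweedler H K_alg (\<lambda>a4 a5. \<beta> (antipode H a4) a5)) (contractL (\<lambda>x. \<alpha> a1 (antipode H x)) a')))"

context
  fixes \<alpha> \<beta> :: "'a \<Rightarrow> 'a \<Rightarrow> 'k"
  assumes \<alpha>: "bilin H H K_alg \<alpha>" and \<beta>: "bilin H H K_alg \<beta>"
begin

lemma bilin_convolution_aux:
  assumes "y \<in> carrier H" shows "bilin H H K_alg (\<lambda>a1 a2. \<beta> a2 (contractL (\<alpha> a1) y))"
  using assms
  by (intro bilinI linear_maps_comp[OF contractL_param bilin_right[OF \<beta>]] bilin_left[OF \<beta>] contractL_closed bilin_right[OF \<alpha>] bilin_left[OF \<alpha>] kspace_H)

lemma convolution_formula:
  assumes "a \<in> carrier H" "b \<in> carrier H"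
  shows "sweedler H K_alg (\<lambda>a1 a2. sweedler H K_alg (\<lambda>b1 b2. \<alpha> a1 b1 * \<beta> a2 b2) b) a
      = sweedler H K_alg (\<lambda>a1 a2. \<beta> a2 (contractL (\<alpha> a1) b)) a"
proof (rule sweedler_cong[OF kspace_K_alg bilin_convolution_aux[OF assms(2)] _ assms(1)])
  fix a1 a2 assume "a1 \<in> carrier H" "a2 \<in> carrier H"
  then show "sweedler H K_alg (\<lambda>b1 b2. \<alpha> a1 b1 * \<beta> a2 b2) b = \<beta> a2 (contractL (\<alpha> a1) b)"
    using sweedler_left[OF kspace_K_alg bilin_right[OF \<alpha>] bilin_right[OF \<beta>] assms(2), of a1 a2] by simp
qed

lemma bilin_convolution: "bilin H H K_alg (\<lambda>a b. sweedler H K_alg (\<lambda>a1 a2. \<beta> a2 (contractL (\<alpha> a1) b)) a)"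
proof (rule bilinI)
  fix y assume "y \<in> carrier H"
  then show "(\<lambda>x. sweedler H K_alg (\<lambda>a1 a2. \<beta> a2 (contractL (\<alpha> a1) y)) x) \<in> linear_maps H K_alg"
    by (intro sweedler_linear kspace_K_alg bilin_convolution_aux)
next
  fix x assume "x \<in> carrier H"
  then show "(\<lambda>b. sweedler H K_alg (\<lambda>a1 a2. \<beta> a2 (contractL (\<alpha> a1) b)) x) \<in> linear_maps H K_alg"
    by (intro sweedler_param_linear kspace_H kspace_K_alg bilin_convolution_aux linear_maps_comp[OF contractL_linear bilin_right[OF \<beta>]] bilin_right[OF \<alpha>])
qed

lemma bilin_twisted_mult_aux:
  assumes "b \<in> carrier H" "a1 \<in> carrier H"
  shows "bilin H H H (\<lambda>a2 a3. a2 \<otimes> contractR (\<beta> a3) (contractL (\<alpha> a1) b))"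
  using assms
  by (intro bilinI linear_mult_left linear_mult_right linear_maps_id contractR_param kspace_H bilin_left[OF \<beta>] bilin_right[OF \<beta>]
      contractL_closed contractR_closed bilin_right[OF \<alpha>])

lemma bilin_twisted_mult_aux':
  assumes "b \<in> carrier H"
  shows "bilin H H H (\<lambda>a1 a'. sweedler H H (\<lambda>a2 a3. a2 \<otimes> contractR (\<beta> a3) (contractL (\<alpha> a1) b)) a')"
  using assms
  by (intro bilinI sweedler_linear sweedler_param_linear kspace_H bilin_twisted_mult_aux linear_mult_left
      linear_maps_comp[OF contractL_param contractR_linear] bilin_right[OF \<beta>] bilin_right[OF \<alpha>] bilin_left[OF \<alpha>])

lemma bilin_twisted_mult: "bilin H H H (twisted_mult \<alpha> \<beta>)"
  unfolding twisted_mult_def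
  by (intro bilinI sweedler_linear sweedler_param_linear kspace_H bilin_twisted_mult_aux bilin_twisted_mult_aux' linear_mult_left
      linear_maps_comp[OF contractL_linear contractR_linear] bilin_right[OF \<beta>] bilin_right[OF \<alpha>])

lemma twisted_mult_sweedler:
  assumes a: "a \<in> carrier H" and b: "b \<in> carrier H"
  shows "sweedler H H (\<lambda>a1 a'. sweedler H H (\<lambda>a2 a3. sweedler H H (\<lambda>b1 b'. sweedler H H (\<lambda>b2 b3.
         (\<alpha> a1 b1 * \<beta> a3 b3) \<odot> (a2 \<otimes> b2)) b') b) a') a = twisted_mult \<alpha> \<beta> a b"
  unfolding twisted_mult_def
proof (rule sweedler_cong[OF kspace_H bilin_twisted_mult_aux'[OF b] _ a])
  fix a1 a' assume a1: "a1 \<in> carrier H" and a': "a' \<in> carrier H"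
  show "sweedler H H (\<lambda>a2 a3. sweedler H H (\<lambda>b1 b'. sweedler H H (\<lambda>b2 b3. (\<alpha> a1 b1 * \<beta> a3 b3) \<odot> (a2 \<otimes> b2)) b') b) a'
    = sweedler H H (\<lambda>a2 a3. a2 \<otimes> contractR (\<beta> a3) (contractL (\<alpha> a1) b)) a'"
  proof (rule sweedler_cong[OF kspace_H bilin_twisted_mult_aux[OF b a1] _ a'])
    fix a2 a3 assume a2: "a2 \<in> carrier H" and a3: "a3 \<in> carrier H"
    note t3 = bilin_right[OF \<beta> a3] and s1 = bilin_right[OF \<alpha> a1]
    have l: "(\<lambda>b'. a2 \<otimes> contractR (\<beta> a3) b') \<in> linear_maps H H"
      by (intro linear_mult_left contractR_linear t3 a2)
    have "sweedler H H (\<lambda>b1 b'. sweedler H H (\<lambda>b2 b3. (\<alpha> a1 b1 * \<beta> a3 b3) \<odot> (a2 \<otimes> b2)) b') b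
      = sweedler H H (\<lambda>b1 b'. \<alpha> a1 b1 \<odot> (a2 \<otimes> contractR (\<beta> a3) b')) b"
    proof (rule sweedler_cong[OF kspace_H bilin_contractL[OF kspace_H s1 l] _ b])
      fix b1 b' assume b1: "b1 \<in> carrier H" and b': "b' \<in> carrier H"
      have l': "(\<lambda>b2. \<alpha> a1 b1 \<odot> (a2 \<otimes> b2)) \<in> linear_maps H H"
        by (intro linear_maps_smult_left linear_mult_left linear_maps_id kspace_H a2)
      have "sweedler H H (\<lambda>b2 b3. (\<alpha> a1 b1 * \<beta> a3 b3) \<odot> (a2 \<otimes> b2)) b'
        = sweedler H H (\<lambda>b2 b3. \<beta> a3 b3 \<odot> (\<alpha> a1 b1 \<odot> (a2 \<otimes> b2))) b'"
        by (rule sweedler_cong[OF kspace_H bilin_contractR[OF kspace_H t3 l'] _ b']) (simp add: a2 mult.commute)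
      then show "sweedler H H (\<lambda>b2 b3. (\<alpha> a1 b1 * \<beta> a3 b3) \<odot> (a2 \<otimes> b2)) b' = \<alpha> a1 b1 \<odot> (a2 \<otimes> contractR (\<beta> a3) b')"
        using sweedler_right[OF kspace_H t3 l' b'] by simp
    qed
    then show "sweedler H H (\<lambda>b1 b'. sweedler H H (\<lambda>b2 b3. (\<alpha> a1 b1 * \<beta> a3 b3) \<odot> (a2 \<otimes> b2)) b') b
      = a2 \<otimes> contractR (\<beta> a3) (contractL (\<alpha> a1) b)"
      using sweedler_left[OF kspace_H s1 l b] by simp
  qed
qed

abbreviation "theta \<equiv> sweedler H K_alg (\<lambda>a4 a5. \<beta> (antipode H a4) a5)"

lemma bilin_theta: "bilin H H K_alg (\<lambda>a4 a5. \<beta> (antipode H a4) a5)"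
  by (intro bilinI bilin_right[OF \<beta>] antipode_closed linear_maps_comp[OF antipode_lin bilin_left[OF \<beta>]])

lemma theta_linear: "theta \<in> linear_maps H K_alg"
  by (rule sweedler_linear[OF kspace_K_alg bilin_theta])

lemma \<alpha>_antipode_linear: "a1 \<in> carrier H \<Longrightarrow> (\<lambda>x. \<alpha> a1 (antipode H x)) \<in> linear_maps H K_alg"
  by (rule linear_maps_comp[OF antipode_lin bilin_right[OF \<alpha>]])

lemma bilin_twisted_antipode: "bilin H H H (\<lambda>a1 a'. antipode H (contractR theta (contractL (\<lambda>x. \<alpha> a1 (antipode H x)) a')))"
  by (intro bilinI linear_maps_comp[OF _ antipode_lin] linear_maps_comp[OF _ contractR_linear[OF theta_linear]]
      contractL_linear \<alpha>_antipode_linear contractL_param kspace_H bilin_left[OF \<alpha>] antipode_closed)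

lemma twisted_antipode_linear: "twisted_antipode \<alpha> \<beta> \<in> linear_maps H H"
  unfolding twisted_antipode_def by (rule sweedler_linear[OF kspace_H bilin_twisted_antipode])

lemma twisted_antipode_sweedler:
  assumes a: "a \<in> carrier H"
  shows "sweedler H H (\<lambda>a1 a'. sweedler H H (\<lambda>a2 a''. sweedler H H (\<lambda>a3 a'''. sweedler H H (\<lambda>a4 a5.
         (\<alpha> a1 (antipode H a2) * \<beta> (antipode H a4) a5) \<odot> antipode H a3) a''') a'') a') a = twisted_antipode \<alpha> \<beta> a"
  unfolding twisted_antipode_def
proof (rule sweedler_cong[OF kspace_H bilin_twisted_antipode _ a])
  fix a1 a' assume a1: "a1 \<in> carrier H" and a': "a' \<in> carrier H"
  have l: "(\<lambda>a''. antipode H (contractR theta a'')) \<in> linear_maps H H"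
    by (intro linear_maps_comp[OF contractR_linear[OF theta_linear] antipode_lin])
  have "sweedler H H (\<lambda>a2 a''. sweedler H H (\<lambda>a3 a'''. sweedler H H (\<lambda>a4 a5.
         (\<alpha> a1 (antipode H a2) * \<beta> (antipode H a4) a5) \<odot> antipode H a3) a''') a'') a'
     = sweedler H H (\<lambda>a2 a''. \<alpha> a1 (antipode H a2) \<odot> antipode H (contractR theta a'')) a'"
  proof (rule sweedler_cong[OF kspace_H bilin_contractL[OF kspace_H \<alpha>_antipode_linear[OF a1] l] _ a'])
    fix a2 a'' assume a2: "a2 \<in> carrier H" and a'': "a'' \<in> carrier H"
    let ?c = "\<alpha> a1 (antipode H a2)"
    have l': "(\<lambda>a3. ?c \<odot> antipode H a3) \<in> linear_maps H H"
      by (intro linear_maps_smult_left antipode_lin kspace_H)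
    have "sweedler H H (\<lambda>a3 a'''. sweedler H H (\<lambda>a4 a5. (?c * \<beta> (antipode H a4) a5) \<odot> antipode H a3) a''') a''
      = sweedler H H (\<lambda>a3 a'''. theta a''' \<odot> (?c \<odot> antipode H a3)) a''"
    proof (rule sweedler_cong[OF kspace_H bilin_contractR[OF kspace_H theta_linear l'] _ a''])
      fix a3 a''' assume a3: "a3 \<in> carrier H" and a''': "a''' \<in> carrier H"
      let ?z = "?c \<odot> antipode H a3"
      have z: "?z \<in> carrier H" using a3 by simp
      have k: "(\<lambda>k. k \<odot> ?z) \<in> linear_maps K_alg H"
        by (rule linear_maps_scalar[OF kspace_H linear_maps_id z])
      have b2: "bilin H H H (\<lambda>a4 a5. \<beta> (antipode H a4) a5 \<odot> ?z)"
        by (intro bilinI linear_maps_comp[OF bilin_right[OF bilin_theta] k] linear_maps_comp[OF bilin_left[OF bilin_theta] k])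
      show "sweedler H H (\<lambda>a4 a5. (?c * \<beta> (antipode H a4) a5) \<odot> antipode H a3) a''' = theta a''' \<odot> ?z"
        unfolding linear_maps_sweedler[OF kspace_K_alg kspace_H bilin_theta k a''']
        by (rule sweedler_cong[OF kspace_H b2 _ a''']) (simp add: a3 mult.commute)
    qed
    then show "sweedler H H (\<lambda>a3 a'''. sweedler H H (\<lambda>a4 a5. (?c * \<beta> (antipode H a4) a5) \<odot> antipode H a3) a''') a''
      = ?c \<odot> antipode H (contractR theta a'')"
      using sweedler_right[OF kspace_H theta_linear l' a''] by simp
  qed
  then show "sweedler H H (\<lambda>a2 a''. sweedler H H (\<lambda>a3 a'''. sweedler H H (\<lambda>a4 a5.
         (\<alpha> a1 (antipode H a2) * \<beta> (antipode H a4) a5) \<odot> antipode H a3) a''') a'') a'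
     = antipode H (contractR theta (contractL (\<lambda>x. \<alpha> a1 (antipode H x)) a'))"
    using sweedler_left[OF kspace_H \<alpha>_antipode_linear[OF a1] l a'] by simp
qed

end

end

section \<open>Contraction on homogeneous words\<close>

context qdata
begin

text \<open>Every left leg in the coproduct of a word has the left degree of this word. If \<open>G\<close> only sees the
  counit of such a left leg, then \<open>G\<close> may be replaced by \<open>\<epsilon>(a) f(b)\<close>, and the
  counit axiom evaluates the sum. All nested Sweedler sums below are evaluated in this way.\<close>

lemma sweedler_left_word:
  assumes Z: "kspace Z" and G: "bilin H H Z G" and f: "f \<in> linear_maps H Z"
    and *: "\<And>ws b. ldeg ws = ldeg u \<Longrightarrow> b \<in> carrier U \<Longrightarrow> G (clw ws) b = counit H (clw ws) \<odot>\<^bsub>Z\<^esub> f b"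
  shows "sweedler H Z G (clw u) = f (clw u)"
proof -
  interpret Z: kspace Z by fact
  have G': "bilin H H Z (\<lambda>a b. counit H a \<odot>\<^bsub>Z\<^esub> f b)"
    by (rule H.bilin_contractL[OF Z H.counit_linear f])
  note L = H.HH.tens_lift_linear[OF Z G] H.HH.tens_lift_linear[OF Z G']
  have "tens_lift Z G S = tens_lift Z (\<lambda>a b. counit H a \<odot>\<^bsub>Z\<^esub> f b) S" if "balanced (ldeg u) r' S" for S r'
    using that
  proof (induction rule: balanced.induct)
    case zero
    then show ?case using linear_maps_zero[OF H.HH.kspace_tensor Z L(1)] linear_maps_zero[OF H.HH.kspace_tensor Z L(2)] by simp
  next
    case (word us vs)
    then show ?case
      using H.HH.tens_lift_pure[OF Z G, of "clw us" "clw vs"] H.HH.tens_lift_pure[OF Z G', of "clw us" "clw vs"] by (simp add: *)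
  next
    case (add S T)
    then show ?case by (simp add: linear_maps_add[OF L(1)] linear_maps_add[OF L(2)] balanced_closed)
  next
    case (smult S c)
    then show ?case by (simp add: linear_maps_smult[OF L(1)] linear_maps_smult[OF L(2)] balanced_closed)
  qed
  then have "sweedler H Z G (clw u) = sweedler H Z (\<lambda>a b. counit H a \<odot>\<^bsub>Z\<^esub> f b) (clw u)"
    unfolding sweedler_def using balanced_comult by blast
  also have "\<dots> = f (H.contractL (counit H) (clw u))"
    by (rule H.sweedler_left[OF Z H.counit_linear f]) simp
  also have "H.contractL (counit H) (clw u) = clw u"
    using hopf_algebra.counit_left[OF hopf_algebra_H, of "clw u"] by (simp add: H.contractL_def)
  finally show ?thesis .
qed

lemma sweedler_right_word:
  assumes Z: "kspace Z" and G: "bilin H H Z G" and f: "f \<in> linear_maps H Z"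
    and *: "\<And>ws a. rdeg ws = rdeg u \<Longrightarrow> a \<in> carrier U \<Longrightarrow> G a (clw ws) = counit H (clw ws) \<odot>\<^bsub>Z\<^esub> f a"
  shows "sweedler H Z G (clw u) = f (clw u)"
proof -
  interpret Z: kspace Z by fact
  have G': "bilin H H Z (\<lambda>a b. counit H b \<odot>\<^bsub>Z\<^esub> f a)"
    by (rule H.bilin_contractR[OF Z H.counit_linear f])
  note L = H.HH.tens_lift_linear[OF Z G] H.HH.tens_lift_linear[OF Z G']
  have "tens_lift Z G S = tens_lift Z (\<lambda>a b. counit H b \<odot>\<^bsub>Z\<^esub> f a) S" if "balanced l (rdeg u) S" for S l
    using that
  proof (induction rule: balanced.induct)
    case zero
    then show ?case using linear_maps_zero[OF H.HH.kspace_tensor Z L(1)] linear_maps_zero[OF H.HH.kspace_tensor Z L(2)] by simp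
  next
    case (word us vs)
    then show ?case
      using H.HH.tens_lift_pure[OF Z G, of "clw us" "clw vs"] H.HH.tens_lift_pure[OF Z G', of "clw us" "clw vs"] by (simp add: *)
  next
    case (add S T)
    then show ?case by (simp add: linear_maps_add[OF L(1)] linear_maps_add[OF L(2)] balanced_closed)
  next
    case (smult S c)
    then show ?case by (simp add: linear_maps_smult[OF L(1)] linear_maps_smult[OF L(2)] balanced_closed)
  qed
  then have "sweedler H Z G (clw u) = sweedler H Z (\<lambda>a b. counit H b \<odot>\<^bsub>Z\<^esub> f a) (clw u)"
    unfolding sweedler_def using balanced_comult by blast
  also have "\<dots> = f (H.contractR (counit H) (clw u))"
    by (rule H.sweedler_right[OF Z H.counit_linear f]) simp
  also have "H.contractR (counit H) (clw u) = clw u"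
    using hopf_algebra.counit_right[OF hopf_algebra_H, of "clw u"] by (simp add: H.contractR_def)
  finally show ?thesis .
qed

lemma contractL_word:
  assumes "\<phi> \<in> linear_maps H K_alg" "\<And>ws. ldeg ws = ldeg u \<Longrightarrow> \<phi> (clw ws) = counit H (clw ws) * k"
  shows "H.contractL \<phi> (clw u) = k \<odot>\<^bsub>U\<^esub> clw u"
  using sweedler_left_word[OF H.kspace_H H.bilin_contractL[OF H.kspace_H assms(1) linear_maps_id]
      linear_maps_smult_left[OF H.kspace_H linear_maps_id, of k], of u] assms(2)
  by (simp add: H.contractL_def)

lemma contractR_word:
  assumes "\<phi> \<in> linear_maps H K_alg" "\<And>ws. rdeg ws = rdeg u \<Longrightarrow> \<phi> (clw ws) = counit H (clw ws) * k"
  shows "H.contractR \<phi> (clw u) = k \<odot>\<^bsub>U\<^esub> clw u"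
  using sweedler_right_word[OF H.kspace_H H.bilin_contractR[OF H.kspace_H assms(1) linear_maps_id]
      linear_maps_smult_left[OF H.kspace_H linear_maps_id, of k], of u] assms(2)
  by (simp add: H.contractR_def)

end

section \<open>Bicharacters and the forms they induce\<close>

definition bichar :: "(('i \<Rightarrow>\<^sub>0 int) \<Rightarrow> ('i \<Rightarrow>\<^sub>0 int) \<Rightarrow> 'k::field) \<Rightarrow> bool" where
  "bichar \<chi> \<longleftrightarrow> (\<forall>a b c. \<chi> (a + b) c = \<chi> a c * \<chi> b c \<and> \<chi> a (b + c) = \<chi> a b * \<chi> a c) \<and> (\<forall>a b. \<chi> a b \<noteq> 0)"

lemma bichar_rules:
  assumes "bichar \<chi>"
  shows "\<chi> (a + b) c = \<chi> a c * \<chi> b c" "\<chi> a (b + c) = \<chi> a b * \<chi> a c" "\<chi> a b \<noteq> 0"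
    "\<chi> 0 a = 1" "\<chi> a 0 = 1" "\<chi> (- a) b = inverse (\<chi> a b)" "\<chi> a (- b) = inverse (\<chi> a b)"
proof -
  show 1: "\<chi> (a + b) c = \<chi> a c * \<chi> b c" "\<chi> a (b + c) = \<chi> a b * \<chi> a c" "\<chi> a b \<noteq> 0" for a b c
    using assms by (auto simp: bichar_def)
  show 2: "\<chi> 0 a = 1" "\<chi> a 0 = 1" for a
    using 1(1)[of 0 0 a] 1(2)[of a 0 0] 1(3)[of 0 a] 1(3)[of a 0] by auto
  show "\<chi> (- a) b = inverse (\<chi> a b)" "\<chi> a (- b) = inverse (\<chi> a b)"
    using 1(1)[of "- a" a b] 1(2)[of a "- b" b] 1(3)[of a b] by (simp_all add: 2 field_simps)
qed

lemma bichar_inverse: "bichar \<chi> \<Longrightarrow> bichar (\<lambda>a b. inverse (\<chi> a b))"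
  by (auto simp: bichar_def)

text \<open>The bilinear extension to the group algebra.\<close>

definition bichar_ext :: "(('i \<Rightarrow>\<^sub>0 int) \<Rightarrow> ('i \<Rightarrow>\<^sub>0 int) \<Rightarrow> 'k::field) \<Rightarrow> (('i \<Rightarrow>\<^sub>0 int) \<Rightarrow>\<^sub>0 'k) \<Rightarrow> (('i \<Rightarrow>\<^sub>0 int) \<Rightarrow>\<^sub>0 'k) \<Rightarrow> 'k" where
  "bichar_ext \<chi> P Q = lin K_alg (\<lambda>\<mu>. lin K_alg (\<chi> \<mu>) Q) P"

lemma lin_K_alg_linear: "lin K_alg f \<in> linear_maps mon_alg K_alg"
proof -
  interpret K: kspace K_alg by (rule kspace_K_alg)
  show ?thesis
  proof (rule linear_mapsI)
    fix x y c
    show "lin K_alg f (x \<oplus>\<^bsub>mon_alg\<^esub> y) = lin K_alg f x \<oplus>\<^bsub>K_alg\<^esub> lin K_alg f y"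
      using K.lin_add[of x UNIV y f] by simp
    show "lin K_alg f (c \<odot>\<^bsub>mon_alg\<^esub> x) = c \<odot>\<^bsub>K_alg\<^esub> lin K_alg f x"
      using K.lin_scale[of x f c] by simp
  qed simp
qed

lemma bichar_ext_linear: "bichar_ext \<chi> P \<in> linear_maps mon_alg K_alg" "(\<lambda>P. bichar_ext \<chi> P Q) \<in> linear_maps mon_alg K_alg"
proof -
  interpret K: kspace K_alg by (rule kspace_K_alg)
  show "(\<lambda>P. bichar_ext \<chi> P Q) \<in> linear_maps mon_alg K_alg"
    using lin_K_alg_linear[of "\<lambda>\<mu>. lin K_alg (\<chi> \<mu>) Q"] by (simp add: bichar_ext_def[abs_def])
  show "bichar_ext \<chi> P \<in> linear_maps mon_alg K_alg"
  proof (rule linear_mapsI)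
    fix x y c
    have a: "lin K_alg (\<lambda>\<mu>. f \<mu> + h \<mu>) P = lin K_alg f P + lin K_alg h P" for f h :: "('a \<Rightarrow>\<^sub>0 int) \<Rightarrow> 'b"
      using K.finsum_addf[of "\<lambda>k. Poly_Mapping.lookup P k * f k" "Poly_Mapping.keys P" "\<lambda>k. Poly_Mapping.lookup P k * h k"]
      by (simp add: lin_def Pi_def algebra_simps)
    have m: "lin K_alg (\<lambda>\<mu>. c * f \<mu>) P = c * lin K_alg f P" for c and f :: "('a \<Rightarrow>\<^sub>0 int) \<Rightarrow> 'b"
      using linear_maps_finsum[OF kspace_K_alg kspace_K_alg linear_maps_smult_left[OF kspace_K_alg linear_maps_id, of c],
          of "\<lambda>k. Poly_Mapping.lookup P k * f k" "Poly_Mapping.keys P"]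
      by (simp add: lin_def Pi_def mult.left_commute)
    show "bichar_ext \<chi> P (x \<oplus>\<^bsub>mon_alg\<^esub> y) = bichar_ext \<chi> P x \<oplus>\<^bsub>K_alg\<^esub> bichar_ext \<chi> P y"
      using linear_maps_add[OF lin_K_alg_linear, of x y] by (simp add: bichar_ext_def a)
    show "bichar_ext \<chi> P (c \<odot>\<^bsub>mon_alg\<^esub> x) = c \<odot>\<^bsub>K_alg\<^esub> bichar_ext \<chi> P x"
      using linear_maps_smult[OF lin_K_alg_linear, of x] by (simp add: bichar_ext_def m)
  qed simp
qed

lemma bichar_ext_single: "bichar_ext \<chi> (Poly_Mapping.single \<mu> a) (Poly_Mapping.single \<nu> b) = a * b * \<chi> \<mu> \<nu>"
proof -
  interpret K: kspace K_alg by (rule kspace_K_alg)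
  show ?thesis by (simp add: bichar_ext_def K.lin_single[simplified])
qed

context qdata
begin

definition sform :: "(('i \<Rightarrow>\<^sub>0 int) \<Rightarrow> ('i \<Rightarrow>\<^sub>0 int) \<Rightarrow> 'k) \<Rightarrow> ('i, 'k) free_alg set \<Rightarrow> ('i, 'k) free_alg set \<Rightarrow> 'k" where
  "sform \<chi> x y = bichar_ext \<chi> (proj x) (proj y)"

definition form_of :: "(('i \<Rightarrow>\<^sub>0 int) \<Rightarrow> ('i \<Rightarrow>\<^sub>0 int) \<Rightarrow> 'k) \<Rightarrow> ('i, 'k) free_alg set \<times> ('i, 'k) free_alg set \<Rightarrow> 'k" where
  "form_of \<chi> = restrict (\<lambda>(x, y). sform \<chi> x y) (carrier H \<times> carrier H)"

lemma linear_maps_H [simp]: "linear_maps H Z = linear_maps U Z" "linear_maps Z H = linear_maps Z U"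
  by (auto simp: linear_maps_def)

lemma bilin_H: "bilin H H Z f = bilin U U Z f"
  by (simp add: bilin_def)

lemma bilin_sform: "bilin H H K_alg (sform \<chi>)"
  unfolding bilin_H sform_def[abs_def]
  by (intro bilinI linear_maps_comp[OF proj_linear bichar_ext_linear(1)] linear_maps_comp[OF proj_linear bichar_ext_linear(2)])

text \<open>The pullback of a bicharacter, described by its values on words. The description also applies to
  forms that are not known to be pullbacks, such as an arbitrary convolution inverse.\<close>

definition word_form :: "(('i \<Rightarrow>\<^sub>0 int) \<Rightarrow> ('i \<Rightarrow>\<^sub>0 int) \<Rightarrow> 'k) \<Rightarrow> (('i, 'k) free_alg set \<Rightarrow> ('i, 'k) free_alg set \<Rightarrow> 'k) \<Rightarrow> bool" where
  "word_form \<chi> \<alpha> \<longleftrightarrow> bilin H H K_alg \<alpha>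
     \<and> (\<forall>u v. \<alpha> (clw u) (clw v) = counit H (clw u) * counit H (clw v) * \<chi> (ldeg u) (ldeg v))"

lemma word_form_bilin: "word_form \<chi> \<alpha> \<Longrightarrow> bilin H H K_alg \<alpha>"
  by (simp add: word_form_def)

lemma bilin_eq_on_words:
  assumes "kspace Z" "bilin H H Z f" "bilin H H Z f'" "\<And>u v. f (clw u) (clw v) = f' (clw u) (clw v)"
    and "x \<in> carrier U" "y \<in> carrier U"
  shows "f x y = f' x y"
proof -
  note f = assms(2)[unfolded bilin_H] and f' = assms(3)[unfolded bilin_H]
  have "f x (clw v) = f' x (clw v)" for v
    by (rule U_linear_eq[OF assms(1) bilin_left[OF f cl_closed] bilin_left[OF f' cl_closed] assms(4,5)])
  then show ?thesis
    by (rule U_linear_eq[OF assms(1) bilin_right[OF f assms(5)] bilin_right[OF f' assms(5)] _ assms(6)])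
qed

lemma word_form_sform: "word_form \<chi> (sform \<chi>)"
  by (simp add: word_form_def bilin_sform) (simp add: sform_def proj_clw bichar_ext_single)

lemma word_form_eq: "word_form \<chi> \<alpha> \<Longrightarrow> x \<in> carrier U \<Longrightarrow> y \<in> carrier U \<Longrightarrow> \<alpha> x y = bichar_ext \<chi> (proj x) (proj y)"
  using bilin_eq_on_words[OF kspace_K_alg word_form_bilin bilin_sform[of \<chi>], of \<chi> \<alpha>] word_form_sform[of \<chi>]
  by (simp add: word_form_def sform_def[symmetric])

text \<open>Left and right degrees are interchangeable, because both counits vanish unless they agree.\<close>

lemma word_form_homog:
  assumes "word_form \<chi> \<alpha>" "homog l1 r1 x" "homog l2 r2 y"
  shows "\<alpha> x y = counit H x * counit H y * \<chi> l1 l2" "\<alpha> x y = counit H x * counit H y * \<chi> r1 r2"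
proof -
  show "\<alpha> x y = counit H x * counit H y * \<chi> l1 l2"
    using word_form_eq[OF assms(1) homog_closed[OF assms(2)] homog_closed[OF assms(3)]]
    by (simp add: proj_homog(1)[OF assms(2)] proj_homog(1)[OF assms(3)] bichar_ext_single)
  show "\<alpha> x y = counit H x * counit H y * \<chi> r1 r2"
    using word_form_eq[OF assms(1) homog_closed[OF assms(2)] homog_closed[OF assms(3)]]
    by (simp add: proj_homog(2)[OF assms(2)] proj_homog(2)[OF assms(3)] bichar_ext_single)
qed

lemma homog_clw: "homog (ldeg u) (rdeg u) (clw u)"
  by (rule homog.word) auto

lemma bilinear_forms_bilin: "f \<in> bilinear_forms H \<Longrightarrow> bilin H H K_alg (\<lambda>x y. f (x, y))"
  by (auto simp: bilinear_forms_def bilin_def)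

lemma form_of_bilinear: "form_of \<chi> \<in> bilinear_forms H"
  using bilin_sform[of \<chi>] unfolding bilinear_forms_def form_of_def bilin_H
  by (auto simp: bilin_def linear_maps_def Pi_iff)

lemma form_of_eq: "x \<in> carrier U \<Longrightarrow> y \<in> carrier U \<Longrightarrow> form_of \<chi> (x, y) = sform \<chi> x y"
  by (simp add: form_of_def)

lemma word_form_form_of: "word_form \<chi> (\<lambda>x y. form_of \<chi> (x, y))"
  using word_form_sform[of \<chi>] bilinear_forms_bilin[OF form_of_bilinear, of \<chi>] by (simp add: word_form_def form_of_eq)

lemma form_of_unique:
  assumes "f \<in> bilinear_forms H" "word_form \<chi> (\<lambda>x y. f (x, y))" shows "f = form_of \<chi>"
proof (rule extensionalityI[of _ "carrier H \<times> carrier H"])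
  show "f \<in> extensional (carrier H \<times> carrier H)" using assms(1) by (simp add: bilinear_forms_def)
  show "form_of \<chi> \<in> extensional (carrier H \<times> carrier H)" by (simp add: form_of_def)
  fix z assume "z \<in> carrier H \<times> carrier H"
  then obtain x y where z: "z = (x, y)" "x \<in> carrier U" "y \<in> carrier U" by auto
  show "f z = form_of \<chi> z"
    using word_form_eq[OF assms(2) z(2,3)] z by (simp add: form_of_eq sform_def)
qed

lemma contractL_word_form:
  assumes "word_form \<chi> \<alpha>" "homog l r' x"
  shows "H.contractL (\<alpha> x) (clw v) = (counit H x * \<chi> l (ldeg v)) \<odot>\<^bsub>U\<^esub> clw v"
  by (rule contractL_word[OF bilin_right[OF word_form_bilin[OF assms(1)]]])
     (use homog_closed[OF assms(2)] word_form_homog(1)[OF assms homog_clw] in auto)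

lemma contractR_word_form:
  assumes "word_form \<chi> \<alpha>" "homog l r' x"
  shows "H.contractR (\<alpha> x) (clw v) = (counit H x * \<chi> r' (rdeg v)) \<odot>\<^bsub>U\<^esub> clw v"
  by (rule contractR_word[OF bilin_right[OF word_form_bilin[OF assms(1)]]])
     (use homog_closed[OF assms(2)] word_form_homog(2)[OF assms homog_clw] in auto)

subsection \<open>Convolution\<close>

text \<open>The first factor only contributes the scalar \<open>\<chi>\<close> on the degrees of the left legs.\<close>

lemma convolution_word:
  assumes "word_form \<chi> \<alpha>" "bilin H H K_alg \<beta>"
  shows "sweedler H K_alg (\<lambda>a1 a2. sweedler H K_alg (\<lambda>b1 b2. \<alpha> a1 b1 * \<beta> a2 b2) (clw v)) (clw u)
    = \<chi> (ldeg u) (ldeg v) * \<beta> (clw u) (clw v)"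
proof -
  note a = word_form_bilin[OF assms(1)]
  note b = bilin_left[OF assms(2), of "clw v", simplified] bilin_right[OF assms(2), simplified]
  let ?G = "\<lambda>a1 a2. \<beta> a2 (H.contractL (\<alpha> a1) (clw v))"
  have bl: "bilin H H K_alg ?G"
    by (intro bilinI linear_maps_comp[OF H.contractL_param bilin_right[OF assms(2)]] bilin_left[OF assms(2)] H.contractL_closed
        bilin_right[OF a] bilin_left[OF a] H.kspace_H) simp_all
  have f: "(\<lambda>a2. \<chi> (ldeg u) (ldeg v) * \<beta> a2 (clw v)) \<in> linear_maps H K_alg"
    using linear_maps_smult_left[OF kspace_K_alg b(1)] by simp
  have "sweedler H K_alg ?G (clw u) = \<chi> (ldeg u) (ldeg v) * \<beta> (clw u) (clw v)"
    by (rule sweedler_left_word[OF kspace_K_alg bl f])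
       (simp add: contractL_word_form[OF assms(1) homog_clw] linear_maps_smult[OF b(2)])
  then show ?thesis by (simp add: H.convolution_formula[OF a assms(2)])
qed

lemma is_conv_inverse_form_of:
  assumes "bichar \<chi>"
  shows "is_conv_inverse H (form_of \<chi>) (form_of (\<lambda>a b. inverse (\<chi> a b)))"
proof -
  have *: "convolution H (form_of \<chi>) (form_of \<eta>) = conv_unit H"
    if "\<And>a b. \<chi> a b * \<eta> a b = 1" for \<chi> \<eta> :: "('i \<Rightarrow>\<^sub>0 int) \<Rightarrow> ('i \<Rightarrow>\<^sub>0 int) \<Rightarrow> 'k"
  proof -
    note a = word_form_form_of[of \<chi>] word_form_form_of[of \<eta>]
    note b = word_form_bilin[OF a(1)] word_form_bilin[OF a(2)]
    let ?f = "\<lambda>a b. sweedler H K_alg (\<lambda>a1 a2. sweedler H K_alg (\<lambda>b1 b2. form_of \<chi> (a1, b1) * form_of \<eta> (a2, b2)) b) a"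
    let ?f' = "\<lambda>a b. sweedler H K_alg (\<lambda>a1 a2. form_of \<eta> (a2, H.contractL (\<lambda>b1. form_of \<chi> (a1, b1)) b)) a"
    have eq: "?f x y = ?f' x y" if "x \<in> carrier U" "y \<in> carrier U" for x y
      using H.convolution_formula[OF b, of x y] that by simp
    have bc: "bilin H H K_alg (\<lambda>a b. counit H a * counit H b)"
      using H.counit_add[simplified] H.counit_smult[simplified]
      by (intro bilinI linear_mapsI) (simp_all add: algebra_simps)
    have "?f' x y = counit H x * counit H y" if "x \<in> carrier U" "y \<in> carrier U" for x y
    proof (rule bilin_eq_on_words[OF kspace_K_alg H.bilin_convolution[OF b] bc _ that])
      fix u v
      have "?f (clw u) (clw v) = \<chi> (ldeg u) (ldeg v) * (counit H (clw u) * counit H (clw v) * \<eta> (ldeg u) (ldeg v))"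
        using convolution_word[OF a(1) b(2), of v u] word_form_homog(1)[OF a(2) homog_clw homog_clw, of u v] by simp
      also have "\<dots> = counit H (clw u) * counit H (clw v)" using \<open>\<And>a b. \<chi> a b * \<eta> a b = 1\<close> by (simp add: mult_ac)
      finally show "?f' (clw u) (clw v) = counit H (clw u) * counit H (clw v)" by (simp add: eq)
    qed
    then show ?thesis unfolding convolution_def conv_unit_def
      by (intro restrict_ext) (auto simp: eq)
  qed
  show ?thesis unfolding is_conv_inverse_def
    using *[of \<chi> "\<lambda>a b. inverse (\<chi> a b)"] *[of "\<lambda>a b. inverse (\<chi> a b)" \<chi>] bichar_rules(3)[OF assms]
    by (simp add: form_of_bilinear)
qed

text \<open>By \<open>convolution_word\<close>, the values of any convolution inverse on words are
  determined, which gives the uniqueness that the definite description of the inverse requires.\<close>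

lemma conv_inverse_form_of:
  assumes "bichar \<chi>" shows "conv_inverse H (form_of \<chi>) = form_of (\<lambda>a b. inverse (\<chi> a b))"
  unfolding conv_inverse_def
proof (rule the_equality[where P = "is_conv_inverse H (form_of \<chi>)", OF is_conv_inverse_form_of[OF assms]])
  fix \<beta> assume \<beta>: "is_conv_inverse H (form_of \<chi>) \<beta>"
  then have b: "\<beta> \<in> bilinear_forms H" "convolution H (form_of \<chi>) \<beta> = conv_unit H" by (auto simp: is_conv_inverse_def)
  note bl = bilinear_forms_bilin[OF b(1)]
  show "\<beta> = form_of (\<lambda>a b. inverse (\<chi> a b))"
  proof (rule form_of_unique[OF b(1)], unfold word_form_def, intro conjI allI bl)
    fix u v
    have "convolution H (form_of \<chi>) \<beta> (clw u, clw v) = counit H (clw u) * counit H (clw v)"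
      by (simp add: b(2) conv_unit_def)
    then have "\<chi> (ldeg u) (ldeg v) * \<beta> (clw u, clw v) = counit H (clw u) * counit H (clw v)"
      using convolution_word[OF word_form_form_of bl, of \<chi> v u] by (simp add: convolution_def)
    then show "\<beta> (clw u, clw v) = counit H (clw u) * counit H (clw v) * inverse (\<chi> (ldeg u) (ldeg v))"
      using bichar_rules(3)[OF assms, of "ldeg u" "ldeg v"] by (simp add: field_simps)
  qed
qed

text \<open>On words of left degrees \<open>\<lambda>\<close>, \<open>\<mu>\<close>, \<open>\<nu>\<close>, both sides of the cocycle identity are
  \<open>\<chi>(\<lambda>, \<mu>) \<chi>(\<lambda>, \<nu>) \<chi>(\<mu>, \<nu>)\<close> times the three counits.\<close>

lemma cocycle_form_of:
  assumes "bichar \<chi>" shows "hopf_2_cocycle H (form_of \<chi>)"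
  unfolding hopf_2_cocycle_def
proof (intro conjI ballI exI[where P = "is_conv_inverse H (form_of \<chi>)", OF is_conv_inverse_form_of[OF assms]] form_of_bilinear)
  note wf = word_form_form_of[of \<chi>] and bl = word_form_bilin[OF word_form_form_of[of \<chi>]]
  note bR = bilin_right[OF bl, simplified] and bL = bilin_left[OF bl, simplified]
  note ch = bichar_rules[OF assms]
  let ?\<alpha> = "\<lambda>x y. form_of \<chi> (x, y)"
  { fix a assume a: "a \<in> carrier H"
    have w: "form_of \<chi> (clw ws, \<one>\<^bsub>U\<^esub>) = counit H (clw ws)" "form_of \<chi> (\<one>\<^bsub>U\<^esub>, clw ws) = counit H (clw ws)" for ws
      using word_form_homog(1)[OF wf homog_clw homog_one, of ws] word_form_homog(1)[OF wf homog_one homog_clw, of ws] H.counit_one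
      by (simp_all add: ch)
    show "form_of \<chi> (a, \<one>\<^bsub>H\<^esub>) = counit H a"
      using U_linear_eq[OF kspace_K_alg bL[of "\<one>\<^bsub>U\<^esub>"] _ w(1), of a] a H.counit_linear by simp
    show "form_of \<chi> (\<one>\<^bsub>H\<^esub>, a) = counit H a"
      using U_linear_eq[OF kspace_K_alg bR[of "\<one>\<^bsub>U\<^esub>"] _ w(2), of a] a H.counit_linear by simp }
  let ?L = "\<lambda>a b c. sweedler H K_alg (\<lambda>a1 a2. sweedler H K_alg (\<lambda>b1 b2. form_of \<chi> (a1, b1) * form_of \<chi> (a2 \<otimes>\<^bsub>U\<^esub> b2, c)) b) a"
  let ?R = "\<lambda>a b c. sweedler H K_alg (\<lambda>b1 b2. sweedler H K_alg (\<lambda>c1 c2. form_of \<chi> (b1, c1) * form_of \<chi> (a, b2 \<otimes>\<^bsub>U\<^esub> c2)) c) b"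
  have m: "(\<lambda>x. x \<otimes>\<^bsub>U\<^esub> y) \<in> linear_maps U U" "(\<lambda>x. y \<otimes>\<^bsub>U\<^esub> x) \<in> linear_maps U U" if "y \<in> carrier U" for y
    using bilin_left[OF U.bilin_mult that] bilin_right[OF U.bilin_mult that] by auto
  have tl: "bilin H H K_alg (\<lambda>a b. form_of \<chi> (a \<otimes>\<^bsub>U\<^esub> b, c))" if "c \<in> carrier U" for c
    unfolding bilin_H using that by (intro bilinI linear_maps_comp[OF _ bL] m)
  have tr: "bilin H H K_alg (\<lambda>a b. form_of \<chi> (c, a \<otimes>\<^bsub>U\<^esub> b))" if "c \<in> carrier U" for c
    unfolding bilin_H using that by (intro bilinI linear_maps_comp[OF _ bR] m)
  fix a b c assume abc: "a \<in> carrier H" "b \<in> carrier H" "c \<in> carrier H"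
  have L: "?L (clw u) (clw v) (clw w) = \<chi> (ldeg u) (ldeg v) * form_of \<chi> (clw (u @ v), clw w)" for u v w
    using convolution_word[OF wf tl, of "clw w" v u] by (simp add: clw_simps)
  have R: "?R (clw u) (clw v) (clw w) = \<chi> (ldeg v) (ldeg w) * form_of \<chi> (clw u, clw (v @ w))" for u v w
    using convolution_word[OF wf tr, of "clw u" w v] by (simp add: clw_simps)
  have e: "counit H (clw (u @ v)) = counit H (clw u) * counit H (clw v)" for u v
    using H.counit_mult by (simp add: clw_simps)
  have LR: "?L (clw u) (clw v) (clw w) = ?R (clw u) (clw v) (clw w)" for u v w
    unfolding L R using word_form_homog(1)[OF wf homog_clw homog_clw] by (simp add: ch e mult_ac)
  \<comment> \<open>Both sides are trilinear, which extends the identity from words to all elements.\<close>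
  note cL = H.convolution_formula[OF bl tl] H.bilin_convolution[OF bl tl] and cR = H.convolution_formula[OF bl tr] H.bilin_convolution[OF bl tr]
  let ?L' = "\<lambda>a b c. sweedler H K_alg (\<lambda>a1 a2. form_of \<chi> (a2 \<otimes>\<^bsub>U\<^esub> H.contractL (?\<alpha> a1) b, c)) a"
  let ?R' = "\<lambda>a b c. sweedler H K_alg (\<lambda>b1 b2. form_of \<chi> (a, b2 \<otimes>\<^bsub>U\<^esub> H.contractL (?\<alpha> b1) c)) b"
  have L': "?L a b c = ?L' a b c" if "a \<in> carrier U" "b \<in> carrier U" "c \<in> carrier U" for a b c
    using cL(1)[OF that(3), of a b] that by simp
  have R': "?R a b c = ?R' a b c" if "a \<in> carrier U" "b \<in> carrier U" "c \<in> carrier U" for a b c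
    using cR(1)[OF that(1), of b c] that by simp
  have hb: "bilin H H K_alg (\<lambda>a1 a2. form_of \<chi> (a2 \<otimes>\<^bsub>U\<^esub> H.contractL (?\<alpha> a1) y, z))" if "y \<in> carrier U" "z \<in> carrier U" for y z
    using that unfolding bilin_H
    by (intro bilinI linear_maps_comp[OF _ bL[OF that(2)]] m linear_maps_comp[OF H.contractL_param[OF H.kspace_H, simplified] m(2)] bR bL
        H.contractL_closed[simplified]) simp_all
  have hb': "bilin H H K_alg (\<lambda>a1 a2. form_of \<chi> (z, a2 \<otimes>\<^bsub>U\<^esub> H.contractL (?\<alpha> a1) y))" if "y \<in> carrier U" "z \<in> carrier U" for y z
    using that unfolding bilin_H
    by (intro bilinI linear_maps_comp[OF _ bR[OF that(2)]] m linear_maps_comp[OF H.contractL_param[OF H.kspace_H, simplified] m(2)] bR bL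
        H.contractL_closed[simplified]) simp_all
  have Lc: "?L' a b \<in> linear_maps U K_alg" if "a \<in> carrier U" "b \<in> carrier U" for a b
    using H.sweedler_param_linear[OF H.kspace_H kspace_K_alg hb[OF that(2)], of "\<lambda>z. z" a] that bR H.contractL_closed[simplified]
    by simp
  have Ra: "(\<lambda>a. ?R' a b c) \<in> linear_maps U K_alg" if "b \<in> carrier U" "c \<in> carrier U" for b c
    using H.sweedler_param_linear[OF H.kspace_H kspace_K_alg hb'[OF that(2)], of "\<lambda>z. z" b] that bL bR H.contractL_closed[simplified]
    by simp
  have step1: "?L' (clw u) (clw v) z = ?R' (clw u) (clw v) z" if "z \<in> carrier U" for u v z
  proof (rule U_linear_eq[OF kspace_K_alg Lc _ _ that])
    show "?R' (clw u) (clw v) \<in> linear_maps U K_alg"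
      using bilin_right[OF cR(2)[of "clw u", unfolded bilin_H], of "clw v"] by simp
    show "?L' (clw u) (clw v) (clw ws) = ?R' (clw u) (clw v) (clw ws)" for ws
      using LR[of ws v u] L'[of "clw u" "clw v" "clw ws"] R'[of "clw u" "clw v" "clw ws"] by simp
  qed auto
  have step2: "?L' (clw u) y z = ?R' (clw u) y z" if "y \<in> carrier U" "z \<in> carrier U" for u y z
  proof (rule U_linear_eq[OF kspace_K_alg, of "\<lambda>y. ?L' (clw u) y z" "\<lambda>y. ?R' (clw u) y z"])
    show "(\<lambda>y. ?L' (clw u) y z) \<in> linear_maps U K_alg"
      using bilin_right[OF cL(2)[OF that(2), unfolded bilin_H], of "clw u"] by simp
    show "(\<lambda>y. ?R' (clw u) y z) \<in> linear_maps U K_alg"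
      using bilin_left[OF cR(2)[of "clw u", unfolded bilin_H] that(2)] by simp
  qed (rule step1[OF that(2)], rule that(1))
  have "?L' a b c = ?R' a b c"
  proof (rule U_linear_eq[OF kspace_K_alg, of "\<lambda>a. ?L' a b c" "\<lambda>a. ?R' a b c"])
    show "(\<lambda>a. ?L' a b c) \<in> linear_maps U K_alg"
      using bilin_left[OF cL(2)[of c, unfolded bilin_H], of b] abc by simp
    show "(\<lambda>a. ?R' a b c) \<in> linear_maps U K_alg"
      using Ra[of b c] abc by simp
    show "a \<in> carrier U" using abc by simp
    show "?L' (clw u) b c = ?R' (clw u) b c" for u
      using step2[of b c u] abc by simp
  qed
  then show "sweedler H K_alg (\<lambda>a1 a2. sweedler H K_alg (\<lambda>b1 b2. form_of \<chi> (a1, b1) * form_of \<chi> (a2 \<otimes>\<^bsub>H\<^esub> b2, c)) b) a =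
          sweedler H K_alg (\<lambda>b1 b2. sweedler H K_alg (\<lambda>c1 c2. form_of \<chi> (b1, c1) * form_of \<chi> (a, b2 \<otimes>\<^bsub>H\<^esub> c2)) c) b"
    using L'[of a b c] R'[of a b c] abc by simp
qed

end

section \<open>The deformed Hopf algebra\<close>

context qdata
begin

abbreviation "inv_char \<chi> \<equiv> \<lambda>a b. inverse (\<chi> a b)"

abbreviation "twist_factor \<chi> l r' l2 r2 \<equiv> \<chi> l l2 * inverse (\<chi> r' r2)"

context
  fixes \<chi> :: "('i \<Rightarrow>\<^sub>0 int) \<Rightarrow> ('i \<Rightarrow>\<^sub>0 int) \<Rightarrow> 'k"
  assumes \<chi>: "bichar \<chi>"
begin

abbreviation "D \<equiv> deform H (form_of \<chi>)"
abbreviation "fa \<equiv> \<lambda>x y. form_of \<chi> (x, y)"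
abbreviation "fb \<equiv> \<lambda>x y. form_of (inv_char \<chi>) (x, y)"

lemmas ch = bichar_rules[OF \<chi>]
lemmas wa = word_form_form_of[of \<chi>] and wb = word_form_form_of[of "inv_char \<chi>"]
lemmas ba = word_form_bilin[OF wa] and bb = word_form_bilin[OF wb]

lemma D_fields [simp]:
  "carrier D = carrier U" "one D = one U" "ring.zero D = ring.zero U" "add D = add U" "module.smult D = module.smult U"
  "comult D = comult H" "counit D = counit H"
  by (simp_all add: deform_def)

lemma linear_maps_D [simp]: "linear_maps D Z = linear_maps U Z" "linear_maps Z D = linear_maps Z U"
  by (auto simp: linear_maps_def)

lemma D_mult: "a \<in> carrier U \<Longrightarrow> b \<in> carrier U \<Longrightarrow> a \<otimes>\<^bsub>D\<^esub> b = H.twisted_mult fa fb a b"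
  using H.twisted_mult_sweedler[OF ba bb, of a b] by (simp add: deform_def conv_inverse_form_of[OF \<chi>])

lemma D_antipode: "a \<in> carrier U \<Longrightarrow> antipode D a = H.twisted_antipode fa fb a"
  using H.twisted_antipode_sweedler[OF ba bb, of a] by (simp add: deform_def conv_inverse_form_of[OF \<chi>])

lemma bilin_D_mult: "bilin U U U (\<otimes>\<^bsub>D\<^esub>)"
  using H.bilin_twisted_mult[OF ba bb] unfolding bilin_H
  by (auto simp: bilin_def linear_maps_def D_mult Pi_iff)

text \<open>The form on the left legs yields \<open>\<chi>\<close> of the left degrees (\<open>sweedler_left_word\<close>), and its inverse on
  the right legs yields \<open>1 / \<chi>\<close> of the right degrees (\<open>sweedler_right_word\<close>).\<close>

lemma D_mult_word: "clw u \<otimes>\<^bsub>D\<^esub> clw v = twist_factor \<chi> (ldeg u) (rdeg u) (ldeg v) (rdeg v) \<odot>\<^bsub>U\<^esub> clw (u @ v)"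
proof -
  let ?G = "\<lambda>a1 a'. sweedler H H (\<lambda>a2 a3. a2 \<otimes>\<^bsub>U\<^esub> H.contractR (fb a3) (H.contractL (fa a1) (clw v))) a'"
  let ?g = "\<lambda>a2 a3. a2 \<otimes>\<^bsub>U\<^esub> H.contractR (fb a3) (clw v)"
  let ?f = "\<lambda>a'. \<chi> (ldeg u) (ldeg v) \<odot>\<^bsub>U\<^esub> sweedler H H ?g a'"
  note R = H.contractR_linear[OF bilin_right[OF bb], simplified]
  have bg: "bilin H H H ?g"
    unfolding bilin_H
    by (intro bilinI) (use U.linear_mult_left[OF _ H.contractR_param[OF H.kspace_H, simplified]] U.linear_mult_right[OF _ linear_maps_id]
        bilin_left[OF bb] bilin_right[OF bb] linear_maps_closed[OF R] in simp_all)
  have lg: "sweedler H H ?g \<in> linear_maps U U"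
    using H.sweedler_linear[OF H.kspace_H bg] by simp
  have f: "?f \<in> linear_maps H H"
    using linear_maps_smult_left[OF H.kspace_H, of "sweedler H H ?g" U] lg by simp
  have bG: "bilin H H H ?G"
    using H.bilin_twisted_mult_aux'[OF ba bb, of "clw v"] by simp
  have "H.twisted_mult fa fb (clw u) (clw v) = sweedler H H ?G (clw u)"
    by (simp add: H.twisted_mult_def)
  also have "\<dots> = ?f (clw u)"
  proof (rule sweedler_left_word[OF H.kspace_H bG f])
    fix ws b assume l: "ldeg ws = ldeg u" and b: "b \<in> carrier U"
    let ?k = "counit H (clw ws) * \<chi> (ldeg u) (ldeg v)"
    have sm: "(\<lambda>x. ?k \<odot>\<^bsub>U\<^esub> x) \<in> linear_maps H H"
      using linear_maps_smult_left[OF H.kspace_H linear_maps_id] by simp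
    have "?G (clw ws) b = sweedler H H (\<lambda>a2 a3. ?k \<odot>\<^bsub>U\<^esub> ?g a2 a3) b"
    proof (rule H.sweedler_cong[OF H.kspace_H])
      show "bilin H H H (\<lambda>a2 a3. ?k \<odot>\<^bsub>U\<^esub> ?g a2 a3)"
        using bg sm by (auto simp: bilin_def intro!: linear_maps_comp[OF _ sm[simplified]])
      fix a2 a3 assume "a2 \<in> carrier H" "a3 \<in> carrier H"
      then show "a2 \<otimes>\<^bsub>U\<^esub> H.contractR (fb a3) (H.contractL (fa (clw ws)) (clw v)) = ?k \<odot>\<^bsub>U\<^esub> ?g a2 a3"
        using contractL_word_form[OF wa homog_clw, of ws v] l R[of a3]
        by (simp add: linear_maps_smult[OF R] linear_maps_closed[OF R])
    qed (use b in simp)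
    also have "\<dots> = ?k \<odot>\<^bsub>U\<^esub> sweedler H H ?g b"
      using H.linear_maps_sweedler[OF H.kspace_H H.kspace_H bg sm, of b] b by simp
    finally show "?G (clw ws) b = counit H (clw ws) \<odot>\<^bsub>H\<^esub> ?f b"
      using linear_maps_closed[OF lg b] by simp
  qed
  also have "sweedler H H ?g (clw u) = inverse (\<chi> (rdeg u) (rdeg v)) \<odot>\<^bsub>U\<^esub> (clw u \<otimes>\<^bsub>U\<^esub> clw v)"
  proof (rule sweedler_right_word[OF H.kspace_H bg])
    show "(\<lambda>a. inverse (\<chi> (rdeg u) (rdeg v)) \<odot>\<^bsub>U\<^esub> (a \<otimes>\<^bsub>U\<^esub> clw v)) \<in> linear_maps H H"
      using linear_maps_smult_left[OF U.kspace_axioms U.linear_mult_right[OF cl_closed linear_maps_id]] by simp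
    fix ws a assume "rdeg ws = rdeg u" "a \<in> carrier U"
    then show "a \<otimes>\<^bsub>U\<^esub> H.contractR (fb (clw ws)) (clw v) = counit H (clw ws) \<odot>\<^bsub>H\<^esub> (inverse (\<chi> (rdeg u) (rdeg v)) \<odot>\<^bsub>U\<^esub> (a \<otimes>\<^bsub>U\<^esub> clw v))"
      using contractR_word_form[OF wb homog_clw, of ws v] by simp
  qed
  finally show ?thesis by (simp add: D_mult clw_simps)
qed

lemma D_mult_homog:
  assumes "homog l1 r1 x" "homog l2 r2 y"
  shows "x \<otimes>\<^bsub>D\<^esub> y = twist_factor \<chi> l1 r1 l2 r2 \<odot>\<^bsub>U\<^esub> (x \<otimes>\<^bsub>U\<^esub> y)"
proof -
  note L = bilin_left[OF bilin_D_mult] and R = bilin_right[OF bilin_D_mult]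
  have U: "kspace U" ..
  show ?thesis using assms(1)
  proof (induction rule: homog.induct)
    case (word ws)
    show ?case using assms(2)
    proof (induction rule: homog.induct)
      case zero
      then show ?case using linear_maps_zero[OF U U R] by simp
    next
      case (word vs)
      then show ?case using D_mult_word[of ws vs] \<open>ldeg ws = l1\<close> \<open>rdeg ws = r1\<close> by (simp add: clw_simps)
    next
      case (add x y)
      then show ?case by (simp add: linear_maps_add[OF R] homog_closed U.r_distr U.smult_add_right)
    next
      case (smult x c)
      then show ?case by (simp add: linear_maps_smult[OF R] homog_closed mult.commute)
    qed
  next
    case zero
    then show ?case using linear_maps_zero[OF U U L] homog_closed[OF assms(2)] by simp
  next
    case (add x y)
    then show ?case using homog_closed[OF assms(2)] by (simp add: linear_maps_add[OF L] homog_closed U.l_distr U.smult_add_right)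
  next
    case (smult x c)
    then show ?case using homog_closed[OF assms(2)] by (simp add: linear_maps_smult[OF L] homog_closed mult.commute)
  qed
qed

lemma D_mult_closed [simp, intro]: "x \<in> carrier U \<Longrightarrow> y \<in> carrier U \<Longrightarrow> x \<otimes>\<^bsub>D\<^esub> y \<in> carrier U"
  by (rule bilin_closed[OF bilin_D_mult])

text \<open>On words, both sides carry the same scalar because \<open>\<chi>\<close> is a bicharacter.\<close>

lemma D_assoc:
  assumes "x \<in> carrier U" "y \<in> carrier U" "z \<in> carrier U"
  shows "x \<otimes>\<^bsub>D\<^esub> y \<otimes>\<^bsub>D\<^esub> z = x \<otimes>\<^bsub>D\<^esub> (y \<otimes>\<^bsub>D\<^esub> z)"
proof -
  have U: "kspace U" ..
  note L = bilin_left[OF bilin_D_mult] and R = bilin_right[OF bilin_D_mult]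
  have w: "clw u \<otimes>\<^bsub>D\<^esub> clw v \<otimes>\<^bsub>D\<^esub> clw w = clw u \<otimes>\<^bsub>D\<^esub> (clw v \<otimes>\<^bsub>D\<^esub> clw w)" for u v w
    by (simp add: D_mult_word linear_maps_smult[OF L] linear_maps_smult[OF R] ch mult_ac inverse_mult_distrib)
  have 1: "clw u \<otimes>\<^bsub>D\<^esub> clw v \<otimes>\<^bsub>D\<^esub> z = clw u \<otimes>\<^bsub>D\<^esub> (clw v \<otimes>\<^bsub>D\<^esub> z)" for u v
  proof (rule U_linear_eq[OF U, of "\<lambda>z. clw u \<otimes>\<^bsub>D\<^esub> clw v \<otimes>\<^bsub>D\<^esub> z" "\<lambda>z. clw u \<otimes>\<^bsub>D\<^esub> (clw v \<otimes>\<^bsub>D\<^esub> z)", OF _ _ w assms(3)])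
    show "(\<lambda>z. clw u \<otimes>\<^bsub>D\<^esub> (clw v \<otimes>\<^bsub>D\<^esub> z)) \<in> linear_maps U U" by (intro linear_maps_comp[OF R R]) auto
  qed (intro R, auto)
  have 2: "clw u \<otimes>\<^bsub>D\<^esub> y \<otimes>\<^bsub>D\<^esub> z = clw u \<otimes>\<^bsub>D\<^esub> (y \<otimes>\<^bsub>D\<^esub> z)" for u
  proof (rule U_linear_eq[OF U, of "\<lambda>y. clw u \<otimes>\<^bsub>D\<^esub> y \<otimes>\<^bsub>D\<^esub> z" "\<lambda>y. clw u \<otimes>\<^bsub>D\<^esub> (y \<otimes>\<^bsub>D\<^esub> z)", OF _ _ 1 assms(2)])
    show "(\<lambda>y. clw u \<otimes>\<^bsub>D\<^esub> y \<otimes>\<^bsub>D\<^esub> z) \<in> linear_maps U U" by (intro linear_maps_comp[OF R L]) (use assms in auto)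
    show "(\<lambda>y. clw u \<otimes>\<^bsub>D\<^esub> (y \<otimes>\<^bsub>D\<^esub> z)) \<in> linear_maps U U" by (intro linear_maps_comp[OF L R]) (use assms in auto)
  qed
  show ?thesis
  proof (rule U_linear_eq[OF U, of "\<lambda>x. x \<otimes>\<^bsub>D\<^esub> y \<otimes>\<^bsub>D\<^esub> z" "\<lambda>x. x \<otimes>\<^bsub>D\<^esub> (y \<otimes>\<^bsub>D\<^esub> z)", OF _ _ 2 assms(1)])
    show "(\<lambda>x. x \<otimes>\<^bsub>D\<^esub> y \<otimes>\<^bsub>D\<^esub> z) \<in> linear_maps U U" by (intro linear_maps_comp[OF L L]) (use assms in auto)
    show "(\<lambda>x. x \<otimes>\<^bsub>D\<^esub> (y \<otimes>\<^bsub>D\<^esub> z)) \<in> linear_maps U U" by (intro L) (use assms in auto)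
  qed
qed

lemma D_one: "x \<in> carrier U \<Longrightarrow> \<one>\<^bsub>U\<^esub> \<otimes>\<^bsub>D\<^esub> x = x" "x \<in> carrier U \<Longrightarrow> x \<otimes>\<^bsub>D\<^esub> \<one>\<^bsub>U\<^esub> = x"
proof -
  have U: "kspace U" ..
  note L = bilin_left[OF bilin_D_mult U.one_closed] and R = bilin_right[OF bilin_D_mult U.one_closed]
  have w: "\<one>\<^bsub>U\<^esub> \<otimes>\<^bsub>D\<^esub> clw ws = clw ws" "clw ws \<otimes>\<^bsub>D\<^esub> \<one>\<^bsub>U\<^esub> = clw ws" for ws
    using D_mult_homog[OF homog_one homog_clw, of ws] D_mult_homog[OF homog_clw homog_one, of ws] by (simp_all add: ch)
  show "x \<in> carrier U \<Longrightarrow> \<one>\<^bsub>U\<^esub> \<otimes>\<^bsub>D\<^esub> x = x"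
    by (rule U_linear_eq[OF U R linear_maps_id w(1)])
  show "x \<in> carrier U \<Longrightarrow> x \<otimes>\<^bsub>D\<^esub> \<one>\<^bsub>U\<^esub> = x"
    by (rule U_linear_eq[OF U L linear_maps_id w(2)])
qed

lemma kalg_D: "kalg D"
proof (rule kalgI)
  show "kspace D"
    by (rule kspaceI; (rule abelian_groupI)?)
       (auto simp: U.smult_add_left U.smult_add_right U.a_ac intro: bexI[of _ "\<ominus>\<^bsub>U\<^esub> x" for x] U.l_neg)
  show "bilin D D D (\<otimes>\<^bsub>D\<^esub>)" using bilin_D_mult by (simp add: bilin_def)
qed (simp_all add: D_assoc D_one)

lemma pure_D: "pure D D = pure H H"
  by (simp add: pure_def tens_class_def tens_rel_def fun_eq_iff)

text \<open>The tensor squares of the deformed and of the original algebra only differ in the product.\<close>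

lemma tensor_D:
  "carrier (tensor D D) = carrier (tensor H H)" "add (tensor D D) = add (tensor H H)"
  "ring.zero (tensor D D) = ring.zero (tensor H H)" "module.smult (tensor D D) = module.smult (tensor H H)"
  "one (tensor D D) = one (tensor H H)"
  by (simp_all add: tensor_def pure_def tens_class_def tens_rel_def fun_eq_iff)

lemma linear_maps_tensor_D: "linear_maps B (tensor D D) = linear_maps B (tensor H H)"
  by (simp add: linear_maps_def tensor_D)

text \<open>The scalars of the two legs are \<open>\<chi>(l, l') / \<chi>(m, m')\<close> and \<open>\<chi>(m, m') / \<chi>(r, r')\<close> with the common inner
  degrees \<open>m\<close> and \<open>m'\<close>, which cancel.\<close>

lemma balanced_mult_D:
  assumes "balanced l1 r1 S" "balanced l2 r2 T"
  shows "S \<otimes>\<^bsub>tensor D D\<^esub> T = twist_factor \<chi> l1 r1 l2 r2 \<odot>\<^bsub>tensor H H\<^esub> (S \<otimes>\<^bsub>tensor H H\<^esub> T)"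
proof -
  interpret D2: kalg2 D D by (intro kalg2.intro kalg_D)
  note T = D2.kspace_tensor
  note L = bilin_left[OF D2.bilin_tensor_mult] and R = bilin_right[OF D2.bilin_tensor_mult]
  note l = linear_maps_zero[OF T T L, unfolded tensor_D] linear_maps_add[OF L, unfolded tensor_D] linear_maps_smult[OF L, unfolded tensor_D]
  note r' = linear_maps_zero[OF T T R, unfolded tensor_D] linear_maps_add[OF R, unfolded tensor_D] linear_maps_smult[OF R, unfolded tensor_D]
  show ?thesis using assms(1)
  proof (induction rule: balanced.induct)
    case (word us vs)
    show ?case using assms(2)
    proof (induction rule: balanced.induct)
      case (word us' vs')
      have "pure H H (clw us) (clw vs) \<otimes>\<^bsub>tensor D D\<^esub> pure H H (clw us') (clw vs')
        = pure H H (clw us \<otimes>\<^bsub>D\<^esub> clw us') (clw vs \<otimes>\<^bsub>D\<^esub> clw vs')"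
        using D2.pure_mult[of "clw us" "clw vs" "clw us'" "clw vs'"] by (simp add: pure_D)
      then show ?case using word \<open>ldeg us = l1\<close> \<open>rdeg us = ldeg vs\<close> \<open>rdeg vs = r1\<close>
          H.HH.pure_smult_left[simplified] H.HH.pure_smult_right[simplified] H.HH.pure_mult[simplified] H.HH.pure_closed[simplified]
        by (simp add: D_mult_word clw_simps ch(3) mult_ac)
    next
      case (add S T)
      then show ?case by (simp add: r' balanced_closed balanced.word[OF \<open>ldeg us = l1\<close> \<open>rdeg us = ldeg vs\<close> \<open>rdeg vs = r1\<close>, THEN balanced_closed] H.HH.T.r_distr H.HH.T.smult_add_right)
    next
      case (smult S c)
      then show ?case by (simp add: r' balanced_closed balanced.word[OF \<open>ldeg us = l1\<close> \<open>rdeg us = ldeg vs\<close> \<open>rdeg vs = r1\<close>, THEN balanced_closed] mult.commute)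
    qed (use balanced.word[OF \<open>ldeg us = l1\<close> \<open>rdeg us = ldeg vs\<close> \<open>rdeg vs = r1\<close>, THEN balanced_closed] in \<open>simp add: r'\<close>)
  next
    case (add S' T')
    then show ?case using balanced_closed[OF assms(2)] by (simp add: l balanced_closed H.HH.T.l_distr H.HH.T.smult_add_right)
  next
    case (smult S' c)
    then show ?case using balanced_closed[OF assms(2)] by (simp add: l balanced_closed mult.commute)
  qed (use balanced_closed[OF assms(2)] in \<open>simp add: l\<close>)
qed

text \<open>The deformed products in the algebra and in its tensor square are obtained from the original
  ones by the same scalar, by \<open>D_mult_word\<close> and \<open>balanced_mult_D\<close>.\<close>

lemma comult_alg_hom_D: "comult D \<in> alg_hom D (tensor D D)"
proof (rule alg_homI)
  interpret D2: kalg2 D D by (intro kalg2.intro kalg_D)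
  show lin: "comult D \<in> linear_maps D (tensor D D)"
    using H.comult_linear by (simp add: linear_maps_tensor_D)
  show "comult D \<one>\<^bsub>D\<^esub> = \<one>\<^bsub>tensor D D\<^esub>"
    using H.comult_one by (simp add: tensor_D H.HH.tensor_one)
  note L = bilin_left[OF D2.bilin_tensor_mult] and R = bilin_right[OF D2.bilin_tensor_mult]
  have cl: "comult H z \<in> carrier (tensor D D)" if "z \<in> carrier U" for z
    using H.comult_closed that by (simp add: tensor_D)
  fix x y assume xy: "x \<in> carrier D" "y \<in> carrier D"
  have "comult H (x \<otimes>\<^bsub>D\<^esub> y) = comult H x \<otimes>\<^bsub>tensor D D\<^esub> comult H y"
  proof (rule bilin_eq_on_words[OF D2.kspace_tensor, of "\<lambda>x y. comult H (x \<otimes>\<^bsub>D\<^esub> y)" "\<lambda>x y. comult H x \<otimes>\<^bsub>tensor D D\<^esub> comult H y"])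
    note lin' = lin[simplified]
    show "bilin H H (tensor D D) (\<lambda>x y. comult H (x \<otimes>\<^bsub>D\<^esub> y))"
      unfolding bilin_H by (intro bilinI linear_maps_comp[OF _ lin'] bilin_left[OF bilin_D_mult] bilin_right[OF bilin_D_mult])
    show "bilin H H (tensor D D) (\<lambda>x y. comult H x \<otimes>\<^bsub>tensor D D\<^esub> comult H y)"
      unfolding bilin_H by (intro bilinI linear_maps_comp[OF lin' L] linear_maps_comp[OF lin' R] cl)
    show "comult H (clw u \<otimes>\<^bsub>D\<^esub> clw v) = comult H (clw u) \<otimes>\<^bsub>tensor D D\<^esub> comult H (clw v)" for u v
      unfolding balanced_mult_D[OF balanced_comult balanced_comult] D_mult_word
      using H.comult_smult H.comult_mult by (simp add: clw_simps)
  qed (use xy in simp_all)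
  then show "comult D (x \<otimes>\<^bsub>D\<^esub> y) = comult D x \<otimes>\<^bsub>tensor D D\<^esub> comult D y" by simp
qed

text \<open>Where the counits do not vanish, left and right degrees agree and the scalar of the deformed
  product is 1.\<close>

lemma counit_alg_hom_D: "counit D \<in> alg_hom D K_alg"
proof (rule alg_homI)
  show "counit D \<in> linear_maps D K_alg" using H.counit_linear by simp
  show "counit D \<one>\<^bsub>D\<^esub> = \<one>\<^bsub>K_alg\<^esub>" using H.counit_one by simp
  fix x y assume xy: "x \<in> carrier D" "y \<in> carrier D"
  note c = H.counit_add[simplified] H.counit_smult[simplified] H.counit_mult[simplified]
  have "counit H (x \<otimes>\<^bsub>D\<^esub> y) = counit H x * counit H y"
  proof (rule bilin_eq_on_words[OF kspace_K_alg, of "\<lambda>x y. counit H (x \<otimes>\<^bsub>D\<^esub> y)" "\<lambda>x y. counit H x * counit H y"])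
    show "bilin H H K_alg (\<lambda>x y. counit H (x \<otimes>\<^bsub>D\<^esub> y))"
      unfolding bilin_H
      by (intro bilinI linear_maps_comp[OF _ H.counit_linear[simplified]] bilin_left[OF bilin_D_mult] bilin_right[OF bilin_D_mult])
    show "bilin H H K_alg (\<lambda>x y. counit H x * counit H y)"
      unfolding bilin_H by (intro bilinI linear_mapsI) (simp_all add: c algebra_simps)
    fix u v
    show "counit H (clw u \<otimes>\<^bsub>D\<^esub> clw v) = counit H (clw u) * counit H (clw v)"
      using rdeg_eq_ldeg[of u] rdeg_eq_ldeg[of v] ch(3)
      by (cases "counit H (clw u) = 0"; cases "counit H (clw v) = 0") (simp_all add: D_mult_word clw_simps c)
  qed (use xy in simp_all)
  then show "counit D (x \<otimes>\<^bsub>D\<^esub> y) = counit D x \<otimes>\<^bsub>K_alg\<^esub> counit D y" by simp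
qed

text \<open>The two outer legs on the left contribute \<open>\<chi>(\<lambda>, -\<lambda>)\<close> for the left degree \<open>\<lambda>\<close>, the two on the right
  contribute \<open>1 / \<chi>(-\<rho>, \<rho>)\<close> for the right degree \<open>\<rho>\<close>.\<close>

lemma D_antipode_word: "antipode D (clw u) = twist_factor \<chi> (ldeg u) (- rdeg u) (- ldeg u) (rdeg u) \<odot>\<^bsub>U\<^esub> antipode H (clw u)"
proof -
  let ?th = "sweedler H K_alg (\<lambda>a4 a5. fb (antipode H a4) a5)"
  let ?\<phi> = "\<lambda>x. bichar_ext \<chi> (Poly_Mapping.single (ldeg u) 1) (proj (antipode H x))"
  let ?f = "\<lambda>a'. antipode H (H.contractR ?th (H.contractL ?\<phi> a'))"
  have S: "antipode H \<in> linear_maps U U" using H.antipode_lin by simp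
  note th = H.theta_linear[OF ba bb, simplified]
  have pS: "proj (antipode H (clw ws)) = Poly_Mapping.single (- ldeg ws) (counit H (clw ws))"
     "proj (antipode H (clw ws)) = Poly_Mapping.single (- rdeg ws) (counit H (clw ws))" for ws
    using proj_homog[OF homog_antipode[of ws]] by (simp_all add: counit_antipode)
  have \<phi>: "?\<phi> \<in> linear_maps U K_alg"
    by (rule linear_maps_comp[OF S linear_maps_comp[OF proj_linear bichar_ext_linear(1)]])
  have f: "?f \<in> linear_maps H H"
    using linear_maps_comp[OF H.contractL_linear[of ?\<phi>] linear_maps_comp[OF H.contractR_linear[of ?th] H.antipode_lin]] \<phi> th by simp
  have "antipode D (clw u) = ?f (clw u)"
    unfolding D_antipode[OF cl_closed] H.twisted_antipode_def
  proof (rule sweedler_left_word[OF H.kspace_H H.bilin_twisted_antipode[OF ba bb] f])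
    fix ws b assume l: "ldeg ws = ldeg u" and b: "b \<in> carrier U"
    let ?e = "counit H (clw ws)"
    have h: "?e \<odot>\<^bsub>U\<^esub> H.contractL ?\<phi> b = H.contractL (\<lambda>x. fa (clw ws) (antipode H x)) b"
    proof -
      have "H.contractL (\<lambda>x. fa (clw ws) (antipode H x)) b = sweedler H H (\<lambda>x y. ?\<phi> x \<odot>\<^bsub>H\<^esub> (?e \<odot>\<^bsub>H\<^esub> y)) b"
        unfolding H.contractL_def
      proof (rule H.sweedler_cong[OF H.kspace_H H.bilin_contractL[OF H.kspace_H]])
        show "?\<phi> \<in> linear_maps H K_alg" using \<phi> by simp
        show "(\<lambda>y. ?e \<odot>\<^bsub>H\<^esub> y) \<in> linear_maps H H" by (rule linear_maps_smult_left[OF H.kspace_H linear_maps_id])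
        fix x y assume xy: "x \<in> carrier H" "y \<in> carrier H"
        have "Poly_Mapping.single (ldeg u) ?e = pm_scale ?e (Poly_Mapping.single (ldeg u) 1)" by simp
        then have "bichar_ext \<chi> (proj (clw ws)) (proj (antipode H x)) = ?e * ?\<phi> x"
          using linear_maps_smult[OF bichar_ext_linear(2)[of \<chi> "proj (antipode H x)"], of "Poly_Mapping.single (ldeg u) 1" ?e]
          by (simp add: proj_clw l)
        then show "fa (clw ws) (antipode H x) \<odot>\<^bsub>H\<^esub> y = ?\<phi> x \<odot>\<^bsub>H\<^esub> (?e \<odot>\<^bsub>H\<^esub> y)"
          using xy word_form_eq[OF wa, of "clw ws" "antipode H x"] by (simp add: mult.commute)
      qed (use b in simp)
      also have "\<dots> = ?e \<odot>\<^bsub>H\<^esub> H.contractL ?\<phi> b"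
        by (rule H.sweedler_left[OF H.kspace_H]) (use \<phi> b linear_maps_smult_left[OF H.kspace_H linear_maps_id] in simp_all)
      finally show ?thesis by simp
    qed
    have "H.contractL ?\<phi> b \<in> carrier U" using H.contractL_closed[of ?\<phi> b] \<phi> b by simp
    then show "antipode H (H.contractR ?th (H.contractL (\<lambda>x. fa (clw ws) (antipode H x)) b)) = ?e \<odot>\<^bsub>H\<^esub> ?f b"
      unfolding h[symmetric]
      using linear_maps_smult[OF H.contractR_linear[of ?th]] linear_maps_smult[OF S] linear_maps_closed[OF H.contractR_linear[of ?th]] th by simp
  qed
  also have "H.contractL ?\<phi> (clw u) = \<chi> (ldeg u) (- ldeg u) \<odot>\<^bsub>U\<^esub> clw u"
    by (rule contractL_word) (use \<phi> in \<open>simp_all add: pS(1) bichar_ext_single\<close>)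
  also have "H.contractR ?th (\<chi> (ldeg u) (- ldeg u) \<odot>\<^bsub>U\<^esub> clw u) = \<chi> (ldeg u) (- ldeg u) \<odot>\<^bsub>U\<^esub> H.contractR ?th (clw u)"
    using linear_maps_smult[OF H.contractR_linear[of ?th]] th by simp
  also have "H.contractR ?th (clw u) = inverse (\<chi> (- rdeg u) (rdeg u)) \<odot>\<^bsub>U\<^esub> clw u"
  proof (rule contractR_word)
    show "?th \<in> linear_maps H K_alg" using th by simp
    fix ws assume r': "rdeg ws = rdeg u"
    let ?h = "\<lambda>x. bichar_ext (inv_char \<chi>) (proj (antipode H x)) (Poly_Mapping.single (rdeg u) 1)"
    have "?th (clw ws) = ?h (clw ws)"
    proof (rule sweedler_right_word[OF kspace_K_alg H.bilin_theta[OF ba bb]])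
      show "?h \<in> linear_maps H K_alg"
        using linear_maps_comp[OF S linear_maps_comp[OF proj_linear bichar_ext_linear(2)]] by simp
      fix w' a assume w': "rdeg w' = rdeg ws" and a: "a \<in> carrier U"
      let ?e = "counit H (clw w')"
      have "Poly_Mapping.single (rdeg u) ?e = pm_scale ?e (Poly_Mapping.single (rdeg u) 1)" by simp
      then have "bichar_ext (inv_char \<chi>) (proj (antipode H a)) (proj (clw w')) = ?e * ?h a"
        using linear_maps_smult[OF bichar_ext_linear(1)[of "inv_char \<chi>" "proj (antipode H a)"], of "Poly_Mapping.single (rdeg u) 1" ?e]
        by (simp add: proj_homog(2)[OF homog_clw] w' r')
      then show "fb (antipode H a) (clw w') = ?e \<odot>\<^bsub>K_alg\<^esub> ?h a"
        using a word_form_eq[OF wb, of "antipode H a" "clw w'"] by simp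
    qed
    then show "?th (clw ws) = counit H (clw ws) * inverse (\<chi> (- rdeg u) (rdeg u))"
      by (simp add: pS(2) r' bichar_ext_single)
  qed
  finally show ?thesis using linear_maps_smult[OF S] by simp
qed

lemma antipode_alg_hom_D: "antipode D \<in> alg_hom D (opposite D)"
proof (rule alg_homI)
  have S: "antipode H \<in> linear_maps U U" using H.antipode_lin by simp
  have lin: "antipode D \<in> linear_maps U U"
    using H.twisted_antipode_linear[OF ba bb] by (simp add: linear_maps_def D_antipode Pi_iff)
  then show "antipode D \<in> linear_maps D (opposite D)" by simp
  show "antipode D \<one>\<^bsub>D\<^esub> = \<one>\<^bsub>opposite D\<^esub>"
    using D_antipode_word[of "[]"] H.antipode_one by (simp add: clw_simps(1) ch)
  fix x y assume xy: "x \<in> carrier D" "y \<in> carrier D"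
  note L = bilin_left[OF bilin_D_mult] and R = bilin_right[OF bilin_D_mult]
  have cl: "antipode D z \<in> carrier U" if "z \<in> carrier U" for z by (rule linear_maps_closed[OF lin that])
  have "antipode D (x \<otimes>\<^bsub>D\<^esub> y) = antipode D y \<otimes>\<^bsub>D\<^esub> antipode D x"
  proof (rule bilin_eq_on_words[OF H.kspace_H, of "\<lambda>x y. antipode D (x \<otimes>\<^bsub>D\<^esub> y)" "\<lambda>x y. antipode D y \<otimes>\<^bsub>D\<^esub> antipode D x"])
    show "bilin H H H (\<lambda>x y. antipode D (x \<otimes>\<^bsub>D\<^esub> y))"
      unfolding bilin_H linear_maps_H bilin_def by (intro conjI ballI linear_maps_comp[OF L lin] linear_maps_comp[OF R lin]) simp_all
    show "bilin H H H (\<lambda>x y. antipode D y \<otimes>\<^bsub>D\<^esub> antipode D x)"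
      unfolding bilin_H linear_maps_H bilin_def by (intro conjI ballI linear_maps_comp[OF lin L] linear_maps_comp[OF lin R] cl) simp_all
    fix u v
    have "antipode D (clw v) \<otimes>\<^bsub>D\<^esub> antipode D (clw u)
      = (twist_factor \<chi> (ldeg v) (- rdeg v) (- ldeg v) (rdeg v) * twist_factor \<chi> (ldeg u) (- rdeg u) (- ldeg u) (rdeg u)
         * twist_factor \<chi> (- rdeg v) (- ldeg v) (- rdeg u) (- ldeg u)) \<odot>\<^bsub>U\<^esub> (antipode H (clw v) \<otimes>\<^bsub>U\<^esub> antipode H (clw u))"
      using D_mult_homog[OF homog_antipode homog_antipode, of v u]
      by (simp add: D_antipode_word linear_maps_smult[OF L] linear_maps_smult[OF R] mult_ac)
    moreover have "antipode D (clw u \<otimes>\<^bsub>D\<^esub> clw v)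
      = (twist_factor \<chi> (ldeg u) (rdeg u) (ldeg v) (rdeg v) *
         twist_factor \<chi> (ldeg u + ldeg v) (- (rdeg u + rdeg v)) (- (ldeg u + ldeg v)) (rdeg u + rdeg v)) \<odot>\<^bsub>U\<^esub> (antipode H (clw v) \<otimes>\<^bsub>U\<^esub> antipode H (clw u))"
      using D_antipode_word[of "u @ v"] H.antipode_mult[of "clw u" "clw v"]
      by (simp add: D_mult_word linear_maps_smult[OF lin] clw_simps)
    moreover have "twist_factor \<chi> (ldeg u) (rdeg u) (ldeg v) (rdeg v) *
         twist_factor \<chi> (ldeg u + ldeg v) (- (rdeg u + rdeg v)) (- (ldeg u + ldeg v)) (rdeg u + rdeg v)
      = twist_factor \<chi> (ldeg v) (- rdeg v) (- ldeg v) (rdeg v) * twist_factor \<chi> (ldeg u) (- rdeg u) (- ldeg u) (rdeg u)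
         * twist_factor \<chi> (- rdeg v) (- ldeg v) (- rdeg u) (- ldeg u)"
      using ch(3) unfolding ch(1,2,6,7) by (simp add: field_simps)
    ultimately show "antipode D (clw u \<otimes>\<^bsub>D\<^esub> clw v) = antipode D (clw v) \<otimes>\<^bsub>D\<^esub> antipode D (clw u)" by simp
  qed (use xy in simp_all)
  then show "antipode D (x \<otimes>\<^bsub>D\<^esub> y) = antipode D x \<otimes>\<^bsub>opposite D\<^esub> antipode D y" by simp
qed

text \<open>A word is a nonzero multiple of the deformed product of its letters.\<close>

lemma generates_D: "generates D (range gg)"
  unfolding generates_def
proof (intro allI impI subsetI)
  fix S x assume S: "range gg \<subseteq> S" "\<one>\<^bsub>D\<^esub> \<in> S" "\<forall>x\<in>S \<inter> carrier D. \<forall>y\<in>S \<inter> carrier D. x \<oplus>\<^bsub>D\<^esub> y \<in> S \<and> x \<otimes>\<^bsub>D\<^esub> y \<in> S"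
    "\<forall>c. \<forall>x\<in>S \<inter> carrier D. c \<odot>\<^bsub>D\<^esub> x \<in> S"
  assume "x \<in> carrier D"
  then have "x \<in> carrier U" by simp
  then show "x \<in> S"
  proof (induction rule: U_induct)
    case zero
    have "0 \<odot>\<^bsub>D\<^esub> \<one>\<^bsub>D\<^esub> \<in> S" by (rule S(4)[rule_format]) (use S(2) in simp)
    then show ?case by simp
  next
    case (word ws)
    then show ?case
    proof (induction ws)
      case (Cons x ws)
      let ?k = "twist_factor \<chi> (ldeg [x]) (rdeg [x]) (ldeg ws) (rdeg ws)"
      have k: "?k \<noteq> 0" by (simp add: ch(3))
      have "gg x \<otimes>\<^bsub>D\<^esub> clw ws \<in> S" using S(1,3) Cons by auto
      then have "inverse ?k \<odot>\<^bsub>D\<^esub> (gg x \<otimes>\<^bsub>D\<^esub> clw ws) \<in> S" using S(4) by auto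
      moreover have e: "gg x \<otimes>\<^bsub>D\<^esub> clw ws = ?k \<odot>\<^bsub>U\<^esub> clw (x # ws)"
        using D_mult_word[of "[x]" ws] by (simp add: clw_singleton)
      have "inverse ?k \<odot>\<^bsub>D\<^esub> (gg x \<otimes>\<^bsub>D\<^esub> clw ws) = clw (x # ws)"
        unfolding e D_fields U.smult_smult[OF cl_closed] left_inverse[OF k] by (rule U.smult_one[OF cl_closed])
      ultimately show ?case by simp
    qed (use S(2) in \<open>simp add: clw_simps\<close>)
  qed (use S(3,4) in simp_all)
qed

lemma prehopf_D: "prehopf D (range gg)"
  by (intro prehopf.intro kalg_D prehopf_axioms.intro generates_D comult_alg_hom_D counit_alg_hom_D antipode_alg_hom_D) auto

lemma D_structure_gen:
  "antipode D (gg x) = twist_factor \<chi> (lgen x) (- rgen x) (- lgen x) (rgen x) \<odot>\<^bsub>U\<^esub> sgen U gg x"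
  using D_antipode_word[of "[x]"] by (simp add: clw_singleton structure_gen)

lemma D_torus: "torus t \<Longrightarrow> gg t \<otimes>\<^bsub>D\<^esub> gg (tinv t) = \<one>\<^bsub>U\<^esub>"
  using D_mult_homog[OF homog_gen[of t] homog_gen[of "tinv t"]] qrep.rel_inv[OF qrep_U, of t] ch(3)
  by (cases t) (simp_all)

text \<open>The scalars in the deformed antipode of \<open>e\<^sub>i\<close> and in the deformed product of \<open>\<omega>\<^sub>i\<^sup>-\<^sup>1\<close> and \<open>e\<^sub>i\<close> coincide,
  hence the deformed antipode is given on generators by the usual formula for the deformed product.\<close>

lemma D_antipode_gen: "antipode D (gg x) = sgen D gg x"
proof (cases x)
  case (Ge i)
  then show ?thesis using D_mult_homog[OF homog_gen[of "Gw_inv i"] homog_gen[of "Ge i"]] by (simp add: D_structure_gen ch)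
next
  case (Gf i)
  then show ?thesis using D_mult_homog[OF homog_gen[of "Gf i"] homog_gen[of "Gw'_inv i"]] by (simp add: D_structure_gen ch)
qed (use ch(3) in \<open>simp_all add: D_structure_gen ch\<close>)

lemma hopf_algebra_D: "hopf_algebra D"
proof -
  interpret D: prehopf D "range gg" by (rule prehopf_D)
  note S = D_antipode_gen
  have gl: "D.group_like (gg t) (gg (tinv t))" if "torus t" for t
    using that D_torus[of t] D_torus[of "tinv t"] ch(3)
    by (cases t) (auto simp: D.group_like_def structure_gen pure_D pure_H S ch)
  show ?thesis
  proof (rule D.hopf_from_skew_primitives)
    fix x assume "x \<in> range gg"
    then obtain y where x: "x = gg y" by auto
    have t: "\<exists>w'. D.group_like x w'" if "torus y" using gl[OF that] x by blast
    show "(\<exists>w'. D.group_like x w') \<or> (\<exists>w. D.skew_left x w) \<or> (\<exists>w. D.skew_right x w)"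
    proof (cases y)
      case (Ge i)
      have "D.skew_left x (gg (Gw i))" unfolding D.skew_left_def
        using gl[of "Gw i"] by (auto simp: x Ge S structure_gen pure_D pure_H tensor_H tensor_D)
      then show ?thesis by blast
    next
      case (Gf i)
      have "D.skew_right x (gg (Gw' i))" unfolding D.skew_right_def
        using gl[of "Gw' i"] by (auto simp: x Gf S structure_gen pure_D pure_H tensor_H tensor_D)
      then show ?thesis by blast
    qed (use t in simp_all)
  qed
qed

end

end

section \<open>The spanning set of ordered monomials\<close>

definition tpow :: "('i \<Rightarrow> 'i generator) \<Rightarrow> 'i \<Rightarrow> int \<Rightarrow> 'i generator list" where
  "tpow T i n = (if 0 \<le> n then replicate (nat n) (T i) else replicate (nat (- n)) (tinv (T i)))"

definition tword :: "('i \<Rightarrow> 'i generator) \<Rightarrow> ('i \<Rightarrow> int) \<Rightarrow> 'i list \<Rightarrow> 'i generator list" where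
  "tword T \<mu> ks = concat (map (\<lambda>i. tpow T i (\<mu> i)) ks)"

abbreviation "Kw \<mu> \<equiv> tword Gw \<mu> (sorted_list_of_set UNIV)"
abbreviation "Kw' \<mu> \<equiv> tword Gw' \<mu> (sorted_list_of_set UNIV)"

lemma word_monom_replicate: "word_monom (replicate n x) = gvar x ^ n"
  by (induction n) (simp_all add: word_monom_Nil word_monom_Cons)

lemma word_monom_concat: "word_monom (concat ws) = prod_list (map word_monom ws)"
  by (induction ws) (simp_all add: word_monom_Nil word_monom_append)

lemma K_mon_word: "K_mon \<mu> = word_monom (Kw \<mu>)" "K'_mon \<mu> = word_monom (Kw' \<mu>)"
  by (simp_all add: K_mon_def K'_mon_def tword_def word_monom_concat comp_def tpow_def if_distrib[of word_monom] word_monom_replicate cong: if_cong)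

lemma EF_mon_word: "E_mon es = word_monom (map Ge es)" "F_mon fs = word_monom (map Gf fs)"
proof -
  show "E_mon es = word_monom (map Ge es)" by (induction es) (simp_all add: E_mon_def word_monom_Nil word_monom_Cons)
  show "F_mon fs = word_monom (map Gf fs)" by (induction fs) (simp_all add: F_mon_def word_monom_Nil word_monom_Cons)
qed

lemma torus_tword: "(\<And>i. torus (T i)) \<Longrightarrow> list_all torus (tword T \<mu> ks)"
  by (auto simp: tword_def tpow_def list_all_iff split: if_splits)

lemma ldeg_tpow:
  assumes "\<And>i. lgen (T i) = sroot i" "\<And>i. lgen (tinv (T i)) = - sroot i"
  shows "ldeg (tpow T i n) = Poly_Mapping.single i n"
proof -
  have "ldeg (replicate m (T i)) = Poly_Mapping.single i (int m)" "ldeg (replicate m (tinv (T i))) = Poly_Mapping.single i (- int m)" for m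
    by (induction m) (simp_all add: assms single_add[symmetric] single_uminus[symmetric] algebra_simps)
  then show ?thesis by (simp add: tpow_def)
qed

lemma lookup_ldeg_tword:
  assumes "\<And>i. lgen (T i) = sroot i" "\<And>i. lgen (tinv (T i)) = - sroot i" "distinct ks"
  shows "Poly_Mapping.lookup (ldeg (tword T \<mu> ks)) i = (if i \<in> set ks then \<mu> i else 0)"
  using assms(3)
  by (induction "ks") (auto simp: tword_def lookup_add ldeg_tpow[OF assms(1,2)] lookup_single when_def)

lemma ldeg_Kw: "Poly_Mapping.lookup (ldeg (Kw \<mu> @ Kw' \<nu>)) = (\<lambda>i :: 'i::{finite,linorder}. \<mu> i + \<nu> i)"
  by (simp add: fun_eq_iff lookup_add lookup_ldeg_tword)

context qdata
begin

interpretation q: qrep A d r s U gg by (rule qrep_U)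

lemma counit_torus_word: "list_all torus ws \<Longrightarrow> counit H (clw ws) = 1"
proof (induction ws)
  case Nil
  then show ?case using H.counit_one by (simp add: clw_simps)
next
  case (Cons x ws)
  then show ?case using counit_clw_Cons[of x ws] by (cases x) auto
qed

lemma counit_word_zero: "\<not> list_all torus ws \<Longrightarrow> counit H (clw ws) = 0"
proof (induction ws)
  case (Cons x ws)
  then show ?case using counit_clw_Cons[of x ws] by (cases x) auto
qed simp

lemma torus_word_commute: "torus t \<Longrightarrow> list_all torus ws \<Longrightarrow> gg t \<otimes>\<^bsub>U\<^esub> clw ws = clw ws \<otimes>\<^bsub>U\<^esub> gg t"
proof (induction ws)
  case (Cons x ws)
  have "gg t \<otimes>\<^bsub>U\<^esub> (gg x \<otimes>\<^bsub>U\<^esub> clw ws) = gg x \<otimes>\<^bsub>U\<^esub> (gg t \<otimes>\<^bsub>U\<^esub> clw ws)"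
    using Cons.prems by (simp add: q.reorder(3))
  then show ?case using Cons by (simp add: clw_simps(2) U.m_assoc)
qed (simp add: clw_simps)

lemma tpow_step:
  assumes "\<And>i. torus (T i)" shows "gg (T i) \<otimes>\<^bsub>U\<^esub> clw (tpow T i n) = clw (tpow T i (n + 1))"
proof (cases "0 \<le> n")
  case True
  then show ?thesis by (simp add: tpow_def nat_add_distrib clw_simps(2)[symmetric])
next
  case False
  then obtain m where n: "n = - int (Suc m)" by (metis int_cases not_le of_nat_0_le_iff)
  have nm: "nat (- n) = Suc m" using n by simp
  have "clw (tpow T i n) = gg (tinv (T i)) \<otimes>\<^bsub>U\<^esub> clw (replicate m (tinv (T i)))"
    using nm False by (simp add: tpow_def clw_simps(2)[symmetric])
  then have "gg (T i) \<otimes>\<^bsub>U\<^esub> clw (tpow T i n) = clw (replicate m (tinv (T i)))"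
    using assms[of i] by (simp add: q.reorder(4))
  also have "replicate m (tinv (T i)) = tpow T i (n + 1)"
  proof (cases "m = 0")
    case False
    have "nat (- (n + 1)) = m" "\<not> 0 \<le> n + 1" using n False by simp_all
    then show ?thesis by (simp only: tpow_def if_False)
  qed (simp add: tpow_def n)
  finally show ?thesis .
qed

lemma tword_step:
  assumes T: "\<And>i. torus (T i)" and "distinct ks" "i \<in> set ks"
  shows "gg (T i) \<otimes>\<^bsub>U\<^esub> clw (tword T \<mu> ks) = clw (tword T (\<mu>(i := \<mu> i + 1)) ks)"
  using assms(2,3)
proof (induction "ks")
  case (Cons j js)
  have sp: "clw (tword T \<nu> (j # js)) = clw (tpow T j (\<nu> j)) \<otimes>\<^bsub>U\<^esub> clw (tword T \<nu> js)" for \<nu>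
    by (simp add: tword_def clw_simps)
  show ?case
  proof (cases "i = j")
    case True
    then have "tword T (\<mu>(i := \<mu> i + 1)) js = tword T \<mu> js"
      using Cons.prems by (auto simp: tword_def intro!: arg_cong[of _ _ concat])
    then show ?thesis unfolding sp using tpow_step[where T = T and i = i and n = "\<mu> i", OF T] True by (simp add: U.m_assoc[symmetric])
  next
    case False
    have "list_all torus (tpow T j (\<mu> j))" using torus_tword[where T = T and \<mu> = \<mu> and ks = "[j]", OF T] by (simp add: tword_def)
    then have "gg (T i) \<otimes>\<^bsub>U\<^esub> clw (tpow T j (\<mu> j)) = clw (tpow T j (\<mu> j)) \<otimes>\<^bsub>U\<^esub> gg (T i)"
      by (rule torus_word_commute[OF T])
    moreover have "gg (T i) \<otimes>\<^bsub>U\<^esub> clw (tword T \<mu> js) = clw (tword T (\<mu>(i := \<mu> i + 1)) js)"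
      by (rule Cons.IH) (use Cons.prems False in auto)
    moreover have "(\<mu>(i := \<mu> i + 1)) j = \<mu> j" using False by simp
    ultimately show ?thesis unfolding sp by (metis U.m_assoc cl_closed)
  qed
qed simp

lemma tword_step_inv:
  assumes T: "\<And>i. torus (T i)" and "distinct ks" "i \<in> set ks"
  shows "gg (tinv (T i)) \<otimes>\<^bsub>U\<^esub> clw (tword T \<mu> ks) = clw (tword T (\<mu>(i := \<mu> i - 1)) ks)"
  using tword_step[where T = T and \<mu> = "\<mu>(i := \<mu> i - 1)", OF assms] q.reorder(5)[OF cl_closed T] by (metis (no_types, lifting) diff_add_cancel fun_upd_same fun_upd_triv fun_upd_upd)

end

locale qfin = qdata A d r s for A :: "'i::{finite,linorder} \<Rightarrow> 'i \<Rightarrow> int" and d and r s :: "'k::field"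
begin

interpretation q: qrep A d r s U gg by (rule qrep_U)

definition pbw_word :: "'i list \<Rightarrow> ('i \<Rightarrow> int) \<Rightarrow> ('i \<Rightarrow> int) \<Rightarrow> 'i list \<Rightarrow> 'i generator list" where
  "pbw_word fs lam rho es = map Gf fs @ (Kw lam @ Kw' rho) @ map Ge es"

text \<open>The span of the ordered monomials.\<close>

inductive pbw :: "('i, 'k) free_alg set \<Rightarrow> bool" where
  zero: "pbw \<zero>\<^bsub>U\<^esub>"
| word: "pbw (clw (pbw_word fs lam rho es))"
| add: "pbw x \<Longrightarrow> pbw y \<Longrightarrow> pbw (x \<oplus>\<^bsub>U\<^esub> y)"
| smult: "pbw x \<Longrightarrow> pbw (c \<odot>\<^bsub>U\<^esub> x)"

lemma pbw_closed: "pbw x \<Longrightarrow> x \<in> carrier U"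
  by (induction rule: pbw.induct) auto

lemma pbw_left_mult:
  assumes "x \<in> carrier U" "\<And>fs lam rho es. pbw (x \<otimes>\<^bsub>U\<^esub> clw (pbw_word fs lam rho es))" "pbw z"
  shows "pbw (x \<otimes>\<^bsub>U\<^esub> z)"
  using assms(3)
proof (induction rule: pbw.induct)
  case zero
  then show ?case using assms(1) pbw.zero by simp
next
  case (word fs lam rho es)
  then show ?case by (rule assms(2))
next
  case (add y z)
  then show ?case using assms(1) pbw.add by (simp add: U.r_distr pbw_closed)
next
  case (smult y c)
  then show ?case using assms(1) pbw.smult by (simp add: pbw_closed)
qed

lemma pbw_f: "pbw z \<Longrightarrow> pbw (gg (Gf i) \<otimes>\<^bsub>U\<^esub> z)"
proof (rule pbw_left_mult)
  fix fs lam rho es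
  show "pbw (gg (Gf i) \<otimes>\<^bsub>U\<^esub> clw (pbw_word fs lam rho es))"
    using pbw.word[of "i # fs" lam rho es] by (simp add: pbw_word_def clw_simps(2))
qed auto

lemma torus_step:
  assumes "torus t" shows "\<exists>lam' rho'. gg t \<otimes>\<^bsub>U\<^esub> clw (Kw lam @ Kw' rho) = clw (Kw lam' @ Kw' rho')"
proof -
  have c: "gg t \<otimes>\<^bsub>U\<^esub> clw (Kw lam @ Kw' rho) = clw (Kw lam) \<otimes>\<^bsub>U\<^esub> (gg t \<otimes>\<^bsub>U\<^esub> clw (Kw' rho))"
    using torus_word_commute[OF assms torus_tword[of Gw lam "sorted_list_of_set UNIV"]]
    by (simp add: clw_simps(3) U.m_assoc[symmetric])
  have s: "gg t \<otimes>\<^bsub>U\<^esub> clw (Kw lam @ Kw' rho) = (gg t \<otimes>\<^bsub>U\<^esub> clw (Kw lam)) \<otimes>\<^bsub>U\<^esub> clw (Kw' rho)"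
    by (simp add: clw_simps(3) U.m_assoc)
  note st = tword_step[of Gw "sorted_list_of_set UNIV"] tword_step_inv[of Gw "sorted_list_of_set UNIV"]
    tword_step[of Gw' "sorted_list_of_set UNIV"] tword_step_inv[of Gw' "sorted_list_of_set UNIV"]
  show ?thesis
  proof (cases t)
    case (Gw i)
    then show ?thesis unfolding s by (simp add: st clw_simps(3)[symmetric]) blast
  next
    case (Gw_inv i)
    then show ?thesis unfolding s using st(2)[of i lam] by (simp add: clw_simps(3)[symmetric]) blast
  next
    case (Gw' i)
    then show ?thesis unfolding c by (simp add: st clw_simps(3)[symmetric]) blast
  next
    case (Gw'_inv i)
    then show ?thesis unfolding c using st(4)[of i rho] by (simp add: clw_simps(3)[symmetric]) blast
  qed (use assms in auto)
qed

lemma pbw_torus: "torus t \<Longrightarrow> pbw z \<Longrightarrow> pbw (gg t \<otimes>\<^bsub>U\<^esub> z)"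
proof (rule pbw_left_mult)
  fix fs lam rho es assume t: "torus t"
  have "\<exists>c. gg t \<otimes>\<^bsub>U\<^esub> clw (map Gf fs) = c \<odot>\<^bsub>U\<^esub> (clw (map Gf fs) \<otimes>\<^bsub>U\<^esub> gg t)"
  proof (induction fs)
    case Nil
    then show ?case using U.smult_one[of "gg t"] by (auto simp: clw_simps(1) intro!: exI[of _ 1])
  next
    case (Cons j fs)
    then obtain c where c: "gg t \<otimes>\<^bsub>U\<^esub> clw (map Gf fs) = c \<odot>\<^bsub>U\<^esub> (clw (map Gf fs) \<otimes>\<^bsub>U\<^esub> gg t)" by blast
    have "gg t \<otimes>\<^bsub>U\<^esub> clw (map Gf (j # fs)) = (inverse (wt A d r s t j) * c) \<odot>\<^bsub>U\<^esub> (clw (map Gf (j # fs)) \<otimes>\<^bsub>U\<^esub> gg t)"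
      using q.reorder(1)[OF cl_closed t] by (simp add: clw_simps(2) c U.m_assoc)
    then show ?case by blast
  qed
  then obtain c where c: "gg t \<otimes>\<^bsub>U\<^esub> clw (map Gf fs) = c \<odot>\<^bsub>U\<^esub> (clw (map Gf fs) \<otimes>\<^bsub>U\<^esub> gg t)" by blast
  obtain lam' rho' where k: "gg t \<otimes>\<^bsub>U\<^esub> clw (Kw lam @ Kw' rho) = clw (Kw lam' @ Kw' rho')"
    using torus_step[OF t] by blast
  let ?F = "clw (map Gf fs)" and ?K = "clw (Kw lam @ Kw' rho)" and ?E = "clw (map Ge es)"
  have "gg t \<otimes>\<^bsub>U\<^esub> clw (pbw_word fs lam rho es) = (gg t \<otimes>\<^bsub>U\<^esub> ?F) \<otimes>\<^bsub>U\<^esub> (?K \<otimes>\<^bsub>U\<^esub> ?E)"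
    by (simp only: pbw_word_def clw_simps(3)[of "map Gf fs"] clw_simps(3)[of "Kw lam @ Kw' rho"] U.m_assoc cl_closed U.m_closed)
  also have "\<dots> = c \<odot>\<^bsub>U\<^esub> (?F \<otimes>\<^bsub>U\<^esub> ((gg t \<otimes>\<^bsub>U\<^esub> ?K) \<otimes>\<^bsub>U\<^esub> ?E))"
    unfolding c by (simp only: U.smult_mult_left U.m_assoc cl_closed U.m_closed)
  also have "\<dots> = c \<odot>\<^bsub>U\<^esub> clw (pbw_word fs lam' rho' es)"
    unfolding k by (simp only: pbw_word_def clw_simps(3)[of "map Gf fs"] clw_simps(3)[of "Kw lam' @ Kw' rho'"])
  finally show "pbw (gg t \<otimes>\<^bsub>U\<^esub> clw (pbw_word fs lam rho es))" by (simp add: pbw.word pbw.smult)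
qed auto

lemma pbw_e: "pbw z \<Longrightarrow> pbw (gg (Ge i) \<otimes>\<^bsub>U\<^esub> z)"
proof (rule pbw_left_mult)
  fix fs lam rho es
  show "pbw (gg (Ge i) \<otimes>\<^bsub>U\<^esub> clw (pbw_word fs lam rho es))"
  proof (induction fs)
    case Nil
    have "\<exists>c. gg (Ge i) \<otimes>\<^bsub>U\<^esub> clw ts = c \<odot>\<^bsub>U\<^esub> (clw ts \<otimes>\<^bsub>U\<^esub> gg (Ge i))" if "list_all torus ts" for ts
      using that
    proof (induction ts)
      case Nil
      then show ?case using U.smult_one[of "gg (Ge i)"] by (auto simp: clw_simps(1) intro!: exI[of _ 1])
    next
      case (Cons t ts)
      then obtain c where c: "gg (Ge i) \<otimes>\<^bsub>U\<^esub> clw ts = c \<odot>\<^bsub>U\<^esub> (clw ts \<otimes>\<^bsub>U\<^esub> gg (Ge i))" by auto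
      have "gg (Ge i) \<otimes>\<^bsub>U\<^esub> clw (t # ts) = (inverse (wt A d r s t i) * c) \<odot>\<^bsub>U\<^esub> (clw (t # ts) \<otimes>\<^bsub>U\<^esub> gg (Ge i))"
        using q.reorder(2)[OF cl_closed, of t i] Cons.prems by (simp add: clw_simps(2) c U.m_assoc)
      then show ?case by blast
    qed
    moreover have "list_all torus (Kw lam @ Kw' rho)" using torus_tword[of Gw] torus_tword[of Gw'] by auto
    ultimately obtain c where c: "gg (Ge i) \<otimes>\<^bsub>U\<^esub> clw (Kw lam @ Kw' rho) = c \<odot>\<^bsub>U\<^esub> (clw (Kw lam @ Kw' rho) \<otimes>\<^bsub>U\<^esub> gg (Ge i))" by blast
    let ?K = "clw (Kw lam @ Kw' rho)"
    have "gg (Ge i) \<otimes>\<^bsub>U\<^esub> clw (pbw_word [] lam rho es) = (gg (Ge i) \<otimes>\<^bsub>U\<^esub> ?K) \<otimes>\<^bsub>U\<^esub> clw (map Ge es)"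
      by (simp only: pbw_word_def list.map append_Nil clw_simps(3)[of "Kw lam @ Kw' rho"] U.m_assoc cl_closed)
    also have "\<dots> = c \<odot>\<^bsub>U\<^esub> clw (pbw_word [] lam rho (i # es))"
      unfolding c by (simp only: pbw_word_def list.map append_Nil clw_simps(3)[of "Kw lam @ Kw' rho"] clw_simps(2) U.m_assoc U.smult_mult_left cl_closed U.m_closed)
    finally show ?case by (simp add: pbw.word pbw.smult)
  next
    case (Cons j fs)
    let ?w = "clw (pbw_word fs lam rho es)"
    have "gg (Ge i) \<otimes>\<^bsub>U\<^esub> clw (pbw_word (j # fs) lam rho es) = (gg (Ge i) \<otimes>\<^bsub>U\<^esub> gg (Gf j)) \<otimes>\<^bsub>U\<^esub> ?w"
      by (simp add: pbw_word_def clw_simps(2) U.m_assoc)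
    also have "\<dots> = gg (Gf j) \<otimes>\<^bsub>U\<^esub> (gg (Ge i) \<otimes>\<^bsub>U\<^esub> ?w)
       \<oplus>\<^bsub>U\<^esub> (if i = j then ef_coeff i \<odot>\<^bsub>U\<^esub> (gg (Gw i) \<otimes>\<^bsub>U\<^esub> ?w \<oplus>\<^bsub>U\<^esub> (- 1) \<odot>\<^bsub>U\<^esub> (gg (Gw' i) \<otimes>\<^bsub>U\<^esub> ?w)) else \<zero>\<^bsub>U\<^esub>)"
      unfolding q.rel_ef by (cases "i = j") (simp_all add: U.l_distr U.m_assoc)
    finally show ?case
      using pbw_f[OF Cons, of j] pbw_torus[OF _ pbw.word[of fs lam rho es], of "Gw i"] pbw_torus[OF _ pbw.word[of fs lam rho es], of "Gw' i"]
      by (auto intro!: pbw.add pbw.smult pbw.zero simp del: U.smult_smult)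
  qed
qed auto

text \<open>The span contains the empty word and is stable under left multiplication by the generators: an
  \<open>e\<^sub>i\<close> is moved to the right across the \<open>f\<^sub>j\<close>, where the commutator leaves torus elements, and
  across the torus, where it picks up a scalar.\<close>

lemma pbw_all: "x \<in> carrier U \<Longrightarrow> pbw x"
proof (induction rule: U_induct)
  case (word ws)
  show ?case
  proof (induction ws)
    case Nil
    have "tword T (\<lambda>_. 0) ks = []" for T and "ks" :: "'i list" by (simp add: tword_def tpow_def)
    then show ?case using pbw.word[of "[]" "\<lambda>_. 0" "\<lambda>_. 0" "[]"] by (simp add: pbw_word_def)
  next
    case (Cons x ws)
    then show ?case unfolding clw_simps(2) by (cases x) (auto intro!: pbw_e pbw_f pbw_torus)
  qed
qed (auto intro: pbw.intros)

lemma linear_eq_on_pbw: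
  assumes "kspace Z" "f \<in> linear_maps U Z" "f' \<in> linear_maps U Z"
    and "\<And>fs lam rho es. f (clw (pbw_word fs lam rho es)) = f' (clw (pbw_word fs lam rho es))" and "x \<in> carrier U"
  shows "f x = f' x"
proof -
  have U: "kspace U" ..
  show ?thesis using pbw_all[OF assms(5)]
    by (induction rule: pbw.induct)
       (simp_all add: assms(4) linear_maps_zero[OF U assms(1)] assms(2,3) linear_maps_add[OF assms(2)] linear_maps_add[OF assms(3)]
         linear_maps_smult[OF assms(2)] linear_maps_smult[OF assms(3)] pbw_closed)
qed

text \<open>Ordered monomials with a nontrivial \<open>f\<close>- or \<open>e\<close>-part are killed by \<open>proj\<close>, so the two forms agree
  on pairs of ordered monomials, which span.\<close>

lemma form_of_characterization:
  assumes b: "f \<in> bilinear_forms H"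
    and t: "\<And>lam rho lam' rho'. f (clw (Kw lam @ Kw' rho), clw (Kw lam' @ Kw' rho'))
        = \<chi> (ldeg (Kw lam @ Kw' rho)) (ldeg (Kw lam' @ Kw' rho'))"
    and z: "\<And>fs lam rho es y. \<not> (fs = [] \<and> es = []) \<Longrightarrow> y \<in> carrier U \<Longrightarrow>
        f (clw (pbw_word fs lam rho es), y) = 0 \<and> f (y, clw (pbw_word fs lam rho es)) = 0"
  shows "f = form_of \<chi>"
proof (rule form_of_unique[OF b], unfold word_form_def, intro conjI allI bilinear_forms_bilin[OF b])
  note bl = bilinear_forms_bilin[OF b] and sl = bilin_sform[of \<chi>]
  have tor: "list_all torus (Kw lam @ Kw' rho)" for lam rho :: "'i \<Rightarrow> int"
    using torus_tword[of Gw] torus_tword[of Gw'] by auto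
  have nt: "counit H (clw (pbw_word fs lam rho es)) = 0" if "\<not> (fs = [] \<and> es = [])" for fs lam rho es
    by (rule counit_word_zero) (use that in \<open>cases fs; cases es; auto simp: pbw_word_def\<close>)
  have sz: "sform \<chi> x y = 0" "sform \<chi> y x = 0" if "proj x = 0" for x y
    using linear_maps_smult[OF bichar_ext_linear(2)[of \<chi> "proj y"], of 0 0] linear_maps_smult[OF bichar_ext_linear(1)[of \<chi> "proj y"], of 0 0]
    by (simp_all add: sform_def that)
  have e: "f (clw (pbw_word fs lam rho es), clw (pbw_word fs' lam' rho' es')) = sform \<chi> (clw (pbw_word fs lam rho es)) (clw (pbw_word fs' lam' rho' es'))"
    for fs lam rho es fs' lam' rho' es'
  proof -
    consider "fs = [] \<and> es = []" "fs' = [] \<and> es' = []" | "\<not> (fs = [] \<and> es = [])" | "\<not> (fs' = [] \<and> es' = [])" by blast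
    then show ?thesis
    proof cases
      case 1
      then show ?thesis using t[of lam rho lam' rho']
        by (simp add: pbw_word_def sform_def proj_clw bichar_ext_single counit_torus_word[OF tor, simplified])
    qed (simp_all add: z sz proj_clw nt)
  qed
  have "f (x, y) = sform \<chi> x y" if x: "x \<in> carrier U" and y: "y \<in> carrier U" for x y
  proof -
    have "f (x, clw (pbw_word fs lam rho es)) = sform \<chi> x (clw (pbw_word fs lam rho es))" for fs lam rho es
      by (rule linear_eq_on_pbw[OF kspace_K_alg bilin_left[OF bl[unfolded bilin_H] cl_closed] bilin_left[OF sl[unfolded bilin_H] cl_closed] e x])
    then show ?thesis
      by (rule linear_eq_on_pbw[OF kspace_K_alg bilin_right[OF bl[unfolded bilin_H] x] bilin_right[OF sl[unfolded bilin_H] x] _ y])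
  qed
  then show "f (clw u, clw v) = counit H (clw u) * counit H (clw v) * \<chi> (ldeg u) (ldeg v)" for u v
    by (simp add: sform_def proj_clw bichar_ext_single)
qed

lemma form_of_torus: "form_of \<chi> (clw (Kw lam @ Kw' rho), clw (Kw lam' @ Kw' rho')) = \<chi> (ldeg (Kw lam @ Kw' rho)) (ldeg (Kw lam' @ Kw' rho'))"
proof -
  have tor: "list_all torus (Kw lam @ Kw' rho)" for lam rho :: "'i \<Rightarrow> int"
    using torus_tword[of Gw] torus_tword[of Gw'] by auto
  show ?thesis by (simp add: form_of_eq sform_def proj_clw bichar_ext_single counit_torus_word[OF tor, simplified])
qed

lemma form_of_vanishes:
  assumes "\<not> (fs = [] \<and> es = [])" "y \<in> carrier U"
  shows "form_of \<chi> (clw (pbw_word fs lam rho es), y) = 0 \<and> form_of \<chi> (y, clw (pbw_word fs lam rho es)) = 0"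
proof -
  have "counit H (clw (pbw_word fs lam rho es)) = 0"
    by (rule counit_word_zero) (use assms(1) in \<open>cases fs; cases es; auto simp: pbw_word_def\<close>)
  then show ?thesis
    using linear_maps_smult[OF bichar_ext_linear(2)[of \<chi> "proj y"], of 0 0] linear_maps_smult[OF bichar_ext_linear(1)[of \<chi> "proj y"], of 0 0] assms(2)
    by (simp add: form_of_eq sform_def proj_clw)
qed

end

section \<open>Comparing two quantum groups\<close>

context qdata
begin

context
  fixes \<chi> :: "('i \<Rightarrow>\<^sub>0 int) \<Rightarrow> ('i \<Rightarrow>\<^sub>0 int) \<Rightarrow> 'k"
  assumes \<chi>: "bichar \<chi>"
begin

lemmas chi = bichar_rules[OF \<chi>]
lemmas D_fields' [simp] = D_fields[OF \<chi>]

text \<open>The degree of the iterated commutator after \<open>n\<close> steps is \<open>l2 + n l\<close>, and the contributions of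
  \<open>\<chi>(l, l)\<close> to both products with \<open>x\<close> cancel. So the two products are always rescaled in the same
  ratio \<open>\<chi>(l, l2) / \<chi>(l2, l)\<close>, by which \<open>b\<close> and \<open>b'\<close> differ, while \<open>v\<close> stays the same.\<close>

lemma qad_D_e:
  assumes "homog l 0 x" "homog l2 0 y" "b * \<chi> l2 l = b' * \<chi> l l2"
  shows "\<exists>K L. qad (D \<chi>) v b n x y = K \<odot>\<^bsub>U\<^esub> qad U v b' n x y \<and> homog L 0 (qad U v b' n x y)
    \<and> \<chi> l L * \<chi> l2 l = \<chi> L l * \<chi> l l2"
proof (induction n)
  case 0
  have "y \<in> carrier U" by (rule homog_closed[OF assms(2)])
  then show ?case using assms(2) by (intro exI[of _ 1] exI[of _ l2]) (simp add: mult.commute)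
next
  case (Suc n)
  then obtain K L where IH: "qad (D \<chi>) v b n x y = K \<odot>\<^bsub>U\<^esub> qad U v b' n x y" "homog L 0 (qad U v b' n x y)"
    "\<chi> l L * \<chi> l2 l = \<chi> L l * \<chi> l l2" by blast
  let ?z = "qad U v b' n x y"
  note L = bilin_left[OF bilin_D_mult[OF \<chi>]] and R = bilin_right[OF bilin_D_mult[OF \<chi>]]
  have x: "x \<in> carrier U" and z: "?z \<in> carrier U" using homog_closed[OF assms(1)] homog_closed[OF IH(2)] by auto
  have xz: "x \<otimes>\<^bsub>D \<chi>\<^esub> ?z = \<chi> l L \<odot>\<^bsub>U\<^esub> (x \<otimes>\<^bsub>U\<^esub> ?z)" "?z \<otimes>\<^bsub>D \<chi>\<^esub> x = \<chi> L l \<odot>\<^bsub>U\<^esub> (?z \<otimes>\<^bsub>U\<^esub> x)"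
    using D_mult_homog[OF \<chi> assms(1) IH(2)] D_mult_homog[OF \<chi> IH(2) assms(1)] by (simp_all add: chi)
  have "(b * \<chi> L l) * \<chi> l l2 = (b' * \<chi> l L) * \<chi> l l2"
    using IH(3) assms(3) by (metis (no_types, lifting) mult.assoc mult.commute)
  then have e: "b * \<chi> L l = b' * \<chi> l L" using chi(3)[of l l2] by simp
  have "qad (D \<chi>) v b (Suc n) x y = (K * \<chi> l L) \<odot>\<^bsub>U\<^esub> (x \<otimes>\<^bsub>U\<^esub> ?z) \<oplus>\<^bsub>U\<^esub> (- (v ^ n * (b * \<chi> L l) * K)) \<odot>\<^bsub>U\<^esub> (?z \<otimes>\<^bsub>U\<^esub> x)"
    using x z by (simp add: IH(1) linear_maps_smult[OF L] linear_maps_smult[OF R] xz mult_ac)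
  also have "\<dots> = (K * \<chi> l L) \<odot>\<^bsub>U\<^esub> qad U v b' (Suc n) x y"
    using x z unfolding e by (simp add: U.smult_add_right mult_ac)
  finally have 1: "qad (D \<chi>) v b (Suc n) x y = (K * \<chi> l L) \<odot>\<^bsub>U\<^esub> qad U v b' (Suc n) x y" .
  have "homog (l + L) 0 (qad U v b' (Suc n) x y)"
    using homog_mult[OF assms(1) IH(2)] homog_mult[OF IH(2) assms(1)]
    by (auto intro!: homog.add homog.smult simp: add.commute)
  moreover have "\<chi> l (l + L) * \<chi> l2 l = \<chi> (l + L) l * \<chi> l l2" using IH(3) by (simp add: chi)
  ultimately show ?case using 1 by blast
qed

text \<open>The counterpart in the right degrees: the deformed product contains \<open>1 / \<chi>\<close> in place of \<open>\<chi>\<close>, and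
  the opposite multiplication exchanges the arguments, so that the ratio is the same.\<close>

lemma qad_D_f:
  assumes "homog 0 l x" "homog 0 l2 y" "b * \<chi> l2 l = b' * \<chi> l l2"
  shows "\<exists>K L. qad (opposite (D \<chi>)) v b n x y = K \<odot>\<^bsub>U\<^esub> qad (opposite U) v b' n x y \<and> homog 0 L (qad (opposite U) v b' n x y)
    \<and> \<chi> l L * \<chi> l2 l = \<chi> L l * \<chi> l l2"
proof (induction n)
  case 0
  have "y \<in> carrier U" by (rule homog_closed[OF assms(2)])
  then show ?case using assms(2) by (intro exI[of _ 1] exI[of _ l2]) (simp add: mult.commute)
next
  case (Suc n)
  then obtain K L where IH: "qad (opposite (D \<chi>)) v b n x y = K \<odot>\<^bsub>U\<^esub> qad (opposite U) v b' n x y" "homog 0 L (qad (opposite U) v b' n x y)"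
    "\<chi> l L * \<chi> l2 l = \<chi> L l * \<chi> l l2" by blast
  let ?z = "qad (opposite U) v b' n x y"
  note L = bilin_left[OF bilin_D_mult[OF \<chi>]] and R = bilin_right[OF bilin_D_mult[OF \<chi>]]
  have x: "x \<in> carrier U" and z: "?z \<in> carrier U" using homog_closed[OF assms(1)] homog_closed[OF IH(2)] by auto
  have xz: "x \<otimes>\<^bsub>D \<chi>\<^esub> ?z = inverse (\<chi> l L) \<odot>\<^bsub>U\<^esub> (x \<otimes>\<^bsub>U\<^esub> ?z)" "?z \<otimes>\<^bsub>D \<chi>\<^esub> x = inverse (\<chi> L l) \<odot>\<^bsub>U\<^esub> (?z \<otimes>\<^bsub>U\<^esub> x)"
    using D_mult_homog[OF \<chi> assms(1) IH(2)] D_mult_homog[OF \<chi> IH(2) assms(1)] by (simp_all add: chi)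
  have "(b * \<chi> L l) * \<chi> l l2 = (b' * \<chi> l L) * \<chi> l l2"
    using IH(3) assms(3) by (metis (no_types, lifting) mult.assoc mult.commute)
  then have "b * \<chi> L l = b' * \<chi> l L" using chi(3)[of l l2] by simp
  then have e: "b * inverse (\<chi> l L) = b' * inverse (\<chi> L l)" using chi(3)[of l L] chi(3)[of L l] by (simp add: field_simps)
  have "qad (opposite (D \<chi>)) v b (Suc n) x y = (K * inverse (\<chi> L l)) \<odot>\<^bsub>U\<^esub> (?z \<otimes>\<^bsub>U\<^esub> x) \<oplus>\<^bsub>U\<^esub> (- (v ^ n * (b * inverse (\<chi> l L)) * K)) \<odot>\<^bsub>U\<^esub> (x \<otimes>\<^bsub>U\<^esub> ?z)"
    using x z by (simp add: IH(1) linear_maps_smult[OF L] linear_maps_smult[OF R] xz mult_ac)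
  also have "\<dots> = (K * inverse (\<chi> L l)) \<odot>\<^bsub>U\<^esub> qad (opposite U) v b' (Suc n) x y"
    using x z unfolding e by (simp add: U.smult_add_right mult_ac)
  finally have 1: "qad (opposite (D \<chi>)) v b (Suc n) x y = (K * inverse (\<chi> L l)) \<odot>\<^bsub>U\<^esub> qad (opposite U) v b' (Suc n) x y" .
  have "homog 0 (l + L) (qad (opposite U) v b' (Suc n) x y)"
    using homog_mult[OF assms(1) IH(2)] homog_mult[OF IH(2) assms(1)]
    by (auto intro!: homog.add homog.smult simp: add.commute)
  moreover have "\<chi> l (l + L) * \<chi> l2 l = \<chi> (l + L) l * \<chi> l l2" using IH(3) by (simp add: chi)
  ultimately show ?case using 1 by blast
qed

text \<open>The generators \<open>f\<^sub>i\<close> are rescaled to compensate for different denominators in the commutators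
  of \<open>e\<^sub>i\<close> and \<open>f\<^sub>i\<close>.\<close>

primrec rescale :: "('i \<Rightarrow> 'k) \<Rightarrow> 'i generator \<Rightarrow> 'k" where
  "rescale c (Ge i) = 1" | "rescale c (Gf i) = c i" | "rescale c (Gw i) = 1" | "rescale c (Gw_inv i) = 1"
| "rescale c (Gw' i) = 1" | "rescale c (Gw'_inv i) = 1"

primrec word_factor :: "('i \<Rightarrow> 'k) \<Rightarrow> 'i generator list \<Rightarrow> 'k" where
  "word_factor c [] = 1"
| "word_factor c (x # ws) = rescale c x * twist_factor \<chi> (lgen x) (rgen x) (ldeg ws) (rdeg ws) * word_factor c ws"

definition rescaled_gen :: "('i \<Rightarrow> 'k) \<Rightarrow> 'i generator \<Rightarrow> ('i, 'k) free_alg set" where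
  "rescaled_gen c x = rescale c x \<odot>\<^bsub>U\<^esub> gg x"

lemma rescaled_gen_closed [simp, intro]: "rescaled_gen c x \<in> carrier U"
  by (simp add: rescaled_gen_def)

lemma word_val_rescaled_gen: "word_val (D \<chi>) (rescaled_gen c) ws = word_factor c ws \<odot>\<^bsub>U\<^esub> clw ws"
proof (induction ws)
  case (Cons x ws)
  note L = bilin_left[OF bilin_D_mult[OF \<chi>]] and R = bilin_right[OF bilin_D_mult[OF \<chi>]]
  show ?case
    using D_mult_word[OF \<chi>, of "[x]" ws] Cons
    by (simp add: rescaled_gen_def linear_maps_smult[OF L] linear_maps_smult[OF R] clw_singleton mult_ac)
qed (simp add: clw_simps)

context
  fixes r0 s0 :: 'k and c :: "'i \<Rightarrow> 'k"
  assumes q0: "qdata A d r0 s0"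
    and v0: "\<And>i. r0 ^ d i / s0 ^ d i = vi i"
    and b0: "\<And>i j. bt A d r0 s0 i j * \<chi> (sroot j) (sroot i) = bet i j * \<chi> (sroot i) (sroot j)"
  defines "c \<equiv> \<lambda>i. (r ^ d i - s ^ d i) / (r0 ^ d i - s0 ^ d i)"
begin

lemma wt0: "torus t \<Longrightarrow> wt A d r0 s0 t j * \<chi> (sroot j) (lgen t) = wt A d r s t j * \<chi> (lgen t) (sroot j)"
proof -
  have n: "bt A d r0 s0 i j \<noteq> 0" "bet i j \<noteq> 0" for i j using qdata.bt_nz[OF q0] by simp_all
  assume "torus t"
  then show ?thesis
  proof (cases t)
    case (Gw i)
    then show ?thesis using b0[of i j] by simp
  next
    case (Gw_inv i)
    then show ?thesis using b0[of i j] n[of i j] n(1)[of i j] chi(3)[of "sroot i" "sroot j"] chi(3)[of "sroot j" "sroot i"]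
      by (simp add: chi field_simps)
  next
    case (Gw' i)
    then show ?thesis using b0[of j i] n[of j i] chi(3)[of "sroot i" "sroot j"] chi(3)[of "sroot j" "sroot i"]
      by (simp add: chi field_simps)
  next
    case (Gw'_inv i)
    then show ?thesis using b0[of j i] n[of j i] chi(3)[of "sroot i" "sroot j"] chi(3)[of "sroot j" "sroot i"]
      by (simp add: chi field_simps)
  qed simp_all
qed

text \<open>The assumption on the \<open>\<beta>\<^sub>i\<^sub>j\<close> says that deforming by \<open>\<chi>\<close> turns the scalars for \<open>r\<close>, \<open>s\<close> into those for
  \<open>r0\<close>, \<open>s0\<close>. The products of \<open>e\<^sub>i\<close> and \<open>f\<^sub>j\<close>, in either order, are not changed by the deformation because one
  of the two degrees of each factor is zero.\<close>

lemma qrep_rescaled_gen: "qrep A d r0 s0 (D \<chi>) (rescaled_gen c)"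
proof (intro qrep.intro qrep_axioms.intro q0 kalg_D[OF \<chi>])
  interpret q: qrep A d r s U gg by (rule qrep_U)
  interpret O: kalg "opposite (D \<chi>)" by (rule kalg_opposite[OF kalg_D[OF \<chi>]])
  interpret D: kalg "D \<chi>" by (rule kalg_D[OF \<chi>])
  note fields = D_fields[OF \<chi>]
  note L = bilin_left[OF bilin_D_mult[OF \<chi>]] and R = bilin_right[OF bilin_D_mult[OF \<chi>]]
  note M = D_mult_homog[OF \<chi> homog_gen homog_gen]
  have tt: "rescaled_gen c t = gg t" if "torus t" for t using that by (cases t) (simp_all add: rescaled_gen_def)
  have te: "rescaled_gen c (Ge i) = gg (Ge i)" "rescaled_gen c (Gf i) = c i \<odot>\<^bsub>U\<^esub> gg (Gf i)" for i by (simp_all add: rescaled_gen_def)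
  have lr: "rgen t = lgen t" if "torus t" for t :: "'i generator" using that by (cases t) auto
  show "rescaled_gen c x \<in> carrier (D \<chi>)" for x by (simp add: fields)
  fix t :: "'i generator" assume t: "torus t"
  show "rescaled_gen c t \<otimes>\<^bsub>D \<chi>\<^esub> rescaled_gen c (tinv t) = \<one>\<^bsub>D \<chi>\<^esub>"
    using D_torus[OF \<chi> t] t by (simp add: tt fields)
  show "rescaled_gen c t \<otimes>\<^bsub>D \<chi>\<^esub> rescaled_gen c t' = rescaled_gen c t' \<otimes>\<^bsub>D \<chi>\<^esub> rescaled_gen c t" if "torus t'" for t'
    using t that M[of t t'] M[of t' t] q.rel_torus[of t t'] chi(3) by (simp add: tt lr)
  fix j
  have w: "wt A d r0 s0 t j \<noteq> 0" using qdata.wt_nz[OF q0] .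
  show "rescaled_gen c t \<otimes>\<^bsub>D \<chi>\<^esub> rescaled_gen c (Ge j) = wt A d r0 s0 t j \<odot>\<^bsub>D \<chi>\<^esub> (rescaled_gen c (Ge j) \<otimes>\<^bsub>D \<chi>\<^esub> rescaled_gen c t)"
    using t M[of t "Ge j"] M[of "Ge j" t] q.rel_te[OF t, of j] wt0[OF t, of j]
    by (simp add: tt te fields chi mult.commute)
  have "inverse (\<chi> (lgen t) (sroot j)) * inverse (wt A d r s t j) = inverse (wt A d r0 s0 t j) * inverse (\<chi> (sroot j) (lgen t))"
    using wt0[OF t, of j] by (metis inverse_mult_distrib mult.commute)
  then show "rescaled_gen c t \<otimes>\<^bsub>D \<chi>\<^esub> rescaled_gen c (Gf j) = inverse (wt A d r0 s0 t j) \<odot>\<^bsub>D \<chi>\<^esub> (rescaled_gen c (Gf j) \<otimes>\<^bsub>D \<chi>\<^esub> rescaled_gen c t)"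
    using t M[of t "Gf j"] M[of "Gf j" t] q.rel_tf[OF t, of j]
    by (simp add: tt te fields chi lr linear_maps_smult[OF L] linear_maps_smult[OF R] mult_ac)
next
  interpret q: qrep A d r s U gg by (rule qrep_U)
  interpret O: kalg "opposite (D \<chi>)" by (rule kalg_opposite[OF kalg_D[OF \<chi>]])
  note fields = D_fields[OF \<chi>]
  note L = bilin_left[OF bilin_D_mult[OF \<chi>]] and R = bilin_right[OF bilin_D_mult[OF \<chi>]]
  note M = D_mult_homog[OF \<chi> homog_gen homog_gen]
  have te: "rescaled_gen c (Ge i) = gg (Ge i)" "rescaled_gen c (Gf i) = c i \<odot>\<^bsub>U\<^esub> gg (Gf i)" "rescaled_gen c (Gw i) = gg (Gw i)" "rescaled_gen c (Gw' i) = gg (Gw' i)" for i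
    by (simp_all add: rescaled_gen_def)
  fix i j :: 'i
  have c: "c i * ef_coeff i = 1 / (r0 ^ d i - s0 ^ d i)" using rs_diff_nz[of i] by (simp add: c_def)
  show "rescaled_gen c (Ge i) \<otimes>\<^bsub>D \<chi>\<^esub> rescaled_gen c (Gf j) = rescaled_gen c (Gf j) \<otimes>\<^bsub>D \<chi>\<^esub> rescaled_gen c (Ge i)
      \<oplus>\<^bsub>D \<chi>\<^esub> (if i = j then (1 / (r0 ^ d i - s0 ^ d i)) \<odot>\<^bsub>D \<chi>\<^esub> (rescaled_gen c (Gw i) \<oplus>\<^bsub>D \<chi>\<^esub> (- 1) \<odot>\<^bsub>D \<chi>\<^esub> rescaled_gen c (Gw' i)) else \<zero>\<^bsub>D \<chi>\<^esub>)"
  proof -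
    have "rescaled_gen c (Ge i) \<otimes>\<^bsub>D \<chi>\<^esub> rescaled_gen c (Gf j) = c j \<odot>\<^bsub>U\<^esub> (gg (Ge i) \<otimes>\<^bsub>U\<^esub> gg (Gf j))"
      "rescaled_gen c (Gf j) \<otimes>\<^bsub>D \<chi>\<^esub> rescaled_gen c (Ge i) = c j \<odot>\<^bsub>U\<^esub> (gg (Gf j) \<otimes>\<^bsub>U\<^esub> gg (Ge i))"
      using M[of "Ge i" "Gf j"] M[of "Gf j" "Ge i"] by (simp_all add: te linear_maps_smult[OF L] linear_maps_smult[OF R] chi)
    then show ?thesis
      unfolding q.rel_ef c[symmetric] by (simp add: fields te U.smult_add_right)
  qed
  assume ij: "i \<noteq> j"
  show "qad (D \<chi>) (r0 ^ d i / s0 ^ d i) (bt A d r0 s0 i j) (serre_len i j) (rescaled_gen c (Ge i)) (rescaled_gen c (Ge j)) = \<zero>\<^bsub>D \<chi>\<^esub>"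
    using qad_D_e[of "sroot i" "gg (Ge i)" "sroot j" "gg (Ge j)" "bt A d r0 s0 i j" "bet i j" "vi i" "serre_len i j"]
      homog_gen[of "Ge i"] homog_gen[of "Ge j"] b0[of i j] q.serre_e[OF ij]
    by (auto simp: te v0 fields)
  show "qad (opposite (D \<chi>)) (r0 ^ d i / s0 ^ d i) (bt A d r0 s0 i j) (serre_len i j) (rescaled_gen c (Gf i)) (rescaled_gen c (Gf j)) = \<zero>\<^bsub>D \<chi>\<^esub>"
    using qad_D_f[of "sroot i" "gg (Gf i)" "sroot j" "gg (Gf j)" "bt A d r0 s0 i j" "bet i j" "vi i" "serre_len i j"]
      homog_gen[of "Gf i"] homog_gen[of "Gf j"] b0[of i j] q.serre_f[OF ij]
      O.qad_scale[of "gg (Gf i)" "gg (Gf j)" "vi i" "bt A d r0 s0 i j" "serre_len i j" "c i" "c j"]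
    by (auto simp: te v0 fields)
qed

end

end

end

lemma word_factor_inverse:
  fixes A :: "'i::linorder \<Rightarrow> 'i \<Rightarrow> int" and r s :: "'k::field" and \<chi> :: "('i \<Rightarrow>\<^sub>0 int) \<Rightarrow> ('i \<Rightarrow>\<^sub>0 int) \<Rightarrow> 'k"
  assumes "qdata A d r s" "bichar \<chi>" "\<And>i. c i * c' i = 1"
  shows "qdata.word_factor \<chi> c ws * qdata.word_factor (\<lambda>a b. inverse (\<chi> a b)) c' ws = 1"
proof -
  note wf = qdata.word_factor.simps[OF assms(1)] and rs = qdata.rescale.simps[OF assms(1)]
  note ch = bichar_rules[OF assms(2)]
  have r: "qdata.rescale c x * qdata.rescale c' x = 1" for x
    by (cases x) (simp_all add: rs[OF assms(2)] assms(3))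
  show ?thesis
  proof (induction ws)
    case (Cons x ws)
    have "qdata.word_factor \<chi> c (x # ws) * qdata.word_factor (\<lambda>a b. inverse (\<chi> a b)) c' (x # ws)
      = (qdata.rescale c x * qdata.rescale c' x) * (qdata.word_factor \<chi> c ws * qdata.word_factor (\<lambda>a b. inverse (\<chi> a b)) c' ws)"
    proof -
      have "(\<chi> a e * inverse (\<chi> b g)) * (inverse (\<chi> a e) * inverse (inverse (\<chi> b g))) = 1" for a b e g :: "'i \<Rightarrow>\<^sub>0 int"
        using ch(3) by (simp add: field_simps)
      from arg_cong[OF this[of "lgen x" "ldeg ws" "rgen x" "rdeg ws"], of "\<lambda>t. t * ((qdata.rescale c x * qdata.rescale c' x) * (qdata.word_factor \<chi> c ws * qdata.word_factor (\<lambda>a b. inverse (\<chi> a b)) c' ws))"]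
      show ?thesis by (simp only: wf[OF assms(2)] wf[OF bichar_inverse[OF assms(2)]] mult_ac mult_1_left mult_1_right)
    qed
    then show ?case using Cons r[of x] by simp
  qed (simp add: wf[OF assms(2)] wf[OF bichar_inverse[OF assms(2)]])
qed

text \<open>The relations of the first quantum group hold in the deformation of the second, and by the
  symmetry of the assumptions in \<open>\<chi>\<close> and \<open>1 / \<chi>\<close> those of the second hold in the deformation of the
  first. The two homomorphisms multiply words by mutually inverse scalars.\<close>

theorem twist_isomorphic:
  fixes A :: "'i::linorder \<Rightarrow> 'i \<Rightarrow> int" and d :: "'i \<Rightarrow> nat" and r s r0 s0 :: "'k::field"
  assumes q0: "qdata A d r0 s0" and q: "qdata A d r s" and \<chi>: "bichar \<chi>"
    and v0: "\<And>i. r0 ^ d i / s0 ^ d i = r ^ d i / s ^ d i"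
    and b0: "\<And>i j. bt A d r0 s0 i j * \<chi> (sroot j) (sroot i) = bt A d r s i j * \<chi> (sroot i) (sroot j)"
  shows "isomorphic_hopf_algebras (quantum_group A d r0 s0) (deform (quantum_group A d r s) (qdata.form_of A d r s \<chi>))"
proof -
  interpret S: qdata A d r0 s0 by fact
  interpret T: qdata A d r s by fact
  let ?\<chi>' = "\<lambda>a b. inverse (\<chi> a b)"
  note \<chi>' = bichar_inverse[OF \<chi>]
  note ch = bichar_rules[OF \<chi>]
  \<comment> \<open>The rescaling replaces the denominator of the commutators in the second quantum group by
    that in the first.\<close>
  define c where "c = (\<lambda>i. (r ^ d i - s ^ d i) / (r0 ^ d i - s0 ^ d i))"
  define c' where "c' = (\<lambda>i. (r0 ^ d i - s0 ^ d i) / (r ^ d i - s ^ d i))"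
  have cc: "c i * c' i = 1" for i using S.rs_diff_nz[of i] T.rs_diff_nz[of i] by (simp add: c_def c'_def)
  let ?D = "T.D \<chi>" and ?D' = "S.D ?\<chi>'"
  have b0': "bt A d r s i j * ?\<chi>' (sroot j) (sroot i) = bt A d r0 s0 i j * ?\<chi>' (sroot i) (sroot j)" for i j
    using b0[of i j] ch(3)[of "sroot i" "sroot j"] ch(3)[of "sroot j" "sroot i"] by (simp add: field_simps)
  have qr: "qrep A d r0 s0 ?D (T.rescaled_gen c)" unfolding c_def
    by (rule T.qrep_rescaled_gen[OF \<chi> q0 v0 b0])
  have qr': "qrep A d r s ?D' (S.rescaled_gen c')" unfolding c'_def
    by (rule S.qrep_rescaled_gen[OF \<chi>' q v0[symmetric] b0'])
  define \<phi> where "\<phi> = (\<lambda>x. free_eval ?D (T.rescaled_gen c) (rep x))"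
  define \<psi> where "\<psi> = (\<lambda>x. free_eval ?D' (S.rescaled_gen c') (rep x))"
  note TD = T.D_fields[OF \<chi>] and SD = S.D_fields[OF \<chi>']
  have \<phi>U: "\<phi> \<in> alg_hom S.U ?D" unfolding \<phi>_def by (rule qrep.induced_alg_hom[OF qr])
  have \<psi>U: "\<psi> \<in> alg_hom T.U ?D'" unfolding \<psi>_def by (rule qrep.induced_alg_hom[OF qr'])
  have \<phi>H: "\<phi> \<in> alg_hom S.H ?D" using \<phi>U by simp
  have fh: "free_hom ?D (T.rescaled_gen c)" and fh': "free_hom ?D' (S.rescaled_gen c')"
    using qr qr' by (simp_all add: qrep_def qrep_axioms_def free_hom_def free_hom_axioms_def)
  have \<phi>_gen: "\<phi> (S.gg x) = T.rescaled_gen c x" for x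
    unfolding \<phi>_def qrep.free_eval_rep[OF qr] by (rule free_hom.free_eval_gvar[OF fh])
  have \<phi>_word: "\<phi> (S.clw ws) = qdata.word_factor \<chi> c ws \<odot>\<^bsub>T.U\<^esub> T.clw ws" for ws
    unfolding \<phi>_def qrep.free_eval_rep[OF qr]
    by (simp add: free_hom.free_eval_single[OF fh] T.word_val_rescaled_gen[OF \<chi>] TD)
  have \<psi>_word: "\<psi> (T.clw ws) = qdata.word_factor ?\<chi>' c' ws \<odot>\<^bsub>S.U\<^esub> S.clw ws" for ws
    unfolding \<psi>_def qrep.free_eval_rep[OF qr']
    by (simp add: free_hom.free_eval_single[OF fh'] S.word_val_rescaled_gen[OF \<chi>'] SD)
  have \<phi>l: "\<phi> \<in> linear_maps S.U T.U" using alg_hom_linear[OF \<phi>U] by (simp add: T.linear_maps_D[OF \<chi>])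
  have \<psi>l: "\<psi> \<in> linear_maps T.U S.U" using alg_hom_linear[OF \<psi>U] by (simp add: S.linear_maps_D[OF \<chi>'])
  note wf = word_factor_inverse[OF q \<chi> cc]
  have inv1: "\<psi> (\<phi> x) = x" if "x \<in> carrier S.U" for x
  proof (rule S.U_linear_eq[OF S.U.kspace_axioms linear_maps_comp[OF \<phi>l \<psi>l] linear_maps_id _ that])
    show "\<psi> (\<phi> (S.clw ws)) = S.clw ws" for ws
      by (simp add: \<phi>_word linear_maps_smult[OF \<psi>l] \<psi>_word wf)
  qed
  have inv2: "\<phi> (\<psi> x) = x" if "x \<in> carrier T.U" for x
  proof (rule T.U_linear_eq[OF T.U.kspace_axioms linear_maps_comp[OF \<psi>l \<phi>l] linear_maps_id _ that])
    show "\<phi> (\<psi> (T.clw ws)) = T.clw ws" for ws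
      using wf[where ws = ws] by (simp add: \<psi>_word linear_maps_smult[OF \<phi>l] \<phi>_word mult.commute)
  qed
  have bij: "bij_betw \<phi> (carrier S.H) (carrier ?D)"
    by (rule bij_betw_byWitness[where f' = \<psi>])
       (use inv1 inv2 linear_maps_closed[OF \<phi>l] linear_maps_closed[OF \<psi>l] in \<open>auto simp: TD\<close>)
  have \<phi>c: "x \<in> carrier S.U \<Longrightarrow> \<phi> x \<in> carrier T.U" for x by (rule linear_maps_closed[OF \<phi>l])
  have \<phi>1: "\<phi> \<one>\<^bsub>S.U\<^esub> = \<one>\<^bsub>T.U\<^esub>" using alg_hom_one[OF \<phi>U] by (simp add: TD)
  interpret D2: kalg2 ?D ?D by (intro kalg2.intro T.kalg_D[OF \<chi>])
  have tg: "T.rescaled_gen c x = T.rescale c x \<odot>\<^bsub>T.U\<^esub> T.gg x" for x by (rule T.rescaled_gen_def[OF \<chi>])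
  note rs = T.rescale.simps[OF \<chi>]
  have com: "comult ?D (\<phi> x) = sweedler S.H (tensor ?D ?D) (\<lambda>a b. pure ?D ?D (\<phi> a) (\<phi> b)) x" if "x \<in> carrier S.H" for x
  proof (rule alg_hom_eq_on_generators[OF S.H.G_generates _ _ _ that])
    let ?g = "\<lambda>a b. pure ?D ?D (\<phi> a) (\<phi> b)"
    show "(\<lambda>x. comult ?D (\<phi> x)) \<in> alg_hom S.H (tensor ?D ?D)"
      by (rule alg_hom_comp[OF \<phi>H T.comult_alg_hom_D[OF \<chi>]])
    have \<phi>l': "\<phi> \<in> linear_maps S.H ?D" by (rule alg_hom_linear[OF \<phi>H])
    have g: "bilin S.H S.H (tensor ?D ?D) ?g"
      by (intro bilinI linear_maps_comp[OF \<phi>l'] bilin_left[OF D2.bilin_pure] bilin_right[OF D2.bilin_pure] linear_maps_closed[OF \<phi>l'])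
    have "tens_lift (tensor ?D ?D) ?g \<in> alg_hom (tensor S.H S.H) (tensor ?D ?D)"
      by (rule S.H.HH.tens_lift_alg_hom[OF D2.kalg_tensor g])
         (simp_all add: alg_hom_mult[OF \<phi>H] alg_hom_one[OF \<phi>H] D2.pure_mult linear_maps_closed[OF \<phi>l'] D2.tensor_one del: S.H_fields)
    then show "sweedler S.H (tensor ?D ?D) ?g \<in> alg_hom S.H (tensor ?D ?D)"
      unfolding sweedler_def by (rule alg_hom_comp[OF S.H.comult_alg_hom])
    have pc: "pure S.U S.U x y \<in> carrier (tensor S.U S.U)" if "x \<in> carrier S.U" "y \<in> carrier S.U" for x y
      using S.H.HH.pure_closed[of x y] that by (simp add: S.tensor_H S.pure_H)
    have pD: "pure ?D ?D = pure T.U T.U" "add (tensor ?D ?D) = add (tensor T.U T.U)"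
      using T.pure_D[OF \<chi>] T.tensor_D(2)[OF \<chi>] by (simp_all add: T.pure_H T.tensor_H)
    note p = S.H.HH.tens_lift_pure[OF D2.kspace_tensor g, unfolded S.pure_H S.H_fields(1) pD]
    note a = linear_maps_add[OF S.H.HH.tens_lift_linear[OF D2.kspace_tensor g], unfolded S.tensor_H pD]
    have pcT: "pure T.U T.U x y \<in> carrier (tensor T.U T.U)" if "x \<in> carrier T.U" "y \<in> carrier T.U" for x y
      using T.H.HH.pure_closed[of x y] that by (simp add: T.tensor_H T.pure_H)
    have sm: "comult T.H (k \<odot>\<^bsub>T.U\<^esub> T.gg x) = k \<odot>\<^bsub>tensor T.U T.U\<^esub> dgen T.U T.gg x" for k x
      using T.H.comult_smult[of "T.gg x" k] by (simp add: T.tensor_H T.structure_gen)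
    interpret TT: kalg2 T.U T.U by (intro kalg2.intro T.kalg_U)
    fix x assume "x \<in> range S.gg"
    then obtain y where y: "x = S.gg y" by auto
    show "comult ?D (\<phi> x) = sweedler S.H (tensor ?D ?D) ?g x"
      unfolding y \<phi>_gen sweedler_def S.structure_gen TD tg sm
      by (cases y) (simp_all add: rs p a pc pD \<phi>_gen tg \<phi>1 TT.pure_smult_left TT.pure_smult_right TT.T.smult_add_right pcT)
  qed
  have cou: "counit ?D (\<phi> x) = counit S.H x" if "x \<in> carrier S.H" for x
  proof (rule alg_hom_eq_on_generators[OF S.H.G_generates alg_hom_comp[OF \<phi>H T.counit_alg_hom_D[OF \<chi>]] S.H.counit_alg_hom _ that])
    fix x assume "x \<in> range S.gg"
    then obtain y where y: "x = S.gg y" by auto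
    show "counit ?D (\<phi> x) = counit S.H x"
      unfolding y \<phi>_gen tg TD S.structure_gen using T.H.counit_smult[of "T.gg y"]
      by (cases y) (simp_all add: rs T.structure_gen)
  qed
  have ant: "antipode ?D (\<phi> x) = \<phi> (antipode S.H x)" if "x \<in> carrier S.H" for x
  proof (rule alg_hom_eq_on_generators[OF S.H.G_generates alg_hom_comp[OF \<phi>H T.antipode_alg_hom_D[OF \<chi>]]
        alg_hom_comp[OF S.H.antipode_alg_hom alg_hom_opposite[OF \<phi>H]] _ that])
    fix x assume "x \<in> range S.gg"
    then obtain y where y: "x = S.gg y" by auto
    have lin: "antipode ?D \<in> linear_maps T.U T.U"
      using alg_hom_linear[OF T.antipode_alg_hom_D[OF \<chi>]] by (simp add: T.linear_maps_D[OF \<chi>])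
    note L = bilin_left[OF T.bilin_D_mult[OF \<chi>]] and R = bilin_right[OF T.bilin_D_mult[OF \<chi>]]
    show "antipode ?D (\<phi> x) = \<phi> (antipode S.H x)"
      unfolding y \<phi>_gen tg S.structure_gen linear_maps_smult[OF lin T.cl_closed] T.D_antipode_gen[OF \<chi>]
      by (cases y) (simp_all add: rs linear_maps_smult[OF \<phi>l] alg_hom_mult[OF \<phi>U] \<phi>_gen tg TD T.D_mult_closed[OF \<chi>]
          linear_maps_smult[OF L] linear_maps_smult[OF R] mult.commute)
  qed
  have "\<phi> \<in> hopf_iso S.H ?D"
    unfolding hopf_iso_def using \<phi>H bij com cou ant by blast
  then show ?thesis
    unfolding isomorphic_hopf_algebras_def using S.hopf_algebra_H T.hopf_algebra_D[OF \<chi>] by blast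
qed

section \<open>The bicharacter of the Euler form\<close>

definition euler_char :: "('i::{finite,linorder} \<Rightarrow> 'i \<Rightarrow> int) \<Rightarrow> ('i \<Rightarrow> nat) \<Rightarrow> 'k::field \<Rightarrow> 'k \<Rightarrow> ('i \<Rightarrow>\<^sub>0 int) \<Rightarrow> ('i \<Rightarrow>\<^sub>0 int) \<Rightarrow> 'k" where
  "euler_char A d rh sh \<mu> \<nu> = rh powi euler_form A d (Poly_Mapping.lookup \<nu>) (Poly_Mapping.lookup \<mu>)
     * sh powi (- euler_form A d (Poly_Mapping.lookup \<mu>) (Poly_Mapping.lookup \<nu>))"

lemma euler_form_add:
  "euler_form A d (Poly_Mapping.lookup (a + b)) c = euler_form A d (Poly_Mapping.lookup a) c + euler_form A d (Poly_Mapping.lookup b) c"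
  "euler_form A d c (Poly_Mapping.lookup (a + b)) = euler_form A d c (Poly_Mapping.lookup a) + euler_form A d c (Poly_Mapping.lookup b)"
  by (simp_all add: euler_form_def lookup_add algebra_simps sum.distrib)

lemma euler_form_sroot: "euler_form A d (Poly_Mapping.lookup (sroot i)) (Poly_Mapping.lookup (sroot j)) = euler A d i j"
proof -
  have "(\<Sum>l\<in>UNIV. (1 when j = l) * f l) = f j" for f :: "'a \<Rightarrow> int"
    using sum.remove[of UNIV j "\<lambda>l. (1 when j = l) * f l"] by (simp add: when_def sum.neutral)
  then have "(\<Sum>k\<in>UNIV. \<Sum>l\<in>UNIV. (1 when i = k) * (1 when j = l) * euler A d k l) = euler A d i j"
    by (simp add: mult.assoc sum_distrib_left[symmetric]) (simp add: when_def if_distrib[of "\<lambda>x. x * _"] cong: if_cong)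
  then show ?thesis unfolding euler_form_def lookup_single .
qed

lemma bichar_euler_char: "rh \<noteq> 0 \<Longrightarrow> sh \<noteq> 0 \<Longrightarrow> bichar (euler_char A d rh sh)"
  by (auto simp: bichar_def euler_char_def euler_form_add power_int_add power_int_not_zero power_int_diff power_int_minus field_simps)

lemma indeterminates_nonzero:
  assumes "indeterminates_over_rat r s" shows "r \<noteq> 0" "s \<noteq> 0"
proof -
  have "poly (map_poly (\<lambda>p. poly (map_poly of_rat p) r) [:[:0, 1:]:]) s \<noteq> 0"
    using assms unfolding indeterminates_over_rat_def by (rule allE[of _ "[:[:0, 1:]:]"]) simp
  then show "r \<noteq> 0" by (auto simp: map_poly_pCons)
  have "poly (map_poly (\<lambda>p. poly (map_poly of_rat p) r) [:0, 1:]) s \<noteq> 0"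
    using assms unfolding indeterminates_over_rat_def by (rule allE[of _ "[:0, 1:]"]) simp
  then show "s \<noteq> 0" by (auto simp: map_poly_pCons)
qed

text \<open>This contains both the existence and the uniqueness of the form in the theorem.\<close>

lemma twisting_form_iff:
  fixes A :: "'i::{finite,linorder} \<Rightarrow> 'i \<Rightarrow> int" and rh sh :: "'k::field"
  assumes "qdata A d (rh / sh) (inverse (rh / sh))"
  shows "twisting_form A d rh sh f \<longleftrightarrow> f = qdata.form_of A d (rh / sh) (inverse (rh / sh)) (euler_char A d rh sh)"
proof -
  interpret qfin A d "rh / sh" "inverse (rh / sh)" using assms by (simp add: qfin_def)
  have w: "cl (K_mon \<mu> * K'_mon \<nu>) = clw (Kw \<mu> @ Kw' \<nu>)" for \<mu> \<nu> :: "'i \<Rightarrow> int"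
    by (simp only: K_mon_word word_monom_append)
  have p: "cl (F_mon fs * K_mon lam * K'_mon rho * E_mon es) = clw (pbw_word fs lam rho es)" for fs es and lam rho :: "'i \<Rightarrow> int"
    by (simp only: pbw_word_def K_mon_word EF_mon_word word_monom_append mult.assoc)
  have e: "euler_char A d rh sh (ldeg (Kw \<mu>1 @ Kw' \<mu>2)) (ldeg (Kw \<nu>1 @ Kw' \<nu>2))
    = rh powi euler_form A d (\<lambda>i. \<nu>1 i + \<nu>2 i) (\<lambda>i. \<mu>1 i + \<mu>2 i) * sh powi (- euler_form A d (\<lambda>i. \<mu>1 i + \<mu>2 i) (\<lambda>i. \<nu>1 i + \<nu>2 i))"
    for \<mu>1 \<mu>2 \<nu>1 \<nu>2 :: "'i \<Rightarrow> int"
    unfolding euler_char_def ldeg_Kw ..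
  show ?thesis
  proof
    assume *: "twisting_form A d rh sh f"
    show "f = form_of (euler_char A d rh sh)"
    proof (rule form_of_characterization)
      show "f \<in> bilinear_forms H" using * by (simp add: twisting_form_def Let_def)
      show "f (clw (Kw lam @ Kw' rho), clw (Kw lam' @ Kw' rho')) = euler_char A d rh sh (ldeg (Kw lam @ Kw' rho)) (ldeg (Kw lam' @ Kw' rho'))"
        for lam rho lam' rho'
        unfolding e using * by (simp only: twisting_form_def Let_def w)
      show "f (clw (pbw_word fs lam rho es), y) = 0 \<and> f (y, clw (pbw_word fs lam rho es)) = 0"
        if "\<not> (fs = [] \<and> es = [])" "y \<in> carrier U" for fs lam rho es y
        using * that unfolding twisting_form_def Let_def p H_fields(1) by blast
    qed
  next
    assume f: "f = form_of (euler_char A d rh sh)"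
    show "twisting_form A d rh sh f"
      unfolding twisting_form_def Let_def p w f e[symmetric] H_fields(1)
      using form_of_bilinear form_of_torus form_of_vanishes by simp
  qed
qed

theorem theorem28:
  fixes scale :: "complex \<Rightarrow> 'g::ab_group_add \<Rightarrow> 'g"
    and bracket :: "'g \<Rightarrow> 'g \<Rightarrow> 'g"
    and A :: "'i::{finite,linorder} \<Rightarrow> 'i \<Rightarrow> int"
    and d :: "'i \<Rightarrow> nat"
    and r s rh sh q :: "'k::field_char_0"
  assumes "simple_lie_algebra scale bracket"
    and "lie_algebra.is_cartan_matrix scale bracket A"
    and "\<And>i. 0 < d i"
    and "Gcd (range d) = 1"
    and "\<And>i j. int (d i) * A i j = int (d j) * A j i"
    and "indeterminates_over_rat r s"
    and "\<exists>t. t ^ weight_exponent A = r * inverse s"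
    and "\<And>n. 0 < n \<Longrightarrow> (r * inverse s) ^ n \<noteq> 1"
    and "rh ^ 2 = r" and "sh ^ 2 = s"
    and "q = rh / sh"
    and "r * inverse s = q ^ 2"
  shows "(\<exists>!\<sigma>. twisting_form A d rh sh \<sigma>)
    \<and> (\<forall>\<sigma>. twisting_form A d rh sh \<sigma> \<longrightarrow>
          hopf_2_cocycle (quantum_group A d q (inverse q)) \<sigma>
        \<and> isomorphic_hopf_algebras (quantum_group A d r s) (deform (quantum_group A d q (inverse q)) \<sigma>))"
proof -
  have nz: "r \<noteq> 0" "s \<noteq> 0" using indeterminates_nonzero[OF assms(6)] by auto
  then have nzh: "rh \<noteq> 0" "sh \<noteq> 0" using assms(9,10) by auto
  then have qnz: "q \<noteq> 0" using assms(11) by simp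
  have rs: "r / s = q / inverse q" using assms(12) qnz by (simp add: divide_inverse power2_eq_square)
  have S: "qdata A d r s"
    using assms(3,5,8) nz by unfold_locales (auto simp: divide_inverse)
  have T: "qdata A d q (inverse q)"
    using assms(3,5,8) qnz rs by unfold_locales (auto simp: divide_inverse)
  let ?\<chi> = "euler_char A d rh sh"
  have \<chi>: "bichar ?\<chi>" by (rule bichar_euler_char[OF nzh])
  have iff: "twisting_form A d rh sh f \<longleftrightarrow> f = qdata.form_of A d q (inverse q) ?\<chi>" for f
    using twisting_form_iff[of A d rh sh f] T by (simp add: assms(11))
  have v: "r ^ d i / s ^ d i = q ^ d i / inverse q ^ d i" for i
    using rs by (metis power_divide)
  have b: "bt A d r s i j * ?\<chi> (sroot j) (sroot i) = bt A d q (inverse q) i j * ?\<chi> (sroot i) (sroot j)" for i j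
  proof -
    define a b where "a = euler A d i j" and "b = euler A d j i"
    \<comment> \<open>On the left, the first factor has the exponents \<open>2b\<close> and \<open>-2a\<close> in the square roots of \<open>r\<close> and \<open>s\<close>.
      On the right, \<open>q = rh / sh\<close> gives \<open>b + a\<close> and \<open>-b - a\<close>, because \<open>q\<close> and its inverse take the places
      of \<open>r\<close> and \<open>s\<close>. The bicharacters make up for the difference.\<close>
    have "bt A d r s i j * ?\<chi> (sroot j) (sroot i) = (rh powi b * rh powi b * rh powi a) * inverse (sh powi a * sh powi a * sh powi b)"
      unfolding bt_def euler_char_def euler_form_sroot a_def[symmetric] b_def[symmetric] assms(9,10)[symmetric]
      using nzh by (simp add: power2_eq_square power_int_mult_distrib power_int_minus field_simps)
    also have "\<dots> = bt A d q (inverse q) i j * ?\<chi> (sroot i) (sroot j)"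
      unfolding bt_def euler_char_def euler_form_sroot a_def[symmetric] b_def[symmetric] assms(11)
      using nzh by (simp add: power_int_mult_distrib power_int_divide_distrib power_int_minus power_int_inverse field_simps)
    finally show ?thesis .
  qed
  show ?thesis
    unfolding iff using qdata.cocycle_form_of[OF T \<chi>] twist_isomorphic[OF S T \<chi> v b] by blast
qed

end
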